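(* Let $s>5/2$ and $\lambda>0$. Suppose that $\rho_0,\Phi_0'\in X^s(\mathbb{R})$, with $\rho_0(x)\ge\rho_{0*}>0$ for some constant $\rho_{0*}$. Let $T>0$, $(a^\varepsilon,v^\varepsilon)$, $\Phi^\varepsilon$ and $u^\varepsilon=a^\varepsilon e^{i\Phi^\varepsilon/\varepsilon}$ be as described in the context. When $\varepsilon\to0$, the Wigner transform $W^\varepsilon$ of $u^\varepsilon$ weakly converges to the bounded measure $$\mu(t,dx,d\xi)=|a(t,x)|^2dx\otimes\delta_{\xi=\partial_x\Phi(t,x)},$$ where $(v,a)=(\partial_x\Phi,a)$ is a solution of $$\begin{cases}\partial_tv+v\,\partial_xv+\lambda\,\partial_x\ln(|a|^2)=0,& v|_{t=0}=\Phi_0',\\[2pt] \partial_ta+v\,\partial_xa+\frac{a}{2}\,\partial_xv=0,& a|_{t=0}=\sqrt{\rho_0}.\end{cases}$$ Moreover, $\mu$ is a solution to the Cauchy problem for the Vlasov equation $$\partial_tf+\xi\,\partial_xf-\lambda\big(\partial_x\ln(\rho)\big)\partial_\xi f=0,\qquad \rho(t,x)=\int_{\mathbb{R}}f(t,x,\xi)\,d\xi,$$ with initial datum $f_0=\rho_0(x)dx\otimes\delta_{\xi=\Phi_0'(x)}$.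
   Context: Zhidkov spaces: for $s\ge1$, $X^s(\mathbb{R})=\{f\in L^\infty(\mathbb{R}):\ f'\in H^{s-1}(\mathbb{R})\}$. Under the stated hypotheses there exists $T>0$, independent of $s>5/2$ and of $\varepsilon\in[0,1]$, such that the system $$\begin{cases}\partial_tv^\varepsilon+v^\varepsilon\partial_xv^\varepsilon+\lambda\,\partial_x\ln(|a^\varepsilon|^2)=0,& v^\varepsilon(0,x)=\Phi_0'(x),\\[2pt] \partial_ta^\varepsilon+v^\varepsilon\partial_xa^\varepsilon+\frac{a^\varepsilon}{2}\partial_xv^\varepsilon=i\frac{\varepsilon}{2}\partial_{xx}^2a^\varepsilon,& a^\varepsilon(0,x)=\sqrt{\rho_0(x)},\end{cases}$$ has a unique solution $(a^\varepsilon,v^\varepsilon)\in C([0,T];X^s(\mathbb{R})\times X^s(\mathbb{R}))$, with $a^\varepsilon$ complex-valued and $v^\varepsilon$ real-valued. For $\varepsilon\in[0,1]$ set $$\Phi^\varepsilon(t,x)=\Phi_0(x)-\int_0^t\Big(\tfrac12|v^\varepsilon(\tau,x)|^2+\lambda\ln\big(|a^\varepsilon(\tau,x)|^2\big)\Big)d\tau,$$ so that $\partial_x\Phi^\varepsilon=v^\varepsilon$. The functions $(a,\Phi)$ in the limit are those obtained for $\varepsilon=0$. For $\varepsilon\in\,]0,1]$, $u^\varepsilon=a^\varepsilon e^{i\Phi^\varepsilon/\varepsilon}$ solves the logarithmic Schrödinger equation $$i\varepsilon\partial_tu^\varepsilon+\frac{\varepsilon^2}{2}\partial_{xx}^2u^\varepsilon=\lambda\ln(|u^\varepsilon|^2)u^\varepsilon,\qquad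 u^\varepsilon(0,x)=\sqrt{\rho_0(x)}\,e^{i\Phi_0(x)/\varepsilon}.$$ The Wigner transform of $u^\varepsilon$ is $$W^\varepsilon(t,x,\xi)=\int_{\mathbb{R}}e^{iy\xi}\,u^\varepsilon\Big(t,x-\frac{\varepsilon}{2}y\Big)\overline{u^\varepsilon}\Big(t,x+\frac{\varepsilon}{2}y\Big)dy,\qquad (t,x,\xi)\in[0,T]\times\mathbb{R}^2.$$ The weak convergence is in $\mathcal{M}_b([0,T]\times\mathbb{R}^2)$, the space of bounded measures on $[0,T]\times\mathbb{R}^2$. Here $\delta_{\xi=v(t,x)}$ denotes the Dirac mass in $\xi$ at $v(t,x)$. The Vlasov equation for a measure $\mu$ is understood in the weak sense, the term $\big(\partial_x\ln\int\mu\,d\xi\big)\partial_\xi\mu$ being read as $\partial_\xi\big(\big(\partial_x\ln\int\mu\,d\xi\big)\mu\big)$.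
   Formalization: Convergence is stated for W^ε/(2π), since W^ε itself tends to 2πμ; μ is shown finite on sets bounded in x only, as its total mass is infinite; W^ε is read as a distribution, tested on continuous functions whose Fourier transform in ξ is integrable in (t,x,y). *)

theory Defs
  imports "HOL-Analysis.Analysis"
begin

section \<open>Sobolev and Zhidkov spaces on the line\<close>

definition L2 :: "(real \<Rightarrow> complex) \<Rightarrow> bool" where
  "L2 f \<longleftrightarrow> f \<in> borel_measurable lborel \<and> integrable lborel (\<lambda>x. (cmod (f x))\<^sup>2)"

text \<open>Plancherel's definition of the Fourier transform on \<open>L2\<close>: \<open>g\<close> is the limit in mean of
  the transforms of the truncations of \<open>f\<close>. It determines \<open>g\<close> up to null sets.\<close>

definition L2_fourier :: "(real \<Rightarrow> complex) \<Rightarrow> (real \<Rightarrow> complex) \<Rightarrow> bool" where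
  "L2_fourier f g \<longleftrightarrow> L2 f \<and> L2 g \<and>
     ((\<lambda>R. \<integral>\<^sup>+\<xi>. ennreal ((cmod (g \<xi> - (LINT x:{-R..R}|lborel. cis (- (x * \<xi>)) * f x)))\<^sup>2) \<partial>lborel)
        \<longlongrightarrow> 0) at_top"

text \<open>The space \<open>H\<^sup>\<sigma>\<close>, for \<open>\<sigma> \<ge> 0\<close> only (where it is contained in \<open>L2\<close>).\<close>

definition sobolev :: "real \<Rightarrow> (real \<Rightarrow> complex) set" where
  "sobolev \<sigma> = {f. \<exists>g. L2_fourier f g \<and>
     integrable lborel (\<lambda>\<xi>. (1 + \<xi>\<^sup>2) powr \<sigma> * (cmod (g \<xi>))\<^sup>2)}"

definition sobolev_norm :: "real \<Rightarrow> (real \<Rightarrow> complex) \<Rightarrow> real" where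
  "sobolev_norm \<sigma> f =
     sqrt (LINT \<xi>|lborel. (1 + \<xi>\<^sup>2) powr \<sigma> * (cmod ((SOME g. L2_fourier f g) \<xi>))\<^sup>2)"

definition test_function :: "(real \<Rightarrow> real) \<Rightarrow> bool" where
  "test_function \<phi> \<longleftrightarrow> (\<forall>n. (deriv ^^ n) \<phi> differentiable_on UNIV) \<and> bounded {x. \<phi> x \<noteq> 0}"

definition weak_derivative :: "(real \<Rightarrow> complex) \<Rightarrow> (real \<Rightarrow> complex) \<Rightarrow> bool" where
  "weak_derivative f g \<longleftrightarrow> (\<forall>\<phi>. test_function \<phi> \<longrightarrow>
     (LINT x|lborel. f x * of_real (deriv \<phi> x)) = - (LINT x|lborel. g x * of_real (\<phi> x)))"

text \<open>The elements of \<open>X\<^sup>s\<close>, \<open>s \<ge> 1\<close>, are identified with their unique continuous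
  representatives: an essentially bounded function whose distributional derivative is
  square integrable has one, and its essential bound is then the supremum.\<close>

definition zhidkov :: "real \<Rightarrow> (real \<Rightarrow> complex) set" where
  "zhidkov s = {f. continuous_on UNIV f \<and> bounded (range f) \<and>
     (\<exists>g. weak_derivative f g \<and> g \<in> sobolev (s - 1))}"

definition zhidkov_norm :: "real \<Rightarrow> (real \<Rightarrow> complex) \<Rightarrow> real" where
  "zhidkov_norm s f = (SUP x. cmod (f x)) +
     sobolev_norm (s - 1) (SOME g. weak_derivative f g \<and> g \<in> sobolev (s - 1))"

text \<open>\<open>C([0,T]; X\<^sup>s)\<close>; functions of \<open>(t,x)\<close> are curried, and their values for \<open>t\<close> outside
  \<open>[0,T]\<close> are irrelevant.\<close>

definition continuous_zhidkov :: "real \<Rightarrow> real \<Rightarrow> (real \<Rightarrow> real \<Rightarrow> complex) \<Rightarrow> bool" where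
  "continuous_zhidkov s T f \<longleftrightarrow> (\<forall>t\<in>{0..T}. f t \<in> zhidkov s \<and>
     ((\<lambda>\<tau>. zhidkov_norm s (\<lambda>x. f \<tau> x - f t x)) \<longlongrightarrow> 0) (at t within {0..T}))"

section \<open>The amplitude-velocity system and the phase\<close>

abbreviation ddx :: "(real \<Rightarrow> 'a::real_normed_vector) \<Rightarrow> real \<Rightarrow> 'a" where
  "ddx f \<equiv> \<lambda>x. vector_derivative f (at x)"

text \<open>For \<open>s > 5/2\<close> the elements of \<open>X\<^sup>s\<close> are \<open>C\<^sup>2\<close>, so that distributional solutions in
  \<open>C([0,T]; X\<^sup>s)\<close> are classical; time derivatives are one-sided at the end points. The
  amplitude must not vanish, for the logarithm to make sense. The case \<open>eps = 0\<close> is the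
  limiting system.\<close>

definition system_solution ::
  "real \<Rightarrow> real \<Rightarrow> real \<Rightarrow> real \<Rightarrow> (real \<Rightarrow> complex) \<Rightarrow> (real \<Rightarrow> real) \<Rightarrow>
   (real \<Rightarrow> real \<Rightarrow> complex) \<Rightarrow> (real \<Rightarrow> real \<Rightarrow> real) \<Rightarrow> bool" where
  "system_solution s lam eps T a0 v0 a v \<longleftrightarrow>
     continuous_zhidkov s T a \<and> continuous_zhidkov s T (\<lambda>t x. of_real (v t x)) \<and>
     (\<forall>x. a 0 x = a0 x) \<and> (\<forall>x. v 0 x = v0 x) \<and>
     (\<forall>t\<in>{0..T}. \<forall>x.
        a t x \<noteq> 0 \<and>
        v t differentiable at x \<and> a t differentiable at x \<and> ddx (a t) differentiable at x \<and>
        (\<exists>vt. ((\<lambda>\<tau>. v \<tau> x) has_vector_derivative vt) (at t within {0..T}) \<and>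
           vt + v t x * ddx (v t) x + lam * ddx (\<lambda>y. ln ((cmod (a t y))\<^sup>2)) x = 0) \<and>
        (\<exists>at'. ((\<lambda>\<tau>. a \<tau> x) has_vector_derivative at') (at t within {0..T}) \<and>
           at' + of_real (v t x) * ddx (a t) x + a t x / 2 * of_real (ddx (v t) x)
             = \<i> * of_real (eps / 2) * ddx (ddx (a t)) x))"

definition phase ::
  "real \<Rightarrow> (real \<Rightarrow> real) \<Rightarrow> (real \<Rightarrow> real \<Rightarrow> complex) \<Rightarrow> (real \<Rightarrow> real \<Rightarrow> real) \<Rightarrow>
   real \<Rightarrow> real \<Rightarrow> real" where
  "phase lam Phi0 a v t x =
     Phi0 x - integral {0..t} (\<lambda>\<tau>. (v \<tau> x)\<^sup>2 / 2 + lam * ln ((cmod (a \<tau> x))\<^sup>2))"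

definition wkb :: "real \<Rightarrow> (real \<Rightarrow> real \<Rightarrow> complex) \<Rightarrow> (real \<Rightarrow> real \<Rightarrow> real) \<Rightarrow>
   real \<Rightarrow> real \<Rightarrow> complex" where
  "wkb eps a Phi t x = a t x * cis (Phi t x / eps)"

section \<open>The Wigner transform\<close>

definition wigner_transform :: "real \<Rightarrow> (real \<Rightarrow> complex) \<Rightarrow> real \<Rightarrow> real \<Rightarrow> complex" where
  "wigner_transform eps u x \<xi> =
     (LINT y|lborel. cis (y * \<xi>) * (u (x - eps / 2 * y) * cnj (u (x + eps / 2 * y))))"

text \<open>There is no factor \<open>1 / (2 * pi)\<close> here, so that the integral of the transform over \<open>\<xi>\<close> is
  \<open>2 * pi * (cmod (u x))\<^sup>2\<close>; convergence to a measure of density \<open>(cmod (u x))\<^sup>2\<close> is for the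
  phase space measure \<open>dx d\<xi> / (2 * pi)\<close>.\<close>

definition fourier_xi :: "(real \<times> real \<times> real \<Rightarrow> complex) \<Rightarrow> real \<Rightarrow> real \<Rightarrow> real \<Rightarrow> complex" where
  "fourier_xi \<phi> t x y = (LINT \<xi>|lborel. cis (y * \<xi>) * \<phi> (t, x, \<xi>))"

text \<open>For bounded \<open>u\<close> which are not square integrable in space, the integral over \<open>y\<close> in the
  Wigner transform does not converge absolutely; it is the Fourier transform of a bounded
  function, hence a distribution in \<open>(t,x,\<xi>)\<close>, which acts on test functions \<open>\<phi>\<close> by
  exchanging the integrals over \<open>y\<close> and \<open>\<xi>\<close>.\<close>

definition wigner_distribution ::
  "real \<Rightarrow> real \<Rightarrow> (real \<Rightarrow> real \<Rightarrow> complex) \<Rightarrow> (real \<times> real \<times> real \<Rightarrow> complex) \<Rightarrow> complex" where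
  "wigner_distribution T eps u \<phi> =
     (LINT t:{0..T}|lborel. LINT x|lborel. LINT y|lborel.
        fourier_xi \<phi> t x y * (u t (x - eps / 2 * y) * cnj (u t (x + eps / 2 * y))))"

lemma wigner_exchange:
  fixes k \<psi> :: "real \<Rightarrow> complex"
  assumes k: "integrable lborel k" and p: "integrable lborel \<psi>"
  shows "(LINT y|lborel. (LINT \<xi>|lborel. cis (y * \<xi>) * \<psi> \<xi>) * k y)
       = (LINT \<xi>|lborel. (LINT y|lborel. cis (y * \<xi>) * k y) * \<psi> \<xi>)"
proof -
  have mk[measurable]: "k \<in> borel_measurable borel" and mp[measurable]: "\<psi> \<in> borel_measurable borel"
    using assms by (auto dest: borel_measurable_integrable)
  have "continuous_on UNIV (\<lambda>z::real \<times> real. cis (fst z * snd z))"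
    by (intro continuous_intros)
  then have mc[measurable]:
    "(\<lambda>z::real \<times> real. cis (fst z * snd z)) \<in> borel_measurable (borel \<Otimes>\<^sub>M borel)"
    by (simp add: borel_prod borel_measurable_continuous_onI)
  have "integrable (lborel \<Otimes>\<^sub>M lborel) (\<lambda>(y, \<xi>). k y * \<psi> \<xi>)"
    using assms by (intro lborel_pair.Fubini_integrable) (auto simp: norm_mult split_beta')
  then have "integrable (lborel \<Otimes>\<^sub>M lborel) (\<lambda>(y, \<xi>). cis (y * \<xi>) * \<psi> \<xi> * k y)"
    by (rule Bochner_Integration.integrable_bound)
       (auto simp: norm_mult split_beta' mult.commute)
  from lborel_pair.Fubini_integral[OF this]
  have "(LINT \<xi>|lborel. LINT y|lborel. cis (y * \<xi>) * \<psi> \<xi> * k y)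
      = (LINT y|lborel. LINT \<xi>|lborel. cis (y * \<xi>) * \<psi> \<xi> * k y)"
    by simp
  moreover have "\<And>\<xi>. (LINT y|lborel. cis (y * \<xi>) * \<psi> \<xi> * k y) = (LINT y|lborel. cis (y * \<xi>) * k y) * \<psi> \<xi>"
    by (subst integral_mult_left_zero[symmetric]) (simp add: ac_simps)
  ultimately show ?thesis by simp
qed

text \<open>Whenever the defining integral of the Wigner transform converges absolutely (in
  particular if \<open>u t\<close> is square integrable), the distribution is the Wigner transform
  integrated against \<open>\<phi>\<close>.\<close>

lemma wigner_distribution_eq:
  assumes "\<And>t x. t \<in> {0..T} \<Longrightarrow>
      integrable lborel (\<lambda>y. u t (x - eps / 2 * y) * cnj (u t (x + eps / 2 * y)))"
    and "\<And>t x. t \<in> {0..T} \<Longrightarrow> integrable lborel (\<lambda>\<xi>. \<phi> (t, x, \<xi>))"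
  shows "wigner_distribution T eps u \<phi> =
    (LINT t:{0..T}|lborel. LINT x|lborel. LINT \<xi>|lborel.
       wigner_transform eps (u t) x \<xi> * \<phi> (t, x, \<xi>))"
  unfolding wigner_distribution_def fourier_xi_def wigner_transform_def
  by (intro set_lebesgue_integral_cong allI impI Bochner_Integration.integral_cong refl
        wigner_exchange assms) auto

text \<open>The Lions-Paul test functions on \<open>[0,T] \<times> \<real>\<^sup>2\<close>: the continuous functions with partial
  Fourier transform integrable in \<open>(t,x,y)\<close>, against which the Wigner distribution of any
  bounded continuous \<open>u\<close> is defined. All functions in \<open>C\<^sub>c\<^sup>\<infinity>\<close> are of this kind. Continuity
  for \<open>t\<close> outside \<open>[0,T]\<close> is no restriction, by constant extension in time.\<close>

definition wigner_test :: "real \<Rightarrow> (real \<times> real \<times> real \<Rightarrow> complex) \<Rightarrow> bool" where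
  "wigner_test T \<phi> \<longleftrightarrow> continuous_on UNIV \<phi> \<and>
     (\<forall>t\<in>{0..T}. \<forall>x. integrable lborel (\<lambda>\<xi>. \<phi> (t, x, \<xi>))) \<and>
     set_integrable lborel ({0..T} \<times> UNIV) (\<lambda>(t, x, y). fourier_xi \<phi> t x y)"

section \<open>Monokinetic measures and the Vlasov equation\<close>

text \<open>\<open>r(x) dx \<otimes> \<delta>\<close> with the Dirac mass at \<open>\<xi> = w(x)\<close>, as the image of \<open>r(x) dx\<close> on the
  graph of \<open>w\<close>.\<close>

definition monokinetic :: "(real \<Rightarrow> real) \<Rightarrow> (real \<Rightarrow> real) \<Rightarrow> (real \<times> real) measure" where
  "monokinetic r w = distr (density lborel (\<lambda>x. ennreal (r x))) borel (\<lambda>x. (x, w x))"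

text \<open>The measure \<open>f(t,dx,d\<xi>) dt\<close> on \<open>[0,T] \<times> \<real>\<^sup>2\<close>, extended by zero.\<close>

definition time_measure ::
  "real \<Rightarrow> (real \<Rightarrow> (real \<times> real) measure) \<Rightarrow> (real \<times> real \<times> real) measure" where
  "time_measure T f = measure_of UNIV (sets borel)
     (\<lambda>A. \<integral>\<^sup>+t. indicator {0..T} t * emeasure (f t) {p. (t, p) \<in> A} \<partial>lborel)"

lemma sets_time_measure: "sets (time_measure T f) = sets borel"
  using sets.sigma_sets_eq[of "borel :: (real \<times> real \<times> real) measure"]
  by (simp add: time_measure_def sets_measure_of)

lemma emeasure_time_measure:
  assumes sets: "\<And>t. t \<in> {0..T} \<Longrightarrow> sets (f t) = sets borel"
    and meas: "\<And>A. A \<in> sets borel \<Longrightarrow>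
      (\<lambda>t. indicator {0..T} t * emeasure (f t) {p. (t, p) \<in> A}) \<in> borel_measurable borel"
    and A: "A \<in> sets borel"
  shows "emeasure (time_measure T f) A =
    (\<integral>\<^sup>+t. indicator {0..T} t * emeasure (f t) {p. (t, p) \<in> A} \<partial>lborel)"
proof (rule emeasure_measure_of[OF time_measure_def])
  let ?m = "\<lambda>A. \<integral>\<^sup>+t. indicator {0..T} t * emeasure (f t) {p. (t, p) \<in> A} \<partial>lborel"
  show "A \<in> sets (time_measure T f)" using A
    by (simp add: sets_time_measure)
  show "positive (sets (time_measure T f)) ?m"
    by (simp add: positive_def)
  show "countably_additive (sets (time_measure T f)) ?m"
  proof (rule countably_additiveI)
    fix B :: "nat \<Rightarrow> (real \<times> real \<times> real) set"
    assume "range B \<subseteq> sets (time_measure T f)" and dis: "disjoint_family B"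
    then have B: "B i \<in> sets borel" for i
      by (auto simp: sets_time_measure)
    have sec: "{p. (t, p) \<in> B i} \<in> sets borel" for t i
    proof -
      have "Pair t \<in> borel \<rightarrow>\<^sub>M (borel :: (real \<times> real \<times> real) measure)"
        by (intro borel_measurable_continuous_onI continuous_intros)
      from measurable_sets[OF this B] show ?thesis by (simp add: vimage_def)
    qed
    have "(\<Sum>i. indicator {0..T} t * emeasure (f t) {p. (t, p) \<in> B i})
        = indicator {0..T} t * emeasure (f t) {p. (t, p) \<in> (\<Union>i. B i)}" for t
    proof (cases "t \<in> {0..T}")
      case True
      have "(\<Sum>i. emeasure (f t) {p. (t, p) \<in> B i}) = emeasure (f t) (\<Union>i. {p. (t, p) \<in> B i})"
        using dis sec sets[OF True] by (intro suminf_emeasure) (auto simp: disjoint_family_on_def)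
      moreover have "(\<Union>i. {p. (t, p) \<in> B i}) = {p. (t, p) \<in> (\<Union>i. B i)}" by auto
      ultimately show ?thesis using True by simp
    qed simp
    then show "(\<Sum>i. ?m (B i)) = ?m (\<Union>i. B i)"
      using meas[OF B] by (subst nn_integral_suminf[symmetric]) simp_all
  qed
qed auto

text \<open>\<open>C\<^sup>1\<close> functions \<open>\<phi>\<close> with compact support in \<open>[0,T) \<times> \<real>\<^sup>2\<close> together with their partial
  derivatives. Since \<open>\<phi>\<close> need not vanish at \<open>t = 0\<close>, the initial datum appears in the weak
  formulation.\<close>

definition vlasov_test ::
  "real \<Rightarrow> (real \<times> real \<times> real \<Rightarrow> real) \<Rightarrow> (real \<times> real \<times> real \<Rightarrow> real) \<Rightarrow>
   (real \<times> real \<times> real \<Rightarrow> real) \<Rightarrow> (real \<times> real \<times> real \<Rightarrow> real) \<Rightarrow> bool" where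
  "vlasov_test T \<phi> \<phi>t \<phi>x \<phi>\<xi> \<longleftrightarrow>
     continuous_on UNIV \<phi>t \<and> continuous_on UNIV \<phi>x \<and> continuous_on UNIV \<phi>\<xi> \<and>
     (\<forall>p. (\<phi> has_derivative (\<lambda>(h, k, l). \<phi>t p * h + \<phi>x p * k + \<phi>\<xi> p * l)) (at p)) \<and>
     (\<exists>T'<T. \<exists>R. \<forall>t x \<xi>. \<phi> (t, x, \<xi>) \<noteq> 0 \<longrightarrow> t \<le> T' \<and> \<bar>x\<bar> \<le> R \<and> \<bar>\<xi>\<bar> \<le> R)"

text \<open>Measure solutions on \<open>[0,T]\<close> of
  \<open>\<partial>\<^sub>t f + \<xi> \<partial>\<^sub>x f - lam \<partial>\<^sub>\<xi> ((\<partial>\<^sub>x ln \<rho>) f) = 0\<close>, \<open>f(0) = f0\<close>, where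
  \<open>\<rho>(t,x) dx\<close> is the image of \<open>f(t)\<close> under \<open>(x,\<xi>) \<mapsto> x\<close>.\<close>

definition vlasov_solution ::
  "real \<Rightarrow> real \<Rightarrow> (real \<Rightarrow> (real \<times> real) measure) \<Rightarrow> (real \<times> real) measure \<Rightarrow> bool" where
  "vlasov_solution lam T f f0 \<longleftrightarrow> f 0 = f0 \<and>
     (\<exists>\<rho>. (\<forall>t\<in>{0..T}. distr (f t) borel fst = density lborel (\<lambda>x. ennreal (\<rho> t x)) \<and>
              (\<forall>x. \<rho> t x > 0 \<and> \<rho> t differentiable at x)) \<and>
          (\<forall>\<phi> \<phi>t \<phi>x \<phi>\<xi>. vlasov_test T \<phi> \<phi>t \<phi>x \<phi>\<xi> \<longrightarrow>
             (let F = (\<lambda>(t, x, \<xi>). \<phi>t (t, x, \<xi>) + \<xi> * \<phi>x (t, x, \<xi>)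
                          - lam * ddx (\<lambda>y. ln (\<rho> t y)) x * \<phi>\<xi> (t, x, \<xi>))
              in set_integrable (time_measure T f) ({0..T} \<times> UNIV) F \<and>
                 integrable f0 (\<lambda>p. \<phi> (0, p)) \<and>
                 (LINT p:({0..T} \<times> UNIV)|time_measure T f. F p) + (LINT p|f0. \<phi> (0, p)) = 0)))"

end

theory Submission
  imports Defs "HOL-Probability.Sinc_Integral" "HOL-Computational_Algebra.Polynomial"
begin

text \<open>Write \<open>u\<^sup>\<epsilon> = b\<^sup>\<epsilon> e\<^bsup>i\<Phi>/\<epsilon>\<^esup>\<close> with the limiting phase \<open>\<Phi>\<close>, that is \<open>b\<^sup>\<epsilon> = a\<^sup>\<epsilon> e\<^bsup>i(\<Phi>\<^sup>\<epsilon> - \<Phi>)/\<epsilon>\<^esup>\<close>, and let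
  \<open>r = |a|\<^sup>2\<close>. The modulated energy, with density \<open>\<epsilon>\<^sup>2/2 |\<partial>\<^sub>x b|\<^sup>2 + \<lambda> (|b|\<^sup>2 ln (|b|\<^sup>2/r) - |b|\<^sup>2 + r)\<close>, is \<open>O(\<epsilon>\<^sup>2)\<close>
  initially, and a Gronwall argument keeps it so on \<open>[0,T]\<close>. No uniform bounds on \<open>(a\<^sup>\<epsilon>, v\<^sup>\<epsilon>)\<close> enter: the functions
  \<open>b\<^sup>\<epsilon>\<close> are Hoelder continuous uniformly in \<open>\<epsilon>\<close>, and \<open>|b\<^sup>\<epsilon>| \<rightarrow> sqrt r\<close> pointwise. Hence
  \<open>u\<^sup>\<epsilon>(x - \<epsilon>y/2) cnj (u\<^sup>\<epsilon>(x + \<epsilon>y/2)) \<rightarrow> r(x) e\<^bsup>-iy\<partial>\<^sub>x\<Phi>(x)\<^esup>\<close> boundedly, and dominated convergence and Fourier inversion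
  give the limit of the Wigner distributions. The Vlasov equation is the conservation law
  \<open>\<partial>\<^sub>t (r \<psi>) + \<partial>\<^sub>x (r v \<psi>) = r (\<partial>\<^sub>t \<phi> + v \<partial>\<^sub>x \<phi> - \<lambda> \<partial>\<^sub>x(ln r) \<partial>\<^sub>\<xi> \<phi>)\<close> for \<open>\<psi>(t,x) = \<phi>(t,x,v(t,x))\<close>.\<close>

text \<open>The obstacle is the lack of decay: \<open>a\<close> and \<open>v\<close> are merely
  bounded, only their derivatives are square integrable, so the energy is integrated against
  \<open>weight d x = 1 / (1 + (d * x)^2)\<close>. Since \<open>|weight'| <= d * weight\<close>,
  cutting off costs a factor \<open>d\<close> times constants that may blow up as
  \<open>eps -> 0\<close>. Gronwall is therefore run at fixed \<open>eps\<close> with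
  \<open>d\<close> small depending on \<open>eps\<close>, and \<open>d -> 0\<close> follows by
  monotone convergence. Dividing out the limiting phase leaves one singular term in the equation of
  \<open>b\<close>, namely \<open>- i (lam/eps) ln (|b|^2/r) b\<close>. Being a real multiple of
  \<open>i b\<close>, it does not act on \<open>|b|\<close>; its effect on the gradient term is
  cancelled, up to derivatives of the weight, by what the dispersive term
  \<open>i (eps/2) bxx\<close> does to the entropy. This cancellation dictates the relative entropy
  of \<open>|b|^2\<close> and \<open>r\<close>, and its factor \<open>lam\<close>. An energy of size
  \<open>O(eps^2)\<close> makes \<open>bx\<close> bounded in L2, whence Hoelder continuity, and
  \<open>|b| - sqrt r\<close> of size \<open>O(eps)\<close> in L2. The phase of \<open>b\<close>
  itself is not controlled; it cancels in the two-point product, whose arguments are at distance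
  \<open>O(eps)\<close>.\<close>

text \<open>The filter \<open>at t within S\<close> is tested on sequences, which reduces the claim
  to dominated convergence for sequences. The bound is asked only off \<open>t\<close>, where
  difference quotients make sense; the parameter will be a time, a frequency scale or
  \<open>eps\<close>.\<close>

lemma integral_dominated_convergence_within:
  fixes s :: "'p::metric_space \<Rightarrow> 'a \<Rightarrow> 'b::{banach, second_countable_topology}"
  assumes "f \<in> borel_measurable M" "\<And>\<tau>. \<tau> \<in> S - {t} \<Longrightarrow> s \<tau> \<in> borel_measurable M" "integrable M w"
    and "AE x in M. ((\<lambda>\<tau>. s \<tau> x) \<longlongrightarrow> f x) (at t within S)"
    and "\<And>\<tau>. \<tau> \<in> S - {t} \<Longrightarrow> AE x in M. norm (s \<tau> x) \<le> w x"
  shows "((\<lambda>\<tau>. integral\<^sup>L M (s \<tau>)) \<longlongrightarrow> integral\<^sup>L M f) (at t within S)"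
  unfolding tendsto_at_iff_sequentially
proof (intro allI impI)
  fix X assume X: "\<forall>i. X i \<in> S - {t}" "X \<longlonglongrightarrow> t"
  have "(\<lambda>n. integral\<^sup>L M (s (X n))) \<longlonglongrightarrow> integral\<^sup>L M f"
  proof (rule integral_dominated_convergence)
    show "AE x in M. (\<lambda>n. s (X n) x) \<longlonglongrightarrow> f x"
      using assms(4)
    proof eventually_elim
      case (elim x)
      then show ?case using X unfolding tendsto_at_iff_sequentially by (auto simp: o_def)
    qed
    show "AE x in M. norm (s (X n) x) \<le> w x" for n using assms(5) X(1) by blast
  qed (use assms(1-3) X in auto)
  then show "((\<lambda>\<tau>. integral\<^sup>L M (s \<tau>)) \<circ> X) \<longlonglongrightarrow> integral\<^sup>L M f" by (simp add: o_def)
qed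

subsection \<open>The Poisson kernel\<close>

lemma has_bochner_integral_inverse_1_plus_square:
  "has_bochner_integral lborel (\<lambda>x::real. 1 / (1 + x\<^sup>2)) pi"
  using integrable_inverse_1_plus_square LBINT_inverse_1_plus_square
  by (simp add: has_bochner_integral_iff set_integrable_def interval_lebesgue_integral_def
      set_lebesgue_integral_def inverse_eq_divide)

text \<open>The Fourier transform of \<open>exp (- (d * |x|))\<close>, that is \<open>2 * pi\<close>
  times the Poisson kernel of the half plane. Abel summation with it carries all of the Fourier
  analysis below.\<close>

definition poisson :: "real \<Rightarrow> real \<Rightarrow> real" where
  "poisson d x = 2 * d / (d\<^sup>2 + x\<^sup>2)"

lemma poisson_nonneg: "d > 0 \<Longrightarrow> poisson d x \<ge> 0"
  by (simp add: poisson_def)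

lemma poisson_commute: "poisson d (x - y) = poisson d (y - x)"
  by (simp add: poisson_def power2_commute)

lemma borel_measurable_poisson [measurable]: "poisson d \<in> borel_measurable borel"
  unfolding poisson_def by measurable

lemma has_bochner_integral_poisson:
  assumes "d > 0"
  shows "has_bochner_integral lborel (\<lambda>x. poisson d (t + x)) (2 * pi)"
proof -
  have "has_bochner_integral lborel (\<lambda>x. 2 / d * (1 / (1 + (t / d + 1 / d * x)\<^sup>2))) (2 / d * (pi /\<^sub>R \<bar>1 / d\<bar>))"
    using assms has_bochner_integral_inverse_1_plus_square
    by (intro has_bochner_integral_mult_right)
      (subst (asm) lborel_has_bochner_integral_real_affine_iff[of "1 / d" _ _ "t / d"], auto)
  moreover have "2 / d * (1 / (1 + (t / d + 1 / d * x)\<^sup>2)) = poisson d (t + x)" for x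
  proof -
    have "1 + (t / d + 1 / d * x)\<^sup>2 = (d\<^sup>2 + (t + x)\<^sup>2) / d\<^sup>2"
      using assms by (simp add: add_divide_distrib[symmetric] power_divide divide_simps)
    then show ?thesis using assms by (simp add: poisson_def power2_eq_square)
  qed
  ultimately show ?thesis using assms by simp
qed

lemma integrable_exp_abs:
  fixes d :: real
  assumes "d > 0"
  shows "integrable lborel (\<lambda>x. exp (- (d * \<bar>x\<bar>)))"
proof -
  have 1: "integrable lborel (\<lambda>x. indicator {0<..} x *\<^sub>R exp (- (x * d)))"
    using integrable_I0i_exp_mscale[OF assms] by (simp add: set_integrable_def)
  then have 2: "integrable lborel (\<lambda>x. indicator {0<..} (0 + (-1) * x) *\<^sub>R exp (- ((0 + (-1) * x) * d)))"
    by (rule lborel_integrable_real_affine) simp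
  have "integrable lborel (\<lambda>x. indicator {0<..} x *\<^sub>R exp (- (x * d)) +
      indicator {0<..} (0 + (-1) * x) *\<^sub>R exp (- ((0 + (-1) * x) * d)))"
    using 1 2 by (rule Bochner_Integration.integrable_add)
  then show ?thesis
  proof (rule integrable_cong_AE_imp)
    show "AE x in lborel. indicator {0<..} x *\<^sub>R exp (- (x * d)) +
      indicator {0<..} (0 + (-1) * x) *\<^sub>R exp (- ((0 + (-1) * x) * d)) = exp (- (d * \<bar>x\<bar>))"
      using AE_lborel_singleton[of 0]
      by eventually_elim (auto simp: indicator_def mult.commute)
  qed simp
qed

lemma integrable_cis_exp_abs:
  assumes "d > 0"
  shows "integrable lborel (\<lambda>x. cis (x * z) * of_real (exp (- (d * \<bar>x\<bar>))))"
proof (rule Bochner_Integration.integrable_bound[OF integrable_exp_abs[OF assms]])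
  have "continuous_on UNIV (\<lambda>x. cis (x * z) * of_real (exp (- (d * \<bar>x\<bar>))))"
    by (intro continuous_intros)
  then show "(\<lambda>x. cis (x * z) * of_real (exp (- (d * \<bar>x\<bar>)))) \<in> borel_measurable lborel"
    by (simp add: borel_measurable_continuous_onI)
qed (simp add: norm_mult)

lemma integral_half_line_cis_exp:
  assumes "d > 0"
  shows "(LINT x|lborel. indicator {0<..} x *\<^sub>R (cis (x * z) * of_real (exp (- (d * \<bar>x\<bar>))))) = 1 / (of_real d - \<i> * of_real z)"
    (is "(LINT x|lborel. indicator {0<..} x *\<^sub>R ?f x) = _")
proof -
  define c where "c = of_real d - \<i> * of_real z"
  have c0: "c \<noteq> 0" using assms by (auto simp: c_def complex_eq_iff)
  have f: "cis (x * z) * of_real (exp (- (d * x))) = exp (- (c * of_real x))" for x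
  proof -
    have "of_real (exp (- (d * x))) = exp (- (of_real d * of_real x) :: complex)"
      using exp_of_real[of "- (d * x)", where 'a = complex] by simp
    then have "cis (x * z) * of_real (exp (- (d * x))) = exp (\<i> * of_real (x * z) + - (of_real d * of_real x))"
      by (simp only: cis_conv_exp exp_add)
    also have "\<i> * of_real (x * z) + - (of_real d * of_real x) = - (c * of_real x)"
      by (simp add: c_def algebra_simps)
    finally show ?thesis .
  qed
  have 1: "((\<lambda>x. - exp (- (c * of_real x)) / c) has_vector_derivative exp (- (c * of_real x))) (at x)" for x
  proof -
    have "((\<lambda>x. - exp (- (c * x)) / c) has_field_derivative exp (- (c * of_real x))) (at (of_real x))"
      using c0 by (auto intro!: derivative_eq_intros)
    then show ?thesis by (rule has_vector_derivative_real_field)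
  qed
  have lim: "((\<lambda>x::real. - exp (- (c * of_real x)) / c) \<longlongrightarrow> 0) at_top"
  proof (rule tendsto_norm_zero_cancel)
    have "((\<lambda>x::real. exp (- (d * x)) / norm c) \<longlongrightarrow> 0 / norm c) at_top"
      using assms c0
      by (intro tendsto_divide tendsto_const)
        (auto intro!: filterlim_compose[OF exp_at_bot] filterlim_tendsto_pos_mult_at_top filterlim_ident
          simp: filterlim_uminus_at_bot)
    then show "((\<lambda>x::real. norm (- exp (- (c * of_real x)) / c)) \<longlongrightarrow> 0) at_top"
      by (simp add: norm_divide c_def)
  qed
  have "(LBINT x=0..\<infinity>. exp (- (c * of_real x))) = 0 - - (1 / c)"
  proof (rule interval_integral_FTC_integrable[where F = "\<lambda>x. - exp (- (c * of_real x)) / c"])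
    have "set_integrable lborel {0<..} ?f"
      unfolding set_integrable_def
      using integrable_cis_exp_abs[OF assms] by (rule integrable_mult_indicator[rotated]) simp
    moreover have "set_integrable lborel {0<..} ?f \<longleftrightarrow> set_integrable lborel {0<..} (\<lambda>x. exp (- (c * of_real x)))"
      by (rule set_integrable_cong) (auto simp: f)
    moreover have "einterval 0 \<infinity> = {0<..}"
      by (auto simp: einterval_def)
    ultimately show "set_integrable lborel (einterval 0 \<infinity>) (\<lambda>x. exp (- (c * of_real x)))" by simp
    have "((\<lambda>x. - exp (- (c * complex_of_real x)) / c) \<longlongrightarrow> - exp (- (c * of_real 0)) / c) (at_right 0)"
      using c0 by (intro tendsto_intros)
    then show "(((\<lambda>x. - exp (- (c * complex_of_real x)) / c) \<circ> real_of_ereal) \<longlongrightarrow> - (1 / c)) (at_right 0)"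
      by (simp add: zero_ereal_def ereal_tendsto_simps)
    show "(((\<lambda>x. - exp (- (c * complex_of_real x)) / c) \<circ> real_of_ereal) \<longlongrightarrow> 0) (at_left \<infinity>)"
      using lim by (simp add: ereal_tendsto_simps)
  qed (use 1 in \<open>auto intro!: continuous_intros\<close>)
  then have "(LINT x:{0<..}|lborel. exp (- (c * of_real x))) = 1 / c"
    by (simp add: interval_lebesgue_integral_0_infty)
  moreover have "(LINT x|lborel. indicator {0<..} x *\<^sub>R ?f x) = (LINT x|lborel. indicator {0<..} x *\<^sub>R exp (- (c * of_real x)))"
    by (rule Bochner_Integration.integral_cong) (auto simp: indicator_def f)
  ultimately show ?thesis by (simp add: c_def set_lebesgue_integral_def)
qed

text \<open>Reflection turns the left half line into the right one with \<open>- z\<close>, and the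
  two partial fractions \<open>1 / (d - i z)\<close> and \<open>1 / (d + i z)\<close> add
  up.\<close>

lemma fourier_exp_abs:
  assumes "d > 0"
  shows "(LINT x|lborel. cis (x * z) * of_real (exp (- (d * \<bar>x\<bar>)))) = of_real (poisson d z)"
proof -
  define f where "f z x = cis (x * z) * of_real (exp (- (d * \<bar>x\<bar>)))" for z x
  have int: "integrable lborel (f z)" for z
    unfolding f_def by (rule integrable_cis_exp_abs[OF assms])
  then have int1: "integrable lborel (\<lambda>x. indicator A x *\<^sub>R f z x)" if "A \<in> sets borel" for A z
    using that by (auto intro!: integrable_mult_indicator)
  have half: "(LINT x|lborel. indicator {0<..} x *\<^sub>R f z x) = 1 / (of_real d - \<i> * of_real z)" for z
    using integral_half_line_cis_exp[OF assms] by (simp add: f_def)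
  have "(LINT x|lborel. f z x) = (LINT x|lborel. indicator {0<..} x *\<^sub>R f z x + indicator {..<0} x *\<^sub>R f z x)"
    using AE_lborel_singleton[of 0] int[of z, THEN borel_measurable_integrable]
    by (intro integral_cong_AE) (auto simp: indicator_def)
  also have "\<dots> = (LINT x|lborel. indicator {0<..} x *\<^sub>R f z x) + (LINT x|lborel. indicator {..<0} x *\<^sub>R f z x)"
    by (intro Bochner_Integration.integral_add int1) auto
  also have "(LINT x|lborel. indicator {..<0} x *\<^sub>R f z x) =
      (LINT x|lborel. indicator {..<0} (0 + (-1) * x) *\<^sub>R f z (0 + (-1) * x))"
    using lborel_integral_real_affine[of "-1" "\<lambda>x. indicator {..<0} x *\<^sub>R f z x" 0] by simp
  also have "\<dots> = (LINT x|lborel. indicator {0<..} x *\<^sub>R f (- z) x)"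
    by (intro Bochner_Integration.integral_cong) (auto simp: indicator_def f_def)
  also have "(LINT x|lborel. indicator {0<..} x *\<^sub>R f z x) + \<dots>
      = 1 / (of_real d - \<i> * of_real z) + 1 / (of_real d + \<i> * of_real z)"
    by (simp add: half)
  also have "\<dots> = of_real (poisson d z)"
  proof -
    have n: "of_real d - \<i> * of_real z \<noteq> 0" "of_real d + \<i> * of_real z \<noteq> 0"
      using assms by (auto simp: complex_eq_iff)
    have m: "(of_real d - \<i> * of_real z) * (of_real d + \<i> * of_real z) = complex_of_real (d\<^sup>2 + z\<^sup>2)"
      by (simp add: algebra_simps power2_eq_square)
    have "1 / (of_real d - \<i> * of_real z) + 1 / (of_real d + \<i> * of_real z)
       = (2 * of_real d) / ((of_real d - \<i> * of_real z) * (of_real d + \<i> * of_real z))"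
      using n by (simp add: divide_simps)
    then show ?thesis by (simp add: m poisson_def)
  qed
  finally show ?thesis by (simp add: f_def)
qed

lemma has_bochner_integral_poisson_Icc:
  assumes "d > 0" "a \<le> b"
  shows "has_bochner_integral lborel (\<lambda>x. indicator {a..b} x * poisson d (x - y))
    (2 * (arctan ((b - y) / d) - arctan ((a - y) / d)))"
proof -
  have "has_bochner_integral lborel (\<lambda>x. indicator {a..b} x *\<^sub>R poisson d (x - y))
     (2 * arctan ((b - y) / d) - 2 * arctan ((a - y) / d))"
  proof (rule has_bochner_integral_FTC_Icc)
    fix x
    have e: "1 + ((x - y) / d)\<^sup>2 = (d\<^sup>2 + (x - y)\<^sup>2) / d\<^sup>2" using assms(1)
      by (simp add: power_divide divide_simps)
    have "inverse (1 + ((x - y) / d)\<^sup>2) * (1 / d) * 2 = poisson d (x - y)"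
      unfolding e using assms(1) by (simp add: poisson_def power2_eq_square)
    then have "((\<lambda>x. 2 * arctan ((x - y) / d)) has_real_derivative poisson d (x - y)) (at x within {a..b})"
      using assms(1) by (auto intro!: derivative_eq_intros)
    then show "((\<lambda>x. 2 * arctan ((x - y) / d)) has_vector_derivative poisson d (x - y)) (at x within {a..b})"
      by (simp add: has_real_derivative_iff_has_vector_derivative)
    show "continuous_on {a..b} (\<lambda>x. poisson d (x - y))"
      unfolding poisson_def using assms(1)
      by (intro continuous_intros) (auto simp: add_pos_nonneg less_imp_neq[symmetric] sum_power2_eq_zero_iff)
  qed (use assms in auto)
  then show ?thesis by (simp add: algebra_simps)
qed

text \<open>A majorant that is uniform in \<open>d <= 1\<close>: close to the interval the total
  mass \<open>2 * pi\<close> of the kernel bounds the integral, far from it the kernel itself is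
  \<open>O(d / y^2)\<close>. The decay \<open>1 / (1 + y^2)\<close> admits functions
  \<open>g\<close> that are only square integrable when \<open>d\<close> tends to 0.\<close>

lemma poisson_Icc_bound:
  assumes "a \<le> b"
  obtains C where "\<And>d y. \<lbrakk>0 < d; d \<le> 1\<rbrakk> \<Longrightarrow>
    \<bar>2 * (arctan ((b - y) / d) - arctan ((a - y) / d))\<bar> \<le> C / (1 + y\<^sup>2)"
proof -
  \<comment> \<open>For \<open>|y| > 2 * L\<close> and \<open>x\<close> in the interval,
    \<open>|x - y| >= |y| / 2\<close>. The two summands of \<open>C\<close> serve the cases
    \<open>|y| <= 2 * L\<close> and \<open>|y| > 2 * L\<close>.\<close>
  define L where "L = \<bar>a\<bar> + \<bar>b\<bar> + 1"
  define C where "C = 2 * pi * (1 + (2 * L)\<^sup>2) + 16 * (b - a)"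
  have "\<bar>2 * (arctan ((b - y) / d) - arctan ((a - y) / d))\<bar> \<le> C / (1 + y\<^sup>2)" if d: "0 < d" "d \<le> 1" for d y
  proof -
    let ?K = "2 * (arctan ((b - y) / d) - arctan ((a - y) / d))"
    note K = has_bochner_integral_poisson_Icc[OF d(1) assms, of y]
    have nn: "?K \<ge> 0" using assms d
      by (simp add: divide_right_mono arctan_le_iff)
    have "?K * (1 + y\<^sup>2) \<le> C"
    proof (cases "\<bar>y\<bar> \<le> 2 * L")
      case True
      have "?K \<le> 2 * pi"
        using arctan_bounded[of "(b - y) / d"] arctan_bounded[of "(a - y) / d"] by auto
      moreover have "1 + y\<^sup>2 \<le> 1 + (2 * L)\<^sup>2"
        using True by (simp add: abs_le_square_iff[symmetric] L_def)
      ultimately have "?K * (1 + y\<^sup>2) \<le> 2 * pi * (1 + (2 * L)\<^sup>2)"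
        using nn by (intro mult_mono) auto
      then show ?thesis using assms by (simp add: C_def)
    next
      case False
      then have y1: "y\<^sup>2 \<ge> 1" using abs_le_square_iff[of 1 y] unfolding L_def by simp linarith
      have "?K \<le> (LINT x|lborel. indicator {a..b} x * (16 / (1 + y\<^sup>2)))"
      proof (subst has_bochner_integral_integral_eq[OF K, symmetric], rule integral_mono)
        show "integrable lborel (\<lambda>x. indicator {a..b} x * poisson d (x - y))"
          using K by (rule integrable.intros)
        fix x
        show "indicator {a..b} x * poisson d (x - y) \<le> indicator {a..b} x * (16 / (1 + y\<^sup>2))"
        proof (cases "x \<in> {a..b}")
          case True
          have "\<bar>x\<bar> \<le> \<bar>a\<bar> + \<bar>b\<bar>" using True by auto
          then have "\<bar>y\<bar> / 2 \<le> \<bar>x - y\<bar>"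
            using False abs_triangle_ineq2_sym[of y x] unfolding L_def by argo
          then have "(\<bar>y\<bar> / 2)\<^sup>2 \<le> (x - y)\<^sup>2" by (simp add: abs_le_square_iff[symmetric])
          then have q: "1 + y\<^sup>2 \<le> 8 * (d\<^sup>2 + (x - y)\<^sup>2)" using y1 by (simp add: power_divide)
             (smt (verit) zero_le_power2)
          have p: "d\<^sup>2 + (x - y)\<^sup>2 > 0" using d by (simp add: add_pos_nonneg)
          have "2 * d * (1 + y\<^sup>2) \<le> 2 * 1 * (8 * (d\<^sup>2 + (x - y)\<^sup>2))"
            using q d by (intro mult_mono) auto
          then have "poisson d (x - y) \<le> 16 / (1 + y\<^sup>2)"
            using p unfolding poisson_def by (simp add: divide_simps add_pos_nonneg)
          then show ?thesis using True by simp
        qed simp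
        show "integrable lborel (\<lambda>x. indicator {a..b} x * (16 / (1 + y\<^sup>2)))"
          by (intro integrable_mult_left integrable_real_indicator) (auto simp: emeasure_lborel_Icc_eq)
      qed
      also have "\<dots> = (b - a) * (16 / (1 + y\<^sup>2))" using assms by simp
      finally have "?K * (1 + y\<^sup>2) \<le> (b - a) * (16 / (1 + y\<^sup>2)) * (1 + y\<^sup>2)"
        by (rule mult_right_mono) auto
      also have "\<dots> = 16 * (b - a)" by (simp add: add_nonneg_eq_0_iff)
      finally have "?K * (1 + y\<^sup>2) \<le> 16 * (b - a)" .
      moreover have "0 \<le> 2 * pi * (1 + (2 * L)\<^sup>2)" by simp
      ultimately show ?thesis unfolding C_def by linarith
    qed
    then show ?thesis using nn by (simp add: pos_le_divide_eq add_pos_nonneg)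
  qed
  then show ?thesis using that by blast
qed

text \<open>The kernel concentrates at its centre, so the limit depends only on the side of each end
  point on which \<open>y\<close> lies. At an end point of a proper interval half of the mass is
  lost, which is harmless almost everywhere.\<close>

lemma poisson_Icc_tendsto:
  assumes "y \<noteq> a" "y \<noteq> b" "a \<le> b"
  shows "((\<lambda>d. 2 * (arctan ((b - y) / d) - arctan ((a - y) / d))) \<longlongrightarrow> indicator {a..b} y * (2 * pi)) (at_right 0)"
proof -
  have inv: "filterlim (\<lambda>d::real. 1 / d) at_top (at_right 0)"
    using filterlim_inverse_at_top_right by (simp add: inverse_eq_divide)
  have p: "((\<lambda>d. arctan (c / d)) \<longlongrightarrow> pi / 2) (at_right 0)" if "c > 0" for c
  proof -
    have "filterlim (\<lambda>d. c * (1 / d)) at_top (at_right 0)"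
      by (rule filterlim_tendsto_pos_mult_at_top[OF tendsto_const that inv])
    from filterlim_compose[OF tendsto_arctan_at_top this] show ?thesis by simp
  qed
  have m: "((\<lambda>d. arctan (c / d)) \<longlongrightarrow> - (pi / 2)) (at_right 0)" if "c < 0" for c
  proof -
    have "((\<lambda>d. - arctan ((- c) / d)) \<longlongrightarrow> - (pi / 2)) (at_right 0)"
      using that by (intro tendsto_minus p) simp
    then show ?thesis by (simp add: arctan_minus)
  qed
  consider "y < a" | "a < y" "y < b" | "b < y" using assms by linarith
  then show ?thesis
  proof cases
    case 1
    have "((\<lambda>d. 2 * (arctan ((b - y) / d) - arctan ((a - y) / d))) \<longlongrightarrow> 2 * (pi / 2 - pi / 2)) (at_right 0)"
      using 1 assms by (intro tendsto_intros p) auto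
    then show ?thesis using 1 by simp
  next
    case 2
    have "((\<lambda>d. 2 * (arctan ((b - y) / d) - arctan ((a - y) / d))) \<longlongrightarrow> 2 * (pi / 2 - - (pi / 2))) (at_right 0)"
      using 2 assms by (intro tendsto_mult tendsto_diff tendsto_const p m) auto
    then show ?thesis using 2 by simp
  next
    case 3
    have "((\<lambda>d. 2 * (arctan ((b - y) / d) - arctan ((a - y) / d))) \<longlongrightarrow> 2 * (- (pi / 2) - - (pi / 2))) (at_right 0)"
      using 3 assms by (intro tendsto_mult tendsto_diff tendsto_const m) auto
    then show ?thesis using 3 by simp
  qed
qed

subsection \<open>Fourier inversion\<close>

lemma borel_measurable_cis_mult [measurable]:
  "f \<in> borel_measurable M \<Longrightarrow> (\<lambda>x. cis (f x)) \<in> borel_measurable M"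
  by (intro borel_measurable_continuous_on[where f = cis] continuous_intros) auto

text \<open>Inversion in integrated form, so that \<open>g\<close> may be rough. Abel means converge
  on the left because \<open>k\<close> is integrable; on the right, \<open>dual\<close> and Fubini
  leave \<open>g\<close> against the Poisson kernel integrated over the interval, which tends to
  \<open>2 * pi\<close> times the indicator. The hypothesis \<open>dual\<close> separates the limit
  from the relation between \<open>g\<close> and \<open>k\<close>: it is verified by Fubini for
  integrable functions and by approximation for Plancherel transforms.\<close>

lemma fourier_inversion_interval:
  fixes g k :: "real \<Rightarrow> complex"
  assumes g [measurable]: "g \<in> borel_measurable borel"
    and gi: "integrable lborel (\<lambda>y. norm (g y) / (1 + y\<^sup>2))"
    and k: "integrable lborel k"
    and dual: "\<And>d x. d > 0 \<Longrightarrow> (LINT \<xi>|lborel. k \<xi> * cis (\<xi> * x) * of_real (exp (- (d * \<bar>\<xi>\<bar>))))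
      = (LINT y|lborel. g y * of_real (poisson d (x - y)))"
    and ab: "a \<le> b"
  shows "(LINT x:{a..b}|lborel. LINT \<xi>|lborel. k \<xi> * cis (\<xi> * x)) = 2 * pi * (LINT y:{a..b}|lborel. g y)"
proof -
  have [measurable]: "k \<in> borel_measurable borel" using k by auto
  define kk where "kk d x = (LINT \<xi>|lborel. k \<xi> * cis (\<xi> * x) * of_real (exp (- (d * \<bar>\<xi>\<bar>))))" for d x
  define K where "K d y = 2 * (arctan ((b - y) / d) - arctan ((a - y) / d))" for d y
  obtain C where C: "\<And>d y. \<lbrakk>0 < d; d \<le> 1\<rbrakk> \<Longrightarrow> \<bar>K d y\<bar> \<le> C / (1 + y\<^sup>2)"
    using poisson_Icc_bound[OF ab] unfolding K_def by blast
  have [measurable]: "(\<lambda>p. kk d (f p)) \<in> borel_measurable M" if [measurable]: "f \<in> borel_measurable M" for d f and M :: "'a measure"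
  proof -
    have "kk d \<in> borel_measurable borel" unfolding kk_def by measurable
    from measurable_compose[OF that this] show ?thesis by simp
  qed
  have int_e: "integrable lborel (\<lambda>\<xi>. k \<xi> * cis (\<xi> * x) * of_real (exp (- (d * \<bar>\<xi>\<bar>))))" if "d \<ge> 0" for d x
  proof (rule Bochner_Integration.integrable_bound[OF k])
    show "AE \<xi> in lborel. norm (k \<xi> * cis (\<xi> * x) * of_real (exp (- (d * \<bar>\<xi>\<bar>)))) \<le> norm (k \<xi>)"
      using that by (intro AE_I2) (auto simp: norm_mult mult_left_le)
  qed measurable
  have bound: "norm (kk d x) \<le> (LINT \<xi>|lborel. norm (k \<xi>))" if "d \<ge> 0" for d x
  proof -
    have "norm (kk d x) \<le> (LINT \<xi>|lborel. norm (k \<xi> * cis (\<xi> * x) * of_real (exp (- (d * \<bar>\<xi>\<bar>)))))"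
      unfolding kk_def by (rule integral_norm_bound)
    also have "\<dots> \<le> (LINT \<xi>|lborel. norm (k \<xi>))"
      using that int_e[OF that] k by (intro integral_mono integrable_norm) (auto simp: norm_mult mult_left_le)
    finally show ?thesis .
  qed
  have lim0: "((\<lambda>d. kk d x) \<longlongrightarrow> kk 0 x) (at_right 0)" for x
    unfolding kk_def
  proof (rule integral_dominated_convergence_within[where w = "\<lambda>\<xi>. norm (k \<xi>)"])
    show "AE \<xi> in lborel. ((\<lambda>d. k \<xi> * cis (\<xi> * x) * of_real (exp (- (d * \<bar>\<xi>\<bar>)))) \<longlongrightarrow>
       k \<xi> * cis (\<xi> * x) * of_real (exp (- (0 * \<bar>\<xi>\<bar>)))) (at_right 0)"
      by (intro AE_I2 tendsto_intros)
  qed (use k in \<open>auto simp: norm_mult mult_left_le\<close>)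
  have L: "((\<lambda>d. LINT x:{a..b}|lborel. kk d x) \<longlongrightarrow> (LINT x:{a..b}|lborel. kk 0 x)) (at_right 0)"
    unfolding set_lebesgue_integral_def
  proof (rule integral_dominated_convergence_within[where w = "\<lambda>x. indicator {a..b} x * (LINT \<xi>|lborel. norm (k \<xi>))"])
    show "AE x in lborel. ((\<lambda>d. indicator {a..b} x *\<^sub>R kk d x) \<longlongrightarrow> indicator {a..b} x *\<^sub>R kk 0 x) (at_right 0)"
      by (intro AE_I2 tendsto_intros lim0)
    show "AE x in lborel. norm (indicator {a..b} x *\<^sub>R kk d x) \<le> indicator {a..b} x * (LINT \<xi>|lborel. norm (k \<xi>))"
      if "d \<in> {0<..} - {0}" for d
      using bound[of d] that by (auto simp: indicator_def)
    show "integrable lborel (\<lambda>x. indicator {a..b} x * (LINT \<xi>|lborel. norm (k \<xi>)))"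
      by (intro integrable_mult_left integrable_real_indicator) (auto simp: emeasure_lborel_Icc_eq)
  qed measurable
  have eq: "(LINT x:{a..b}|lborel. kk d x) = (LINT y|lborel. g y * of_real (K d y))" if d: "0 < d" "d \<le> 1" for d
  proof -
    have "(LINT x:{a..b}|lborel. kk d x) = (LINT x|lborel. LINT y|lborel. indicator {a..b} x *\<^sub>R (g y * of_real (poisson d (x - y))))"
      unfolding set_lebesgue_integral_def kk_def dual[OF d(1)] by simp
    also have "\<dots> = (LINT y|lborel. LINT x|lborel. indicator {a..b} x *\<^sub>R (g y * of_real (poisson d (x - y))))"
    proof (rule lborel_pair.Fubini_integral[symmetric])
      have "integrable (lborel \<Otimes>\<^sub>M lborel) (\<lambda>(y, x). indicator {a..b} x *\<^sub>R (g y * of_real (poisson d (x - y))))"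
      proof (rule lborel_pair.Fubini_integrable)
        have 1: "integrable lborel (\<lambda>x. indicator {a..b} x * poisson d (x - y))" for y
          using has_bochner_integral_poisson_Icc[OF d(1) ab] by (rule integrable.intros)
        have "(LINT x|lborel. norm (indicator {a..b} x *\<^sub>R (g y * of_real (poisson d (x - y))))) = norm (g y) * K d y" for y
        proof -
          have "(LINT x|lborel. norm (indicator {a..b} x *\<^sub>R (g y * of_real (poisson d (x - y)))))
            = (LINT x|lborel. norm (g y) * (indicator {a..b} x * poisson d (x - y)))"
            using poisson_nonneg[OF d(1)] by (intro Bochner_Integration.integral_cong) (auto simp: norm_mult indicator_def)
          also have "\<dots> = norm (g y) * K d y"
            using has_bochner_integral_integral_eq[OF has_bochner_integral_poisson_Icc[OF d(1) ab]]
            by (simp add: K_def)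
          finally show ?thesis .
        qed
        moreover have "integrable lborel (\<lambda>y. norm (g y) * K d y)"
        proof (rule Bochner_Integration.integrable_bound)
          show "integrable lborel (\<lambda>y. C * (norm (g y) / (1 + y\<^sup>2)))" using gi by (rule integrable_mult_right)
          show "(\<lambda>y. norm (g y) * K d y) \<in> borel_measurable lborel" unfolding K_def by measurable
          show "AE y in lborel. norm (norm (g y) * K d y) \<le> norm (C * (norm (g y) / (1 + y\<^sup>2)))"
          proof (rule AE_I2)
            fix y
            have "norm (norm (g y) * K d y) \<le> norm (g y) * (C / (1 + y\<^sup>2))"
              using mult_left_mono[OF C[OF d] norm_ge_zero] by (simp add: abs_mult)
            also have "\<dots> = C * (norm (g y) / (1 + y\<^sup>2))" by simp
            also have "\<dots> \<le> norm (C * (norm (g y) / (1 + y\<^sup>2)))" by (simp only: real_norm_def abs_ge_self)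
            finally show "norm (norm (g y) * K d y) \<le> norm (C * (norm (g y) / (1 + y\<^sup>2)))" .
          qed
        qed
        ultimately show "integrable lborel (\<lambda>y. LINT x|lborel. norm (case (y, x) of (y, x) \<Rightarrow> indicator {a..b} x *\<^sub>R (g y * of_real (poisson d (x - y)))))"
          by simp
        show "AE y in lborel. integrable lborel (\<lambda>x. case (y, x) of (y, x) \<Rightarrow> indicator {a..b} x *\<^sub>R (g y * of_real (poisson d (x - y))))"
        proof (rule AE_I2)
          fix y
          have "integrable lborel (\<lambda>x. g y * of_real (indicator {a..b} x * poisson d (x - y)))"
            by (intro integrable_mult_right integrable_of_real 1)
          then show "integrable lborel (\<lambda>x. case (y, x) of (y, x) \<Rightarrow> indicator {a..b} x *\<^sub>R (g y * of_real (poisson d (x - y))))"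
            by (simp add: scaleR_conv_of_real mult_ac)
        qed
      qed measurable
      then show "integrable (lborel \<Otimes>\<^sub>M lborel) (\<lambda>(x, y). indicator {a..b} x *\<^sub>R (g y * of_real (poisson d (x - y))))"
        by (subst (asm) lborel_pair.integrable_product_swap_iff[symmetric]) (simp add: split_beta')
    qed
    also have "\<dots> = (LINT y|lborel. g y * of_real (K d y))"
    proof (rule Bochner_Integration.integral_cong)
      fix y
      have "(LINT x|lborel. indicator {a..b} x *\<^sub>R (g y * of_real (poisson d (x - y))))
         = (LINT x|lborel. g y * of_real (indicator {a..b} x * poisson d (x - y)))"
        by (intro Bochner_Integration.integral_cong) (auto simp: indicator_def)
      also have "\<dots> = g y * of_real (K d y)"
        using has_bochner_integral_integral_eq[OF has_bochner_integral_poisson_Icc[OF d(1) ab]]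
        by (simp add: K_def del: of_real_mult)
      finally show "(LINT x|lborel. indicator {a..b} x *\<^sub>R (g y * of_real (poisson d (x - y)))) = g y * of_real (K d y)" .
    qed simp
    finally show ?thesis .
  qed
  \<comment> \<open>The parameter stays in \<open>{0<..1}\<close> because the majorant
    \<open>C / (1 + y^2)\<close> holds for \<open>d <= 1\<close> only.\<close>
  have R: "((\<lambda>d. LINT y|lborel. g y * of_real (K d y)) \<longlongrightarrow> (LINT y|lborel. g y * of_real (indicator {a..b} y * (2 * pi)))) (at 0 within {0<..1})"
  proof (rule integral_dominated_convergence_within[where w = "\<lambda>y. C * (norm (g y) / (1 + y\<^sup>2))"])
    show "integrable lborel (\<lambda>y. C * (norm (g y) / (1 + y\<^sup>2)))" using gi by (rule integrable_mult_right)
    show "AE y in lborel. ((\<lambda>d. g y * of_real (K d y)) \<longlongrightarrow> g y * of_real (indicator {a..b} y * (2 * pi))) (at 0 within {0<..1})"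
      using AE_lborel_singleton[of a] AE_lborel_singleton[of b]
    proof eventually_elim
      case (elim y)
      have "((\<lambda>d. g y * of_real (K d y)) \<longlongrightarrow> g y * of_real (indicator {a..b} y * (2 * pi))) (at_right 0)"
        unfolding K_def using elim ab by (intro tendsto_mult tendsto_const tendsto_of_real poisson_Icc_tendsto) auto
      then show ?case by (rule tendsto_within_subset) auto
    qed
    show "AE y in lborel. norm (g y * of_real (K d y)) \<le> C * (norm (g y) / (1 + y\<^sup>2))" if "d \<in> {0<..1} - {0}" for d
    proof (rule AE_I2)
      fix y
      have "norm (g y) * \<bar>K d y\<bar> \<le> norm (g y) * (C / (1 + y\<^sup>2))"
        using C[of d y] that by (intro mult_left_mono) auto
      then show "norm (g y * of_real (K d y)) \<le> C * (norm (g y) / (1 + y\<^sup>2))"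
        by (simp add: norm_mult mult.commute)
    qed
  qed (unfold K_def, measurable)
  have "((\<lambda>d. LINT y|lborel. g y * of_real (K d y)) \<longlongrightarrow> (LINT x:{a..b}|lborel. kk 0 x)) (at 0 within {0<..1})"
    using tendsto_within_subset[OF L, of "{0<..1}"]
    by (rule Lim_transform_within[where d = 1]) (auto simp: eq)
  with R have "(LINT x:{a..b}|lborel. kk 0 x) = (LINT y|lborel. g y * of_real (indicator {a..b} y * (2 * pi)))"
    by (intro tendsto_unique[of "at 0 within {0<..1::real}"]) (auto simp: trivial_limit_within islimpt_greaterThanLessThan1 intro: islimpt_subset[OF islimpt_greaterThanLessThan1[of 0 1]])
  also have "\<dots> = (LINT y|lborel. 2 * pi * (indicator {a..b} y *\<^sub>R g y))"
    by (intro Bochner_Integration.integral_cong) (auto simp: indicator_def)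
  also have "\<dots> = 2 * pi * (LINT y:{a..b}|lborel. g y)"
    unfolding set_lebesgue_integral_def by (rule integral_mult_right_zero)
  finally show ?thesis by (simp add: kk_def)
qed

lemma continuous_eq_0_if_set_integral_eq_0:
  fixes f :: "real \<Rightarrow> complex"
  assumes f: "continuous_on UNIV f" and "\<And>a b. a \<le> b \<Longrightarrow> (LINT x:{a..b}|lborel. f x) = 0"
  shows "f x = 0"
proof -
  have ci: "continuous_on {x..x + 1} f" using f continuous_on_subset by blast
  have "((\<lambda>u. integral {x..u} f) has_vector_derivative f x) (at x within {x..x + 1})"
    by (rule integral_has_vector_derivative[OF ci]) auto
  moreover have "integral {x..u} f = 0" if "u \<in> {x..x + 1}" for u
  proof -
    have "set_integrable lborel {x..u} f"
      using borel_integrable_atLeastAtMost'[OF continuous_on_subset[OF f]] by blast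
    then show ?thesis using assms(2)[of x u] that set_borel_integral_eq_integral(2)[of "{x..u}" f] by auto
  qed
  ultimately have "((\<lambda>u. 0) has_vector_derivative f x) (at x within {x..x + 1})"
    by (auto intro: has_vector_derivative_transform[where f = "\<lambda>u. integral {x..u} f"])
  then show "f x = 0"
    using vector_derivative_unique_within[of x "{x..x + 1}" "\<lambda>_. 0" "f x" 0]
    by (auto simp: trivial_limit_within islimpt_Icc)
qed

lemma continuous_on_fourier:
  fixes k :: "real \<Rightarrow> complex"
  assumes "integrable lborel k"
  shows "continuous_on UNIV (\<lambda>x. LINT \<xi>|lborel. k \<xi> * cis (\<xi> * x))"
proof -
  have [measurable]: "k \<in> borel_measurable borel" using assms by auto
  show ?thesis
    unfolding continuous_on_def
  proof
    fix x
    show "((\<lambda>x. LINT \<xi>|lborel. k \<xi> * cis (\<xi> * x)) \<longlongrightarrow> (LINT \<xi>|lborel. k \<xi> * cis (\<xi> * x))) (at x)"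
      by (rule integral_dominated_convergence_within[where w = "\<lambda>\<xi>. norm (k \<xi>)"])
        (use assms in \<open>auto simp: norm_mult intro!: tendsto_intros AE_I2\<close>)
  qed
qed

text \<open>The inversion over intervals identifies the integrals of two continuous functions, which
  are therefore equal at every point.\<close>

lemma fourier_inversion:
  fixes f :: "real \<Rightarrow> complex"
  assumes fc: "continuous_on UNIV f" and f: "integrable lborel f"
    and k: "integrable lborel (\<lambda>y. LINT \<xi>|lborel. cis (y * \<xi>) * f \<xi>)"
  shows "(LINT y|lborel. (LINT \<xi>|lborel. cis (y * \<xi>) * f \<xi>) * cis (- (y * w))) = 2 * pi * f w"
proof -
  define F where "F y = (LINT \<xi>|lborel. cis (y * \<xi>) * f \<xi>)" for y
  \<comment> \<open>\<open>F\<close> and the inversion over intervals both use \<open>cis\<close>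
    with a positive sign, so the latter returns the reflection of \<open>f\<close>, evaluated at
    \<open>- w\<close>.\<close>
  define g where "g x = f (- x)" for x
  have [measurable]: "f \<in> borel_measurable borel" "F \<in> borel_measurable borel" using f k unfolding F_def[symmetric] by auto
  have gc: "continuous_on UNIV g" unfolding g_def by (intro continuous_on_compose2[OF fc] continuous_intros) auto
  have gi: "integrable lborel g"
    using lborel_integrable_real_affine[OF f, of "-1" 0] by (simp add: g_def[abs_def])
  have "(LINT x:{a..b}|lborel. (LINT y|lborel. F y * cis (y * x))) = 2 * pi * (LINT y:{a..b}|lborel. g y)" if "a \<le> b" for a b
  proof (rule fourier_inversion_interval)
    show "g \<in> borel_measurable borel" using gi by auto
    show "integrable lborel (\<lambda>y. norm (g y) / (1 + y\<^sup>2))"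
      by (rule Bochner_Integration.integrable_bound[OF gi])
        (use gi in \<open>auto simp: divide_le_eq mult_le_cancel_left1 add_pos_nonneg intro!: AE_I2\<close>)
    fix d x :: real assume d: "d > 0"
    have "(LINT y|lborel. F y * cis (y * x) * of_real (exp (- (d * \<bar>y\<bar>))))
       = (LINT y|lborel. (LINT \<xi>|lborel. cis (y * \<xi>) * f \<xi>) * (cis (y * x) * of_real (exp (- (d * \<bar>y\<bar>)))))"
      by (simp add: F_def mult_ac)
    also have "\<dots> = (LINT \<xi>|lborel. (LINT y|lborel. cis (y * \<xi>) * (cis (y * x) * of_real (exp (- (d * \<bar>y\<bar>))))) * f \<xi>)"
      by (rule wigner_exchange[OF integrable_cis_exp_abs[OF d] f])
    also have "\<dots> = (LINT \<xi>|lborel. f \<xi> * of_real (poisson d (x + \<xi>)))"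
    proof (rule Bochner_Integration.integral_cong)
      fix \<xi>
      have "cis (y * \<xi>) * (cis (y * x) * of_real (exp (- (d * \<bar>y\<bar>)))) = cis (y * (x + \<xi>)) * of_real (exp (- (d * \<bar>y\<bar>)))" for y
        by (simp add: mult.assoc[symmetric] cis_mult algebra_simps)
      then have "(LINT y|lborel. cis (y * \<xi>) * (cis (y * x) * of_real (exp (- (d * \<bar>y\<bar>))))) = of_real (poisson d (x + \<xi>))"
        by (simp only: fourier_exp_abs[OF d])
      then show "(LINT y|lborel. cis (y * \<xi>) * (cis (y * x) * of_real (exp (- (d * \<bar>y\<bar>))))) * f \<xi> = f \<xi> * of_real (poisson d (x + \<xi>))"
        by (metis mult.commute)
    qed simp
    also have "\<dots> = (LINT \<xi>|lborel. g \<xi> * of_real (poisson d (x - \<xi>)))"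
      by (subst lborel_integral_real_affine[of "-1" _ 0]) (simp_all add: g_def)
    finally show "(LINT y|lborel. F y * cis (y * x) * of_real (exp (- (d * \<bar>y\<bar>)))) = (LINT y|lborel. g y * of_real (poisson d (x - y)))" .
  qed (use k that in \<open>auto simp: F_def[symmetric]\<close>)
  moreover define H where "H x = (LINT y|lborel. F y * cis (y * x)) - 2 * pi * g x" for x
  have Fc: "continuous_on UNIV (\<lambda>x. LINT y|lborel. F y * cis (y * x))"
    using k by (intro continuous_on_fourier) (simp add: F_def)
  have "H (- w) = 0"
  proof (rule continuous_eq_0_if_set_integral_eq_0)
    show "continuous_on UNIV H" unfolding H_def by (intro continuous_intros Fc gc)
    fix a b :: real assume ab: "a \<le> b"
    have "set_integrable lborel {a..b} (\<lambda>x. LINT y|lborel. F y * cis (y * x))" "set_integrable lborel {a..b} g"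
      using borel_integrable_atLeastAtMost' Fc gc continuous_on_subset by blast+
    then show "(LINT x:{a..b}|lborel. H x) = 0"
      unfolding H_def using calculation[OF ab]
      by (subst set_integral_diff) auto
  qed
  then show ?thesis by (simp add: H_def g_def F_def)
qed

section \<open>Plancherel's inequality for integrable, square integrable functions\<close>

lemma borel_measurable_cnj [measurable (raw)]:
  "f \<in> borel_measurable M \<Longrightarrow> (\<lambda>x. cnj (f x)) \<in> borel_measurable M"
  by (intro borel_measurable_continuous_on[where f = cnj] continuous_intros) auto

text \<open>Damping \<open>|F|^2\<close> by \<open>exp (- (d * |x|))\<close> and expanding the
  square gives a quadratic form in \<open>k\<close> with the kernel
  \<open>poisson d (\<xi> - \<eta>)\<close>. This kernel is positive, symmetric and of mass
  \<open>2 * pi\<close> in each variable, so the Schur test bounds the form uniformly in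
  \<open>d\<close>; then \<open>d -> 0\<close> by monotone convergence.\<close>

lemma nn_integral_fourier_le:
  fixes k :: "real \<Rightarrow> complex"
  assumes k: "integrable lborel k" and k2: "integrable lborel (\<lambda>\<xi>. (norm (k \<xi>))\<^sup>2)"
  shows "(\<integral>\<^sup>+x. ennreal ((norm (LINT \<xi>|lborel. k \<xi> * cis (\<xi> * x)))\<^sup>2) \<partial>lborel) \<le> ennreal (2 * pi * (LINT \<xi>|lborel. (norm (k \<xi>))\<^sup>2))"
proof -
  have mk [measurable]: "k \<in> borel_measurable borel" using k by auto
  define F where "F x = (LINT \<xi>|lborel. k \<xi> * cis (\<xi> * x))" for x
  define B where "B = (LINT \<xi>|lborel. (norm (k \<xi>))\<^sup>2)"
  define e where "e d x = complex_of_real (exp (- (d * \<bar>x\<bar>)))" for d x :: real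
  have [measurable]: "F \<in> borel_measurable borel" "e d \<in> borel_measurable borel" for d
    unfolding F_def e_def by measurable
  have bF: "norm (F x) \<le> (LINT \<xi>|lborel. norm (k \<xi>))" for x
  proof -
    have "norm (F x) \<le> (LINT \<xi>|lborel. norm (k \<xi> * cis (\<xi> * x)))"
      unfolding F_def by (rule integral_norm_bound)
    then show ?thesis by (simp add: norm_mult)
  qed
  have kk: "integrable (lborel \<Otimes>\<^sub>M lborel) (\<lambda>(\<xi>, \<eta>). norm (k \<xi>) * norm (k \<eta>))"
    using k by (intro lborel_pair.Fubini_integrable) auto
  have sq: "F x * cnj (F x) = (LINT p|(lborel \<Otimes>\<^sub>M lborel). k (fst p) * cnj (k (snd p)) * cis ((fst p - snd p) * x))" for x
  proof -
    have "F x * cnj (F x) = (LINT \<xi>|lborel. LINT \<eta>|lborel. k \<xi> * cis (\<xi> * x) * cnj (k \<eta> * cis (\<eta> * x)))"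
      unfolding F_def by (simp add: integral_cnj[symmetric] del: complex_cnj_mult)
    also have "\<dots> = (LINT p|(lborel \<Otimes>\<^sub>M lborel). (case p of (\<xi>, \<eta>) \<Rightarrow> k \<xi> * cis (\<xi> * x) * cnj (k \<eta> * cis (\<eta> * x))))"
    proof -
      have "integrable (lborel \<Otimes>\<^sub>M lborel) (\<lambda>(\<xi>, \<eta>). k \<xi> * cis (\<xi> * x) * cnj (k \<eta> * cis (\<eta> * x)))"
        by (rule Bochner_Integration.integrable_bound[OF kk]) (auto simp: norm_mult)
      from lborel_pair.integral_fst'[OF this] show ?thesis by (simp only: prod.case)
    qed
    also have "\<dots> = (LINT p|(lborel \<Otimes>\<^sub>M lborel). k (fst p) * cnj (k (snd p)) * cis ((fst p - snd p) * x))"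
    proof (rule Bochner_Integration.integral_cong)
      fix p :: "real \<times> real"
      have "cis (fst p * x) * cis (- (snd p * x)) = cis ((fst p - snd p) * x)"
        by (simp add: cis_mult left_diff_distrib)
      then show "(case p of (\<xi>, \<eta>) \<Rightarrow> k \<xi> * cis (\<xi> * x) * cnj (k \<eta> * cis (\<eta> * x)))
         = k (fst p) * cnj (k (snd p)) * cis ((fst p - snd p) * x)"
        by (simp add: split_beta' cis_cnj mult_ac)
    qed simp
    finally show ?thesis .
  qed
  have *: "(\<integral>\<^sup>+x. ennreal ((norm (F x))\<^sup>2 * exp (- (d * \<bar>x\<bar>))) \<partial>lborel) \<le> ennreal (2 * pi * B)" if d: "d > 0" for d
  proof -
    have int: "integrable lborel (\<lambda>x. (norm (F x))\<^sup>2 * exp (- (d * \<bar>x\<bar>)))"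
    proof (rule Bochner_Integration.integrable_bound)
      show "integrable lborel (\<lambda>x. (LINT \<xi>|lborel. norm (k \<xi>))\<^sup>2 * exp (- (d * \<bar>x\<bar>)))"
        using integrable_exp_abs[OF d] by simp
      show "AE x in lborel. norm ((norm (F x))\<^sup>2 * exp (- (d * \<bar>x\<bar>))) \<le> norm ((LINT \<xi>|lborel. norm (k \<xi>))\<^sup>2 * exp (- (d * \<bar>x\<bar>)))"
        using bF by (intro AE_I2) (auto simp: abs_mult intro!: mult_right_mono power_mono)
    qed measurable
    have "complex_of_real (LINT x|lborel. (norm (F x))\<^sup>2 * exp (- (d * \<bar>x\<bar>)))
       = (LINT x|lborel. LINT p|(lborel \<Otimes>\<^sub>M lborel). k (fst p) * cnj (k (snd p)) * cis ((fst p - snd p) * x) * e d x)"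
      unfolding integral_complex_of_real[symmetric]
    proof (rule Bochner_Integration.integral_cong)
      fix x
      have "complex_of_real ((norm (F x))\<^sup>2 * exp (- (d * \<bar>x\<bar>))) = F x * cnj (F x) * e d x"
        by (simp only: of_real_mult complex_norm_square e_def)
      then show "complex_of_real ((norm (F x))\<^sup>2 * exp (- (d * \<bar>x\<bar>)))
        = (LINT p|(lborel \<Otimes>\<^sub>M lborel). k (fst p) * cnj (k (snd p)) * cis ((fst p - snd p) * x) * e d x)"
        unfolding sq by (simp only: integral_mult_left_zero)
    qed simp
    also have "\<dots> = (LINT p|(lborel \<Otimes>\<^sub>M lborel). LINT x|lborel. k (fst p) * cnj (k (snd p)) * cis ((fst p - snd p) * x) * e d x)"
    proof (rule pair_sigma_finite.Fubini_integral[symmetric])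
      show "pair_sigma_finite (lborel :: real measure) (lborel \<Otimes>\<^sub>M lborel :: (real \<times> real) measure)"
        unfolding lborel_prod by unfold_locales
      then interpret P: pair_sigma_finite "lborel :: real measure" "lborel \<Otimes>\<^sub>M lborel :: (real \<times> real) measure" .
      show "integrable (lborel \<Otimes>\<^sub>M (lborel \<Otimes>\<^sub>M lborel)) (\<lambda>(x, p). k (fst p) * cnj (k (snd p)) * cis ((fst p - snd p) * x) * e d x)"
      proof (rule Bochner_Integration.integrable_bound)
        show "integrable (lborel \<Otimes>\<^sub>M (lborel \<Otimes>\<^sub>M lborel)) (\<lambda>(x, p). exp (- (d * \<bar>x\<bar>)) * (norm (k (fst p)) * norm (k (snd p))))"
          using kk integrable_exp_abs[OF d] by (intro P.Fubini_integrable) (auto simp: split_beta')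
      qed (auto simp: e_def norm_mult split_beta')
    qed
    also have "\<dots> = (LINT p|(lborel \<Otimes>\<^sub>M lborel). k (fst p) * cnj (k (snd p)) * of_real (poisson d (fst p - snd p)))"
    proof (rule Bochner_Integration.integral_cong)
      fix p :: "real \<times> real"
      have "(LINT x|lborel. k (fst p) * cnj (k (snd p)) * cis ((fst p - snd p) * x) * e d x)
        = k (fst p) * cnj (k (snd p)) * (LINT x|lborel. cis (x * (fst p - snd p)) * e d x)"
        by (subst integral_mult_right_zero[symmetric]) (simp add: mult_ac)
      then show "(LINT x|lborel. k (fst p) * cnj (k (snd p)) * cis ((fst p - snd p) * x) * e d x)
          = k (fst p) * cnj (k (snd p)) * of_real (poisson d (fst p - snd p))"
        unfolding e_def fourier_exp_abs[OF d] .
    qed simp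
    finally have "norm (complex_of_real (LINT x|lborel. (norm (F x))\<^sup>2 * exp (- (d * \<bar>x\<bar>))))
      = norm (LINT p|(lborel \<Otimes>\<^sub>M lborel). k (fst p) * cnj (k (snd p)) * of_real (poisson d (fst p - snd p)))"
      by (rule arg_cong)
    then have "\<bar>LINT x|lborel. (norm (F x))\<^sup>2 * exp (- (d * \<bar>x\<bar>))\<bar>
      = norm (LINT p|(lborel \<Otimes>\<^sub>M lborel). k (fst p) * cnj (k (snd p)) * of_real (poisson d (fst p - snd p)))"
      unfolding norm_of_real .
    also have "\<dots> \<le> 2 * pi * B"
    proof -
      have i0: "integrable lborel (\<lambda>\<eta>. poisson d (\<xi> - \<eta>))" "(LINT \<eta>|lborel. poisson d (\<xi> - \<eta>)) = 2 * pi" for \<xi>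
        using has_bochner_integral_poisson[OF d, of "- \<xi>"] poisson_commute[of d \<xi>]
        by (simp_all add: has_bochner_integral_iff)
      have i1: "integrable (lborel \<Otimes>\<^sub>M lborel) (\<lambda>(\<xi>, \<eta>). (norm (k \<xi>))\<^sup>2 * poisson d (\<xi> - \<eta>))"
        using i0 k2 poisson_nonneg[OF d] by (intro lborel_pair.Fubini_integrable) (auto simp: abs_mult)
      then have i2: "integrable (lborel \<Otimes>\<^sub>M lborel) (\<lambda>(\<xi>, \<eta>). (norm (k \<eta>))\<^sup>2 * poisson d (\<xi> - \<eta>))"
        by (subst (asm) lborel_pair.integrable_product_swap_iff[symmetric]) (simp add: split_beta' poisson_commute)
      have v1: "(LINT p|(lborel \<Otimes>\<^sub>M lborel). (case p of (\<xi>, \<eta>) \<Rightarrow> (norm (k \<xi>))\<^sup>2 * poisson d (\<xi> - \<eta>))) = 2 * pi * B"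
        using lborel_pair.integral_fst'[OF i1] i0 by (simp add: B_def mult.commute)
      have v2: "(LINT p|(lborel \<Otimes>\<^sub>M lborel). (case p of (\<xi>, \<eta>) \<Rightarrow> (norm (k \<eta>))\<^sup>2 * poisson d (\<xi> - \<eta>))) = 2 * pi * B"
        using lborel_pair.integral_product_swap[of "\<lambda>(\<xi>, \<eta>). (norm (k \<eta>))\<^sup>2 * poisson d (\<xi> - \<eta>)"] v1
        by (simp add: split_beta' poisson_commute)
      have "norm (LINT p|(lborel \<Otimes>\<^sub>M lborel). k (fst p) * cnj (k (snd p)) * of_real (poisson d (fst p - snd p)))
         \<le> (LINT p|(lborel \<Otimes>\<^sub>M lborel). norm (k (fst p) * cnj (k (snd p)) * of_real (poisson d (fst p - snd p))))"
        by (rule integral_norm_bound)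
      also have "\<dots> \<le> (LINT p|(lborel \<Otimes>\<^sub>M lborel). 1/2 * ((case p of (\<xi>, \<eta>) \<Rightarrow> (norm (k \<xi>))\<^sup>2 * poisson d (\<xi> - \<eta>)) +
          (case p of (\<xi>, \<eta>) \<Rightarrow> (norm (k \<eta>))\<^sup>2 * poisson d (\<xi> - \<eta>))))"
      proof (rule Bochner_Integration.integral_mono')
        fix p :: "real \<times> real"
        obtain \<xi> \<eta> where p: "p = (\<xi>, \<eta>)" by (cases p)
        have "norm (k \<xi>) * norm (k \<eta>) \<le> 1/2 * ((norm (k \<xi>))\<^sup>2 + (norm (k \<eta>))\<^sup>2)"
          using sum_squares_bound[of "norm (k \<xi>)" "norm (k \<eta>)"] by simp
        from mult_right_mono[OF this poisson_nonneg[OF d, of "\<xi> - \<eta>"]]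
        show "norm (k (fst p) * cnj (k (snd p)) * of_real (poisson d (fst p - snd p))) \<le> 1/2 * ((case p of (\<xi>, \<eta>) \<Rightarrow> (norm (k \<xi>))\<^sup>2 * poisson d (\<xi> - \<eta>)) +
          (case p of (\<xi>, \<eta>) \<Rightarrow> (norm (k \<eta>))\<^sup>2 * poisson d (\<xi> - \<eta>)))"
          using poisson_nonneg[OF d, of "\<xi> - \<eta>"] by (simp add: p norm_mult algebra_simps)
        show "0 \<le> 1/2 * ((case p of (\<xi>, \<eta>) \<Rightarrow> (norm (k \<xi>))\<^sup>2 * poisson d (\<xi> - \<eta>)) +
          (case p of (\<xi>, \<eta>) \<Rightarrow> (norm (k \<eta>))\<^sup>2 * poisson d (\<xi> - \<eta>)))"
          using poisson_nonneg[OF d] by (simp add: p)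
      qed (use i1 i2 in auto)
      also have "\<dots> = 2 * pi * B" using i1 i2 v1 v2 by simp
      finally show ?thesis .
    qed
    finally show ?thesis
      using int by (subst nn_integral_eq_integral) (auto intro!: ennreal_leI)
  qed
  have "(\<lambda>n. \<integral>\<^sup>+x. ennreal ((norm (F x))\<^sup>2 * exp (- (1 / real (Suc n) * \<bar>x\<bar>))) \<partial>lborel) \<longlonglongrightarrow> (\<integral>\<^sup>+x. ennreal ((norm (F x))\<^sup>2) \<partial>lborel)"
  proof (rule nn_integral_LIMSEQ)
    show "incseq (\<lambda>n x. ennreal ((norm (F x))\<^sup>2 * exp (- (1 / real (Suc n) * \<bar>x\<bar>))))"
      by (intro incseq_SucI le_funI ennreal_leI mult_left_mono) (auto intro!: divide_left_mono)
    show "(\<lambda>n. ennreal ((norm (F x))\<^sup>2 * exp (- (1 / real (Suc n) * \<bar>x\<bar>)))) \<longlonglongrightarrow> ennreal ((norm (F x))\<^sup>2)" for x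
    proof -
      have "(\<lambda>n. (norm (F x))\<^sup>2 * exp (- (1 / real (Suc n) * \<bar>x\<bar>))) \<longlonglongrightarrow> (norm (F x))\<^sup>2 * exp (- (0 * \<bar>x\<bar>))"
        by (intro tendsto_intros LIMSEQ_Suc[OF lim_1_over_n])
      then show ?thesis by (intro tendsto_ennrealI) simp
    qed
  qed measurable
  then have "(\<integral>\<^sup>+x. ennreal ((norm (F x))\<^sup>2) \<partial>lborel) \<le> ennreal (2 * pi * B)"
    by (rule LIMSEQ_le_const2) (intro exI allI impI *, simp)
  then show ?thesis by (simp add: F_def B_def)
qed

subsection \<open>Compactly supported smooth functions\<close>

text \<open>The polynomial and the power are parameters because the resulting family is closed under
  differentiation: \<open>bump_deriv\<close> acts on the parameters alone, and every higher
  derivative of a function defined by cases is then available at once.\<close>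

definition bump :: "real poly \<Rightarrow> nat \<Rightarrow> real \<Rightarrow> real" where
  "bump q n x = (if \<bar>x\<bar> < 1 then poly q x * exp (- 1 / (1 - x\<^sup>2)) / (1 - x\<^sup>2) ^ n else 0)"

definition bump_deriv :: "real poly \<times> nat \<Rightarrow> real poly \<times> nat" where
  "bump_deriv = (\<lambda>(q, n). (pderiv q * [:1, 0, -1:]\<^sup>2 + q * (smult (2 * real n) [:0, 1, 0, -1:] - [:0, 2:]), n + 2))"

text \<open>With \<open>m = n + 2\<close>, the inequality
  \<open>1 / (p * m) <= exp (1 / (p * m))\<close> is raised to the power \<open>m\<close>. This
  exponent leaves a factor \<open>p^2\<close>, and quadratic vanishing is what makes the bump
  differentiable at the ends of its support.\<close>

lemma exp_minus_inverse_le: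
  fixes p :: real
  assumes "p > 0"
  shows "exp (- 1 / p) / p ^ n \<le> real (n + 2) ^ (n + 2) * p\<^sup>2"
proof -
  have "1 / (p * real (n + 2)) \<le> exp (1 / (p * real (n + 2)))"
    using exp_ge_add_one_self[of "1 / (p * real (n + 2))"] by linarith
  then have "(1 / (p * real (n + 2))) ^ (n + 2) \<le> exp (1 / (p * real (n + 2))) ^ (n + 2)"
    using assms by (intro power_mono) auto
  also have "\<dots> = exp (1 / p)"
  proof -
    have "real (n + 2) * (1 / (p * real (n + 2))) = 1 / p" by simp
    then show ?thesis by (simp only: exp_of_nat_mult[symmetric])
  qed
  finally have "1 \<le> exp (1 / p) * (p * real (n + 2)) ^ (n + 2)"
    using assms by (simp add: power_divide pos_divide_le_eq)
  then have "exp (- 1 / p) \<le> (p * real (n + 2)) ^ (n + 2)"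
    by (simp add: exp_minus inverse_eq_divide pos_divide_le_eq mult.commute)
  then have "exp (- 1 / p) / p ^ n \<le> (p * real (n + 2)) ^ (n + 2) / p ^ n"
    using assms by (intro divide_right_mono) auto
  also have "\<dots> = real (n + 2) ^ (n + 2) * p\<^sup>2"
    using assms by (simp add: power_mult_distrib power_add power2_eq_square)
  finally show ?thesis .
qed

text \<open>Inside the support this is the quotient rule. At any point \<open>x\<close> with
  \<open>|x| >= 1\<close>, in particular at the boundary, the function vanishes and is
  \<open>O(|y - x|^2)\<close> nearby, so its derivative is 0.\<close>

lemma bump_has_derivative:
  "(bump q n has_real_derivative case_prod bump (bump_deriv (q, n)) x) (at x)"
proof (cases "\<bar>x\<bar> < 1")
  case True
  define p where "p = 1 - x\<^sup>2"
  have p: "p > 0" using True by (simp add: p_def abs_square_less_1)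
  have "((\<lambda>x. poly q x * exp (- 1 / (1 - x\<^sup>2)) / (1 - x\<^sup>2) ^ n) has_real_derivative
     ((poly (pderiv q) x * exp (- 1 / p) + poly q x * (exp (- 1 / p) * (- (2 * x) / p\<^sup>2))) * p ^ n
        - poly q x * exp (- 1 / p) * (real n * p ^ (n - 1) * - (2 * x))) / (p ^ n * p ^ n)) (at x)"
    using p unfolding p_def
    by (auto intro!: derivative_eq_intros simp: power2_eq_square)
  also have "((poly (pderiv q) x * exp (- 1 / p) + poly q x * (exp (- 1 / p) * (- (2 * x) / p\<^sup>2))) * p ^ n
        - poly q x * exp (- 1 / p) * (real n * p ^ (n - 1) * - (2 * x))) / (p ^ n * p ^ n)
     = (poly (pderiv q) x * p\<^sup>2 + poly q x * (2 * real n * x * p - 2 * x)) * exp (- 1 / p) / p ^ (n + 2)"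
    using p by (cases n) (simp_all add: field_simps power2_eq_square)
  also have "\<dots> = case_prod bump (bump_deriv (q, n)) x"
    using True by (simp add: bump_def bump_deriv_def p_def power2_eq_square algebra_simps)
  finally have *: "((\<lambda>x. poly q x * exp (- 1 / (1 - x\<^sup>2)) / (1 - x\<^sup>2) ^ n) has_real_derivative
     case_prod bump (bump_deriv (q, n)) x) (at x)" .
  have "open {x::real. \<bar>x\<bar> < 1}" by (intro open_Collect_less continuous_intros)
  with * show ?thesis
    by (rule has_field_derivative_transform_within_open) (use True in \<open>auto simp: bump_def\<close>)
next
  case False
  obtain B where B: "\<And>y. y \<in> {-1..1} \<Longrightarrow> \<bar>poly q y\<bar> \<le> B"
  proof -
    have "compact (poly q ` {-1..1})"
      by (intro compact_continuous_image continuous_intros) auto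
    then have "bounded (poly q ` {-1..1})" by (rule compact_imp_bounded)
    then show ?thesis using that unfolding bounded_iff by (metis atLeastAtMost_iff imageI real_norm_def)
  qed
  have B0: "B \<ge> 0" using B[of 0] by auto
  \<comment> \<open>The 4 comes from \<open>1 - y^2 <= 2 * |y - x|\<close> for
    \<open>|y| < 1 <= |x|\<close>, squared.\<close>
  define C where "C = B * (real (n + 2) ^ (n + 2) * 4)"
  have C0: "C \<ge> 0" using B0 by (simp add: C_def)
  have le: "\<bar>bump q n y\<bar> \<le> C * \<bar>y - x\<bar>\<^sup>2" for y
  proof (cases "\<bar>y\<bar> < 1")
    case True
    define p where "p = 1 - y\<^sup>2"
    have p: "p > 0" using True by (simp add: p_def abs_square_less_1)
    have "p = (1 - \<bar>y\<bar>) * (1 + \<bar>y\<bar>)" by (simp add: p_def algebra_simps power2_eq_square)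
    also have "\<dots> \<le> \<bar>y - x\<bar> * 2" using True False by (intro mult_mono) auto
    finally have "p\<^sup>2 \<le> (\<bar>y - x\<bar> * 2)\<^sup>2" using p by (intro power_mono) auto
    then have p2: "p\<^sup>2 \<le> 4 * \<bar>y - x\<bar>\<^sup>2" by (simp add: power_mult_distrib)
    have "\<bar>bump q n y\<bar> = \<bar>poly q y\<bar> * (exp (- 1 / p) / p ^ n)"
      using True p by (simp add: bump_def p_def[symmetric] abs_mult)
    also have "\<dots> \<le> B * (real (n + 2) ^ (n + 2) * p\<^sup>2)"
      using B[of y] True B0 p exp_minus_inverse_le[OF p, of n] by (intro mult_mono) (auto simp: abs_less_iff)
    also have "\<dots> \<le> B * (real (n + 2) ^ (n + 2) * (4 * \<bar>y - x\<bar>\<^sup>2))"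
      using B0 p2 by (intro mult_left_mono) auto
    finally show ?thesis by (simp add: C_def mult_ac)
  qed (use C0 in \<open>simp add: bump_def\<close>)
  have x0: "bump q n x = 0" using False by (simp add: bump_def)
  have "((\<lambda>y. (bump q n y - bump q n x) / (y - x)) \<longlongrightarrow> 0) (at x)"
  proof (rule Lim_null_comparison)
    show "\<forall>\<^sub>F y in at x. norm ((bump q n y - bump q n x) / (y - x)) \<le> C * \<bar>y - x\<bar>"
      unfolding eventually_at_filter
    proof (intro always_eventually allI impI)
      fix y assume "y \<noteq> x"
      then show "norm ((bump q n y - bump q n x) / (y - x)) \<le> C * \<bar>y - x\<bar>"
        using le[of y] by (simp add: x0 abs_divide pos_divide_le_eq power2_eq_square mult.assoc)
    qed
    have "((\<lambda>y. C * \<bar>y - x\<bar>) \<longlongrightarrow> C * \<bar>x - x\<bar>) (at x)" by (intro tendsto_intros)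
    then show "((\<lambda>y. C * \<bar>y - x\<bar>) \<longlongrightarrow> 0) (at x)" by simp
  qed
  moreover have "case_prod bump (bump_deriv (q, n)) x = 0" using False by (simp add: bump_def bump_deriv_def)
  ultimately show ?thesis by (simp add: has_field_derivative_iff)
qed

definition bump_derivs :: "nat \<Rightarrow> real \<Rightarrow> real" where
  "bump_derivs k = case_prod bump ((bump_deriv ^^ k) (1, 0))"

lemma bump_derivs_has_derivative: "(bump_derivs k has_real_derivative bump_derivs (Suc k) x) (at x)"
  using bump_has_derivative[of "fst ((bump_deriv ^^ k) (1, 0))" "snd ((bump_deriv ^^ k) (1, 0))" x]
  by (simp add: bump_derivs_def split_beta')

lemma bump_derivs_eq_0: "\<bar>x\<bar> \<ge> 1 \<Longrightarrow> bump_derivs k x = 0"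
  by (simp add: bump_derivs_def bump_def split_beta')

lemma isCont_bump_derivs [continuous_intros]: "isCont (bump_derivs k) x"
  using bump_derivs_has_derivative DERIV_isCont by blast

lemma bump_derivs_nonneg: "bump_derivs 0 x \<ge> 0"
  by (auto simp: bump_derivs_def bump_def)

lemma bump_derivs_0_pos: "bump_derivs 0 0 > 0"
  by (auto simp: bump_derivs_def bump_def)

lemma higher_deriv_eq:
  fixes D :: "nat \<Rightarrow> real \<Rightarrow> real"
  assumes "\<And>n x. (D n has_real_derivative D (Suc n) x) (at x)"
  shows "(deriv ^^ n) (D 0) = D n"
proof (induction n)
  case (Suc n)
  then show ?case using assms by (auto intro!: ext DERIV_imp_deriv)
qed simp

lemma test_functionI:
  fixes D :: "nat \<Rightarrow> real \<Rightarrow> real"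
  assumes "\<And>n x. (D n has_real_derivative D (Suc n) x) (at x)" and "bounded {x. D 0 x \<noteq> 0}"
  shows "test_function (D 0)" "deriv (D 0) = D 1"
proof -
  show "test_function (D 0)"
    unfolding test_function_def higher_deriv_eq[of D, OF assms(1)]
    using assms by (auto simp: differentiable_on_def real_differentiable_def intro: differentiableI
        has_field_derivative_imp_has_derivative differentiable_at_withinI)
  show "deriv (D 0) = D 1"
    using higher_deriv_eq[of D 1, OF assms(1)] by simp
qed

text \<open>A smooth Heaviside function \<open>E\<close>, with \<open>c\<close> the integral of the
  bump. Differences of its rescaled translates are test functions that approximate the indicator of
  an interval.\<close>

lemma smooth_step_exists:
  obtains E c where "c > 0" "\<And>x. (E has_real_derivative bump_derivs 0 x / c) (at x)"
    "\<And>x. x \<le> -1 \<Longrightarrow> E x = 0" "\<And>x. x \<ge> 1 \<Longrightarrow> E x = 1" "\<And>x. 0 \<le> E x" "\<And>x. E x \<le> 1"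
    "has_bochner_integral lborel (bump_derivs 0) c"
proof -
  obtain B where "\<forall>x. (B has_vector_derivative bump_derivs 0 x) (at x)"
    using einterval_antiderivative[of "-\<infinity>" \<infinity> "bump_derivs 0"] isCont_bump_derivs by auto
  then have B: "(B has_real_derivative bump_derivs 0 x) (at x)" for x
    by (simp add: has_real_derivative_iff_has_vector_derivative)
  have Bm: "B x \<le> B y" if "x \<le> y" for x y
    by (rule DERIV_nonneg_imp_nondecreasing[OF that]) (use B bump_derivs_nonneg in blast)
  have lo: "B x = B (-1)" if "x \<le> -1" for x
  proof (cases "x = -1")
    case False
    then have "x < -1" using that by simp
    moreover have "(B has_real_derivative 0) (at y)" if "y < -1" for y
      using B[of y] bump_derivs_eq_0[of y 0] that by simp
    ultimately show ?thesis
      using DERIV_isconst_end[of x "-1" B] DERIV_isCont[OF B] by (simp add: continuous_at_imp_continuous_on)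
  qed simp
  have hi: "B x = B 1" if "x \<ge> 1" for x
  proof (cases "x = 1")
    case False
    then have "1 < x" using that by simp
    moreover have "(B has_real_derivative 0) (at y)" if "1 < y" for y
      using B[of y] bump_derivs_eq_0[of y 0] that by simp
    ultimately show ?thesis
      using DERIV_isconst_end[of 1 x B] DERIV_isCont[OF B] by (simp add: continuous_at_imp_continuous_on)
  qed simp
  define c where "c = B 1 - B (-1)"
  have c: "c > 0"
  proof (rule ccontr)
    assume "\<not> c > 0"
    then have "B y = B 1" if "y \<in> {-1<..<1}" for y
      using Bm[of "-1" y] Bm[of y 1] that by (auto simp: c_def)
    then have "(B has_real_derivative 0) (at 0)"
      by (intro has_field_derivative_transform_within_open[of "\<lambda>_. B 1" 0 0 "{-1<..<1}" B]) auto
    then show False using DERIV_unique[OF B[of 0]] bump_derivs_0_pos by auto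
  qed
  show thesis
  proof (rule that[of c "\<lambda>x. (B x - B (-1)) / c"])
    show "((\<lambda>x. (B x - B (-1)) / c) has_real_derivative bump_derivs 0 x / c) (at x)" for x
      using B c by (auto intro!: derivative_eq_intros)
    show "x \<le> -1 \<Longrightarrow> (B x - B (-1)) / c = 0" for x using lo[of x] by simp
    show "x \<ge> 1 \<Longrightarrow> (B x - B (-1)) / c = 1" for x using c hi[of x] by (simp add: c_def)
    show "0 \<le> (B x - B (-1)) / c" for x
    proof -
      have "B (-1) \<le> B x" using Bm[of "-1" x] lo[of x] by (metis linear order_refl)
      then show ?thesis using c by simp
    qed
    show "(B x - B (-1)) / c \<le> 1" for x
    proof -
      have "B x \<le> B 1" using Bm[of x 1] hi[of x] by (metis linear order_refl)
      then show ?thesis using c by (simp add: c_def)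
    qed
    have "has_bochner_integral lborel (\<lambda>x. bump_derivs 0 x * indicator {-1..1} x) c"
      unfolding c_def by (rule has_bochner_integral_FTC_Icc_real) (use B isCont_bump_derivs in auto)
    moreover have "(\<lambda>x. bump_derivs 0 x * indicator {-1..1} x) = bump_derivs 0"
    proof
      show "bump_derivs 0 x * indicator {-1..1} x = bump_derivs 0 x" for x
        using bump_derivs_eq_0[of x 0] by (cases "\<bar>x\<bar> < 1") (auto simp: indicator_def)
    qed
    ultimately show "has_bochner_integral lborel (bump_derivs 0) c" by simp
  qed (fact c)
qed

section \<open>Weak derivatives and increments\<close>

lemma L2_measurable: "L2 g \<Longrightarrow> g \<in> borel_measurable borel"
  by (auto simp: L2_def)

lemma L2_set_integrable:
  assumes "L2 g"
  shows "set_integrable lborel {a..b} g"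
  unfolding set_integrable_def
proof (rule Bochner_Integration.integrable_bound)
  have [measurable]: "g \<in> borel_measurable borel" using assms by (rule L2_measurable)
  show "(\<lambda>x. indicator {a..b} x *\<^sub>R g x) \<in> borel_measurable lborel" by measurable
  show "integrable lborel (\<lambda>x. indicator {a..b} x + (norm (g x))\<^sup>2 :: real)"
    using assms by (intro Bochner_Integration.integrable_add integrable_real_indicator)
      (auto simp: L2_def emeasure_lborel_Icc_eq)
  show "AE x in lborel. norm (indicator {a..b} x *\<^sub>R g x) \<le> norm (indicator {a..b} x + (norm (g x))\<^sup>2 :: real)"
  proof (rule AE_I2)
    fix x
    have "norm (g x) \<le> 1 + (norm (g x))\<^sup>2"
    proof -
      have "norm (g x) \<le> 2 * norm (g x)" by simp
      also have "\<dots> \<le> 1 + (norm (g x))\<^sup>2"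
        using sum_squares_bound[of "norm (g x)" 1] by (simp add: add.commute)
      finally show ?thesis .
    qed
    then show "norm (indicator {a..b} x *\<^sub>R g x) \<le> norm (indicator {a..b} x + (norm (g x))\<^sup>2 :: real)"
      by (auto simp: indicator_def)
  qed
qed

lemma continuous_on_UNIV_measurable:
  "continuous_on UNIV f \<Longrightarrow> (f :: real \<Rightarrow> complex) \<in> borel_measurable borel"
  by (rule borel_measurable_continuous_onI)

text \<open>The weak derivative is tested against a smoothed indicator of the interval. The
  derivative of this test function is the difference of two approximate identities, at
  \<open>a\<close> and at \<open>b\<close>, which evaluate the continuous function \<open>f\<close>
  in the limit.\<close>

lemma weak_derivative_increment:
  fixes f g :: "real \<Rightarrow> complex"
  assumes fc: "continuous_on UNIV f" and fb: "\<And>x. norm (f x) \<le> M"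
    and w: "weak_derivative f g" and g: "L2 g" and ab: "a \<le> b"
  shows "f b - f a = (LINT x:{a..b}|lborel. g x)"
proof -
  obtain E c where E: "c > 0" "\<And>x. (E has_real_derivative bump_derivs 0 x / c) (at x)"
    "\<And>x. x \<le> -1 \<Longrightarrow> E x = 0" "\<And>x. x \<ge> 1 \<Longrightarrow> E x = 1" "\<And>x. 0 \<le> E x" "\<And>x. E x \<le> 1"
    "has_bochner_integral lborel (bump_derivs 0) c"
    using smooth_step_exists by metis
  have [measurable]: "f \<in> borel_measurable borel" "g \<in> borel_measurable borel"
    using fc g by (auto intro: continuous_on_UNIV_measurable L2_measurable)
  have bi: "integrable lborel (bump_derivs 0)" "(LINT z|lborel. bump_derivs 0 z) = c"
    using E(7) by (simp_all add: has_bochner_integral_iff)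
  have [measurable]: "bump_derivs 0 \<in> borel_measurable borel" using bi(1) by auto
  have Ec: "continuous_on UNIV E"
    using E(2) by (meson DERIV_isCont continuous_at_imp_continuous_on)
  have [measurable]: "E \<in> borel_measurable borel"
    using Ec by (rule borel_measurable_continuous_onI)
  \<comment> \<open>The scales are at least 1, so that all the test functions vanish outside
    \<open>{a - 1..b + 1}\<close>.\<close>
  define n where "n i = real (Suc i)" for i
  have n: "n i \<ge> 1" for i by (simp add: n_def)
  \<comment> \<open>\<open>D i k\<close> is the derivative of order \<open>k\<close> of the test
    function \<open>D i 0\<close>; all orders are given together because
    \<open>test_functionI\<close> asks for the whole tower.\<close>
  define D where "D i k x = (case k of 0 \<Rightarrow> E (n i * (x - a)) - E (n i * (x - b))
     | Suc m \<Rightarrow> n i ^ Suc m * (bump_derivs m (n i * (x - a)) - bump_derivs m (n i * (x - b))) / c)" for i k x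
  have D: "(D i k has_real_derivative D i (Suc k) x) (at x)" for i k x
  proof (cases k)
    case 0
    have "((\<lambda>x. E (n i * (x - a)) - E (n i * (x - b))) has_real_derivative
       (bump_derivs 0 (n i * (x - a)) / c * n i - bump_derivs 0 (n i * (x - b)) / c * n i)) (at x)"
      by (rule derivative_eq_intros DERIV_chain2[OF E(2)] refl | simp)+
    then show ?thesis using 0 by (simp add: D_def[abs_def] algebra_simps diff_divide_distrib)
  next
    case (Suc m)
    have "((\<lambda>x. n i ^ Suc m * (bump_derivs m (n i * (x - a)) - bump_derivs m (n i * (x - b))) / c) has_real_derivative
       n i ^ Suc m * (bump_derivs (Suc m) (n i * (x - a)) * n i - bump_derivs (Suc m) (n i * (x - b)) * n i) / c) (at x)"
      using E(1) by (auto intro!: derivative_eq_intros DERIV_chain2[OF bump_derivs_has_derivative])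
    then show ?thesis using Suc by (simp add: D_def[abs_def] algebra_simps)
  qed
  have nneg: "n i * y \<le> -1" if "y \<le> -1" for i y
    using mult_right_mono_neg[OF n[of i], of y] that by (metis (no_types) mult_1 neg_le_0_iff_le order_trans zero_le_one)
  have npos: "n i * y \<ge> 1" if "y \<ge> 1" for i y
    using mult_right_mono[OF n[of i], of y] that by (metis (no_types) mult_1 order_trans zero_le_one)
  have out: "D i 0 x = 0" if "x \<notin> {a - 1..b + 1}" for i x
  proof -
    have "x < a - 1 \<or> x > b + 1" using that by auto
    then show ?thesis
    proof (elim disjE)
      assume 1: "x < a - 1"
      have "n i * (x - a) \<le> -1" "n i * (x - b) \<le> -1" using 1 ab by (auto intro!: nneg)
      from E(3)[OF this(1)] E(3)[OF this(2)] show ?thesis by (simp add: D_def)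
    next
      assume 2: "x > b + 1"
      have "n i * (x - a) \<ge> 1" "n i * (x - b) \<ge> 1" using 2 ab by (auto intro!: npos)
      from E(4)[OF this(1)] E(4)[OF this(2)] show ?thesis by (simp add: D_def)
    qed
  qed
  have t: "test_function (D i 0)" "deriv (D i 0) = D i 1" for i
  proof -
    have "{x. D i 0 x \<noteq> 0} \<subseteq> {a - 1..b + 1}" using out by blast
    then have bd: "bounded {x. D i 0 x \<noteq> 0}" by (rule bounded_subset[OF bounded_closed_interval])
    show "test_function (D i 0)" "deriv (D i 0) = D i 1"
      using test_functionI[of "D i", OF D bd] by auto
  qed
  have weq: "(LINT x|lborel. f x * of_real (D i 1 x)) = - (LINT x|lborel. g x * of_real (D i 0 x))" for i
    using w t[of i] unfolding weak_derivative_def by metis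
  have shift: "integrable lborel (\<lambda>x. f x * of_real (n i * bump_derivs 0 (n i * (x - p))))"
    "(LINT x|lborel. f x * of_real (n i * bump_derivs 0 (n i * (x - p)))) = (LINT z|lborel. f (p + z / n i) * of_real (bump_derivs 0 z))" for i p
  proof -
    have i0: "integrable lborel (\<lambda>z. f (p + z / n i) * of_real (bump_derivs 0 z))"
    proof (rule Bochner_Integration.integrable_bound)
      show "integrable lborel (\<lambda>z. M * bump_derivs 0 z)" using bi(1) by simp
      show "AE z in lborel. norm (f (p + z / n i) * of_real (bump_derivs 0 z)) \<le> norm (M * bump_derivs 0 z)"
        using fb order_trans[OF norm_ge_zero fb] bump_derivs_nonneg by (intro AE_I2) (auto simp: norm_mult intro!: mult_right_mono)
    qed measurable
    have n0: "n i \<noteq> 0" using n[of i] by auto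
    define F where "F x = f x * of_real (n i * bump_derivs 0 (n i * (x - p)))" for x
    have F: "F (p + (1 / n i) * z) = of_real (n i) * (f (p + z / n i) * of_real (bump_derivs 0 z))" for z
      using n0 by (simp add: F_def)
    have "integrable lborel (\<lambda>z. F (p + (1 / n i) * z))"
      unfolding F using i0 by simp
    then show "integrable lborel (\<lambda>x. f x * of_real (n i * bump_derivs 0 (n i * (x - p))))"
      using n0 by (subst (asm) lborel_integrable_real_affine_iff) (auto simp: F_def[abs_def])
    have "(LINT x|lborel. F x) = \<bar>1 / n i\<bar> *\<^sub>R (LINT z|lborel. F (p + (1 / n i) * z))"
      using n0 by (intro lborel_integral_real_affine) auto
    also have "\<dots> = (LINT z|lborel. f (p + z / n i) * of_real (bump_derivs 0 z))"
      unfolding F using n0 n[of i] by (simp add: scaleR_conv_of_real)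
    finally show "(LINT x|lborel. f x * of_real (n i * bump_derivs 0 (n i * (x - p)))) = (LINT z|lborel. f (p + z / n i) * of_real (bump_derivs 0 z))"
      by (simp add: F_def)
  qed
  have lim_n: "(\<lambda>i. z / n i) \<longlonglongrightarrow> 0" for z
    using LIMSEQ_Suc[OF lim_const_over_n[of z]] by (simp add: n_def)
  have limf: "(\<lambda>i. LINT z|lborel. f (p + z / n i) * of_real (bump_derivs 0 z)) \<longlonglongrightarrow> f p * of_real c" for p
  proof -
    have "(\<lambda>i. LINT z|lborel. f (p + z / n i) * of_real (bump_derivs 0 z)) \<longlonglongrightarrow> (LINT z|lborel. f p * of_real (bump_derivs 0 z))"
    proof (rule integral_dominated_convergence)
      show "integrable lborel (\<lambda>z. M * bump_derivs 0 z)" using bi(1) by simp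
      show "AE z in lborel. norm (f (p + z / n i) * of_real (bump_derivs 0 z)) \<le> M * bump_derivs 0 z" for i
        using fb bump_derivs_nonneg by (intro AE_I2) (auto simp: norm_mult intro!: mult_right_mono)
      show "AE z in lborel. (\<lambda>i. f (p + z / n i) * of_real (bump_derivs 0 z)) \<longlonglongrightarrow> f p * of_real (bump_derivs 0 z)"
      proof (intro AE_I2 tendsto_mult tendsto_const)
        fix z
        have "(\<lambda>i. p + z / n i) \<longlonglongrightarrow> p + 0" by (intro tendsto_add tendsto_const lim_n)
        then show "(\<lambda>i. f (p + z / n i)) \<longlonglongrightarrow> f p"
          using continuous_on_tendsto_compose[OF fc, of "\<lambda>i. p + z / n i" p sequentially] by simp
      qed
    qed measurable
    then show ?thesis by (simp add: bi)
  qed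
  have L: "(LINT x|lborel. f x * of_real (D i 1 x)) = ((LINT z|lborel. f (a + z / n i) * of_real (bump_derivs 0 z))
     - (LINT z|lborel. f (b + z / n i) * of_real (bump_derivs 0 z))) / of_real c" for i
  proof -
    have "(LINT x|lborel. f x * of_real (D i 1 x)) = (LINT x|lborel. (f x * of_real (n i * bump_derivs 0 (n i * (x - a)))
       - f x * of_real (n i * bump_derivs 0 (n i * (x - b)))) / of_real c)"
      by (intro Bochner_Integration.integral_cong) (simp_all add: D_def algebra_simps diff_divide_distrib)
    also have "\<dots> = ((LINT z|lborel. f (a + z / n i) * of_real (bump_derivs 0 z))
     - (LINT z|lborel. f (b + z / n i) * of_real (bump_derivs 0 z))) / of_real c"
      by (subst integral_divide_zero, subst Bochner_Integration.integral_diff) (use shift in auto)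
    finally show ?thesis .
  qed
  have "(\<lambda>i. LINT x|lborel. f x * of_real (D i 1 x)) \<longlonglongrightarrow> (f a * of_real c - f b * of_real c) / of_real c"
    unfolding L using E(1) by (intro tendsto_divide tendsto_diff limf tendsto_const) auto
  moreover have "(\<lambda>i. - (LINT x|lborel. g x * of_real (D i 0 x))) \<longlonglongrightarrow> - (LINT x|lborel. indicator {a..b} x *\<^sub>R g x)"
  proof (rule tendsto_minus, rule integral_dominated_convergence)
    show "integrable lborel (\<lambda>x. norm (indicator {a - 1..b + 1} x *\<^sub>R g x))"
      using L2_set_integrable[OF g] unfolding set_integrable_def by (rule integrable_norm)
    show "AE x in lborel. norm (g x * of_real (D i 0 x)) \<le> norm (indicator {a - 1..b + 1} x *\<^sub>R g x)" for i
    proof (rule AE_I2)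
      fix x
      have "\<bar>D i 0 x\<bar> \<le> 1"
        using E(5)[of "n i * (x - a)"] E(6)[of "n i * (x - a)"] E(5)[of "n i * (x - b)"] E(6)[of "n i * (x - b)"]
        by (simp add: D_def abs_le_iff)
      then show "norm (g x * of_real (D i 0 x)) \<le> norm (indicator {a - 1..b + 1} x *\<^sub>R g x)"
        using out[of x i] by (cases "x \<in> {a - 1..b + 1}") (auto simp: norm_mult mult_left_le)
    qed
    show "AE x in lborel. (\<lambda>i. g x * of_real (D i 0 x)) \<longlonglongrightarrow> indicator {a..b} x *\<^sub>R g x"
      using AE_lborel_singleton[of a] AE_lborel_singleton[of b]
    proof eventually_elim
      case (elim x)
      have ev: "\<forall>\<^sub>F i in sequentially. n i * \<bar>y\<bar> \<ge> 1" if "y \<noteq> 0" for y :: real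
      proof -
        obtain N where N: "real N * \<bar>y\<bar> > 1" using reals_Archimedean3[of "\<bar>y\<bar>"] \<open>y \<noteq> 0\<close> by (meson zero_less_abs_iff)
        have "n i * \<bar>y\<bar> \<ge> 1" if "i \<ge> N" for i
          using that mult_right_mono[of "real N" "n i" "\<bar>y\<bar>"] N by (simp add: n_def)
        then show ?thesis by (auto simp: eventually_sequentially)
      qed
      have Elim: "\<forall>\<^sub>F i in sequentially. E (n i * y) = (if y > 0 then 1 else 0)" if "y \<noteq> 0" for y
        using ev[OF that]
      proof eventually_elim
        case (elim i)
        then show ?case using E(3)[of "n i * y"] E(4)[of "n i * y"] that by (cases "y > 0") auto
      qed
      have "\<forall>\<^sub>F i in sequentially. E (n i * (x - a)) = (if x - a > 0 then 1 else 0) \<and> E (n i * (x - b)) = (if x - b > 0 then 1 else 0)"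
        using elim by (intro eventually_conj Elim) auto
      then have "\<forall>\<^sub>F i in sequentially. g x * of_real (D i 0 x) = indicator {a..b} x *\<^sub>R g x"
        by (rule eventually_mono) (use elim ab in \<open>auto simp: D_def indicator_def\<close>)
      then show ?case by (rule tendsto_eventually)
    qed
    show "(\<lambda>x. g x * of_real (D i 0 x)) \<in> borel_measurable lborel" for i
      unfolding D_def by simp measurable
  qed measurable
  ultimately have "(f a * of_real c - f b * of_real c) / of_real c = - (LINT x|lborel. indicator {a..b} x *\<^sub>R g x)"
    unfolding weq by (rule LIMSEQ_unique)
  moreover have "(f a * of_real c - f b * of_real c) / of_real c = f a - f b"
    using E(1) by (simp add: diff_divide_distrib)
  ultimately have "f a - f b = - (LINT x:{a..b}|lborel. g x)" by (simp add: set_lebesgue_integral_def)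
  then show ?thesis by (metis minus_diff_eq minus_minus)
qed

subsection \<open>Regularity of Zhidkov functions\<close>

lemma L2_integrable: "L2 f \<Longrightarrow> integrable lborel (\<lambda>x. (norm (f x))\<^sup>2)"
  by (simp add: L2_def)

lemma L2_diff:
  assumes "L2 f" "L2 g"
  shows "L2 (\<lambda>x. f x - g x)"
  unfolding L2_def
proof
  have [measurable]: "f \<in> borel_measurable borel" "g \<in> borel_measurable borel"
    using assms by (auto intro: L2_measurable)
  show "(\<lambda>x. f x - g x) \<in> borel_measurable lborel" by measurable
  show "integrable lborel (\<lambda>x. (norm (f x - g x))\<^sup>2)"
  proof (rule Bochner_Integration.integrable_bound)
    show "integrable lborel (\<lambda>x. 2 * (norm (f x))\<^sup>2 + 2 * (norm (g x))\<^sup>2)"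
      using assms by (simp add: L2_integrable)
    show "AE x in lborel. norm ((norm (f x - g x))\<^sup>2) \<le> norm (2 * (norm (f x))\<^sup>2 + 2 * (norm (g x))\<^sup>2)"
    proof (rule AE_I2)
      fix x
      have "(norm (f x - g x))\<^sup>2 \<le> (norm (f x) + norm (g x))\<^sup>2"
        by (intro power_mono norm_triangle_ineq4) auto
      also have "\<dots> \<le> 2 * (norm (f x))\<^sup>2 + 2 * (norm (g x))\<^sup>2"
        using sum_squares_bound[of "norm (f x)" "norm (g x)"] by (simp add: power2_sum)
      finally show "norm ((norm (f x - g x))\<^sup>2) \<le> norm (2 * (norm (f x))\<^sup>2 + 2 * (norm (g x))\<^sup>2)" by simp
    qed
  qed measurable
qed

lemma norm_diff_square_le: "(norm (a - b :: 'a::real_normed_vector))\<^sup>2 \<le> 2 * (norm a)\<^sup>2 + 2 * (norm b)\<^sup>2"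
proof -
  have "(norm (a - b))\<^sup>2 \<le> (norm a + norm b)\<^sup>2"
    by (intro power_mono norm_triangle_ineq4) auto
  also have "\<dots> \<le> 2 * (norm a)\<^sup>2 + 2 * (norm b)\<^sup>2"
    using sum_squares_bound[of "norm a" "norm b"] by (simp add: power2_sum)
  finally show ?thesis .
qed

section \<open>Plancherel transforms\<close>

definition trunc_fourier :: "(real \<Rightarrow> complex) \<Rightarrow> real \<Rightarrow> real \<Rightarrow> complex" where
  "trunc_fourier f R \<xi> = (LINT x:{-R..R}|lborel. cis (- (x * \<xi>)) * f x)"

lemma L2_fourier_alt:
  "L2_fourier f g \<longleftrightarrow> L2 f \<and> L2 g \<and>
     ((\<lambda>R. \<integral>\<^sup>+\<xi>. ennreal ((norm (g \<xi> - trunc_fourier f R \<xi>))\<^sup>2) \<partial>lborel) \<longlongrightarrow> 0) at_top"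
  by (simp add: L2_fourier_def trunc_fourier_def)

lemma borel_measurable_trunc_fourier [measurable]:
  assumes [measurable]: "f \<in> borel_measurable borel"
  shows "trunc_fourier f R \<in> borel_measurable borel"
  unfolding trunc_fourier_def set_lebesgue_integral_def by measurable

lemma trunc_fourier_integrable:
  assumes "L2 f"
  shows "set_integrable lborel {-R..R} (\<lambda>x. cis (- (x * \<xi>)) * f x)"
proof -
  have [measurable]: "f \<in> borel_measurable borel" using assms by (rule L2_measurable)
  show ?thesis
    unfolding set_integrable_def
  proof (rule Bochner_Integration.integrable_bound)
    show "integrable lborel (\<lambda>x. indicator {-R..R} x *\<^sub>R f x)"
      using L2_set_integrable[OF assms] by (simp add: set_integrable_def)
    show "(\<lambda>x. indicator {-R..R} x *\<^sub>R (cis (- (x * \<xi>)) * f x)) \<in> borel_measurable lborel" by measurable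
  qed (simp add: norm_mult)
qed

lemma nn_integral_square_diff_le:
  fixes f g :: "real \<Rightarrow> complex"
  assumes [measurable]: "f \<in> borel_measurable borel" "g \<in> borel_measurable borel"
  shows "(\<integral>\<^sup>+\<xi>. ennreal ((norm (f \<xi> - g \<xi>))\<^sup>2) \<partial>lborel)
    \<le> 2 * (\<integral>\<^sup>+\<xi>. ennreal ((norm (f \<xi>))\<^sup>2) \<partial>lborel) + 2 * (\<integral>\<^sup>+\<xi>. ennreal ((norm (g \<xi>))\<^sup>2) \<partial>lborel)"
proof -
  have "(\<integral>\<^sup>+\<xi>. ennreal ((norm (f \<xi> - g \<xi>))\<^sup>2) \<partial>lborel) \<le> (\<integral>\<^sup>+\<xi>. 2 * ennreal ((norm (f \<xi>))\<^sup>2) + 2 * ennreal ((norm (g \<xi>))\<^sup>2) \<partial>lborel)"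
  proof (rule nn_integral_mono)
    fix \<xi>
    have "ennreal ((norm (f \<xi> - g \<xi>))\<^sup>2) \<le> ennreal (2 * (norm (f \<xi>))\<^sup>2 + 2 * (norm (g \<xi>))\<^sup>2)"
      by (intro ennreal_leI norm_diff_square_le)
    then show "ennreal ((norm (f \<xi> - g \<xi>))\<^sup>2) \<le> 2 * ennreal ((norm (f \<xi>))\<^sup>2) + 2 * ennreal ((norm (g \<xi>))\<^sup>2)"
      by (simp add: ennreal_plus ennreal_mult')
  qed
  also have "\<dots> = 2 * (\<integral>\<^sup>+\<xi>. ennreal ((norm (f \<xi>))\<^sup>2) \<partial>lborel) + 2 * (\<integral>\<^sup>+\<xi>. ennreal ((norm (g \<xi>))\<^sup>2) \<partial>lborel)"
    by (subst nn_integral_add, measurable) (simp add: nn_integral_cmult)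
  finally show ?thesis .
qed

lemma tendsto_0_two_mult_add:
  fixes f g :: "real \<Rightarrow> ennreal"
  assumes "(f \<longlongrightarrow> 0) F" "(g \<longlongrightarrow> 0) F"
  shows "((\<lambda>R. 2 * f R + 2 * g R) \<longlongrightarrow> 0) F"
proof -
  have "((\<lambda>R. (f R + f R) + (g R + g R)) \<longlongrightarrow> (0 + 0) + (0 + 0)) F"
    by (intro tendsto_add assms)
  then show ?thesis by (simp add: mult_2)
qed

lemma L2_fourier_diff:
  assumes "L2_fourier f1 g1" "L2_fourier f2 g2"
  shows "L2_fourier (\<lambda>x. f1 x - f2 x) (\<lambda>\<xi>. g1 \<xi> - g2 \<xi>)"
proof -
  have L: "L2 f1" "L2 f2" "L2 g1" "L2 g2" using assms by (auto simp: L2_fourier_def)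
  have [measurable]: "f1 \<in> borel_measurable borel" "f2 \<in> borel_measurable borel"
    "g1 \<in> borel_measurable borel" "g2 \<in> borel_measurable borel"
    using L by (auto intro: L2_measurable)
  have td: "trunc_fourier (\<lambda>x. f1 x - f2 x) R \<xi> = trunc_fourier f1 R \<xi> - trunc_fourier f2 R \<xi>" for R \<xi>
    unfolding trunc_fourier_def right_diff_distrib
    by (rule set_integral_diff) (intro trunc_fourier_integrable L)+
  have "((\<lambda>R. \<integral>\<^sup>+\<xi>. ennreal ((norm ((g1 \<xi> - trunc_fourier f1 R \<xi>) - (g2 \<xi> - trunc_fourier f2 R \<xi>)))\<^sup>2) \<partial>lborel) \<longlongrightarrow> 0) at_top"
  proof (rule tendsto_sandwich[OF _ _ tendsto_const])
    show "((\<lambda>R. 2 * (\<integral>\<^sup>+\<xi>. ennreal ((norm (g1 \<xi> - trunc_fourier f1 R \<xi>))\<^sup>2) \<partial>lborel)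
       + 2 * (\<integral>\<^sup>+\<xi>. ennreal ((norm (g2 \<xi> - trunc_fourier f2 R \<xi>))\<^sup>2) \<partial>lborel)) \<longlongrightarrow> 0) at_top"
      using assms unfolding L2_fourier_alt by (intro tendsto_0_two_mult_add) auto
    show "\<forall>\<^sub>F R in at_top. (\<integral>\<^sup>+\<xi>. ennreal ((norm ((g1 \<xi> - trunc_fourier f1 R \<xi>) - (g2 \<xi> - trunc_fourier f2 R \<xi>)))\<^sup>2) \<partial>lborel)
      \<le> 2 * (\<integral>\<^sup>+\<xi>. ennreal ((norm (g1 \<xi> - trunc_fourier f1 R \<xi>))\<^sup>2) \<partial>lborel)
       + 2 * (\<integral>\<^sup>+\<xi>. ennreal ((norm (g2 \<xi> - trunc_fourier f2 R \<xi>))\<^sup>2) \<partial>lborel)"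
      by (intro always_eventually allI nn_integral_square_diff_le) measurable
  qed auto
  then show ?thesis
    unfolding L2_fourier_alt using L by (auto simp: td L2_diff algebra_simps)
qed

text \<open>The difference of two transforms of \<open>f\<close> is a transform of 0, all of whose
  truncated transforms vanish. This makes the choice by \<open>SOME\<close> in
  \<open>sobolev_norm\<close> immaterial.\<close>

lemma L2_fourier_unique:
  assumes "L2_fourier f g1" "L2_fourier f g2"
  shows "AE \<xi> in lborel. g1 \<xi> = g2 \<xi>"
proof -
  have "L2_fourier (\<lambda>x. f x - f x) (\<lambda>\<xi>. g1 \<xi> - g2 \<xi>)" by (rule L2_fourier_diff[OF assms])
  moreover have "trunc_fourier (\<lambda>x. 0) R \<xi> = 0" for R \<xi>
    by (simp add: trunc_fourier_def)
  ultimately have *: "L2 (\<lambda>\<xi>. g1 \<xi> - g2 \<xi>)" "((\<lambda>R::real. \<integral>\<^sup>+\<xi>. ennreal ((norm (g1 \<xi> - g2 \<xi>))\<^sup>2) \<partial>lborel) \<longlongrightarrow> 0) at_top"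
    by (auto simp: L2_fourier_alt)
  have [measurable]: "(\<lambda>\<xi>. g1 \<xi> - g2 \<xi>) \<in> borel_measurable borel" using *(1) by (rule L2_measurable)
  have "(\<integral>\<^sup>+\<xi>. ennreal ((norm (g1 \<xi> - g2 \<xi>))\<^sup>2) \<partial>lborel) = 0"
    using *(2) by (simp add: tendsto_const_iff)
  then have "AE \<xi> in lborel. ennreal ((norm (g1 \<xi> - g2 \<xi>))\<^sup>2) = 0"
    by (subst (asm) nn_integral_0_iff_AE) measurable
  then show ?thesis by eventually_elim simp
qed

text \<open>The hypothesis \<open>dual\<close> of \<open>fourier_inversion_interval\<close> for a
  Plancherel transform. For the truncations of \<open>f\<close> it is Fubini together with
  \<open>fourier_exp_abs\<close>. As the truncation is removed, the left side converges because the
  damping factor is square integrable, the right side because \<open>f\<close> times the Poisson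
  kernel is integrable.\<close>

lemma L2_fourier_poisson:
  assumes f: "L2_fourier f g" and d: "d > 0"
  shows "(LINT \<xi>|lborel. g \<xi> * cis (\<xi> * x) * of_real (exp (- (d * \<bar>\<xi>\<bar>)))) = (LINT y|lborel. f y * of_real (poisson d (x - y)))"
proof -
  have L: "L2 f" "L2 g" using f by (auto simp: L2_fourier_def)
  have [measurable]: "f \<in> borel_measurable borel" "g \<in> borel_measurable borel"
    using L by (auto intro: L2_measurable)
  define \<psi> where "\<psi> \<xi> = cis (\<xi> * x) * complex_of_real (exp (- (d * \<bar>\<xi>\<bar>)))" for \<xi>
  have \<psi>i: "integrable lborel \<psi>" unfolding \<psi>_def by (rule integrable_cis_exp_abs[OF d])
  have [measurable]: "\<psi> \<in> borel_measurable borel" using \<psi>i by auto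
  have n\<psi>: "norm (\<psi> \<xi>) = exp (- (d * \<bar>\<xi>\<bar>))" for \<xi> by (simp add: \<psi>_def norm_mult)
  have \<psi>2: "integrable lborel (\<lambda>\<xi>. (norm (\<psi> \<xi>))\<^sup>2)"
    using integrable_exp_abs[of "2 * d"] d by (simp add: n\<psi> exp_double[symmetric] algebra_simps flip: exp_of_nat_mult)
  define P where "P = (LINT \<xi>|lborel. (norm (\<psi> \<xi>))\<^sup>2)"
  have prod_int: "integrable lborel (\<lambda>\<xi>. h \<xi> * \<psi> \<xi>)" if "L2 h" for h
  proof (rule Bochner_Integration.integrable_bound)
    have [measurable]: "h \<in> borel_measurable borel" using that by (rule L2_measurable)
    show "(\<lambda>\<xi>. h \<xi> * \<psi> \<xi>) \<in> borel_measurable lborel" by measurable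
    show "integrable lborel (\<lambda>\<xi>. (norm (h \<xi>))\<^sup>2 + (norm (\<psi> \<xi>))\<^sup>2)" using that \<psi>2 by (simp add: L2_integrable)
    show "AE \<xi> in lborel. norm (h \<xi> * \<psi> \<xi>) \<le> norm ((norm (h \<xi>))\<^sup>2 + (norm (\<psi> \<xi>))\<^sup>2)"
    proof (rule AE_I2)
      fix \<xi>
      have "norm (h \<xi>) * norm (\<psi> \<xi>) \<le> 2 * norm (h \<xi>) * norm (\<psi> \<xi>)" by simp
      also have "\<dots> \<le> (norm (h \<xi>))\<^sup>2 + (norm (\<psi> \<xi>))\<^sup>2" by (rule sum_squares_bound)
      finally show "norm (h \<xi> * \<psi> \<xi>) \<le> norm ((norm (h \<xi>))\<^sup>2 + (norm (\<psi> \<xi>))\<^sup>2)" by (simp add: norm_mult)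
    qed
  qed
  have tr: "(LINT \<xi>|lborel. trunc_fourier f R \<xi> * \<psi> \<xi>) = (LINT y:{-R..R}|lborel. f y * of_real (poisson d (x - y)))" for R
  proof -
    define k where "k y = \<psi> (- y)" for y
    define p where "p y = indicator {-R..R} y *\<^sub>R f y" for y
    have ki: "integrable lborel k" using lborel_integrable_real_affine[OF \<psi>i, of "-1" 0] by (simp add: k_def[abs_def])
    have pi: "integrable lborel p" using L2_set_integrable[OF L(1)] by (simp add: set_integrable_def p_def[abs_def])
    have "(LINT \<xi>|lborel. trunc_fourier f R \<xi> * \<psi> \<xi>) = (LINT y|lborel. trunc_fourier f R (- y) * \<psi> (- y))"
      by (subst lborel_integral_real_affine[of "-1" _ 0]) simp_all
    also have "\<dots> = (LINT y|lborel. (LINT \<xi>|lborel. cis (y * \<xi>) * p \<xi>) * k y)"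
      unfolding trunc_fourier_def set_lebesgue_integral_def k_def p_def by (simp add: mult.commute)
    also have "\<dots> = (LINT \<xi>|lborel. (LINT y|lborel. cis (y * \<xi>) * k y) * p \<xi>)"
      by (rule wigner_exchange[OF ki pi])
    also have "\<dots> = (LINT \<xi>|lborel. of_real (poisson d (x - \<xi>)) * p \<xi>)"
    proof (rule Bochner_Integration.integral_cong)
      fix \<xi>
      have "cis (y * \<xi>) * k y = cis (y * (\<xi> - x)) * of_real (exp (- (d * \<bar>y\<bar>)))" for y
      proof -
        have "cis (y * \<xi>) * cis (- y * x) = cis (y * (\<xi> - x))" by (simp add: cis_mult algebra_simps)
        then show ?thesis by (simp add: k_def \<psi>_def mult.assoc[symmetric])
      qed
      then have "(LINT y|lborel. cis (y * \<xi>) * k y) = of_real (poisson d (\<xi> - x))"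
        by (simp only: fourier_exp_abs[OF d])
      then show "(LINT y|lborel. cis (y * \<xi>) * k y) * p \<xi> = of_real (poisson d (x - \<xi>)) * p \<xi>"
        by (simp add: poisson_commute)
    qed simp
    also have "\<dots> = (LINT y:{-R..R}|lborel. f y * of_real (poisson d (x - y)))"
      unfolding set_lebesgue_integral_def p_def by (intro Bochner_Integration.integral_cong) (auto simp: indicator_def)
    finally show ?thesis .
  qed
  have pb: "poisson d z \<le> 2 / d" for z
  proof -
    have "d\<^sup>2 + z\<^sup>2 > 0" using d by (simp add: add_pos_nonneg)
    moreover have "2 * d * d \<le> 2 * (d\<^sup>2 + z\<^sup>2)" by (simp add: power2_eq_square)
    ultimately show ?thesis using d by (simp add: poisson_def divide_simps)
  qed
  have fp: "integrable lborel (\<lambda>y. f y * of_real (poisson d (x - y)))"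
  proof (rule Bochner_Integration.integrable_bound)
    have "integrable lborel (\<lambda>y. poisson d (x - y))"
      using has_bochner_integral_poisson[OF d, of "- x"] poisson_commute[of d x]
      by (simp add: has_bochner_integral_iff)
    then show "integrable lborel (\<lambda>y. 2 / d * ((norm (f y))\<^sup>2) + poisson d (x - y))"
      using L by (intro Bochner_Integration.integrable_add integrable_mult_right) (auto simp: L2_integrable)
    show "AE y in lborel. norm (f y * of_real (poisson d (x - y))) \<le> norm (2 / d * ((norm (f y))\<^sup>2) + poisson d (x - y))"
    proof (rule AE_I2)
      fix y
      have p0: "poisson d (x - y) \<ge> 0" by (rule poisson_nonneg[OF d])
      have "norm (f y) \<le> 2 * norm (f y) * 1" by simp
      also have "\<dots> \<le> (norm (f y))\<^sup>2 + 1\<^sup>2" by (rule sum_squares_bound)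
      finally have "norm (f y) * poisson d (x - y) \<le> ((norm (f y))\<^sup>2 + 1) * poisson d (x - y)"
        using p0 by (intro mult_right_mono) auto
      also have "\<dots> \<le> (norm (f y))\<^sup>2 * (2 / d) + poisson d (x - y)"
        using mult_left_mono[OF pb[of "x - y"], of "(norm (f y))\<^sup>2"] by (simp add: algebra_simps)
      also have "\<dots> = 2 / d * (norm (f y))\<^sup>2 + poisson d (x - y)" by simp
      also have "\<dots> \<le> norm (2 / d * (norm (f y))\<^sup>2 + poisson d (x - y))" by (simp only: real_norm_def abs_ge_self)
      finally show "norm (f y * of_real (poisson d (x - y))) \<le> norm (2 / d * ((norm (f y))\<^sup>2) + poisson d (x - y))"
        using p0 by (simp add: norm_mult)
    qed
  qed measurable
  define A where "A = (LINT \<xi>|lborel. g \<xi> * \<psi> \<xi>)"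
  define S where "S R = (LINT y:{-R..R}|lborel. f y * of_real (poisson d (x - y)))" for R
  define S' where "S' = (LINT y|lborel. f y * of_real (poisson d (x - y)))"
  have Slim: "(S \<longlongrightarrow> S') at_top"
    unfolding S_def S'_def set_lebesgue_integral_def
  proof (rule integral_dominated_convergence_at_top)
    show "integrable lborel (\<lambda>y. norm (f y * of_real (poisson d (x - y))))" using fp by (rule integrable_norm)
    show "AE y in lborel. ((\<lambda>R. indicator {-R..R} y *\<^sub>R (f y * of_real (poisson d (x - y)))) \<longlongrightarrow> f y * of_real (poisson d (x - y))) at_top"
    proof (rule AE_I2)
      fix y
      have "\<forall>\<^sub>F R in at_top. indicator {-R..R} y *\<^sub>R (f y * of_real (poisson d (x - y))) = f y * of_real (poisson d (x - y))"
        using eventually_ge_at_top[of "\<bar>y\<bar>"] by eventually_elim (auto simp: indicator_def abs_le_iff)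
      then show "((\<lambda>R. indicator {-R..R} y *\<^sub>R (f y * of_real (poisson d (x - y)))) \<longlongrightarrow> f y * of_real (poisson d (x - y))) at_top"
        by (rule tendsto_eventually)
    qed
  qed (auto simp: indicator_def intro!: always_eventually AE_I2)
  \<comment> \<open>Cauchy-Schwarz in the form \<open>p * q <= p^2 / \<eta> + \<eta> * q^2\<close>;
    for large \<open>R\<close> the error \<open>h\<close> of the truncated transform has squared
    norm at most \<open>\<eta>^2\<close>, which leaves \<open>\<eta> * (1 + P)\<close>.\<close>
  have close: "norm (A - S') \<le> \<eta> * (P + 1)" if \<eta>: "\<eta> > 0" for \<eta>
  proof (rule tendsto_upperbound)
    show "((\<lambda>R. norm (A - S R)) \<longlongrightarrow> norm (A - S')) at_top" by (intro tendsto_intros Slim)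
    have "\<forall>\<^sub>F R in at_top. (\<integral>\<^sup>+\<xi>. ennreal ((norm (g \<xi> - trunc_fourier f R \<xi>))\<^sup>2) \<partial>lborel) < ennreal (\<eta>\<^sup>2)"
      using f \<eta> unfolding L2_fourier_alt by (intro order_tendstoD(2)) auto
    then show "\<forall>\<^sub>F R in at_top. norm (A - S R) \<le> \<eta> * (P + 1)"
    proof eventually_elim
      case (elim R)
      define h where "h \<xi> = g \<xi> - trunc_fourier f R \<xi>" for \<xi>
      have [measurable]: "h \<in> borel_measurable borel" unfolding h_def by measurable
      have h2: "integrable lborel (\<lambda>\<xi>. (norm (h \<xi>))\<^sup>2)"
        using elim by (intro integrableI_bounded) (auto simp: h_def intro: less_trans)
      have hL: "L2 h" using h2 by (simp add: L2_def)
      have hs: "(LINT \<xi>|lborel. (norm (h \<xi>))\<^sup>2) \<le> \<eta>\<^sup>2"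
      proof -
        have "ennreal (LINT \<xi>|lborel. (norm (h \<xi>))\<^sup>2) \<le> ennreal (\<eta>\<^sup>2)"
          using elim h2 by (subst nn_integral_eq_integral[symmetric]) (auto simp: h_def)
        then show ?thesis by (subst (asm) ennreal_le_iff) auto
      qed
      have "A - S R = (LINT \<xi>|lborel. h \<xi> * \<psi> \<xi>)"
      proof -
        have "trunc_fourier f R \<xi> * \<psi> \<xi> = g \<xi> * \<psi> \<xi> - h \<xi> * \<psi> \<xi>" for \<xi> by (simp add: h_def algebra_simps)
        then have "S R = (LINT \<xi>|lborel. g \<xi> * \<psi> \<xi> - h \<xi> * \<psi> \<xi>)" using tr[of R] by (simp add: S_def)
        also have "\<dots> = A - (LINT \<xi>|lborel. h \<xi> * \<psi> \<xi>)"
          unfolding A_def using prod_int[OF L(2)] prod_int[OF hL] by simp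
        finally show ?thesis by simp
      qed
      also have "norm \<dots> \<le> (LINT \<xi>|lborel. norm (h \<xi> * \<psi> \<xi>))" by (rule integral_norm_bound)
      also have "\<dots> \<le> (LINT \<xi>|lborel. 1 / \<eta> * (norm (h \<xi>))\<^sup>2 + \<eta> * (norm (\<psi> \<xi>))\<^sup>2)"
      proof (rule integral_mono)
        show "integrable lborel (\<lambda>\<xi>. norm (h \<xi> * \<psi> \<xi>))" using prod_int[OF hL] by (rule integrable_norm)
        show "integrable lborel (\<lambda>\<xi>. 1 / \<eta> * (norm (h \<xi>))\<^sup>2 + \<eta> * (norm (\<psi> \<xi>))\<^sup>2)"
          by (intro Bochner_Integration.integrable_add integrable_mult_right h2 \<psi>2)
        fix \<xi>
        have "norm (h \<xi>) * (\<eta> * norm (\<psi> \<xi>)) \<le> 2 * norm (h \<xi>) * (\<eta> * norm (\<psi> \<xi>))" using \<eta> by simp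
        also have "\<dots> \<le> (norm (h \<xi>))\<^sup>2 + (\<eta> * norm (\<psi> \<xi>))\<^sup>2" by (rule sum_squares_bound)
        finally show "norm (h \<xi> * \<psi> \<xi>) \<le> 1 / \<eta> * (norm (h \<xi>))\<^sup>2 + \<eta> * (norm (\<psi> \<xi>))\<^sup>2"
          using \<eta> by (simp add: norm_mult field_simps power2_eq_square)
      qed
      also have "\<dots> = 1 / \<eta> * (LINT \<xi>|lborel. (norm (h \<xi>))\<^sup>2) + \<eta> * P"
        using h2 \<psi>2 by (subst Bochner_Integration.integral_add) (auto simp: P_def)
      also have "\<dots> \<le> 1 / \<eta> * \<eta>\<^sup>2 + \<eta> * P"
        using hs \<eta> by (intro add_right_mono mult_left_mono) auto
      also have "\<dots> = \<eta> * (P + 1)" using \<eta> by (simp add: power2_eq_square algebra_simps)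
      finally show ?case .
    qed
  qed simp
  have P0: "P \<ge> 0" by (simp add: P_def)
  have "norm (A - S') \<le> 0"
  proof (rule field_le_epsilon)
    fix e :: real assume "e > 0"
    moreover have "e / (P + 1) * (P + 1) = e" using P0 by simp
    ultimately show "norm (A - S') \<le> 0 + e"
      using close[of "e / (P + 1)"] P0 by simp
  qed
  then show ?thesis by (simp add: A_def S'_def \<psi>_def mult.assoc)
qed

section \<open>Embedding into twice differentiable functions for \<open>s > 5/2\<close>\<close>

lemma integrable_one_plus_square_powr:
  assumes "p > 1/2"
  shows "integrable lborel (\<lambda>x::real. (1 + x\<^sup>2) powr (- p))"
proof -
  define h where "h x = indicator {1..} x *\<^sub>R (x powr (- 2 * p))" for x :: real
  have "((\<lambda>x. x powr (- 2 * p)) has_integral -(1 powr (- 2 * p + 1)) / (- 2 * p + 1)) {1..}"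
    using assms by (intro has_integral_powr_to_inf) auto
  then have "(\<lambda>x::real. x powr (- 2 * p)) absolutely_integrable_on {1..}"
    by (intro nonnegative_absolutely_integrable_1) (auto intro: has_integral_integrable)
  then have "integrable lebesgue h"
    by (simp add: set_integrable_def h_def[abs_def])
  then have h: "integrable lborel h"
    by (subst (asm) integrable_completion) (auto simp: h_def[abs_def])
  then have h': "integrable lborel (\<lambda>x. h (- x))"
    using lborel_integrable_real_affine[OF h, of "-1" 0] by simp
  show ?thesis
  proof (rule Bochner_Integration.integrable_bound)
    show "integrable lborel (\<lambda>x. indicator {-1..1} x + h x + h (- x))"
      using h h' by (intro Bochner_Integration.integrable_add integrable_real_indicator) (auto simp: emeasure_lborel_Icc_eq)
    show "AE x in lborel. norm ((1 + x\<^sup>2) powr (- p)) \<le> norm (indicator {-1..1} x + h x + h (- x))"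
    proof (rule AE_I2)
      fix x :: real
      have h0: "h y \<ge> 0" for y by (simp add: h_def indicator_def)
      have "(1 + x\<^sup>2) powr (- p) \<le> indicator {-1..1} x + h x + h (- x)"
      proof (cases "\<bar>x\<bar> \<le> 1")
        case True
        have "(1 + x\<^sup>2) powr (- p) \<le> (1 + x\<^sup>2) powr 0" using assms by (intro powr_mono) auto
        also have "\<dots> = 1" by (simp add: add_nonneg_eq_0_iff)
        finally show ?thesis using True h0[of x] h0[of "- x"] by (auto simp: indicator_def abs_le_iff)
      next
        case False
        have "(1 + x\<^sup>2) powr (- p) \<le> (\<bar>x\<bar>\<^sup>2) powr (- p)"
          using False assms by (intro powr_mono2') auto
        also have "\<dots> = \<bar>x\<bar> powr (- 2 * p)"
        proof -
          have "\<bar>x\<bar>\<^sup>2 = \<bar>x\<bar> powr 2" using False by (simp add: powr_numeral)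
          then show ?thesis by (simp only: powr_powr) simp
        qed
        also have "\<dots> \<le> indicator {-1..1} x + h x + h (- x)"
          using False by (cases "x \<ge> 0") (auto simp: h_def indicator_def)
        finally show ?thesis .
      qed
      then show "norm ((1 + x\<^sup>2) powr (- p)) \<le> norm (indicator {-1..1} x + h x + h (- x))"
        by simp
    qed
  qed measurable
qed

lemma has_vector_derivative_iff_quotient:
  fixes f :: "real \<Rightarrow> 'a::real_normed_vector"
  shows "(f has_vector_derivative D) (at x within S) \<longleftrightarrow> ((\<lambda>y. (f y - f x) /\<^sub>R (y - x)) \<longlongrightarrow> D) (at x within S)"
proof -
  have eq: "norm ((f y - f x) /\<^sub>R (y - x) - D) = norm (f y - f x - (y - x) *\<^sub>R D) / norm (y - x)" if "y \<noteq> x" for y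
  proof -
    have "(f y - f x) /\<^sub>R (y - x) - D = (f y - f x - (y - x) *\<^sub>R D) /\<^sub>R (y - x)"
      using that by (simp add: scaleR_right_diff_distrib)
    then show ?thesis by (simp add: divide_inverse mult.commute)
  qed
  have "((\<lambda>y. (f y - f x) /\<^sub>R (y - x)) \<longlongrightarrow> D) (at x within S) \<longleftrightarrow>
     ((\<lambda>y. norm ((f y - f x) /\<^sub>R (y - x) - D)) \<longlongrightarrow> 0) (at x within S)"
    by (subst tendsto_norm_zero_iff) (rule Lim_null)
  also have "\<dots> \<longleftrightarrow> ((\<lambda>y. norm (f y - f x - (y - x) *\<^sub>R D) / norm (y - x)) \<longlongrightarrow> 0) (at x within S)"
    by (rule filterlim_cong) (auto simp: eventually_at_filter eq)
  also have "\<dots> \<longleftrightarrow> (f has_vector_derivative D) (at x within S)"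
    by (simp add: has_vector_derivative_def has_derivative_iff_norm bounded_linear_scaleR_left)
  finally show ?thesis by simp
qed

lemma norm_cis_diff_le: "norm (cis a - cis b) \<le> \<bar>a - b\<bar>"
proof -
  have "norm (cis a - cis b) \<le> 1 * norm (a - b)"
  proof (rule differentiable_bound[of UNIV cis "\<lambda>x h. h *\<^sub>R (\<i> * cis x)"])
    show "(cis has_derivative (\<lambda>h. h *\<^sub>R (\<i> * cis x))) (at x within UNIV)" for x
      using has_derivative_cis[OF has_derivative_ident, of x UNIV] by simp
    show "onorm (\<lambda>h. h *\<^sub>R (\<i> * cis x)) \<le> 1" for x
      by (intro onorm_bound) (auto simp: norm_mult)
  qed auto
  then show ?thesis by simp
qed

text \<open>Differentiation under the integral: as \<open>cis\<close> is 1-Lipschitz, the difference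
  quotients are dominated by \<open>|\<xi>| * |k|\<close>.\<close>

lemma fourier_has_derivative:
  fixes k :: "real \<Rightarrow> complex"
  assumes k: "integrable lborel k" and k1: "integrable lborel (\<lambda>\<xi>. of_real \<xi> * k \<xi>)"
  shows "((\<lambda>x. LINT \<xi>|lborel. k \<xi> * cis (\<xi> * x)) has_vector_derivative
    (LINT \<xi>|lborel. (\<i> * of_real \<xi> * k \<xi>) * cis (\<xi> * x))) (at x)"
proof -
  have [measurable]: "k \<in> borel_measurable borel" using k by auto
  have ki: "integrable lborel (\<lambda>\<xi>. k \<xi> * cis (\<xi> * x))" for x
    by (rule Bochner_Integration.integrable_bound[OF k]) (auto simp: norm_mult)
  have "((\<lambda>y. (LINT \<xi>|lborel. (k \<xi> * cis (\<xi> * y) - k \<xi> * cis (\<xi> * x)) / of_real (y - x))) \<longlongrightarrow>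
    (LINT \<xi>|lborel. (\<i> * of_real \<xi> * k \<xi>) * cis (\<xi> * x))) (at x)"
  proof (rule integral_dominated_convergence_within[where w = "\<lambda>\<xi>. norm (of_real \<xi> * k \<xi>)"])
    show "integrable lborel (\<lambda>\<xi>. norm (of_real \<xi> * k \<xi>))" using k1 by (rule integrable_norm)
    show "AE \<xi> in lborel. norm ((k \<xi> * cis (\<xi> * y) - k \<xi> * cis (\<xi> * x)) / of_real (y - x)) \<le> norm (of_real \<xi> * k \<xi>)"
      if "y \<in> UNIV - {x}" for y
    proof (rule AE_I2)
      fix \<xi>
      have "norm (k \<xi> * cis (\<xi> * y) - k \<xi> * cis (\<xi> * x)) = norm (k \<xi>) * norm (cis (\<xi> * y) - cis (\<xi> * x))"
        by (simp add: norm_mult[symmetric] right_diff_distrib)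
      also have "\<dots> \<le> norm (k \<xi>) * (\<bar>\<xi>\<bar> * \<bar>y - x\<bar>)"
        using norm_cis_diff_le[of "\<xi> * y" "\<xi> * x"] by (intro mult_left_mono) (auto simp: abs_mult[symmetric] algebra_simps)
      finally show "norm ((k \<xi> * cis (\<xi> * y) - k \<xi> * cis (\<xi> * x)) / of_real (y - x)) \<le> norm (of_real \<xi> * k \<xi>)"
        using that by (simp only: norm_divide norm_mult norm_of_real) (simp add: pos_divide_le_eq mult_ac)
    qed
    show "AE \<xi> in lborel. ((\<lambda>y. (k \<xi> * cis (\<xi> * y) - k \<xi> * cis (\<xi> * x)) / of_real (y - x)) \<longlongrightarrow> (\<i> * of_real \<xi> * k \<xi>) * cis (\<xi> * x)) (at x)"
    proof (rule AE_I2)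
      fix \<xi>
      have "((\<lambda>z. k \<xi> * exp (\<i> * (of_real \<xi> * z))) has_field_derivative (\<i> * of_real \<xi> * k \<xi>) * exp (\<i> * (of_real \<xi> * of_real x))) (at (of_real x))"
        by (auto intro!: derivative_eq_intros)
      from has_vector_derivative_real_field[OF this]
      have "((\<lambda>y. k \<xi> * cis (\<xi> * y)) has_vector_derivative (\<i> * of_real \<xi> * k \<xi>) * cis (\<xi> * x)) (at x)"
        by (simp add: cis_conv_exp)
      then show "((\<lambda>y. (k \<xi> * cis (\<xi> * y) - k \<xi> * cis (\<xi> * x)) / of_real (y - x)) \<longlongrightarrow> (\<i> * of_real \<xi> * k \<xi>) * cis (\<xi> * x)) (at x)"
        by (simp add: has_vector_derivative_iff_quotient scaleR_conv_of_real divide_inverse mult.commute of_real_inverse)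
    qed
  qed measurable
  moreover have "(LINT \<xi>|lborel. (k \<xi> * cis (\<xi> * y) - k \<xi> * cis (\<xi> * x)) / of_real (y - x))
     = ((LINT \<xi>|lborel. k \<xi> * cis (\<xi> * y)) - (LINT \<xi>|lborel. k \<xi> * cis (\<xi> * x))) /\<^sub>R (y - x)" for y
    unfolding integral_divide_zero Bochner_Integration.integral_diff[OF ki ki]
    by (simp add: scaleR_conv_of_real divide_inverse mult.commute)
  ultimately show ?thesis
    by (simp only: has_vector_derivative_iff_quotient)
qed

text \<open>The norm of \<open>X\<^sup>s\<close> enters through all strict upper bounds \<open>M\<close>, which are positive, so that the
  Cauchy-Schwarz inequality can be replaced by \<open>2 p q \<le> p\<^sup>2 / M + M q\<^sup>2\<close>.\<close>

lemma zhidkov_regular: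
  assumes s: "s > 5/2"
  obtains C where "C \<ge> 1" "\<And>f. f \<in> zhidkov s \<Longrightarrow> \<exists>f1 f2.
    (\<forall>x. (f has_vector_derivative f1 x) (at x)) \<and> (\<forall>x. (f1 has_vector_derivative f2 x) (at x)) \<and>
    continuous_on UNIV f2 \<and>
    (\<forall>M > zhidkov_norm s f. \<forall>x. norm (f x) \<le> C * M \<and> norm (f1 x) \<le> C * M \<and> norm (f2 x) \<le> C * M) \<and>
    (\<forall>M > zhidkov_norm s f. (\<integral>\<^sup>+x. ennreal ((norm (f1 x))\<^sup>2) \<partial>lborel) \<le> ennreal (C * M\<^sup>2)) \<and>
    (\<forall>M > zhidkov_norm s f. (\<integral>\<^sup>+x. ennreal ((norm (f2 x))\<^sup>2) \<partial>lborel) \<le> ennreal (C * M\<^sup>2))"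
proof -
  \<comment> \<open>Finite because \<open>s - 2 > 1/2\<close>, which is where \<open>s > 5/2\<close>
    enters. It is the second factor when \<open>sqrt (1 + \<xi>^2) * |k|\<close> is split into
    \<open>(1 + \<xi>^2) powr ((s - 1) / 2) * |k|\<close> and
    \<open>(1 + \<xi>^2) powr (- (s - 2) / 2)\<close>.\<close>
  define B where "B = (LINT \<xi>|lborel. (1 + \<xi>\<^sup>2) powr (- (s - 2)))"
  have Bi: "integrable lborel (\<lambda>\<xi>. (1 + \<xi>\<^sup>2) powr (- (s - 2)))"
    using s by (intro integrable_one_plus_square_powr) auto
  have B0: "B \<ge> 0" unfolding B_def by simp
  define C where "C = 1 + B"
  have C1: "C \<ge> 1" using B0 by (simp add: C_def)
  show thesis
  proof (rule that[OF C1])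
    fix f assume fz: "f \<in> zhidkov s"
    \<comment> \<open>\<open>g\<close>, and \<open>k\<close> below, are the very choices made in the
      definitions of the norms, so that \<open>zn\<close> holds by unfolding. Integrability is known
      for some other transform \<open>k1\<close> and is carried over by almost everywhere
      uniqueness.\<close>
    define g where "g = (SOME g. weak_derivative f g \<and> g \<in> sobolev (s - 1))"
    have g: "weak_derivative f g" "g \<in> sobolev (s - 1)"
      using fz someI_ex[of "\<lambda>g. weak_derivative f g \<and> g \<in> sobolev (s - 1)"]
      by (auto simp: zhidkov_def g_def)
    define k where "k = (SOME k. L2_fourier g k)"
    obtain k1 where k1: "L2_fourier g k1" "integrable lborel (\<lambda>\<xi>. (1 + \<xi>\<^sup>2) powr (s - 1) * (norm (k1 \<xi>))\<^sup>2)"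
      using g(2) by (auto simp: sobolev_def)
    have k: "L2_fourier g k" unfolding k_def by (rule someI[of "L2_fourier g", OF k1(1)])
    have gL: "L2 g" and kL: "L2 k" using k by (auto simp: L2_fourier_def)
    have [measurable]: "g \<in> borel_measurable borel" "k \<in> borel_measurable borel" "k1 \<in> borel_measurable borel"
      using gL kL k1(1) by (auto intro: L2_measurable simp: L2_fourier_def)
    have kw: "integrable lborel (\<lambda>\<xi>. (1 + \<xi>\<^sup>2) powr (s - 1) * (norm (k \<xi>))\<^sup>2)"
    proof (rule integrable_cong_AE_imp[OF k1(2)])
      show "AE \<xi> in lborel. (1 + \<xi>\<^sup>2) powr (s - 1) * (norm (k1 \<xi>))\<^sup>2 = (1 + \<xi>\<^sup>2) powr (s - 1) * (norm (k \<xi>))\<^sup>2"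
        using L2_fourier_unique[OF k1(1) k] by eventually_elim simp
    qed measurable
    define N where "N = (LINT \<xi>|lborel. (1 + \<xi>\<^sup>2) powr (s - 1) * (norm (k \<xi>))\<^sup>2)"
    have N0: "N \<ge> 0" unfolding N_def by simp
    have zn: "zhidkov_norm s f = (SUP x. norm (f x)) + sqrt N"
      by (simp add: zhidkov_norm_def sobolev_norm_def N_def k_def g_def)
    have fc: "continuous_on UNIV f" and fb: "bounded (range f)" using fz by (auto simp: zhidkov_def)
    then have bdd: "bdd_above (range (\<lambda>x. norm (f x)))"
      by (auto simp: bounded_iff bdd_above_def)
    have fsup: "norm (f x) \<le> (SUP x. norm (f x))" for x by (rule cSUP_upper[OF _ bdd]) simp
    have sup0: "(SUP x. norm (f x)) \<ge> 0" using order_trans[OF norm_ge_zero fsup[of 0]] .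
    have MN: "M > 0 \<and> N \<le> M\<^sup>2 \<and> (\<forall>x. norm (f x) \<le> M)" if M: "M > zhidkov_norm s f" for M
    proof -
      have "sqrt N < M" "(SUP x. norm (f x)) \<le> M" using M sup0 N0 by (auto simp: zn intro: less_imp_le order_trans add_increasing2)
        (smt (verit) real_sqrt_ge_zero)+
      moreover from this have "M > 0" using N0 by (meson le_less_trans real_sqrt_ge_zero)
      ultimately show ?thesis using fsup N0 by (auto intro: order_trans real_le_lsqrt simp: sqrt_le_D less_imp_le)
    qed
    have w1: "(1 + \<xi>\<^sup>2) powr (s - 1) \<ge> 1 + \<xi>\<^sup>2" for \<xi> :: real
      using powr_mono[of 1 "s - 1" "1 + \<xi>\<^sup>2"] s by simp
    have am: "sqrt (1 + \<xi>\<^sup>2) * norm (k \<xi>) \<le> ((1 + \<xi>\<^sup>2) powr (s - 1) * (norm (k \<xi>))\<^sup>2) / M + M * (1 + \<xi>\<^sup>2) powr (- (s - 2))"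
      if M: "M > 0" for M \<xi>
    proof -
      define p where "p = (1 + \<xi>\<^sup>2) powr ((s - 1) / 2) * norm (k \<xi>)"
      define q where "q = (1 + \<xi>\<^sup>2) powr (- (s - 2) / 2)"
      have halves: "(y powr (r / 2))\<^sup>2 = y powr r" for y r :: real
        by (simp add: power2_eq_square flip: powr_add)
      have pos: "1 + \<xi>\<^sup>2 > 0" by (simp add: add_pos_nonneg)
      have "(s - 1) / 2 + - (s - 2) / 2 = 1 / 2" by (simp add: field_simps)
      then have "(1 + \<xi>\<^sup>2) powr ((s - 1) / 2) * (1 + \<xi>\<^sup>2) powr (- (s - 2) / 2) = sqrt (1 + \<xi>\<^sup>2)"
        using pos by (simp only: powr_add[symmetric] powr_half_sqrt less_imp_le)
      then have "sqrt (1 + \<xi>\<^sup>2) * norm (k \<xi>) = p * q" by (simp add: p_def q_def mult_ac)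
      also have "\<dots> \<le> p\<^sup>2 / M + M * q\<^sup>2"
      proof -
        have pq0: "p * q \<ge> 0" by (simp add: p_def q_def)
        have "2 * p * (M * q) \<le> p\<^sup>2 + (M * q)\<^sup>2" by (rule sum_squares_bound)
        moreover have "2 * p * (M * q) = p * q * M + p * q * M" by (simp add: algebra_simps)
        moreover have "0 \<le> p * q * M" using pq0 M by simp
        ultimately have "p * q * M \<le> p\<^sup>2 + (M * q)\<^sup>2" by linarith
        then show ?thesis using M by (simp add: field_simps power2_eq_square)
      qed
      also have "p\<^sup>2 = (1 + \<xi>\<^sup>2) powr (s - 1) * (norm (k \<xi>))\<^sup>2"
        by (simp only: p_def power_mult_distrib halves)
      also have "q\<^sup>2 = (1 + \<xi>\<^sup>2) powr (- (s - 2))" by (simp only: q_def halves)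
      finally show ?thesis .
    qed
    have ami: "integrable lborel (\<lambda>\<xi>. ((1 + \<xi>\<^sup>2) powr (s - 1) * (norm (k \<xi>))\<^sup>2) / M + M * (1 + \<xi>\<^sup>2) powr (- (s - 2)))" for M
      using kw Bi by simp
    have i1: "integrable lborel (\<lambda>\<xi>. sqrt (1 + \<xi>\<^sup>2) * norm (k \<xi>))"
    proof (rule Bochner_Integration.integrable_bound[OF ami[of 1]])
      show "AE \<xi> in lborel. norm (sqrt (1 + \<xi>\<^sup>2) * norm (k \<xi>)) \<le> norm ((1 + \<xi>\<^sup>2) powr (s - 1) * (norm (k \<xi>))\<^sup>2 / 1 + 1 * (1 + \<xi>\<^sup>2) powr (- (s - 2)))"
        using am[of 1] by (intro AE_I2) (simp add: abs_mult)
    qed measurable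
    have i1b: "(LINT \<xi>|lborel. sqrt (1 + \<xi>\<^sup>2) * norm (k \<xi>)) \<le> C * M" if "M > zhidkov_norm s f" for M
    proof -
      have M: "M > 0" "N \<le> M\<^sup>2" using MN[OF that] by auto
      have "(LINT \<xi>|lborel. sqrt (1 + \<xi>\<^sup>2) * norm (k \<xi>)) \<le> (LINT \<xi>|lborel. ((1 + \<xi>\<^sup>2) powr (s - 1) * (norm (k \<xi>))\<^sup>2) / M + M * (1 + \<xi>\<^sup>2) powr (- (s - 2)))"
        by (rule integral_mono[OF i1 ami]) (rule am[OF M(1)])
      also have "\<dots> = N / M + M * B" using kw Bi by (simp add: N_def B_def)
      also have "\<dots> \<le> C * M" using M by (simp add: C_def field_simps power2_eq_square)
      finally show ?thesis .
    qed
    have ksq: "norm (k \<xi>) \<le> sqrt (1 + \<xi>\<^sup>2) * norm (k \<xi>)" "norm (of_real \<xi> * k \<xi>) \<le> sqrt (1 + \<xi>\<^sup>2) * norm (k \<xi>)" for \<xi>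
    proof -
      have "1 \<le> sqrt (1 + \<xi>\<^sup>2)" "\<bar>\<xi>\<bar> \<le> sqrt (1 + \<xi>\<^sup>2)" by (auto intro: real_le_rsqrt)
      from this[THEN mult_right_mono, of "norm (k \<xi>)"]
      show "norm (k \<xi>) \<le> sqrt (1 + \<xi>\<^sup>2) * norm (k \<xi>)" "norm (of_real \<xi> * k \<xi>) \<le> sqrt (1 + \<xi>\<^sup>2) * norm (k \<xi>)"
        by (simp_all add: norm_mult)
    qed
    have ki: "integrable lborel k"
      by (rule Bochner_Integration.integrable_bound[OF i1]) (use ksq in \<open>auto simp: abs_mult intro!: AE_I2\<close>)
    have k1i: "integrable lborel (\<lambda>\<xi>. of_real \<xi> * k \<xi>)"
      by (rule Bochner_Integration.integrable_bound[OF i1]) (use ksq in \<open>auto simp: abs_mult intro!: AE_I2\<close>)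
    define F1 where "F1 x = (LINT \<xi>|lborel. k \<xi> * cis (\<xi> * x))" for x
    define F2 where "F2 x = (LINT \<xi>|lborel. (\<i> * of_real \<xi> * k \<xi>) * cis (\<xi> * x))" for x
    \<comment> \<open>The factor in the inversion formula. Both \<open>|c|\<close> and
      \<open>|c|^2 * 2 * pi\<close> are at most 1, so that neither inversion nor Plancherel enlarges
      \<open>C\<close>.\<close>
    define c where "c = complex_of_real (1 / (2 * pi))"
    have nc: "norm c \<le> 1" "(norm c)\<^sup>2 * (2 * pi) \<le> 1"
      using pi_gt3 by (auto simp: c_def norm_divide power2_eq_square field_simps)
    have ik1: "integrable lborel (\<lambda>\<xi>. \<i> * of_real \<xi> * k \<xi>)"
      using integrable_mult_right[OF k1i, of \<i>] by (simp add: mult.assoc)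
    have F1c: "continuous_on UNIV F1" unfolding F1_def by (rule continuous_on_fourier[OF ki])
    have F2c: "continuous_on UNIV F2" unfolding F2_def by (rule continuous_on_fourier[OF ik1])
    have F12: "(F1 has_vector_derivative F2 x) (at x)" for x
      unfolding F1_def F2_def by (rule fourier_has_derivative[OF ki k1i])
    obtain A where A: "\<And>x. norm (f x) \<le> A" using fb by (auto simp: bounded_iff)
    \<comment> \<open>\<open>f\<close> is a primitive of its weak derivative \<open>g\<close>, and
      \<open>g\<close> has the same integrals over intervals as the continuous function
      \<open>c * F1\<close>. Hence \<open>f\<close> itself, without modification on a null set, is
      differentiable everywhere.\<close>
    have incr: "f b - f a = integral {a..b} (\<lambda>x. c * F1 x)" if "a \<le> b" for a b
    proof -
      have "(LINT x:{a..b}|lborel. F1 x) = 2 * pi * (LINT y:{a..b}|lborel. g y)"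
        unfolding F1_def
      proof (rule fourier_inversion_interval[OF _ _ ki L2_fourier_poisson[OF k] that])
        show "integrable lborel (\<lambda>y. norm (g y) / (1 + y\<^sup>2))"
        proof (rule Bochner_Integration.integrable_bound)
          show "integrable lborel (\<lambda>y. (norm (g y))\<^sup>2 + 1 / (1 + y\<^sup>2))"
            using L2_integrable[OF gL] has_bochner_integral_inverse_1_plus_square by (auto simp: has_bochner_integral_iff)
          show "AE y in lborel. norm (norm (g y) / (1 + y\<^sup>2)) \<le> norm ((norm (g y))\<^sup>2 + 1 / (1 + y\<^sup>2))"
          proof (rule AE_I2)
            fix y
            have "norm (g y) \<le> 2 * norm (g y) * 1" by simp
            also have "\<dots> \<le> (norm (g y))\<^sup>2 + 1\<^sup>2" by (rule sum_squares_bound)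
            finally have "norm (g y) / (1 + y\<^sup>2) \<le> ((norm (g y))\<^sup>2 + 1) / (1 + y\<^sup>2)"
              by (intro divide_right_mono) auto
            also have "\<dots> = (norm (g y))\<^sup>2 / (1 + y\<^sup>2) + 1 / (1 + y\<^sup>2)" by (simp add: add_divide_distrib)
            also have "\<dots> \<le> (norm (g y))\<^sup>2 + 1 / (1 + y\<^sup>2)"
              using divide_left_mono[of 1 "1 + y\<^sup>2" "(norm (g y))\<^sup>2"] by (simp add: add_pos_nonneg)
            finally show "norm (norm (g y) / (1 + y\<^sup>2)) \<le> norm ((norm (g y))\<^sup>2 + 1 / (1 + y\<^sup>2))"
              by simp
          qed
        qed measurable
      qed (use gL in \<open>auto intro: L2_measurable\<close>)
      moreover have "f b - f a = (LINT x:{a..b}|lborel. g x)"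
        by (rule weak_derivative_increment[OF fc A g(1) gL that])
      ultimately have "f b - f a = c * (LINT x:{a..b}|lborel. F1 x)"
        by (simp add: c_def)
      also have "(LINT x:{a..b}|lborel. F1 x) = integral {a..b} F1"
        by (intro set_borel_integral_eq_integral borel_integrable_atLeastAtMost' continuous_on_subset[OF F1c]) auto
      finally show ?thesis by simp
    qed
    have f1: "(f has_vector_derivative c * F1 x) (at x)" for x
    proof -
      have cc: "continuous_on {x - 1..x + 1} (\<lambda>x. c * F1 x)"
        by (intro continuous_intros continuous_on_subset[OF F1c]) auto
      have "((\<lambda>u. integral {x - 1..u} (\<lambda>x. c * F1 x)) has_vector_derivative c * F1 x) (at x within {x - 1..x + 1})"
        by (rule integral_has_vector_derivative[OF cc]) auto
      from has_vector_derivative_add[OF has_vector_derivative_const[of "f (x - 1)"] this]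
      have "((\<lambda>u. f (x - 1) + integral {x - 1..u} (\<lambda>x. c * F1 x)) has_vector_derivative c * F1 x) (at x within {x - 1..x + 1})"
        by (simp only: add_0_left)
      then have "(f has_vector_derivative c * F1 x) (at x within {x - 1..x + 1})"
      proof (rule has_vector_derivative_transform[rotated 2])
        show "f y = f (x - 1) + integral {x - 1..y} (\<lambda>x. c * F1 x)" if "y \<in> {x - 1..x + 1}" for y
          using incr[of "x - 1" y] that by (simp add: algebra_simps)
      qed auto
      moreover have "x \<in> interior {x - 1..x + 1}" by simp
      ultimately show ?thesis using at_within_interior by metis
    qed
    have F1b: "norm (F1 x) \<le> C * M" and F2b: "norm (F2 x) \<le> C * M" if "M > zhidkov_norm s f" for x M
    proof -
      have "norm (F1 x) \<le> (LINT \<xi>|lborel. norm (k \<xi> * cis (\<xi> * x)))" unfolding F1_def by (rule integral_norm_bound)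
      also have "\<dots> \<le> (LINT \<xi>|lborel. sqrt (1 + \<xi>\<^sup>2) * norm (k \<xi>))"
        using ki ksq by (intro integral_mono[OF _ i1]) (auto simp: norm_mult)
      finally show "norm (F1 x) \<le> C * M" using i1b[OF that] by simp
      have "norm (F2 x) \<le> (LINT \<xi>|lborel. norm (\<i> * of_real \<xi> * k \<xi> * cis (\<xi> * x)))" unfolding F2_def by (rule integral_norm_bound)
      also have "\<dots> \<le> (LINT \<xi>|lborel. sqrt (1 + \<xi>\<^sup>2) * norm (k \<xi>))"
        using integrable_norm[OF k1i] ksq by (intro integral_mono[OF _ i1]) (auto simp: norm_mult)
      finally show "norm (F2 x) \<le> C * M" using i1b[OF that] by simp
    qed
    have sq: "(\<integral>\<^sup>+x. ennreal ((norm (c * (LINT \<xi>|lborel. h \<xi> * cis (\<xi> * x))))\<^sup>2) \<partial>lborel) \<le> ennreal (C * M\<^sup>2)"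
      if M: "M > zhidkov_norm s f" and h: "integrable lborel h" and hle: "\<And>\<xi>. (norm (h \<xi>))\<^sup>2 \<le> (1 + \<xi>\<^sup>2) powr (s - 1) * (norm (k \<xi>))\<^sup>2" for h M
    proof -
      have [measurable]: "h \<in> borel_measurable borel" using h by auto
      have h2: "integrable lborel (\<lambda>\<xi>. (norm (h \<xi>))\<^sup>2)"
        by (rule Bochner_Integration.integrable_bound[OF kw]) (use hle in \<open>auto simp: abs_mult intro!: AE_I2\<close>)
      have "(LINT \<xi>|lborel. (norm (h \<xi>))\<^sup>2) \<le> N" unfolding N_def by (rule integral_mono[OF h2 kw hle])
      also have "N \<le> M\<^sup>2" using MN[OF M] by blast
      finally have hM: "(LINT \<xi>|lborel. (norm (h \<xi>))\<^sup>2) \<le> M\<^sup>2" .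
      have "(\<integral>\<^sup>+x. ennreal ((norm (c * (LINT \<xi>|lborel. h \<xi> * cis (\<xi> * x))))\<^sup>2) \<partial>lborel)
         = ennreal ((norm c)\<^sup>2) * (\<integral>\<^sup>+x. ennreal ((norm (LINT \<xi>|lborel. h \<xi> * cis (\<xi> * x)))\<^sup>2) \<partial>lborel)"
        by (subst nn_integral_cmult[symmetric]) (auto simp: norm_mult power_mult_distrib ennreal_mult)
      also have "\<dots> \<le> ennreal ((norm c)\<^sup>2) * ennreal (2 * pi * (LINT \<xi>|lborel. (norm (h \<xi>))\<^sup>2))"
        by (intro mult_left_mono nn_integral_fourier_le[OF h h2]) auto
      also have "\<dots> = ennreal ((norm c)\<^sup>2 * (2 * pi) * (LINT \<xi>|lborel. (norm (h \<xi>))\<^sup>2))"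
        by (subst ennreal_mult[symmetric]) (auto simp: mult.assoc)
      also have "\<dots> \<le> ennreal (1 * M\<^sup>2)"
        using nc hM by (intro ennreal_leI mult_mono) auto
      also have "\<dots> \<le> ennreal (C * M\<^sup>2)" using C1 by (intro ennreal_leI mult_right_mono) auto
      finally show ?thesis .
    qed
    show "\<exists>f1 f2.
      (\<forall>x. (f has_vector_derivative f1 x) (at x)) \<and> (\<forall>x. (f1 has_vector_derivative f2 x) (at x)) \<and>
      continuous_on UNIV f2 \<and>
      (\<forall>M > zhidkov_norm s f. \<forall>x. norm (f x) \<le> C * M \<and> norm (f1 x) \<le> C * M \<and> norm (f2 x) \<le> C * M) \<and>
      (\<forall>M > zhidkov_norm s f. (\<integral>\<^sup>+x. ennreal ((norm (f1 x))\<^sup>2) \<partial>lborel) \<le> ennreal (C * M\<^sup>2)) \<and>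
      (\<forall>M > zhidkov_norm s f. (\<integral>\<^sup>+x. ennreal ((norm (f2 x))\<^sup>2) \<partial>lborel) \<le> ennreal (C * M\<^sup>2))"
    proof (intro exI conjI allI impI)
      show "(f has_vector_derivative c * F1 x) (at x)" for x by (rule f1)
      show "((\<lambda>x. c * F1 x) has_vector_derivative c * F2 x) (at x)" for x
        using F12[of x] by (auto intro!: derivative_eq_intros)
      show "continuous_on UNIV (\<lambda>x. c * F2 x)" by (intro continuous_intros F2c)
      fix M assume M: "M > zhidkov_norm s f"
      have M0: "M > 0" "\<And>x. norm (f x) \<le> M" using MN[OF M] by auto
      show "norm (f x) \<le> C * M" for x
      proof -
        have "M \<le> C * M" using mult_right_mono[OF C1 less_imp_le[OF M0(1)]] by (simp only: mult_1)
        then show ?thesis using M0(2)[of x] by (rule order_trans[rotated])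
      qed
      show "norm (c * F1 x) \<le> C * M" for x
        using mult_mono[OF nc(1) F1b[OF M, of x]] by (simp add: norm_mult)
      show "norm (c * F2 x) \<le> C * M" for x
        using mult_mono[OF nc(1) F2b[OF M, of x]] by (simp add: norm_mult)
      show "(\<integral>\<^sup>+x. ennreal ((norm (c * F1 x))\<^sup>2) \<partial>lborel) \<le> ennreal (C * M\<^sup>2)"
        unfolding F1_def
      proof (rule sq[OF M ki])
        fix \<xi>
        have "1 * (norm (k \<xi>))\<^sup>2 \<le> (1 + \<xi>\<^sup>2) powr (s - 1) * (norm (k \<xi>))\<^sup>2"
          by (intro mult_right_mono order_trans[OF _ w1]) auto
        then show "(norm (k \<xi>))\<^sup>2 \<le> (1 + \<xi>\<^sup>2) powr (s - 1) * (norm (k \<xi>))\<^sup>2" by simp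
      qed
      show "(\<integral>\<^sup>+x. ennreal ((norm (c * F2 x))\<^sup>2) \<partial>lborel) \<le> ennreal (C * M\<^sup>2)"
        unfolding F2_def
      proof (rule sq[OF M ik1])
        fix \<xi>
        have "\<xi>\<^sup>2 * (norm (k \<xi>))\<^sup>2 \<le> (1 + \<xi>\<^sup>2) powr (s - 1) * (norm (k \<xi>))\<^sup>2"
          by (intro mult_right_mono order_trans[OF _ w1]) auto
        then show "(norm (\<i> * of_real \<xi> * k \<xi>))\<^sup>2 \<le> (1 + \<xi>\<^sup>2) powr (s - 1) * (norm (k \<xi>))\<^sup>2"
          by (simp add: norm_mult power_mult_distrib)
      qed
    qed
  qed
qed

section \<open>Differences of Zhidkov functions\<close>

lemma test_functionD:
  assumes "test_function \<phi>"
  obtains R where "\<And>x. (\<phi> has_real_derivative deriv \<phi> x) (at x)" "continuous_on UNIV \<phi>" "continuous_on UNIV (deriv \<phi>)"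
    "\<And>x. \<bar>x\<bar> > R \<Longrightarrow> \<phi> x = 0" "\<And>x. \<bar>x\<bar> > R \<Longrightarrow> deriv \<phi> x = 0"
proof -
  have "\<phi> differentiable_on UNIV" "deriv \<phi> differentiable_on UNIV"
    using assms[unfolded test_function_def, THEN conjunct1, THEN spec, of 0]
      assms[unfolded test_function_def, THEN conjunct1, THEN spec, of 1] by simp_all
  then have d: "(\<phi> has_real_derivative deriv \<phi> x) (at x)" "continuous_on UNIV (deriv \<phi>)" for x
    by (auto simp: DERIV_deriv_iff_real_differentiable differentiable_on_def intro: differentiable_imp_continuous_on)
  obtain R where R: "\<And>x. \<phi> x \<noteq> 0 \<Longrightarrow> \<bar>x\<bar> \<le> R"
    using assms by (auto simp: test_function_def bounded_iff)
  have "deriv \<phi> x = 0" if "\<bar>x\<bar> > R" for x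
  proof -
    have "open {y::real. R < \<bar>y\<bar>}" by (intro open_Collect_less continuous_intros)
    then have "(\<phi> has_real_derivative 0) (at x)"
      by (rule has_field_derivative_transform_within_open[of "\<lambda>_. 0", rotated])
        (use that R in \<open>auto simp: not_le[symmetric]\<close>)
    then show ?thesis by (rule DERIV_imp_deriv)
  qed
  moreover have "continuous_on UNIV \<phi>"
    using d(1) by (meson DERIV_isCont continuous_at_imp_continuous_on)
  ultimately show ?thesis using that[of R] d R by (meson not_le)
qed

lemma integrable_compact_support:
  fixes f :: "real \<Rightarrow> complex"
  assumes "set_integrable lborel {-R..R} f" "\<And>x. \<bar>x\<bar> > R \<Longrightarrow> f x = 0"
  shows "integrable lborel f"
proof -
  have "(\<lambda>x. indicator {-R..R} x *\<^sub>R f x) = f"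
  proof
    show "indicator {-R..R} x *\<^sub>R f x = f x" for x
      using assms(2)[of x] by (cases "\<bar>x\<bar> \<le> R") (auto simp: indicator_def)
  qed
  then show ?thesis using assms(1) by (simp add: set_integrable_def)
qed

text \<open>Continuity and square integrability guarantee that the products with test functions are
  integrable; a Bochner integral defaults to 0 otherwise and would not split.\<close>

lemma weak_derivative_diff:
  assumes f: "continuous_on UNIV f1" "continuous_on UNIV f2" and g: "L2 g1" "L2 g2"
    and w: "weak_derivative f1 g1" "weak_derivative f2 g2"
  shows "weak_derivative (\<lambda>x. f1 x - f2 x) (\<lambda>x. g1 x - g2 x)"
  unfolding weak_derivative_def
proof (intro allI impI)
  fix \<phi> assume t: "test_function \<phi>"
  obtain R where R: "continuous_on UNIV \<phi>" "continuous_on UNIV (deriv \<phi>)"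
    "\<And>x. \<bar>x\<bar> > R \<Longrightarrow> \<phi> x = 0" "\<And>x. \<bar>x\<bar> > R \<Longrightarrow> deriv \<phi> x = 0"
    using test_functionD[OF t] by metis
  have fi: "integrable lborel (\<lambda>x. f x * of_real (deriv \<phi> x))" if "continuous_on UNIV f" for f :: "real \<Rightarrow> complex"
    by (rule integrable_compact_support[of R])
      (use R that in \<open>auto intro!: borel_integrable_atLeastAtMost' continuous_intros intro: continuous_on_subset\<close>)
  have gi: "integrable lborel (\<lambda>x. g x * of_real (\<phi> x))" if "L2 g" for g :: "real \<Rightarrow> complex"
  proof (rule integrable_compact_support[of R])
    have [measurable]: "g \<in> borel_measurable borel" using that by (rule L2_measurable)
    have [measurable]: "\<phi> \<in> borel_measurable borel" using R(1) by (rule borel_measurable_continuous_onI)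
    have "compact (\<phi> ` {-R..R})"
      by (intro compact_continuous_image continuous_on_subset[OF R(1)]) auto
    then have "bounded (\<phi> ` {-R..R})" by (rule compact_imp_bounded)
    then obtain B where B: "\<And>x. x \<in> {-R..R} \<Longrightarrow> \<bar>\<phi> x\<bar> \<le> B"
      unfolding bounded_iff by (metis imageI real_norm_def)
    show "set_integrable lborel {-R..R} (\<lambda>x. g x * of_real (\<phi> x))"
      unfolding set_integrable_def
    proof (rule Bochner_Integration.integrable_bound)
      show "integrable lborel (\<lambda>x. of_real B * (indicator {-R..R} x *\<^sub>R g x))"
        using L2_set_integrable[OF that] by (intro integrable_mult_right) (simp add: set_integrable_def)
      show "AE x in lborel. norm (indicator {-R..R} x *\<^sub>R (g x * of_real (\<phi> x))) \<le> norm (of_real B * (indicator {-R..R} x *\<^sub>R g x))"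
      proof (rule AE_I2)
        fix x
        show "norm (indicator {-R..R} x *\<^sub>R (g x * of_real (\<phi> x))) \<le> norm (of_real B * (indicator {-R..R} x *\<^sub>R g x))"
        proof (cases "x \<in> {-R..R}")
          case True
          then have "\<bar>\<phi> x\<bar> \<le> \<bar>B\<bar>" using B[of x] by linarith
          then show ?thesis using True by (simp add: norm_mult mult.commute mult_right_mono)
        qed simp
      qed
    qed measurable
  qed (use R in auto)
  have "(LINT x|lborel. (f1 x - f2 x) * of_real (deriv \<phi> x)) = (LINT x|lborel. f1 x * of_real (deriv \<phi> x)) - (LINT x|lborel. f2 x * of_real (deriv \<phi> x))"
    unfolding left_diff_distrib by (intro Bochner_Integration.integral_diff fi f)
  also have "\<dots> = - ((LINT x|lborel. g1 x * of_real (\<phi> x)) - (LINT x|lborel. g2 x * of_real (\<phi> x)))"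
    using w t by (simp add: weak_derivative_def)
  also have "(LINT x|lborel. g1 x * of_real (\<phi> x)) - (LINT x|lborel. g2 x * of_real (\<phi> x)) = (LINT x|lborel. (g1 x - g2 x) * of_real (\<phi> x))"
    unfolding left_diff_distrib by (intro Bochner_Integration.integral_diff[symmetric] gi g)
  finally show "(LINT x|lborel. (f1 x - f2 x) * of_real (deriv \<phi> x)) = - (LINT x|lborel. (g1 x - g2 x) * of_real (\<phi> x))" .
qed

lemma sobolev_imp_L2: "g \<in> sobolev \<sigma> \<Longrightarrow> L2 g"
  by (auto simp: sobolev_def L2_fourier_def)

lemma sobolev_diff:
  assumes "f1 \<in> sobolev \<sigma>" "f2 \<in> sobolev \<sigma>"
  shows "(\<lambda>x. f1 x - f2 x) \<in> sobolev \<sigma>"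
proof -
  obtain g1 g2 where g: "L2_fourier f1 g1" "integrable lborel (\<lambda>\<xi>. (1 + \<xi>\<^sup>2) powr \<sigma> * (cmod (g1 \<xi>))\<^sup>2)"
    "L2_fourier f2 g2" "integrable lborel (\<lambda>\<xi>. (1 + \<xi>\<^sup>2) powr \<sigma> * (cmod (g2 \<xi>))\<^sup>2)"
    using assms by (auto simp: sobolev_def)
  have [measurable]: "g1 \<in> borel_measurable borel" "g2 \<in> borel_measurable borel"
    using g by (auto simp: L2_fourier_def intro: L2_measurable)
  have "integrable lborel (\<lambda>\<xi>. (1 + \<xi>\<^sup>2) powr \<sigma> * (cmod (g1 \<xi> - g2 \<xi>))\<^sup>2)"
  proof (rule Bochner_Integration.integrable_bound)
    show "integrable lborel (\<lambda>\<xi>. 2 * ((1 + \<xi>\<^sup>2) powr \<sigma> * (cmod (g1 \<xi>))\<^sup>2) + 2 * ((1 + \<xi>\<^sup>2) powr \<sigma> * (cmod (g2 \<xi>))\<^sup>2))"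
      using g by (intro Bochner_Integration.integrable_add integrable_mult_right)
    show "AE \<xi> in lborel. norm ((1 + \<xi>\<^sup>2) powr \<sigma> * (cmod (g1 \<xi> - g2 \<xi>))\<^sup>2)
       \<le> norm (2 * ((1 + \<xi>\<^sup>2) powr \<sigma> * (cmod (g1 \<xi>))\<^sup>2) + 2 * ((1 + \<xi>\<^sup>2) powr \<sigma> * (cmod (g2 \<xi>))\<^sup>2))"
    proof (rule AE_I2)
      fix \<xi>
      have "(1 + \<xi>\<^sup>2) powr \<sigma> * (cmod (g1 \<xi> - g2 \<xi>))\<^sup>2 \<le> (1 + \<xi>\<^sup>2) powr \<sigma> * (2 * (cmod (g1 \<xi>))\<^sup>2 + 2 * (cmod (g2 \<xi>))\<^sup>2)"
        by (intro mult_left_mono norm_diff_square_le) auto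
      then show "norm ((1 + \<xi>\<^sup>2) powr \<sigma> * (cmod (g1 \<xi> - g2 \<xi>))\<^sup>2)
       \<le> norm (2 * ((1 + \<xi>\<^sup>2) powr \<sigma> * (cmod (g1 \<xi>))\<^sup>2) + 2 * ((1 + \<xi>\<^sup>2) powr \<sigma> * (cmod (g2 \<xi>))\<^sup>2))"
        by (simp add: algebra_simps)
    qed
  qed measurable
  then show ?thesis using L2_fourier_diff[OF g(1,3)] by (auto simp: sobolev_def)
qed

text \<open>Continuity in time is a statement on the norm of \<open>f \<tau> - f t\<close>, from
  which \<open>zhidkov_regular\<close> extracts information for members of the space.\<close>

lemma zhidkov_diff:
  assumes "f1 \<in> zhidkov s" "f2 \<in> zhidkov s"
  shows "(\<lambda>x. f1 x - f2 x) \<in> zhidkov s"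
proof -
  obtain g1 g2 where g: "weak_derivative f1 g1" "g1 \<in> sobolev (s - 1)" "weak_derivative f2 g2" "g2 \<in> sobolev (s - 1)"
    using assms by (auto simp: zhidkov_def)
  have f: "continuous_on UNIV f1" "continuous_on UNIV f2" "bounded (range f1)" "bounded (range f2)"
    using assms by (auto simp: zhidkov_def)
  have "weak_derivative (\<lambda>x. f1 x - f2 x) (\<lambda>x. g1 x - g2 x)"
    using f g by (intro weak_derivative_diff) (auto intro: sobolev_imp_L2)
  moreover have "bounded (range (\<lambda>x. f1 x - f2 x))"
    by (rule bounded_minus_comp) (use f in auto)
  moreover have "continuous_on UNIV (\<lambda>x. f1 x - f2 x)" using f by (intro continuous_intros)
  ultimately show ?thesis using sobolev_diff[OF g(2,4)] by (auto simp: zhidkov_def)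
qed

section \<open>Continuous curves in Zhidkov spaces\<close>

lemma continuous_on_joint_uniform:
  fixes g :: "real \<Rightarrow> real \<Rightarrow> 'a::metric_space"
  assumes c: "\<And>t. t \<in> S \<Longrightarrow> continuous_on UNIV (g t)"
    and u: "\<And>t e. t \<in> S \<Longrightarrow> e > 0 \<Longrightarrow> \<forall>\<^sub>F \<tau> in at t within S. \<forall>x. dist (g \<tau> x) (g t x) \<le> e"
  shows "continuous_on (S \<times> UNIV) (\<lambda>(t, x). g t x)"
  unfolding continuous_on_iff
proof (intro ballI allI impI)
  fix p :: "real \<times> real" and e :: real assume "p \<in> S \<times> UNIV" "e > 0"
  then obtain t x where p: "p = (t, x)" "t \<in> S" and e: "e > 0" by auto
  obtain d1 where d1: "d1 > 0" "\<And>\<tau> y. \<tau> \<in> S \<Longrightarrow> \<tau> \<noteq> t \<Longrightarrow> dist \<tau> t < d1 \<Longrightarrow> dist (g \<tau> y) (g t y) \<le> e / 2"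
    using u[OF p(2), of "e / 2"] e unfolding eventually_at by auto
  obtain d2 where d2: "d2 > 0" "\<And>y. dist y x < d2 \<Longrightarrow> dist (g t y) (g t x) < e / 2"
    using c[OF p(2)] e unfolding continuous_on_iff by (metis UNIV_I half_gt_zero)
  show "\<exists>d>0. \<forall>q\<in>S \<times> UNIV. dist q p < d \<longrightarrow> dist (case q of (t, x) \<Rightarrow> g t x) (case p of (t, x) \<Rightarrow> g t x) < e"
  proof (intro exI[of _ "min d1 d2"] conjI ballI impI)
    fix q assume q: "q \<in> S \<times> (UNIV :: real set)" "dist q p < min d1 d2"
    obtain \<tau> y where q': "q = (\<tau>, y)" "\<tau> \<in> S" using q by auto
    have "dist \<tau> t < d1" "dist y x < d2"
      using q dist_fst_le[of q p] dist_snd_le[of q p] by (auto simp: q' p)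
    then have "dist (g \<tau> y) (g t y) \<le> e / 2" "dist (g t y) (g t x) < e / 2"
      using d1(2)[OF q'(2)] d2(2) e by (cases "\<tau> = t"; auto)+
    then have "dist (g \<tau> y) (g t x) < e" using dist_triangle[of "g \<tau> y" "g t x" "g t y"] by linarith
    then show "dist (case q of (t, x) \<Rightarrow> g t x) (case p of (t, x) \<Rightarrow> g t x) < e" by (simp add: q' p)
  qed (use d1 d2 in auto)
qed

text \<open>To be read with \<open>P \<tau> B\<close> as "\<open>B\<close> bounds everything of
  interest at time \<open>\<tau>\<close>"; a finite subcover and a maximum give one bound for all
  times.\<close>

lemma compact_local_bound:
  fixes S :: "real set"
  assumes S: "compact S" and mono: "\<And>\<tau> A B. P \<tau> A \<Longrightarrow> A \<le> B \<Longrightarrow> P \<tau> B"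
    and local: "\<And>t. t \<in> S \<Longrightarrow> \<exists>B d. d > 0 \<and> (\<forall>\<tau>\<in>S. dist \<tau> t < d \<longrightarrow> P \<tau> B)"
  shows "\<exists>B::real. \<forall>\<tau>\<in>S. P \<tau> B"
proof -
  obtain B d where Bd: "\<And>t. t \<in> S \<Longrightarrow> d t > 0 \<and> (\<forall>\<tau>\<in>S. dist \<tau> t < d t \<longrightarrow> P \<tau> (B t))"
    using local by metis
  have "S \<subseteq> (\<Union>t\<in>S. ball t (d t))" using Bd by force
  then obtain F where F: "F \<subseteq> S" "finite F" "S \<subseteq> (\<Union>t\<in>F. ball t (d t))"
    using compactE_image[OF S, of S "\<lambda>t. ball t (d t)"] by auto
  have "P \<tau> (Max (B ` F))" if \<tau>: "\<tau> \<in> S" for \<tau>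
  proof -
    obtain t where t: "t \<in> F" "dist \<tau> t < d t" using subsetD[OF F(3) \<tau>] by (auto simp: dist_commute)
    then have "P \<tau> (B t)" using Bd F that by blast
    then show ?thesis using mono t F by auto
  qed
  then show ?thesis by blast
qed

lemma continuous_on_vector_derivative_UNIV:
  "(\<And>x. (f has_vector_derivative f' x) (at x)) \<Longrightarrow> continuous_on UNIV f"
  by (meson continuous_at_imp_continuous_on has_vector_derivative_continuous)

text \<open>Everything follows from applying \<open>zhidkov_regular\<close> to
  \<open>f \<tau> - f t\<close>: smallness of its norm makes \<open>f\<close>, \<open>fx\<close> and
  \<open>fxx\<close> close uniformly in \<open>x\<close>, hence jointly continuous, and gives bounds
  near each time, which compactness of \<open>{0..T}\<close> makes uniform.\<close>

lemma continuous_zhidkov_regular: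
  fixes f :: "real \<Rightarrow> real \<Rightarrow> complex"
  assumes s: "s > 5/2" and T: "T \<ge> 0" and f: "continuous_zhidkov s T f"
  obtains fx fxx K where
    "\<And>t x. t \<in> {0..T} \<Longrightarrow> (f t has_vector_derivative fx t x) (at x)"
    "\<And>t x. t \<in> {0..T} \<Longrightarrow> (fx t has_vector_derivative fxx t x) (at x)"
    "\<And>t x. t \<in> {0..T} \<Longrightarrow> norm (f t x) \<le> K \<and> norm (fx t x) \<le> K \<and> norm (fxx t x) \<le> K"
    "\<And>t. t \<in> {0..T} \<Longrightarrow> (\<integral>\<^sup>+x. ennreal ((norm (fx t x))\<^sup>2) \<partial>lborel) \<le> ennreal K"
    "\<And>t. t \<in> {0..T} \<Longrightarrow> (\<integral>\<^sup>+x. ennreal ((norm (fxx t x))\<^sup>2) \<partial>lborel) \<le> ennreal K"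
    "continuous_on ({0..T} \<times> UNIV) (\<lambda>(t, x). f t x)"
    "continuous_on ({0..T} \<times> UNIV) (\<lambda>(t, x). fx t x)"
    "continuous_on ({0..T} \<times> UNIV) (\<lambda>(t, x). fxx t x)"
proof -
  define fx where "fx t = ddx (f t)" for t
  define fxx where "fxx t = ddx (fx t)" for t
  obtain C where C: "C \<ge> 1" "\<And>f. f \<in> zhidkov s \<Longrightarrow> \<exists>f1 f2.
    (\<forall>x. (f has_vector_derivative f1 x) (at x)) \<and> (\<forall>x. (f1 has_vector_derivative f2 x) (at x)) \<and>
    continuous_on UNIV f2 \<and>
    (\<forall>M > zhidkov_norm s f. \<forall>x. norm (f x) \<le> C * M \<and> norm (f1 x) \<le> C * M \<and> norm (f2 x) \<le> C * M) \<and>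
    (\<forall>M > zhidkov_norm s f. (\<integral>\<^sup>+x. ennreal ((norm (f1 x))\<^sup>2) \<partial>lborel) \<le> ennreal (C * M\<^sup>2)) \<and>
    (\<forall>M > zhidkov_norm s f. (\<integral>\<^sup>+x. ennreal ((norm (f2 x))\<^sup>2) \<partial>lborel) \<le> ennreal (C * M\<^sup>2))"
    using zhidkov_regular[OF s] by blast
  have fz: "f t \<in> zhidkov s" if "t \<in> {0..T}" for t using f that by (simp add: continuous_zhidkov_def)
  have R: "(f t has_vector_derivative fx t x) (at x)" "(fx t has_vector_derivative fxx t x) (at x)"
    "continuous_on UNIV (fxx t)"
    "\<And>M. M > zhidkov_norm s (f t) \<Longrightarrow> norm (f t x) \<le> C * M \<and> norm (fx t x) \<le> C * M \<and> norm (fxx t x) \<le> C * M"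
    "\<And>M. M > zhidkov_norm s (f t) \<Longrightarrow> (\<integral>\<^sup>+x. ennreal ((norm (fx t x))\<^sup>2) \<partial>lborel) \<le> ennreal (C * M\<^sup>2)"
    "\<And>M. M > zhidkov_norm s (f t) \<Longrightarrow> (\<integral>\<^sup>+x. ennreal ((norm (fxx t x))\<^sup>2) \<partial>lborel) \<le> ennreal (C * M\<^sup>2)"
    if t: "t \<in> {0..T}" for t x
  proof -
    obtain f1 f2 where 1: "\<And>x. (f t has_vector_derivative f1 x) (at x)" "\<And>x. (f1 has_vector_derivative f2 x) (at x)"
      and 2: "continuous_on UNIV f2"
      "\<And>M x. M > zhidkov_norm s (f t) \<Longrightarrow> norm (f t x) \<le> C * M \<and> norm (f1 x) \<le> C * M \<and> norm (f2 x) \<le> C * M"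
      "\<And>M. M > zhidkov_norm s (f t) \<Longrightarrow> (\<integral>\<^sup>+x. ennreal ((norm (f1 x))\<^sup>2) \<partial>lborel) \<le> ennreal (C * M\<^sup>2)"
      "\<And>M. M > zhidkov_norm s (f t) \<Longrightarrow> (\<integral>\<^sup>+x. ennreal ((norm (f2 x))\<^sup>2) \<partial>lborel) \<le> ennreal (C * M\<^sup>2)"
      using C(2)[OF fz[OF t]] by metis
    have "fx t = f1" unfolding fx_def by (rule ext) (rule vector_derivative_at[OF 1(1)])
    moreover have "fxx t = f2" unfolding fxx_def \<open>fx t = f1\<close> by (rule ext) (rule vector_derivative_at[OF 1(2)])
    ultimately show "(f t has_vector_derivative fx t x) (at x)" "(fx t has_vector_derivative fxx t x) (at x)"
    "continuous_on UNIV (fxx t)"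
    "\<And>M. M > zhidkov_norm s (f t) \<Longrightarrow> norm (f t x) \<le> C * M \<and> norm (fx t x) \<le> C * M \<and> norm (fxx t x) \<le> C * M"
    "\<And>M. M > zhidkov_norm s (f t) \<Longrightarrow> (\<integral>\<^sup>+x. ennreal ((norm (fx t x))\<^sup>2) \<partial>lborel) \<le> ennreal (C * M\<^sup>2)"
    "\<And>M. M > zhidkov_norm s (f t) \<Longrightarrow> (\<integral>\<^sup>+x. ennreal ((norm (fxx t x))\<^sup>2) \<partial>lborel) \<le> ennreal (C * M\<^sup>2)"
      using 1 2 by simp_all
  qed
  define N where "N t \<tau> = zhidkov_norm s (\<lambda>x. f \<tau> x - f t x)" for t \<tau>
  have Nlim: "(N t \<longlongrightarrow> 0) (at t within {0..T})" if "t \<in> {0..T}" for t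
    using f that by (simp add: continuous_zhidkov_def N_def[abs_def])
  have D: "norm (f \<tau> x - f t x) \<le> C * M \<and> norm (fx \<tau> x - fx t x) \<le> C * M \<and> norm (fxx \<tau> x - fxx t x) \<le> C * M"
    "(\<integral>\<^sup>+x. ennreal ((norm (fx \<tau> x - fx t x))\<^sup>2) \<partial>lborel) \<le> ennreal (C * M\<^sup>2)"
    "(\<integral>\<^sup>+x. ennreal ((norm (fxx \<tau> x - fxx t x))\<^sup>2) \<partial>lborel) \<le> ennreal (C * M\<^sup>2)"
    if t: "t \<in> {0..T}" "\<tau> \<in> {0..T}" and M: "M > N t \<tau>" for t \<tau> x M
  proof -
    let ?h = "\<lambda>x. f \<tau> x - f t x"
    have Mh: "M > zhidkov_norm s ?h" using M by (simp add: N_def)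
    from C(2)[OF zhidkov_diff[OF fz[OF t(2)] fz[OF t(1)]]]
    obtain f1 f2 where *: "\<forall>x. (?h has_vector_derivative f1 x) (at x)" "\<forall>x. (f1 has_vector_derivative f2 x) (at x)"
      "\<forall>M > zhidkov_norm s ?h. \<forall>x. norm (?h x) \<le> C * M \<and> norm (f1 x) \<le> C * M \<and> norm (f2 x) \<le> C * M"
      "\<forall>M > zhidkov_norm s ?h. (\<integral>\<^sup>+x. ennreal ((norm (f1 x))\<^sup>2) \<partial>lborel) \<le> ennreal (C * M\<^sup>2)"
      "\<forall>M > zhidkov_norm s ?h. (\<integral>\<^sup>+x. ennreal ((norm (f2 x))\<^sup>2) \<partial>lborel) \<le> ennreal (C * M\<^sup>2)"
      by (elim exE conjE) rule
    note 1 = *(1,2)[rule_format]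
    note 2 = *(3-5)[rule_format, OF Mh]
    have e1: "f1 x = fx \<tau> x - fx t x" for x
      by (rule vector_derivative_unique_at[OF 1(1)[of x] has_vector_derivative_diff[OF R(1)[OF t(2), of x] R(1)[OF t(1), of x]]])
    have "((\<lambda>x. fx \<tau> x - fx t x) has_vector_derivative f2 x) (at x)" for x
    proof -
      have "f1 = (\<lambda>x. fx \<tau> x - fx t x)" by (rule ext) (rule e1)
      from 1(2)[of x, unfolded this] show ?thesis .
    qed
    from vector_derivative_unique_at[OF this has_vector_derivative_diff[OF R(2)[OF t(2)] R(2)[OF t(1)]]]
    have e2: "f2 x = fxx \<tau> x - fxx t x" for x .
    show "norm (f \<tau> x - f t x) \<le> C * M \<and> norm (fx \<tau> x - fx t x) \<le> C * M \<and> norm (fxx \<tau> x - fxx t x) \<le> C * M"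
      "(\<integral>\<^sup>+x. ennreal ((norm (fx \<tau> x - fx t x))\<^sup>2) \<partial>lborel) \<le> ennreal (C * M\<^sup>2)"
      "(\<integral>\<^sup>+x. ennreal ((norm (fxx \<tau> x - fxx t x))\<^sup>2) \<partial>lborel) \<le> ennreal (C * M\<^sup>2)"
      using 2(1)[of x] 2(2,3) by (simp_all only: e1 e2)
  qed
  have cf: "continuous_on UNIV (f t)" "continuous_on UNIV (fx t)" "continuous_on UNIV (fxx t)" if "t \<in> {0..T}" for t
    by (rule continuous_on_vector_derivative_UNIV[OF R(1)[OF that]],
        rule continuous_on_vector_derivative_UNIV[OF R(2)[OF that]], rule R(3)[OF that])
  have unif: "\<forall>\<^sub>F \<tau> in at t within {0..T}. \<forall>x. dist (f \<tau> x) (f t x) \<le> e \<and> dist (fx \<tau> x) (fx t x) \<le> e \<and> dist (fxx \<tau> x) (fxx t x) \<le> e"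
    if t: "t \<in> {0..T}" and e: "e > 0" for t e
  proof -
    have "\<forall>\<^sub>F \<tau> in at t within {0..T}. N t \<tau> < e / C"
      using C(1) e by (intro order_tendstoD(2)[OF Nlim[OF t]]) auto
    moreover have "\<forall>\<^sub>F \<tau> in at t within {0..T}. \<tau> \<in> {0..T}"
      by (auto simp: eventually_at_filter)
    ultimately show ?thesis
    proof eventually_elim
      case (elim \<tau>)
      then show ?case using D(1)[OF t elim(2,1)] C(1) by (auto simp: dist_norm)
    qed
  qed
  have "\<exists>B. \<forall>t\<in>{0..T}. (\<forall>x. norm (f t x) \<le> B \<and> norm (fx t x) \<le> B \<and> norm (fxx t x) \<le> B) \<and>
    (\<integral>\<^sup>+x. ennreal ((norm (fx t x))\<^sup>2) \<partial>lborel) \<le> ennreal B \<and> (\<integral>\<^sup>+x. ennreal ((norm (fxx t x))\<^sup>2) \<partial>lborel) \<le> ennreal B"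
  proof (rule compact_local_bound)
    fix t assume t: "t \<in> {0..T}"
    define M where "M = \<bar>zhidkov_norm s (f t)\<bar> + 1"
    have M: "M > zhidkov_norm s (f t)" "M > 0" by (auto simp: M_def)
    have "\<forall>\<^sub>F \<tau> in at t within {0..T}. N t \<tau> < 1"
      by (intro order_tendstoD(2)[OF Nlim[OF t]]) auto
    then obtain d where d: "d > 0" "\<And>\<tau>. \<tau> \<in> {0..T} \<Longrightarrow> \<tau> \<noteq> t \<Longrightarrow> dist \<tau> t < d \<Longrightarrow> N t \<tau> < 1"
      unfolding eventually_at by auto
    \<comment> \<open>The bounds at \<open>t\<close> itself are \<open>C * M\<close> and
      \<open>C * M^2\<close>. At times where the norm of the difference is below 1, the triangle
      inequality gives \<open>C * M + C\<close>, and its squared version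
      \<open>2 * C + 2 * (C * M^2)\<close>.\<close>
    define B where "B = C * M + C + (2 * C + 2 * (C * M\<^sup>2))"
    have B: "C * M \<le> B" "C * M\<^sup>2 \<le> B" "C * M + C \<le> B" "2 * C + 2 * (C * M\<^sup>2) \<le> B"
      using C(1) M(2) by (auto simp: B_def)
    have L: "(\<integral>\<^sup>+x. ennreal ((norm (g \<tau> x))\<^sup>2) \<partial>lborel) \<le> ennreal B"
      if "continuous_on UNIV (g \<tau>)" "continuous_on UNIV (g t)"
       "(\<integral>\<^sup>+x. ennreal ((norm (g \<tau> x - g t x))\<^sup>2) \<partial>lborel) \<le> ennreal C"
       "(\<integral>\<^sup>+x. ennreal ((norm (g t x))\<^sup>2) \<partial>lborel) \<le> ennreal (C * M\<^sup>2)" for g :: "real \<Rightarrow> real \<Rightarrow> complex" and \<tau>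
    proof -
      have [measurable]: "g \<tau> \<in> borel_measurable borel" "g t \<in> borel_measurable borel"
        using that by (auto intro: borel_measurable_continuous_onI)
      have m2: "(\<lambda>x. - g t x) \<in> borel_measurable borel" "(\<lambda>x. g \<tau> x - g t x) \<in> borel_measurable borel" by measurable
      have "(\<integral>\<^sup>+x. ennreal ((norm (g \<tau> x))\<^sup>2) \<partial>lborel) = (\<integral>\<^sup>+x. ennreal ((norm ((g \<tau> x - g t x) - (- g t x)))\<^sup>2) \<partial>lborel)" by simp
      also have "\<dots> \<le> 2 * (\<integral>\<^sup>+x. ennreal ((norm (g \<tau> x - g t x))\<^sup>2) \<partial>lborel) + 2 * (\<integral>\<^sup>+x. ennreal ((norm (- g t x))\<^sup>2) \<partial>lborel)"
        by (rule nn_integral_square_diff_le[OF m2(2,1)])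
      also have "\<dots> \<le> 2 * ennreal C + 2 * ennreal (C * M\<^sup>2)"
        using that by (intro add_mono mult_left_mono) auto
      also have "\<dots> = ennreal (2 * C + 2 * (C * M\<^sup>2))" using C(1) by (simp add: ennreal_plus ennreal_mult')
      also have "\<dots> \<le> ennreal B" by (intro ennreal_leI B)
      finally show ?thesis .
    qed
    show "\<exists>B d. d > 0 \<and> (\<forall>\<tau>\<in>{0..T}. dist \<tau> t < d \<longrightarrow> (\<forall>x. norm (f \<tau> x) \<le> B \<and> norm (fx \<tau> x) \<le> B \<and> norm (fxx \<tau> x) \<le> B) \<and>
    (\<integral>\<^sup>+x. ennreal ((norm (fx \<tau> x))\<^sup>2) \<partial>lborel) \<le> ennreal B \<and> (\<integral>\<^sup>+x. ennreal ((norm (fxx \<tau> x))\<^sup>2) \<partial>lborel) \<le> ennreal B)"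
    proof (rule exI[of _ B], rule exI[of _ d], rule conjI[OF d(1)], intro ballI impI)
      fix \<tau> assume \<tau>: "\<tau> \<in> {0..T}" "dist \<tau> t < d"
      show "(\<forall>x. norm (f \<tau> x) \<le> B \<and> norm (fx \<tau> x) \<le> B \<and> norm (fxx \<tau> x) \<le> B) \<and>
        (\<integral>\<^sup>+x. ennreal ((norm (fx \<tau> x))\<^sup>2) \<partial>lborel) \<le> ennreal B \<and> (\<integral>\<^sup>+x. ennreal ((norm (fxx \<tau> x))\<^sup>2) \<partial>lborel) \<le> ennreal B"
      proof (cases "\<tau> = t")
        case True
        have "norm (f t x) \<le> C * M \<and> norm (fx t x) \<le> C * M \<and> norm (fxx t x) \<le> C * M" for x
          by (rule R(4)[OF t M(1)])
        then show ?thesis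
          using order_trans[OF R(5)[OF t M(1)] ennreal_leI[OF B(2)]] order_trans[OF R(6)[OF t M(1)] ennreal_leI[OF B(2)]] B(1) True
          by (auto intro: order_trans)
      next
        case False
        have N1: "1 > N t \<tau>" using d(2) \<tau> False by auto
        note D1 = D[OF t \<tau>(1) N1]
        have tri: "norm a \<le> B" if "norm (a - b) \<le> C * 1" "norm b \<le> C * M" for a b :: complex
          using that B(3) norm_triangle_ineq[of "a - b" b] by simp
        have "norm (f \<tau> x) \<le> B \<and> norm (fx \<tau> x) \<le> B \<and> norm (fxx \<tau> x) \<le> B" for x
          using D1(1)[of x] R(4)[OF t M(1), of x] by (auto intro: tri)
        moreover have "(\<integral>\<^sup>+x. ennreal ((norm (fx \<tau> x))\<^sup>2) \<partial>lborel) \<le> ennreal B"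
          using D1(2) R(5)[OF t M(1)] cf[OF t] cf[OF \<tau>(1)] by (intro L) auto
        moreover have "(\<integral>\<^sup>+x. ennreal ((norm (fxx \<tau> x))\<^sup>2) \<partial>lborel) \<le> ennreal B"
          using D1(3) R(6)[OF t M(1)] cf[OF t] cf[OF \<tau>(1)] by (intro L) auto
        ultimately show ?thesis by blast
      qed
    qed
  next
    fix \<tau> A B
    assume "(\<forall>x. norm (f \<tau> x) \<le> A \<and> norm (fx \<tau> x) \<le> A \<and> norm (fxx \<tau> x) \<le> A) \<and>
        (\<integral>\<^sup>+x. ennreal ((norm (fx \<tau> x))\<^sup>2) \<partial>lborel) \<le> ennreal A \<and> (\<integral>\<^sup>+x. ennreal ((norm (fxx \<tau> x))\<^sup>2) \<partial>lborel) \<le> ennreal A" "A \<le> B"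
    then show "(\<forall>x. norm (f \<tau> x) \<le> B \<and> norm (fx \<tau> x) \<le> B \<and> norm (fxx \<tau> x) \<le> B) \<and>
        (\<integral>\<^sup>+x. ennreal ((norm (fx \<tau> x))\<^sup>2) \<partial>lborel) \<le> ennreal B \<and> (\<integral>\<^sup>+x. ennreal ((norm (fxx \<tau> x))\<^sup>2) \<partial>lborel) \<le> ennreal B"
      using ennreal_leI[of A B] by (meson order_trans)
  qed auto
  then obtain K where K: "\<And>t x. t \<in> {0..T} \<Longrightarrow> norm (f t x) \<le> K \<and> norm (fx t x) \<le> K \<and> norm (fxx t x) \<le> K"
    "\<And>t. t \<in> {0..T} \<Longrightarrow> (\<integral>\<^sup>+x. ennreal ((norm (fx t x))\<^sup>2) \<partial>lborel) \<le> ennreal K"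
    "\<And>t. t \<in> {0..T} \<Longrightarrow> (\<integral>\<^sup>+x. ennreal ((norm (fxx t x))\<^sup>2) \<partial>lborel) \<le> ennreal K"
    by blast
  have J: "continuous_on ({0..T} \<times> UNIV) (\<lambda>(t, x). f t x)" "continuous_on ({0..T} \<times> UNIV) (\<lambda>(t, x). fx t x)"
    "continuous_on ({0..T} \<times> UNIV) (\<lambda>(t, x). fxx t x)"
    by (intro continuous_on_joint_uniform cf eventually_mono[OF unif]; auto)+
  show thesis by (rule that[OF R(1) R(2) K J]) auto
qed

subsection \<open>The modulated energy estimate\<close>

text \<open>A cut-off for quantities that are only bounded. Unlike a compactly supported one, it
  controls its own derivative, \<open>|weight'| <= d * weight\<close>, so that the terms caused by
  the cut-off can be absorbed into the energy; and it increases to 1 as \<open>d\<close> decreases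
  to 0.\<close>

definition weight :: "real \<Rightarrow> real \<Rightarrow> real" where
  "weight d x = 1 / (1 + (d * x)\<^sup>2)"

definition weight' :: "real \<Rightarrow> real \<Rightarrow> real" where
  "weight' d x = - (2 * d\<^sup>2 * x) / (1 + (d * x)\<^sup>2)\<^sup>2"

lemma weight_pos: "weight d x > 0" and weight_le_1: "weight d x \<le> 1"
  by (auto simp: weight_def add_pos_nonneg divide_le_eq)

lemma weight_has_derivative: "(weight d has_real_derivative weight' d x) (at x)"
  unfolding weight_def[abs_def] weight'_def
  by (auto intro!: derivative_eq_intros simp: add_nonneg_eq_0_iff power2_eq_square)

lemma continuous_on_weight [continuous_intros]: "continuous_on UNIV (weight d)" "continuous_on UNIV (weight' d)"
  unfolding weight_def[abs_def] weight'_def[abs_def]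
  by (auto intro!: continuous_intros simp: add_nonneg_eq_0_iff)

lemma borel_measurable_weight [measurable]: "weight d \<in> borel_measurable borel" "weight' d \<in> borel_measurable borel"
  by (intro borel_measurable_continuous_onI continuous_on_weight)+

lemma weight'_le:
  assumes "d > 0"
  shows "\<bar>weight' d x\<bar> \<le> d * weight d x"
proof -
  have "2 * \<bar>d * x\<bar> * 1 \<le> \<bar>d * x\<bar>\<^sup>2 + 1\<^sup>2" by (rule sum_squares_bound)
  then have "2 * \<bar>d * x\<bar> \<le> 1 + (d * x)\<^sup>2" by (simp only: power2_abs mult_1_right one_power2 add.commute)
  then have "d * (2 * \<bar>d * x\<bar>) \<le> d * (1 + (d * x)\<^sup>2)" using assms by (intro mult_left_mono) auto
  moreover have "\<bar>weight' d x\<bar> = d * (2 * \<bar>d * x\<bar>) / (1 + (d * x)\<^sup>2)\<^sup>2"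
    using assms by (simp add: weight'_def abs_mult power2_eq_square)
  ultimately have "\<bar>weight' d x\<bar> \<le> d * (1 + (d * x)\<^sup>2) / (1 + (d * x)\<^sup>2)\<^sup>2"
    by (simp add: divide_right_mono)
  also have "\<dots> = d * weight d x" by (simp add: weight_def power2_eq_square add_nonneg_eq_0_iff)
  finally show ?thesis .
qed

lemma has_bochner_integral_weight:
  assumes "d > 0"
  shows "has_bochner_integral lborel (weight d) (pi / d)"
  using assms has_bochner_integral_inverse_1_plus_square
  by (subst (asm) lborel_has_bochner_integral_real_affine_iff[of d _ _ 0])
    (auto simp: weight_def[abs_def] divide_inverse mult.commute)

lemma integrable_weight: "d > 0 \<Longrightarrow> integrable lborel (weight d)"
  using has_bochner_integral_weight by (auto simp: has_bochner_integral_iff)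

lemma weight_tendsto_at_top:
  assumes "d > 0"
  shows "(weight d \<longlongrightarrow> 0) at_top"
  unfolding weight_def[abs_def] inverse_eq_divide[symmetric]
  using assms
  by (intro tendsto_inverse_0_at_top filterlim_tendsto_add_at_top[OF tendsto_const] filterlim_pow_at_top
      filterlim_tendsto_pos_mult_at_top[OF tendsto_const _ filterlim_ident]) auto

lemma weight_tendsto_at_bot:
  assumes "d > 0"
  shows "(weight d \<longlongrightarrow> 0) at_bot"
  using weight_tendsto_at_top[OF assms] by (simp add: filterlim_at_bot_mirror weight_def[abs_def])

text \<open>A primitive that is dominated by the weight vanishes at both ends of the line; fluxes
  disappear by this lemma.\<close>

lemma integral_derivative_eq_0:
  fixes F :: "real \<Rightarrow> real"
  assumes d: "d > 0" and F: "\<And>x. (F has_real_derivative F' x) (at x)" and c: "continuous_on UNIV F'"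
    and F'b: "\<And>x. \<bar>F' x\<bar> \<le> C * weight d x" and Fb: "\<And>x. \<bar>F x\<bar> \<le> C * weight d x"
  shows "integrable lborel F'" "(LINT x|lborel. F' x) = 0"
proof -
  have [measurable]: "F' \<in> borel_measurable borel" using c by (rule borel_measurable_continuous_onI)
  show i: "integrable lborel F'"
  proof (rule Bochner_Integration.integrable_bound)
    show "integrable lborel (\<lambda>x. C * weight d x)" using integrable_weight[OF d] by simp
    show "AE x in lborel. norm (F' x) \<le> norm (C * weight d x)"
      using F'b by (intro AE_I2) (metis abs_ge_self order_trans real_norm_def)
  qed measurable
  have lim: "(F \<longlongrightarrow> 0) at_top" "(F \<longlongrightarrow> 0) at_bot"
  proof -
    have "(F \<longlongrightarrow> 0) G" if "(weight d \<longlongrightarrow> 0) G" for G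
    proof (rule Lim_null_comparison)
      show "\<forall>\<^sub>F x in G. norm (F x) \<le> C * weight d x" using Fb by simp
      show "((\<lambda>x. C * weight d x) \<longlongrightarrow> 0) G" using tendsto_mult_left[OF that, of C] by simp
    qed
    then show "(F \<longlongrightarrow> 0) at_top" "(F \<longlongrightarrow> 0) at_bot"
      using weight_tendsto_at_top[OF d] weight_tendsto_at_bot[OF d] by blast+
  qed
  have "(LBINT x=-\<infinity>..\<infinity>. F' x) = 0 - 0"
  proof (rule interval_integral_FTC_integrable)
    show "((F \<circ> real_of_ereal) \<longlongrightarrow> 0) (at_right (- \<infinity>))" "((F \<circ> real_of_ereal) \<longlongrightarrow> 0) (at_left \<infinity>)"
      using lim by (simp_all add: ereal_tendsto_simps)
    show "set_integrable lborel (einterval (- \<infinity>) \<infinity>) F'" using i by (simp add: set_integrable_def)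
    show "isCont F' x" for x using c by (simp add: continuous_on_eq_continuous_at)
  qed (use F in \<open>auto simp: has_real_derivative_iff_has_vector_derivative\<close>)
  then show "(LINT x|lborel. F' x) = 0"
    by (simp add: interval_lebesgue_integral_def set_lebesgue_integral_def)
qed

lemma cmod_square_has_derivative:
  assumes "(b has_vector_derivative b') (at x within S)"
  shows "((\<lambda>x. (cmod (b x))\<^sup>2) has_real_derivative 2 * Re (cnj (b x) * b')) (at x within S)"
proof -
  have "((\<lambda>x. (Re (b x))\<^sup>2 + (Im (b x))\<^sup>2) has_real_derivative 2 * Re (b x) * Re b' + 2 * Im (b x) * Im b') (at x within S)"
    using assms by (auto intro!: derivative_eq_intros)
  then show ?thesis by (simp add: cmod_power2 algebra_simps)
qed

lemma Re_cnj_mult_has_derivative: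
  assumes "(f has_vector_derivative f') (at x within S)" "(g has_vector_derivative g') (at x within S)"
  shows "((\<lambda>x. Re (cnj (f x) * g x)) has_real_derivative Re (cnj f' * g x) + Re (cnj (f x) * g')) (at x within S)"
proof -
  have "((\<lambda>x. Re (f x) * Re (g x) + Im (f x) * Im (g x)) has_real_derivative
     (Re f' * Re (g x) + Im f' * Im (g x)) + (Re (f x) * Re g' + Im (f x) * Im g')) (at x within S)"
    using assms by (auto intro!: derivative_eq_intros)
  then show ?thesis by simp
qed

text \<open>The Bregman divergence of \<open>p * ln p\<close>; the affine terms make it nonnegative
  and zero at \<open>p = q\<close>. Its partial derivatives are \<open>ln (p / q)\<close> and
  \<open>1 - p / q\<close>.\<close>

definition rel_entropy :: "real \<Rightarrow> real \<Rightarrow> real" where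
  "rel_entropy p q = p * ln (p / q) - p + q"

lemma rel_entropy_has_derivative:
  assumes "(p has_real_derivative p') (at x within S)" "(q has_real_derivative q') (at x within S)" "p x > 0" "q x > 0"
  shows "((\<lambda>x. rel_entropy (p x) (q x)) has_real_derivative p' * ln (p x / q x) + q' * (1 - p x / q x)) (at x within S)"
proof -
  have "((\<lambda>x. p x / q x) has_real_derivative (p' * q x - p x * q') / (q x * q x)) (at x within S)"
    using assms by (intro DERIV_divide) auto
  then have "((\<lambda>x. ln (p x / q x)) has_real_derivative 1 / (p x / q x) * ((p' * q x - p x * q') / (q x * q x))) (at x within S)"
    using assms by (intro DERIV_chain2[OF DERIV_ln_divide]) auto
  then have *: "((\<lambda>x. p x * ln (p x / q x) - p x + q x) has_real_derivative
     p' * ln (p x / q x) + (1 / (p x / q x) * ((p' * q x - p x * q') / (q x * q x))) * p x - p' + q') (at x within S)"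
    using assms by (intro DERIV_add DERIV_diff DERIV_mult)
  have e: "(1 / (p x / q x) * ((p' * q x - p x * q') / (q x * q x))) * p x = p' - q' * (p x / q x)"
    using assms(3,4) by (simp add: field_simps)
  have "p' * ln (p x / q x) + (p' - q' * (p x / q x)) - p' + q' = p' * ln (p x / q x) + q' * (1 - p x / q x)"
    by (simp add: right_diff_distrib)
  with *[unfolded e] show ?thesis by (simp only: rel_entropy_def)
qed

text \<open>With \<open>y = sqrt (p / q)\<close> the difference of the two sides is
  \<open>2 * q * y * (y * ln y - y + 1)\<close>, which is nonnegative since
  \<open>ln (1 / y) <= 1 / y - 1\<close>. Comparing square roots gives coercivity without an upper
  bound on \<open>p\<close>, for which no bound uniform in \<open>eps\<close> is at hand.\<close>

lemma rel_entropy_ge: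
  assumes "p > 0" "q > 0"
  shows "(sqrt p - sqrt q)\<^sup>2 \<le> rel_entropy p q"
proof -
  define y where "y = sqrt (p / q)"
  have y: "y > 0" using assms by (simp add: y_def)
  have py: "p = q * y\<^sup>2" using assms by (simp add: y_def)
  have "ln (1 / y) \<le> 1 / y - 1" using y by (intro ln_le_minus_one) simp
  then have "y * (1 - 1 / y) \<le> y * ln y" using y by (intro mult_left_mono) (auto simp: ln_div)
  then have l: "y - 1 \<le> y * ln y" using y by (simp add: algebra_simps)
  have "rel_entropy p q - (sqrt p - sqrt q)\<^sup>2 = q * (2 * y * (y * ln y - (y - 1)))"
  proof -
    have "sqrt p = sqrt q * y" using assms y by (simp add: py real_sqrt_mult)
    then have "sqrt p - sqrt q = sqrt q * (y - 1)" by (simp add: algebra_simps)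
    then have "(sqrt p - sqrt q)\<^sup>2 = q * (y - 1)\<^sup>2" using assms by (simp add: power_mult_distrib)
    moreover have "ln (p / q) = 2 * ln y" using assms y by (simp add: py ln_realpow)
    ultimately show ?thesis by (simp add: rel_entropy_def py power2_eq_square algebra_simps)
  qed
  moreover have "q * (2 * y * (y * ln y - (y - 1))) \<ge> 0" using l y assms by (intro mult_nonneg_nonneg) auto
  ultimately show ?thesis by linarith
qed

lemma rel_entropy_nonneg: "p > 0 \<Longrightarrow> q > 0 \<Longrightarrow> rel_entropy p q \<ge> 0"
  using rel_entropy_ge by (meson order_trans zero_le_power2)

text \<open>This replaces an upper bound on \<open>|b|^2\<close>: where \<open>|b|^2\<close> appears
  in the remainder, it is split between the bounded density \<open>r\<close> and the energy.\<close>

lemma le_rel_entropy: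
  assumes "p > 0" "q > 0"
  shows "p \<le> 2 * q + 2 * rel_entropy p q"
proof -
  have "p = (sqrt q - (sqrt q - sqrt p))\<^sup>2" using assms by simp
  also have "\<dots> \<le> 2 * (sqrt q)\<^sup>2 + 2 * (sqrt q - sqrt p)\<^sup>2"
    using norm_diff_square_le[of "sqrt q" "sqrt q - sqrt p"] by simp
  also have "(sqrt q - sqrt p)\<^sup>2 \<le> rel_entropy p q"
    using rel_entropy_ge[OF assms] by (simp add: power2_commute)
  finally show ?thesis using assms by simp
qed

text \<open>For \<open>eps > 0\<close> the modulus \<open>|b|\<close> has no positive lower bound on
  the line, so \<open>ln (|b|^2 / r)\<close> may be unbounded; its product with \<open>|b|\<close>
  is not, by this inequality.\<close>

lemma abs_mult_ln_le:
  fixes x :: real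
  assumes "x > 0"
  shows "x * \<bar>ln x\<bar> \<le> 1 + x\<^sup>2"
proof -
  have "ln (1 / x) \<le> 1 / x - 1" using assms by (intro ln_le_minus_one) simp
  then have "x * (- ln x) \<le> x * (1 / x - 1)" using assms by (intro mult_left_mono) (auto simp: ln_div)
  moreover have "x * (1 / x - 1) = 1 - x" using assms by (simp add: right_diff_distrib)
  ultimately have 1: "x * (- ln x) \<le> 1 + x\<^sup>2" using assms zero_le_power2[of x] by linarith
  have "x * ln x \<le> x * (x - 1)" using ln_le_minus_one[OF assms] assms by (intro mult_left_mono) auto
  then have "x * ln x \<le> 1 + x\<^sup>2" using assms by (simp add: algebra_simps power2_eq_square)
  with 1 show ?thesis by (cases "ln x \<ge> 0") auto
qed

text \<open>The time derivative of the energy density is a divergence up to a remainder which is controlled by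
  the energy density itself. Here \<open>L\<close> stands for \<open>ln (|b|\<^sup>2 / r)\<close> and \<open>k\<close>, \<open>k'\<close> for the weight and its derivative.\<close>

lemma energy_identity:
  fixes b bx bxx bt :: complex and w wx wxx r rx L eps lam k k' :: real
  assumes "eps > 0" "r > 0"
    and bt: "bt = - (of_real w * bx + of_real (wx / 2) * b) + \<i> * of_real (eps / 2) * bxx - \<i> * of_real (lam / eps * L) * b"
  shows "- eps\<^sup>2 * Re (cnj bt * (of_real k' * bx + of_real k * bxx))
      + lam * (k * (2 * Re (cnj b * bt) * L + - (rx * w + r * wx) * (1 - (cmod b)\<^sup>2 / r)))
    = (- lam * (k' * (w * ((cmod b)\<^sup>2 * L - (cmod b)\<^sup>2 + r)) + k * (wx * ((cmod b)\<^sup>2 * L - (cmod b)\<^sup>2 + r)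
          + w * (2 * Re (cnj b * bx) * L + rx * (1 - (cmod b)\<^sup>2 / r))))
       + eps\<^sup>2 / 2 * (k' * (w * (cmod bx)\<^sup>2 + wx * Re (cnj bx * b))
          + k * (wx * (cmod bx)\<^sup>2 + w * (2 * Re (cnj bx * bxx)) + wxx * Re (cnj bx * b) + wx * (Re (cnj bxx * b) + Re (cnj bx * bx)))))
      + (k * (eps\<^sup>2 * (- wx * (cmod bx)\<^sup>2 - wxx / 2 * Re (cnj bx * b)))
       + k' * (lam * (w * ((cmod b)\<^sup>2 * L - (cmod b)\<^sup>2 + r)) - eps\<^sup>2 / 2 * (w * (cmod bx)\<^sup>2 + wx * Re (cnj bx * b))
           - eps\<^sup>2 * Re (cnj bt * bx)))"
proof -
  obtain b1 b2 where b: "b = Complex b1 b2" by (cases b)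
  obtain c1 c2 where c: "bx = Complex c1 c2" by (cases bx)
  obtain e1 e2 where e: "bxx = Complex e1 e2" by (cases bxx)
  \<comment> \<open>Once \<open>lam / eps * L\<close> and \<open>|b|^2 / r\<close> are named, the
    claim is a polynomial identity in real and imaginary parts, modulo the relations
    \<open>eM\<close> and \<open>Pr\<close>. The terms with \<open>M\<close> and \<open>bxx\<close>
    coming from the gradient and from the entropy cancel.\<close>
  define M where "M = lam / eps * L"
  define P where "P = (b1\<^sup>2 + b2\<^sup>2) / r"
  have eM: "lam * L = eps * M" using assms by (simp add: M_def)
  have Pr: "b1\<^sup>2 + b2\<^sup>2 = P * r" using assms by (simp add: P_def)
  have bt': "Re bt = - (w * c1 + wx / 2 * b1) - eps / 2 * e2 + M * b2"
    "Im bt = - (w * c2 + wx / 2 * b2) + eps / 2 * e1 - M * b1"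
    unfolding bt M_def[symmetric] by (simp_all add: b c e)
  have cb: "(cmod b)\<^sup>2 = b1\<^sup>2 + b2\<^sup>2" "(cmod bx)\<^sup>2 = c1\<^sup>2 + c2\<^sup>2" by (simp_all add: b c cmod_power2)
  show ?thesis
    unfolding cb P_def[symmetric]
    apply (simp add: b c e bt')
    using eM Pr
    by algebra
qed

text \<open>The situation after division by the limiting phase: \<open>w\<close> is the limiting
  velocity and \<open>r\<close> the limiting density. The constants play different roles.
  \<open>K\<close> bounds the limit and the initial gradient and enters the final estimate;
  \<open>M\<close> bounds \<open>b\<close> at fixed \<open>eps\<close>, may blow up as
  \<open>eps -> 0\<close>, and only justifies convergence of integrals. No time derivative of
  \<open>bx\<close> is assumed.\<close>

locale wkb_comparison =
  fixes b bx bxx :: "real \<Rightarrow> real \<Rightarrow> complex" and w wx wxx r rx :: "real \<Rightarrow> real \<Rightarrow> real"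
    and eps lam T K M rmin :: real
  assumes eps: "0 < eps" "eps \<le> 1" and lam: "lam > 0" and T: "T > 0" and K: "K \<ge> 1" and rmin: "rmin > 0"
    and b_x: "\<And>t x. t \<in> {0..T} \<Longrightarrow> (b t has_vector_derivative bx t x) (at x)"
    and bx_x: "\<And>t x. t \<in> {0..T} \<Longrightarrow> (bx t has_vector_derivative bxx t x) (at x)"
    and bxx_c: "\<And>t. t \<in> {0..T} \<Longrightarrow> continuous_on UNIV (bxx t)"
    and bx_ct: "\<And>x. continuous_on {0..T} (\<lambda>t. bx t x)"
    and bxx_ct: "\<And>x. continuous_on {0..T} (\<lambda>t. bxx t x)"
    and b_bound: "\<And>t x. t \<in> {0..T} \<Longrightarrow> norm (b t x) \<le> M \<and> norm (bx t x) \<le> M \<and> norm (bxx t x) \<le> M"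
    and b_nz: "\<And>t x. t \<in> {0..T} \<Longrightarrow> b t x \<noteq> 0"
    and b_t: "\<And>t x. t \<in> {0..T} \<Longrightarrow> ((\<lambda>\<tau>. b \<tau> x) has_vector_derivative
      (- (of_real (w t x) * bx t x + of_real (wx t x / 2) * b t x) + \<i> * of_real (eps / 2) * bxx t x
        - \<i> * of_real (lam / eps * ln ((cmod (b t x))\<^sup>2 / r t x)) * b t x)) (at t within {0..T})"
    and r_bound: "\<And>t x. t \<in> {0..T} \<Longrightarrow> rmin \<le> r t x \<and> r t x \<le> K \<and> \<bar>rx t x\<bar> \<le> K"
    and r_x: "\<And>t x. t \<in> {0..T} \<Longrightarrow> (r t has_real_derivative rx t x) (at x)"
    and rx_c: "\<And>t. t \<in> {0..T} \<Longrightarrow> continuous_on UNIV (rx t)"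
    and r_t: "\<And>t x. t \<in> {0..T} \<Longrightarrow> ((\<lambda>\<tau>. r \<tau> x) has_real_derivative - (rx t x * w t x + r t x * wx t x)) (at t within {0..T})"
    and w_x: "\<And>t x. t \<in> {0..T} \<Longrightarrow> (w t has_real_derivative wx t x) (at x)"
    and wx_x: "\<And>t x. t \<in> {0..T} \<Longrightarrow> (wx t has_real_derivative wxx t x) (at x)"
    and wxx_c: "\<And>t. t \<in> {0..T} \<Longrightarrow> continuous_on UNIV (wxx t)"
    and w_bound: "\<And>t x. t \<in> {0..T} \<Longrightarrow> \<bar>w t x\<bar> \<le> K \<and> \<bar>wx t x\<bar> \<le> K \<and> \<bar>wxx t x\<bar> \<le> K"
    and wxx_L2: "\<And>t. t \<in> {0..T} \<Longrightarrow> (\<integral>\<^sup>+x. ennreal ((wxx t x)\<^sup>2) \<partial>lborel) \<le> ennreal K"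
    and init: "\<And>x. (cmod (b 0 x))\<^sup>2 = r 0 x"
    and init_L2: "(\<integral>\<^sup>+x. ennreal ((cmod (bx 0 x))\<^sup>2) \<partial>lborel) \<le> ennreal K"
begin

definition bt :: "real \<Rightarrow> real \<Rightarrow> complex" where
  "bt t x = - (of_real (w t x) * bx t x + of_real (wx t x / 2) * b t x) + \<i> * of_real (eps / 2) * bxx t x
        - \<i> * of_real (lam / eps * ln ((cmod (b t x))\<^sup>2 / r t x)) * b t x"

definition h :: "real \<Rightarrow> real \<Rightarrow> real" where
  "h t x = rel_entropy ((cmod (b t x))\<^sup>2) (r t x)"

definition L :: "real \<Rightarrow> real \<Rightarrow> real" where
  "L t x = ln ((cmod (b t x))\<^sup>2 / r t x)"

definition ht :: "real \<Rightarrow> real \<Rightarrow> real" where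
  "ht t x = 2 * Re (cnj (b t x) * bt t x) * L t x + - (rx t x * w t x + r t x * wx t x) * (1 - (cmod (b t x))\<^sup>2 / r t x)"

definition dens :: "real \<Rightarrow> real \<Rightarrow> real" where
  "dens t x = eps\<^sup>2 / 2 * (cmod (bx t x))\<^sup>2 + lam * h t x"

lemma b_t': "t \<in> {0..T} \<Longrightarrow> ((\<lambda>\<tau>. b \<tau> x) has_vector_derivative bt t x) (at t within {0..T})"
  using b_t by (simp add: bt_def)

lemma rho_pos: "t \<in> {0..T} \<Longrightarrow> (cmod (b t x))\<^sup>2 > 0"
  using b_nz by simp

lemma r_pos: "t \<in> {0..T} \<Longrightarrow> r t x > 0"
  using r_bound rmin by (meson less_le_trans)

lemma h_t: "t \<in> {0..T} \<Longrightarrow> ((\<lambda>\<tau>. h \<tau> x) has_real_derivative ht t x) (at t within {0..T})"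
  unfolding h_def ht_def L_def
  by (intro rel_entropy_has_derivative cmod_square_has_derivative b_t' r_t rho_pos r_pos)

lemma h_x: "t \<in> {0..T} \<Longrightarrow>
   (h t has_real_derivative 2 * Re (cnj (b t x) * bx t x) * L t x + rx t x * (1 - (cmod (b t x))\<^sup>2 / r t x)) (at x)"
  unfolding h_def[abs_def] L_def
  by (intro rel_entropy_has_derivative cmod_square_has_derivative b_x r_x rho_pos r_pos)

lemma h_nonneg: "t \<in> {0..T} \<Longrightarrow> h t x \<ge> 0"
  unfolding h_def by (intro rel_entropy_nonneg rho_pos r_pos)

lemma dens_nonneg: "t \<in> {0..T} \<Longrightarrow> dens t x \<ge> 0"
  unfolding dens_def using h_nonneg lam by simp

lemma real_DERIV_continuous_on: "(\<And>x. (f has_real_derivative f' x) (at x)) \<Longrightarrow> continuous_on UNIV f"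
  by (meson DERIV_isCont continuous_at_imp_continuous_on)

lemma cont:
  assumes "t \<in> {0..T}"
  shows "continuous_on UNIV (b t)" "continuous_on UNIV (bx t)" "continuous_on UNIV (w t)" "continuous_on UNIV (wx t)"
    "continuous_on UNIV (r t)" "continuous_on UNIV (h t)" "continuous_on UNIV (L t)" "continuous_on UNIV (bt t)"
    "continuous_on UNIV (ht t)" "continuous_on UNIV (dens t)"
proof -
  show c: "continuous_on UNIV (b t)" "continuous_on UNIV (bx t)" "continuous_on UNIV (w t)" "continuous_on UNIV (wx t)"
    "continuous_on UNIV (r t)"
    by (rule continuous_on_vector_derivative_UNIV[OF b_x[OF assms]], rule continuous_on_vector_derivative_UNIV[OF bx_x[OF assms]],
        rule real_DERIV_continuous_on[OF w_x[OF assms]], rule real_DERIV_continuous_on[OF wx_x[OF assms]],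
        rule real_DERIV_continuous_on[OF r_x[OF assms]])
  show cL: "continuous_on UNIV (L t)"
    unfolding L_def[abs_def] using rho_pos[OF assms] r_pos[OF assms]
    by (intro continuous_intros c) (auto simp: less_imp_neq[symmetric] b_nz[OF assms])
  show ch: "continuous_on UNIV (h t)"
    by (rule real_DERIV_continuous_on[OF h_x[OF assms]])
  show cbt: "continuous_on UNIV (bt t)"
    unfolding bt_def[abs_def] L_def[symmetric]
    by (intro continuous_intros c cL bxx_c assms) (use eps in auto)
  show "continuous_on UNIV (ht t)"
    unfolding ht_def[abs_def] using r_pos[OF assms]
    by (intro continuous_intros c cL cbt rx_c assms) (auto simp: less_imp_neq[symmetric])
  show "continuous_on UNIV (dens t)"
    unfolding dens_def[abs_def] by (intro continuous_intros c ch)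
qed

lemma meas [measurable (raw)]:
  assumes "t \<in> {0..T}"
  shows "b t \<in> borel_measurable borel" "bx t \<in> borel_measurable borel" "bxx t \<in> borel_measurable borel"
    "bt t \<in> borel_measurable borel" "h t \<in> borel_measurable borel" "ht t \<in> borel_measurable borel"
    "dens t \<in> borel_measurable borel" "wxx t \<in> borel_measurable borel"
  by (intro borel_measurable_continuous_onI cont bxx_c wxx_c assms)+

text \<open>All quantities are bounded, but the bounds depend on \<open>M\<close> and \<open>eps\<close>.\<close>

lemma bounds: "\<exists>N \<ge> 1. \<forall>t\<in>{0..T}. \<forall>x. norm (b t x) * \<bar>L t x\<bar> \<le> N \<and> norm (b t x) \<le> N \<and> norm (bx t x) \<le> N \<and> norm (bxx t x) \<le> N
   \<and> norm (bt t x) \<le> N \<and> \<bar>h t x\<bar> \<le> N \<and> \<bar>ht t x\<bar> \<le> N \<and>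
   \<bar>2 * Re (cnj (b t x) * bx t x) * L t x + rx t x * (1 - (cmod (b t x))\<^sup>2 / r t x)\<bar> \<le> N"
proof -
  have M0: "M \<ge> 0" using b_bound[of 0 0] T by (auto intro: order_trans[OF norm_ge_zero])
  define Q where "Q = M\<^sup>2 / rmin"
  define A where "A = 2 * K * (1 + Q)"
  define B where "B = K * M + K / 2 * M + eps / 2 * M + lam / eps * A"
  define C where "C = 2 * M * A + 2 * K * K * (1 + Q)"
  define D where "D = 2 * B * A + 2 * K * K * (1 + Q)"
  define E where "E = A * M + M\<^sup>2 + K"
  have Q0: "Q \<ge> 0" using rmin by (simp add: Q_def)
  have A0: "A \<ge> 0" using Q0 K by (simp add: A_def)
  have B0: "B \<ge> 0" using A0 M0 K eps lam by (simp add: B_def)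
  have C0: "C \<ge> 0" "D \<ge> 0" "E \<ge> 0" using A0 B0 Q0 M0 K by (simp_all add: C_def D_def E_def)
  define N where "N = 1 + A + M + B + C + D + E"
  have N: "1 \<le> N" "A \<le> N" "M \<le> N" "B \<le> N" "C \<le> N" "D \<le> N" "E \<le> N"
    using A0 B0 C0 M0 by (simp_all add: N_def)
  have "norm (b t x) * \<bar>L t x\<bar> \<le> A \<and> norm (b t x) \<le> M \<and> norm (bx t x) \<le> M \<and> norm (bxx t x) \<le> M
   \<and> norm (bt t x) \<le> B \<and> \<bar>h t x\<bar> \<le> E \<and> \<bar>ht t x\<bar> \<le> D \<and>
   \<bar>2 * Re (cnj (b t x) * bx t x) * L t x + rx t x * (1 - (cmod (b t x))\<^sup>2 / r t x)\<bar> \<le> C" if t: "t \<in> {0..T}" for t x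
  proof -
    define q where "q = (cmod (b t x))\<^sup>2 / r t x"
    have q0: "q > 0" using rho_pos[OF t] r_pos[OF t] by (simp add: q_def)
    have bM: "norm (b t x) \<le> M" "norm (bx t x) \<le> M" "norm (bxx t x) \<le> M" using b_bound[OF t] by auto
    have rb: "rmin \<le> r t x" "r t x \<le> K" "\<bar>rx t x\<bar> \<le> K" using r_bound[OF t] by auto
    have wb: "\<bar>w t x\<bar> \<le> K" "\<bar>wx t x\<bar> \<le> K" using w_bound[OF t] by auto
    have qQ: "q \<le> Q" unfolding q_def Q_def
      using rb rmin bM M0 by (intro frac_le power_mono) auto
    \<comment> \<open>Factoring out \<open>sqrt r\<close> reduces \<open>|b| * |L|\<close> to
      \<open>sqrt q * |ln q|\<close>, which is bounded for bounded \<open>q\<close>, also near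
      0.\<close>
    have nb: "norm (b t x) = sqrt (r t x) * sqrt q"
      using r_pos[OF t, of x] by (simp add: q_def real_sqrt_divide)
    have sr: "sqrt (r t x) \<le> K"
      using rb K r_pos[OF t, of x] by (intro real_le_lsqrt) (auto simp: power2_eq_square intro: order_trans[OF _ mult_right_mono[of 1 K K]])
    have "sqrt q * \<bar>ln (sqrt q)\<bar> \<le> 1 + (sqrt q)\<^sup>2" using q0 by (intro abs_mult_ln_le) auto
    then have sl: "sqrt q * \<bar>ln q\<bar> \<le> 2 * (1 + q)" using q0 by (simp add: ln_sqrt)
    have Lq: "L t x = ln q" by (simp add: L_def q_def)
    have "norm (b t x) * \<bar>L t x\<bar> = sqrt (r t x) * (sqrt q * \<bar>ln q\<bar>)" by (simp add: nb Lq)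
    also have "\<dots> \<le> K * (2 * (1 + Q))"
    proof (rule mult_mono[OF sr])
      show "sqrt q * \<bar>ln q\<bar> \<le> 2 * (1 + Q)" using sl qQ by argo
    qed (use K q0 in auto)
    finally have bL: "norm (b t x) * \<bar>L t x\<bar> \<le> A" by (simp add: A_def algebra_simps)
    have bt: "norm (bt t x) \<le> B"
    proof -
      have tri: "norm (- (p + q) + u - v) \<le> norm p + norm q + norm u + norm v" for p q u v :: complex
        using norm_triangle_ineq4[of "- (p + q) + u" v] norm_triangle_ineq[of "- (p + q)" u] norm_triangle_ineq[of p q]
        unfolding norm_minus_cancel by linarith
      have "norm (bt t x) \<le> norm (of_real (w t x) * bx t x) + norm (of_real (wx t x / 2) * b t x)
        + norm (\<i> * of_real (eps / 2) * bxx t x) + norm (\<i> * of_real (lam / eps * L t x) * b t x)"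
        unfolding bt_def L_def[symmetric]
        by (rule tri)
      also have "\<dots> = \<bar>w t x\<bar> * norm (bx t x) + \<bar>wx t x\<bar> / 2 * norm (b t x) + eps / 2 * norm (bxx t x) + lam / eps * (norm (b t x) * \<bar>L t x\<bar>)"
        using eps lam by (simp add: norm_mult norm_divide abs_mult)
      also have "\<dots> \<le> B"
        unfolding B_def using wb bM bL K M0 eps lam by (intro add_mono mult_mono mult_left_mono) auto
      finally show ?thesis .
    qed
    have q1: "\<bar>1 - (cmod (b t x))\<^sup>2 / r t x\<bar> \<le> 1 + Q" using q0 qQ by (simp add: q_def[symmetric] abs_le_iff)
    have ReL: "\<bar>2 * Re (cnj (b t x) * z) * L t x\<bar> \<le> 2 * Z * A" if "norm z \<le> Z" for z Z
    proof -
      have "\<bar>2 * Re (cnj (b t x) * z) * L t x\<bar> = 2 * \<bar>Re (cnj (b t x) * z)\<bar> * \<bar>L t x\<bar>" by (simp only: abs_mult abs_numeral)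
      also have "\<dots> \<le> 2 * (norm (b t x) * norm z) * \<bar>L t x\<bar>"
      proof (intro mult_right_mono mult_left_mono)
        show "\<bar>Re (cnj (b t x) * z)\<bar> \<le> norm (b t x) * norm z"
          using abs_Re_le_cmod[of "cnj (b t x) * z"] by (simp only: norm_mult complex_mod_cnj)
      qed auto
      also have "\<dots> = 2 * norm z * (norm (b t x) * \<bar>L t x\<bar>)" by simp
      also have "\<dots> \<le> 2 * Z * A" using that bL A0 order_trans[OF norm_ge_zero that] by (intro mult_mono) auto
      finally show ?thesis .
    qed
    have "\<bar>rx t x * (1 - (cmod (b t x))\<^sup>2 / r t x)\<bar> \<le> K * (1 + Q)"
      unfolding abs_mult using K by (intro mult_mono[OF rb(3) q1]) auto
    also have "\<dots> \<le> 2 * K * K * (1 + Q)"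
    proof (rule mult_right_mono)
      have "1 * K \<le> 2 * K * K" using K by (intro mult_right_mono) auto
      then show "K \<le> 2 * K * K" by simp
    qed (use Q0 in simp)
    finally have c: "\<bar>2 * Re (cnj (b t x) * bx t x) * L t x + rx t x * (1 - (cmod (b t x))\<^sup>2 / r t x)\<bar> \<le> C"
      using ReL[OF bM(2)] unfolding C_def by linarith
    have "\<bar>rx t x * w t x + r t x * wx t x\<bar> \<le> K * K + K * K"
    proof (rule order_trans[OF abs_triangle_ineq], rule add_mono)
      show "\<bar>rx t x * w t x\<bar> \<le> K * K" unfolding abs_mult using K by (intro mult_mono[OF rb(3) wb(1)]) auto
      have "\<bar>r t x\<bar> \<le> K" using rb r_pos[OF t, of x] by simp
      then show "\<bar>r t x * wx t x\<bar> \<le> K * K" unfolding abs_mult using K by (intro mult_mono[OF _ wb(2)]) auto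
    qed
    then have "\<bar>- (rx t x * w t x + r t x * wx t x) * (1 - (cmod (b t x))\<^sup>2 / r t x)\<bar> \<le> (K * K + K * K) * (1 + Q)"
      unfolding abs_mult abs_minus_cancel using K by (intro mult_mono[OF _ q1]) auto
    then have d: "\<bar>ht t x\<bar> \<le> D"
    proof -
      have "(K * K + K * K) * (1 + Q) = 2 * K * K * (1 + Q)" by (simp add: algebra_simps)
      then show ?thesis using \<open>\<bar>- (rx t x * w t x + r t x * wx t x) * (1 - (cmod (b t x))\<^sup>2 / r t x)\<bar> \<le> _\<close> ReL[OF bt]
        unfolding ht_def D_def by linarith
    qed
    have "h t x = (cmod (b t x) * L t x) * cmod (b t x) - (cmod (b t x))\<^sup>2 + r t x"
      by (simp add: h_def rel_entropy_def L_def power2_eq_square)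
    moreover have "(cmod (b t x) * L t x) * cmod (b t x) \<le> A * M"
    proof -
      have "cmod (b t x) * L t x \<le> cmod (b t x) * \<bar>L t x\<bar>" by (intro mult_left_mono) auto
      also have "\<dots> \<le> A" by (rule bL)
      finally show ?thesis using bM A0 by (intro mult_mono) auto
    qed
    moreover have "0 \<le> (cmod (b t x))\<^sup>2" "0 \<le> M\<^sup>2" by auto
    ultimately have "h t x \<le> E" using rb unfolding E_def by linarith
    then have e: "\<bar>h t x\<bar> \<le> E" using h_nonneg[OF t, of x] by simp
    show ?thesis using bL bM bt c d e by blast
  qed
  then show ?thesis using N by (intro exI[of _ N]) (meson order_trans)
qed

end

section \<open>Boundedness without explicit constants, and weighted integrals\<close>

definition bdd :: "(real \<Rightarrow> 'a::real_normed_vector) \<Rightarrow> bool" where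
  "bdd f \<longleftrightarrow> (\<exists>C. \<forall>x. norm (f x) \<le> C)"

lemma bddI: "(\<And>x. norm (f x) \<le> C) \<Longrightarrow> bdd f"
  by (auto simp: bdd_def)

lemma bdd_const: "bdd (\<lambda>_. c)"
  by (auto simp: bdd_def)

lemma bdd_add: "bdd f \<Longrightarrow> bdd g \<Longrightarrow> bdd (\<lambda>x. f x + g x)"
  unfolding bdd_def by (metis add_mono norm_triangle_le)

lemma bdd_minus: "bdd f \<Longrightarrow> bdd (\<lambda>x. - f x)"
  by (simp add: bdd_def)

lemma bdd_diff: "bdd f \<Longrightarrow> bdd g \<Longrightarrow> bdd (\<lambda>x. f x - g x)"
  using bdd_add[OF _ bdd_minus, of f g] by simp

lemma bdd_mult:
  fixes f g :: "real \<Rightarrow> 'a::real_normed_algebra"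
  assumes "bdd f" "bdd g"
  shows "bdd (\<lambda>x. f x * g x)"
proof -
  obtain A B where A: "\<And>x. norm (f x) \<le> A" and B: "\<And>x. norm (g x) \<le> B"
    using assms by (auto simp: bdd_def)
  have "norm (f x * g x) \<le> A * B" for x
    by (rule order_trans[OF norm_mult_ineq mult_mono[OF A B]]) (use order_trans[OF norm_ge_zero A] in auto)
  then show ?thesis by (rule bddI)
qed

lemma bdd_Re: "bdd f \<Longrightarrow> bdd (\<lambda>x. Re (f x))"
  unfolding bdd_def by (metis abs_Re_le_cmod order_trans real_norm_def)

lemma bdd_cnj: "bdd f \<Longrightarrow> bdd (\<lambda>x. cnj (f x))"
  by (simp add: bdd_def)

lemma bdd_cmod_square: "bdd f \<Longrightarrow> bdd (\<lambda>x. (cmod (f x))\<^sup>2)"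
  using bdd_mult[of "\<lambda>x. cmod (f x)" "\<lambda>x. cmod (f x)"] by (simp add: bdd_def power2_eq_square)

lemmas bdd_intros = bdd_const bdd_add bdd_minus bdd_diff bdd_mult bdd_Re bdd_cnj bdd_cmod_square

text \<open>Integrands and fluxes all have this shape with bounded coefficients; the lemma yields
  both integrability and decay at infinity.\<close>

lemma bdd_weight_bound:
  assumes d: "d > 0" and "bdd X" "bdd Y"
  shows "\<exists>C. \<forall>x. \<bar>weight' d x * X x + weight d x * Y x\<bar> \<le> C * weight d x"
proof -
  obtain A B where A: "\<And>x. \<bar>X x\<bar> \<le> A" and B: "\<And>x. \<bar>Y x\<bar> \<le> B"
    using assms by (auto simp: bdd_def)
  have "\<bar>weight' d x * X x + weight d x * Y x\<bar> \<le> (d * A + B) * weight d x" for x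
  proof -
    have "\<bar>weight' d x * X x\<bar> \<le> (d * weight d x) * A"
      unfolding abs_mult using weight_pos[of d x] d by (intro mult_mono[OF weight'_le[OF d] A]) auto
    moreover have "\<bar>weight d x * Y x\<bar> \<le> weight d x * B"
      unfolding abs_mult using weight_pos[of d x] B by (intro mult_mono) auto
    ultimately show ?thesis by (simp add: algebra_simps)
  qed
  then show ?thesis by blast
qed

lemma integrable_weight_bound:
  fixes f :: "real \<Rightarrow> real"
  assumes d: "d > 0" and c: "continuous_on UNIV f" and "\<exists>C. \<forall>x. \<bar>f x\<bar> \<le> C * weight d x"
  shows "integrable lborel f"
proof -
  obtain C where C: "\<And>x. \<bar>f x\<bar> \<le> C * weight d x" using assms by blast
  show ?thesis
  proof (rule Bochner_Integration.integrable_bound)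
    show "integrable lborel (\<lambda>x. C * weight d x)" using integrable_weight[OF d] by simp
    show "f \<in> borel_measurable lborel" using c by (simp add: borel_measurable_continuous_onI)
    show "AE x in lborel. norm (f x) \<le> norm (C * weight d x)"
      using C by (intro AE_I2) (metis abs_ge_self order_trans real_norm_def)
  qed
qed

lemma integrable_weight_mult:
  fixes f :: "real \<Rightarrow> real"
  assumes d: "d > 0" and c: "continuous_on UNIV f" and b: "bdd f"
  shows "integrable lborel (\<lambda>x. weight d x * f x)"
proof (rule integrable_weight_bound[OF d])
  show "continuous_on UNIV (\<lambda>x. weight d x * f x)" by (intro continuous_intros c)
  show "\<exists>C. \<forall>x. \<bar>weight d x * f x\<bar> \<le> C * weight d x"
    using bdd_weight_bound[OF d bdd_const[of 0] b] by simp
qed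

lemma lipschitz_vector_derivative:
  fixes f :: "real \<Rightarrow> 'a::real_normed_vector"
  assumes "\<And>t. t \<in> {0..T} \<Longrightarrow> (f has_vector_derivative f' t) (at t within {0..T})"
    and "\<And>t. t \<in> {0..T} \<Longrightarrow> norm (f' t) \<le> B" and "x \<in> {0..T}" "y \<in> {0..T}"
  shows "norm (f x - f y) \<le> B * \<bar>x - y\<bar>"
proof -
  have "norm (f x - f y) \<le> B * norm (x - y)"
  proof (rule differentiable_bound[of "{0..T}" f "\<lambda>t h. h *\<^sub>R f' t"])
    show "(f has_derivative (\<lambda>h. h *\<^sub>R f' t)) (at t within {0..T})" if "t \<in> {0..T}" for t
      using assms(1)[OF that] by (simp add: has_vector_derivative_def)
    show "onorm (\<lambda>h. h *\<^sub>R f' t) \<le> B" if "t \<in> {0..T}" for t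
      using assms(2)[OF that] order_trans[OF norm_ge_zero assms(2)[OF that]]
      by (intro onorm_bound) (auto simp: mult.commute[of B] intro!: mult_left_mono)
  qed (use assms in auto)
  then show ?thesis by simp
qed

text \<open>The term with \<open>wxx\<close> pairs the gradient with \<open>|b|\<close>, which is
  not small; it leaves the source \<open>eps^2 * wxx^2\<close>, harmless because \<open>wxx\<close>
  is square integrable and of the right order in \<open>eps\<close>. The terms with
  \<open>k'\<close> carry a factor \<open>d\<close>. Those among them that involve the bound
  \<open>N\<close>, which depends on \<open>eps\<close>, end up with \<open>d^2\<close>, so that one
  factor \<open>d\<close> survives the mass \<open>pi / d\<close> of the weight. All else is
  absorbed into the energy density.\<close>

lemma remainder_le:
  fixes b bx bt :: complex and w wx wxx r h eps lam K N d k k' :: real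
  assumes eps: "0 < eps" "eps \<le> 1" and lam: "lam > 0" and K: "K \<ge> 1" and d: "0 < d" "d \<le> 1"
    and k: "k > 0" "\<bar>k'\<bar> \<le> d * k" and bds: "\<bar>w\<bar> \<le> K" "\<bar>wx\<bar> \<le> K" "\<bar>wxx\<bar> \<le> K" "r \<le> K" "h \<ge> 0"
    and bh: "(cmod b)\<^sup>2 \<le> 2 * r + 2 * h" and N: "cmod b \<le> N" "cmod bt \<le> N"
  shows "k * (eps\<^sup>2 * (- wx * (cmod bx)\<^sup>2 - wxx / 2 * Re (cnj bx * b)))
       + k' * (lam * (w * h) - eps\<^sup>2 / 2 * (w * (cmod bx)\<^sup>2 + wx * Re (cnj bx * b)) - eps\<^sup>2 * Re (cnj bt * bx))
    \<le> (3 * K + 2 + K\<^sup>2 / lam) * (k * (eps\<^sup>2 / 2 * (cmod bx)\<^sup>2 + lam * h)) + eps\<^sup>2 / 2 * K * (k * wxx\<^sup>2)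
      + eps\<^sup>2 / 2 * (d * ((K / 2 + 1) * N))\<^sup>2 * k"
proof -
  define a where "a = cmod bx"
  define R where "R = Re (cnj bx * b)"
  define S where "S = Re (cnj bt * bx)"
  define M where "M = (K / 2 + 1) * N"
  have a0: "a \<ge> 0" by (simp add: a_def)
  have N0: "N \<ge> 0" using N(1) norm_ge_zero[of b] by linarith
  have R: "\<bar>R\<bar> \<le> a * cmod b"
    using abs_Re_le_cmod[of "cnj bx * b"] unfolding R_def a_def by (simp only: norm_mult complex_mod_cnj)
  have RN: "\<bar>R\<bar> \<le> a * N" by (rule order_trans[OF R mult_left_mono[OF N(1) a0]])
  have "\<bar>S\<bar> \<le> cmod bt * a"
    using abs_Re_le_cmod[of "cnj bt * bx"] unfolding S_def a_def by (simp only: norm_mult complex_mod_cnj)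
  also have "\<dots> \<le> N * a" by (rule mult_right_mono[OF N(2) a0])
  finally have SN: "\<bar>S\<bar> \<le> a * N" by (simp add: mult.commute)
  have e1: "eps\<^sup>2 \<le> 1" using eps by (simp add: power_le_one)
  have e0: "eps\<^sup>2 > 0" using eps by simp
  have t1: "- wx * a\<^sup>2 \<le> K * a\<^sup>2" using bds(2) by (intro mult_right_mono) auto
  \<comment> \<open>After Young's inequality the product \<open>wxx^2 * |b|^2\<close> is split by
    \<open>bh\<close>: the part with \<open>r\<close> keeps \<open>wxx^2\<close> as a source, while
    in the part with \<open>h\<close> the function \<open>wxx\<close> is bounded by
    \<open>K\<close>.\<close>
  have t2: "- wxx / 2 * R \<le> a\<^sup>2 / 4 + K / 2 * wxx\<^sup>2 + K\<^sup>2 / 2 * h"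
  proof -
    have "- wxx / 2 * R \<le> \<bar>wxx\<bar> / 2 * \<bar>R\<bar>" using abs_ge_self[of "- wxx / 2 * R"] by (simp add: abs_mult)
    also have "\<dots> \<le> \<bar>wxx\<bar> / 2 * (a * cmod b)" using R by (intro mult_left_mono) auto
    also have "\<dots> \<le> (a\<^sup>2 + (\<bar>wxx\<bar> * cmod b)\<^sup>2) / 4"
      using sum_squares_bound[of a "\<bar>wxx\<bar> * cmod b"] by simp
    also have "(\<bar>wxx\<bar> * cmod b)\<^sup>2 \<le> wxx\<^sup>2 * (2 * K + 2 * h)"
      unfolding power_mult_distrib power2_abs using bh bds(4) by (intro mult_left_mono) auto
    also have "wxx\<^sup>2 * (2 * K + 2 * h) = 2 * K * wxx\<^sup>2 + 2 * (wxx\<^sup>2 * h)" by (simp add: algebra_simps)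
    also have "wxx\<^sup>2 * h \<le> K\<^sup>2 * h" using bds(3,5) K by (intro mult_right_mono) (auto simp: abs_le_square_iff[symmetric])
    finally show ?thesis by (simp add: field_simps)
  qed
  have "k * (eps\<^sup>2 * (- wx * a\<^sup>2 - wxx / 2 * R)) \<le> k * (eps\<^sup>2 * (K * a\<^sup>2 + (a\<^sup>2 / 4 + K / 2 * wxx\<^sup>2 + K\<^sup>2 / 2 * h)))"
    using t1 t2 k(1) e0 by (intro mult_left_mono) auto
  also have "\<dots> \<le> k * ((2 * K + 1 / 2) * (eps\<^sup>2 / 2 * a\<^sup>2) + eps\<^sup>2 / 2 * K * wxx\<^sup>2 + K\<^sup>2 / 2 * h)"
  proof (rule mult_left_mono)
    have "eps\<^sup>2 * (K\<^sup>2 / 2 * h) \<le> 1 * (K\<^sup>2 / 2 * h)" using e1 bds(5) by (intro mult_right_mono) auto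
    moreover have "eps\<^sup>2 * (K * a\<^sup>2 + (a\<^sup>2 / 4 + K / 2 * wxx\<^sup>2 + K\<^sup>2 / 2 * h))
      = (2 * K + 1 / 2) * (eps\<^sup>2 / 2 * a\<^sup>2) + eps\<^sup>2 / 2 * K * wxx\<^sup>2 + eps\<^sup>2 * (K\<^sup>2 / 2 * h)"
      by (simp add: field_simps)
    ultimately show "eps\<^sup>2 * (K * a\<^sup>2 + (a\<^sup>2 / 4 + K / 2 * wxx\<^sup>2 + K\<^sup>2 / 2 * h))
      \<le> (2 * K + 1 / 2) * (eps\<^sup>2 / 2 * a\<^sup>2) + eps\<^sup>2 / 2 * K * wxx\<^sup>2 + K\<^sup>2 / 2 * h"
      by linarith
  qed (use k in simp)
  finally have A: "k * (eps\<^sup>2 * (- wx * a\<^sup>2 - wxx / 2 * R)) \<le> k * ((2 * K + 1 / 2) * (eps\<^sup>2 / 2 * a\<^sup>2) + eps\<^sup>2 / 2 * K * wxx\<^sup>2 + K\<^sup>2 / 2 * h)" .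
  define Z where "Z = lam * (w * h) - eps\<^sup>2 / 2 * (w * a\<^sup>2 + wx * R) - eps\<^sup>2 * S"
  have Zb: "\<bar>Z\<bar> \<le> K * (eps\<^sup>2 / 2 * a\<^sup>2 + lam * h) + eps\<^sup>2 * (M * a)"
  proof -
    have z1: "\<bar>lam * (w * h)\<bar> \<le> lam * (K * h)" using bds(1,5) lam by (simp add: abs_mult mult_right_mono)
    have z2: "\<bar>w * a\<^sup>2\<bar> \<le> K * a\<^sup>2" using bds(1) by (simp add: abs_mult mult_right_mono)
    have z3: "\<bar>wx * R\<bar> \<le> K * (a * N)" unfolding abs_mult using K by (intro mult_mono[OF bds(2) RN]) auto
    have "\<bar>w * a\<^sup>2 + wx * R\<bar> \<le> K * a\<^sup>2 + K * (a * N)" using z2 z3 by linarith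
    then have z4: "\<bar>eps\<^sup>2 / 2 * (w * a\<^sup>2 + wx * R)\<bar> \<le> eps\<^sup>2 / 2 * (K * a\<^sup>2 + K * (a * N))"
      unfolding abs_mult using e0 by (simp add: mult_left_mono)
    have z5: "\<bar>eps\<^sup>2 * S\<bar> \<le> eps\<^sup>2 * (a * N)" using SN e0 by (simp add: abs_mult)
    have "\<bar>Z\<bar> \<le> lam * (K * h) + eps\<^sup>2 / 2 * (K * a\<^sup>2 + K * (a * N)) + eps\<^sup>2 * (a * N)"
      unfolding Z_def using z1 z4 z5 by linarith
    also have "\<dots> = K * (eps\<^sup>2 / 2 * a\<^sup>2 + lam * h) + eps\<^sup>2 * (M * a)" by (simp add: M_def algebra_simps)
    finally show ?thesis .
  qed
  have dn: "eps\<^sup>2 / 2 * a\<^sup>2 + lam * h \<ge> 0" using lam bds(5) by simp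
  have "k' * Z \<le> \<bar>k'\<bar> * \<bar>Z\<bar>" using abs_ge_self[of "k' * Z"] by (simp add: abs_mult)
  also have "\<dots> \<le> (d * k) * (K * (eps\<^sup>2 / 2 * a\<^sup>2 + lam * h) + eps\<^sup>2 * (M * a))"
    using Zb k d by (intro mult_mono) auto
  also have "\<dots> = k * (d * (K * (eps\<^sup>2 / 2 * a\<^sup>2 + lam * h)) + eps\<^sup>2 * (d * M * a))" by (simp add: algebra_simps)
  also have "\<dots> \<le> k * (1 * (K * (eps\<^sup>2 / 2 * a\<^sup>2 + lam * h)) + eps\<^sup>2 * ((a\<^sup>2 + (d * M)\<^sup>2) / 2))"
  proof (intro mult_left_mono add_mono mult_right_mono)
    show "d * M * a \<le> (a\<^sup>2 + (d * M)\<^sup>2) / 2" using sum_squares_bound[of a "d * M"] by (simp add: mult_ac)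
  qed (use k d dn K in auto)
  finally have B: "k' * Z \<le> k * (K * (eps\<^sup>2 / 2 * a\<^sup>2 + lam * h) + eps\<^sup>2 * ((a\<^sup>2 + (d * M)\<^sup>2) / 2))" by simp
  have "k * (eps\<^sup>2 * (- wx * a\<^sup>2 - wxx / 2 * R)) + k' * Z
     \<le> k * ((2 * K + 1 / 2) * (eps\<^sup>2 / 2 * a\<^sup>2) + eps\<^sup>2 / 2 * K * wxx\<^sup>2 + K\<^sup>2 / 2 * h)
      + k * (K * (eps\<^sup>2 / 2 * a\<^sup>2 + lam * h) + eps\<^sup>2 * ((a\<^sup>2 + (d * M)\<^sup>2) / 2))" using A B by linarith
  also have "\<dots> = k * ((3 * K + 3 / 2) * (eps\<^sup>2 / 2 * a\<^sup>2) + (K + K\<^sup>2 / lam / 2) * (lam * h)) + eps\<^sup>2 / 2 * K * (k * wxx\<^sup>2) + eps\<^sup>2 / 2 * (d * M)\<^sup>2 * k"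
    using lam by (simp add: field_simps)
  also have "\<dots> \<le> k * ((3 * K + 2 + K\<^sup>2 / lam) * (eps\<^sup>2 / 2 * a\<^sup>2) + (3 * K + 2 + K\<^sup>2 / lam) * (lam * h)) + eps\<^sup>2 / 2 * K * (k * wxx\<^sup>2) + eps\<^sup>2 / 2 * (d * M)\<^sup>2 * k"
  proof -
    have "K\<^sup>2 / lam \<ge> 0" using lam by simp
    moreover have "3 * K + 3 / 2 \<le> 3 * K + 2 + P \<and> K + P / 2 \<le> 3 * K + 2 + P" if "P \<ge> 0" for P
      using K that by auto
    ultimately have c: "3 * K + 3 / 2 \<le> 3 * K + 2 + K\<^sup>2 / lam" "K + K\<^sup>2 / lam / 2 \<le> 3 * K + 2 + K\<^sup>2 / lam"
      by blast+
    show ?thesis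
      by (intro add_right_mono mult_left_mono add_mono mult_right_mono c) (use k lam bds(5) in auto)
  qed
  also have "\<dots> = (3 * K + 2 + K\<^sup>2 / lam) * (k * (eps\<^sup>2 / 2 * a\<^sup>2 + lam * h)) + eps\<^sup>2 / 2 * K * (k * wxx\<^sup>2) + eps\<^sup>2 / 2 * (d * M)\<^sup>2 * k"
    by (simp add: algebra_simps)
  finally show ?thesis by (simp only: Z_def a_def R_def S_def M_def)
qed

lemma lborel_measurable_continuous:
  "continuous_on UNIV f \<Longrightarrow> f \<in> borel_measurable lborel"
  by (simp add: borel_measurable_continuous_onI)

section \<open>The time derivative of the weighted energy\<close>

context wkb_comparison
begin

lemma bdd_all:
  assumes t: "t \<in> {0..T}"
  shows "bdd (b t)" "bdd (bx t)" "bdd (bxx t)" "bdd (bt t)" "bdd (h t)" "bdd (ht t)" "bdd (w t)" "bdd (wx t)" "bdd (wxx t)"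
    "bdd (\<lambda>x. 2 * Re (cnj (b t x) * bx t x) * L t x + rx t x * (1 - (cmod (b t x))\<^sup>2 / r t x))" "bdd (dens t)"
proof -
  obtain N where N: "\<And>x. norm (b t x) \<le> N \<and> norm (bx t x) \<le> N \<and> norm (bxx t x) \<le> N
   \<and> norm (bt t x) \<le> N \<and> \<bar>h t x\<bar> \<le> N \<and> \<bar>ht t x\<bar> \<le> N \<and>
   \<bar>2 * Re (cnj (b t x) * bx t x) * L t x + rx t x * (1 - (cmod (b t x))\<^sup>2 / r t x)\<bar> \<le> N"
    using bounds t by meson
  show *: "bdd (b t)" "bdd (bx t)" "bdd (bxx t)" "bdd (bt t)" "bdd (h t)" "bdd (ht t)"
    "bdd (\<lambda>x. 2 * Re (cnj (b t x) * bx t x) * L t x + rx t x * (1 - (cmod (b t x))\<^sup>2 / r t x))"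
    by (rule bddI[of _ N]; use N in simp)+
  show "bdd (w t)" "bdd (wx t)" "bdd (wxx t)"
    by (rule bddI[of _ K]; use w_bound[OF t] in simp)+
  show "bdd (dens t)" unfolding dens_def[abs_def] by (intro bdd_intros *)
qed

text \<open>\<open>bx\<close> cannot simply be differentiated in time: \<open>bt\<close> contains
  \<open>bxx\<close>, so a third derivative in \<open>x\<close> would appear. Instead, the increment
  \<open>|bx \<tau>|^2 - |bx t|^2\<close> is factored as a difference times a sum, and the
  \<open>x\<close> derivative is moved off the difference before dividing by
  \<open>\<tau> - t\<close>. The quotient \<open>G\<close> then contains only difference quotients
  of \<open>b\<close>, which converge to \<open>bt\<close> and are bounded by the mean value
  inequality.\<close>

lemma parabolic_energy_has_derivative:
  assumes d: "d > 0" and t: "t \<in> {0..T}"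
  shows "((\<lambda>\<tau>. LINT x|lborel. weight d x * (cmod (bx \<tau> x))\<^sup>2) has_real_derivative
    (LINT x|lborel. - 2 * Re (cnj (bt t x) * (of_real (weight' d x) * bx t x + of_real (weight d x) * bxx t x)))) (at t within {0..T})"
  unfolding has_field_derivative_iff
proof -
  obtain N where N: "N \<ge> 1" "\<And>t x. t \<in> {0..T} \<Longrightarrow> norm (bx t x) \<le> N \<and> norm (bxx t x) \<le> N \<and> norm (bt t x) \<le> N"
    using bounds by metis
  define G where "G \<tau> x = - Re (cnj ((b \<tau> x - b t x) /\<^sub>R (\<tau> - t)) *
     (of_real (weight' d x) * (bx \<tau> x + bx t x) + of_real (weight d x) * (bxx \<tau> x + bxx t x)))" for \<tau> x
  have eq: "((LINT x|lborel. weight d x * (cmod (bx \<tau> x))\<^sup>2) - (LINT x|lborel. weight d x * (cmod (bx t x))\<^sup>2)) / (\<tau> - t)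
     = (LINT x|lborel. G \<tau> x)" if \<tau>: "\<tau> \<in> {0..T}" for \<tau>
  proof -
    define X where "X x = Re (cnj (b \<tau> x - b t x) * (bx \<tau> x + bx t x))" for x
    define Y where "Y x = Re (cnj (bx \<tau> x - bx t x) * (bx \<tau> x + bx t x)) + Re (cnj (b \<tau> x - b t x) * (bxx \<tau> x + bxx t x))" for x
    \<comment> \<open>The derivative of \<open>weight d x * X x\<close>. Its integral is 0, and
      subtracting it performs the integration by parts.\<close>
    define F' where "F' x = weight' d x * X x + weight d x * Y x" for x
    have Xb: "bdd X" "bdd Y" unfolding X_def[abs_def] Y_def[abs_def] by (intro bdd_intros bdd_all t \<tau>)+
    obtain C1 where C1: "\<And>x. \<bar>F' x\<bar> \<le> C1 * weight d x" using bdd_weight_bound[OF d Xb] by (auto simp: F'_def)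
    obtain C2 where C2: "\<And>x. \<bar>weight d x * X x\<bar> \<le> C2 * weight d x"
      using bdd_weight_bound[OF d bdd_const[of 0] Xb(1)] by auto
    define C where "C = max C1 C2"
    have C: "\<bar>F' x\<bar> \<le> C * weight d x" "\<bar>weight d x * X x\<bar> \<le> C * weight d x" for x
    proof -
      have "C1 * weight d x \<le> C * weight d x" "C2 * weight d x \<le> C * weight d x"
        using weight_pos[of d x] by (intro mult_right_mono; simp add: C_def)+
      then show "\<bar>F' x\<bar> \<le> C * weight d x" "\<bar>weight d x * X x\<bar> \<le> C * weight d x"
        using C1[of x] C2[of x] by linarith+
    qed
    have X_x: "(X has_real_derivative Y x) (at x)" for x
      unfolding X_def[abs_def] Y_def
      by (intro Re_cnj_mult_has_derivative has_vector_derivative_add has_vector_derivative_diff b_x bx_x t \<tau>)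
    have F: "((\<lambda>x. weight d x * X x) has_real_derivative F' x) (at x)" for x
      unfolding F'_def using DERIV_mult[OF weight_has_derivative X_x[of x]] by (simp add: mult.commute)
    have F'c: "continuous_on UNIV F'"
      unfolding F'_def[abs_def] X_def Y_def by (intro continuous_intros cont bxx_c t \<tau>)
    note F'0 = integral_derivative_eq_0[OF d F F'c C]
    have Re_sq: "Re (cnj (u - v) * (u + v)) = (cmod u)\<^sup>2 - (cmod v)\<^sup>2" for u v
      unfolding cmod_power2 by (simp add: power2_eq_square algebra_simps)
    have i1: "integrable lborel (\<lambda>x. weight d x * (cmod (bx s x))\<^sup>2)" if "s \<in> {0..T}" for s
      by (intro integrable_weight_mult[OF d] continuous_intros cont bdd_intros bdd_all that)
    have "(LINT x|lborel. weight d x * (cmod (bx \<tau> x))\<^sup>2) - (LINT x|lborel. weight d x * (cmod (bx t x))\<^sup>2)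
       = (LINT x|lborel. weight d x * (cmod (bx \<tau> x))\<^sup>2 - weight d x * (cmod (bx t x))\<^sup>2)"
      by (intro Bochner_Integration.integral_diff[symmetric] i1 t \<tau>)
    also have "\<dots> = (LINT x|lborel. weight d x * (cmod (bx \<tau> x))\<^sup>2 - weight d x * (cmod (bx t x))\<^sup>2 - F' x)"
      by (subst (2) Bochner_Integration.integral_diff) (use F'0 i1[OF t] i1[OF \<tau>] in auto)
    also have "\<dots> = (LINT x|lborel. (\<tau> - t) * G \<tau> x)"
    proof (rule Bochner_Integration.integral_cong)
      fix x
      have "(\<tau> - t) * G \<tau> x = - Re (cnj (b \<tau> x - b t x) * (of_real (weight' d x) * (bx \<tau> x + bx t x) + of_real (weight d x) * (bxx \<tau> x + bxx t x)))"
      proof (cases "\<tau> = t")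
        case False
        have "(\<tau> - t) * Re (cnj (z /\<^sub>R (\<tau> - t)) * y) = Re (cnj z * y)" for z y
          using False by (simp add: field_simps)
        then show ?thesis unfolding G_def by (simp only: mult_minus_right)
      qed (simp add: G_def)
      also have "\<dots> = - (weight' d x * X x + weight d x * Re (cnj (b \<tau> x - b t x) * (bxx \<tau> x + bxx t x)))"
        unfolding X_def by (simp add: algebra_simps)
      finally show "weight d x * (cmod (bx \<tau> x))\<^sup>2 - weight d x * (cmod (bx t x))\<^sup>2 - F' x = (\<tau> - t) * G \<tau> x"
        unfolding F'_def Y_def Re_sq by (simp add: algebra_simps)
    qed simp
    finally show ?thesis by (cases "\<tau> = t") (simp_all add: G_def)
  qed
  have "((\<lambda>\<tau>. LINT x|lborel. G \<tau> x) \<longlongrightarrow>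
     (LINT x|lborel. - 2 * Re (cnj (bt t x) * (of_real (weight' d x) * bx t x + of_real (weight d x) * bxx t x)))) (at t within {0..T})"
  proof (rule integral_dominated_convergence_within[where w = "\<lambda>x. N * (2 * N * (d + 1)) * weight d x"])
    show "(\<lambda>x. - 2 * Re (cnj (bt t x) * (of_real (weight' d x) * bx t x + of_real (weight d x) * bxx t x))) \<in> borel_measurable lborel"
      by (intro lborel_measurable_continuous continuous_intros cont bxx_c t)
    show "G \<tau> \<in> borel_measurable lborel" if "\<tau> \<in> {0..T} - {t}" for \<tau>
      unfolding G_def[abs_def] using that
      by (intro lborel_measurable_continuous continuous_intros cont bxx_c t) auto
    show "integrable lborel (\<lambda>x. N * (2 * N * (d + 1)) * weight d x)" using integrable_weight[OF d] by simp
    show "AE x in lborel. norm (G \<tau> x) \<le> N * (2 * N * (d + 1)) * weight d x" if \<tau>: "\<tau> \<in> {0..T} - {t}" for \<tau>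
    proof (rule AE_I2)
      fix x
      have \<tau>': "\<tau> \<in> {0..T}" "\<tau> \<noteq> t" using \<tau> by auto
      have "norm (b \<tau> x - b t x) \<le> N * \<bar>\<tau> - t\<bar>"
        by (rule lipschitz_vector_derivative[OF b_t' _ \<tau>'(1) t]) (use N in auto)
      then have q: "norm ((b \<tau> x - b t x) /\<^sub>R (\<tau> - t)) \<le> N"
        using \<tau>' by (simp only: norm_scaleR norm_inverse real_norm_def) (simp add: divide_inverse[symmetric] pos_divide_le_eq mult.commute[of "inverse _"])
      have bxb: "norm (bx \<tau> x + bx t x) \<le> 2 * N" "norm (bxx \<tau> x + bxx t x) \<le> 2 * N"
        using N(2)[OF \<tau>'(1), of x] N(2)[OF t, of x] norm_triangle_ineq[of "bx \<tau> x" "bx t x"] norm_triangle_ineq[of "bxx \<tau> x" "bxx t x"]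
        by linarith+
      have "norm (of_real (weight' d x) * (bx \<tau> x + bx t x)) \<le> (d * weight d x) * (2 * N)"
        unfolding norm_mult norm_of_real using d weight_pos[of d x] by (intro mult_mono[OF weight'_le[OF d] bxb(1)]) auto
      moreover have "norm (of_real (weight d x) * (bxx \<tau> x + bxx t x)) \<le> weight d x * (2 * N)"
        unfolding norm_mult norm_of_real using weight_pos[of d x] by (intro mult_mono[OF _ bxb(2)]) auto
      ultimately have s: "norm (of_real (weight' d x) * (bx \<tau> x + bx t x) + of_real (weight d x) * (bxx \<tau> x + bxx t x)) \<le> 2 * N * (d + 1) * weight d x"
        using norm_triangle_ineq[of "of_real (weight' d x) * (bx \<tau> x + bx t x)" "of_real (weight d x) * (bxx \<tau> x + bxx t x)"]
        by (simp add: algebra_simps)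
      have "norm (G \<tau> x) \<le> norm (cnj ((b \<tau> x - b t x) /\<^sub>R (\<tau> - t)) *
          (of_real (weight' d x) * (bx \<tau> x + bx t x) + of_real (weight d x) * (bxx \<tau> x + bxx t x)))"
        unfolding G_def real_norm_def abs_minus_cancel by (rule abs_Re_le_cmod)
      also have "\<dots> \<le> N * (2 * N * (d + 1) * weight d x)"
        unfolding norm_mult complex_mod_cnj using N(1) by (intro mult_mono[OF q s]) auto
      finally show "norm (G \<tau> x) \<le> N * (2 * N * (d + 1)) * weight d x" by (simp add: mult.assoc)
    qed
    show "AE x in lborel. ((\<lambda>\<tau>. G \<tau> x) \<longlongrightarrow> - 2 * Re (cnj (bt t x) * (of_real (weight' d x) * bx t x + of_real (weight d x) * bxx t x))) (at t within {0..T})"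
    proof (rule AE_I2)
      fix x
      have c1: "((\<lambda>\<tau>. bx \<tau> x) \<longlongrightarrow> bx t x) (at t within {0..T})" "((\<lambda>\<tau>. bxx \<tau> x) \<longlongrightarrow> bxx t x) (at t within {0..T})"
        using bx_ct[of x] bxx_ct[of x] t by (auto simp: continuous_on_def)
      have c2: "((\<lambda>\<tau>. (b \<tau> x - b t x) /\<^sub>R (\<tau> - t)) \<longlongrightarrow> bt t x) (at t within {0..T})"
        using b_t'[OF t, of x] by (simp add: has_vector_derivative_iff_quotient)
      have "((\<lambda>\<tau>. G \<tau> x) \<longlongrightarrow> - Re (cnj (bt t x) * (of_real (weight' d x) * (bx t x + bx t x) + of_real (weight d x) * (bxx t x + bxx t x)))) (at t within {0..T})"
        unfolding G_def by (intro tendsto_intros c1 c2)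
      then show "((\<lambda>\<tau>. G \<tau> x) \<longlongrightarrow> - 2 * Re (cnj (bt t x) * (of_real (weight' d x) * bx t x + of_real (weight d x) * bxx t x))) (at t within {0..T})"
        by (simp add: algebra_simps)
    qed
  qed
  then show "((\<lambda>\<tau>. ((LINT x|lborel. weight d x * (cmod (bx \<tau> x))\<^sup>2) - (LINT x|lborel. weight d x * (cmod (bx t x))\<^sup>2)) / (\<tau> - t)) \<longlongrightarrow>
     (LINT x|lborel. - 2 * Re (cnj (bt t x) * (of_real (weight' d x) * bx t x + of_real (weight d x) * bxx t x)))) (at t within {0..T})"
    by (rule Lim_transform_within[where d = 1]) (auto simp: eq)
qed

text \<open>In contrast to the gradient term, the entropy density has a time derivative, so its
  difference quotients are dominated directly.\<close>

lemma entropy_has_derivative: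
  assumes d: "d > 0" and t: "t \<in> {0..T}"
  shows "((\<lambda>\<tau>. LINT x|lborel. weight d x * h \<tau> x) has_real_derivative (LINT x|lborel. weight d x * ht t x)) (at t within {0..T})"
  unfolding has_field_derivative_iff
proof -
  obtain N where N: "N \<ge> 1" "\<And>t x. t \<in> {0..T} \<Longrightarrow> \<bar>ht t x\<bar> \<le> N"
    using bounds by metis
  have i1: "integrable lborel (\<lambda>x. weight d x * h s x)" if "s \<in> {0..T}" for s
    by (intro integrable_weight_mult[OF d] cont bdd_all that)
  have eq: "((LINT x|lborel. weight d x * h \<tau> x) - (LINT x|lborel. weight d x * h t x)) / (\<tau> - t)
     = (LINT x|lborel. weight d x * ((h \<tau> x - h t x) / (\<tau> - t)))" if \<tau>: "\<tau> \<in> {0..T}" for \<tau>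
    by (subst Bochner_Integration.integral_diff[symmetric, OF i1[OF \<tau>] i1[OF t]], subst integral_divide_zero[symmetric])
      (simp add: right_diff_distrib)
  have "((\<lambda>\<tau>. LINT x|lborel. weight d x * ((h \<tau> x - h t x) / (\<tau> - t))) \<longlongrightarrow> (LINT x|lborel. weight d x * ht t x)) (at t within {0..T})"
  proof (rule integral_dominated_convergence_within[where w = "\<lambda>x. N * weight d x"])
    show "(\<lambda>x. weight d x * ht t x) \<in> borel_measurable lborel"
      by (intro lborel_measurable_continuous continuous_intros cont t)
    show "(\<lambda>x. weight d x * ((h \<tau> x - h t x) / (\<tau> - t))) \<in> borel_measurable lborel" if "\<tau> \<in> {0..T} - {t}" for \<tau>
      using that by (intro lborel_measurable_continuous continuous_intros cont t) auto
    show "integrable lborel (\<lambda>x. N * weight d x)" using integrable_weight[OF d] by simp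
    show "AE x in lborel. norm (weight d x * ((h \<tau> x - h t x) / (\<tau> - t))) \<le> N * weight d x" if \<tau>: "\<tau> \<in> {0..T} - {t}" for \<tau>
    proof (rule AE_I2)
      fix x
      have "norm (h \<tau> x - h t x) \<le> N * \<bar>\<tau> - t\<bar>"
      proof (rule lipschitz_vector_derivative)
        show "((\<lambda>\<tau>. h \<tau> x) has_vector_derivative ht s x) (at s within {0..T})" if "s \<in> {0..T}" for s
          using h_t[OF that] by (simp add: has_real_derivative_iff_has_vector_derivative)
      qed (use N t \<tau> in auto)
      then have "norm ((h \<tau> x - h t x) / (\<tau> - t)) \<le> N" using \<tau> by (simp add: abs_divide divide_le_eq)
      from mult_left_mono[OF this, of "weight d x"]
      have "weight d x * norm ((h \<tau> x - h t x) / (\<tau> - t)) \<le> weight d x * N"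
        using weight_pos[of d x] by simp
      moreover have "norm (weight d x * z) = weight d x * norm z" for z
        using weight_pos[of d x] by (simp add: abs_mult)
      ultimately show "norm (weight d x * ((h \<tau> x - h t x) / (\<tau> - t))) \<le> N * weight d x"
        by (metis mult.commute)
    qed
    show "AE x in lborel. ((\<lambda>\<tau>. weight d x * ((h \<tau> x - h t x) / (\<tau> - t))) \<longlongrightarrow> weight d x * ht t x) (at t within {0..T})"
      using h_t[OF t] by (intro AE_I2 tendsto_mult tendsto_const) (simp add: has_field_derivative_iff)
  qed
  then show "((\<lambda>\<tau>. ((LINT x|lborel. weight d x * h \<tau> x) - (LINT x|lborel. weight d x * h t x)) / (\<tau> - t)) \<longlongrightarrow>
     (LINT x|lborel. weight d x * ht t x)) (at t within {0..T})"
    by (rule Lim_transform_within[where d = 1]) (auto simp: eq)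
qed

end

lemma bdd_square: "bdd f \<Longrightarrow> bdd (\<lambda>x. (f x :: real)\<^sup>2)"
  unfolding power2_eq_square by (rule bdd_mult)

context wkb_comparison
begin

definition energy :: "real \<Rightarrow> real \<Rightarrow> real" where
  "energy d t = (LINT x|lborel. weight d x * dens t x)"

lemma energy_split:
  assumes d: "d > 0" and t: "t \<in> {0..T}"
  shows "energy d t = eps\<^sup>2 / 2 * (LINT x|lborel. weight d x * (cmod (bx t x))\<^sup>2) + lam * (LINT x|lborel. weight d x * h t x)"
proof -
  have i1: "integrable lborel (\<lambda>x. weight d x * (cmod (bx t x))\<^sup>2)"
    by (intro integrable_weight_mult[OF d] continuous_intros cont bdd_intros bdd_all t)
  have i2: "integrable lborel (\<lambda>x. weight d x * h t x)"
    by (intro integrable_weight_mult[OF d] cont bdd_all t)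
  have "energy d t = (LINT x|lborel. eps\<^sup>2 / 2 * (weight d x * (cmod (bx t x))\<^sup>2) + lam * (weight d x * h t x))"
    unfolding energy_def dens_def by (simp add: algebra_simps)
  also have "\<dots> = eps\<^sup>2 / 2 * (LINT x|lborel. weight d x * (cmod (bx t x))\<^sup>2) + lam * (LINT x|lborel. weight d x * h t x)"
    by (subst Bochner_Integration.integral_add) (use i1 i2 in auto)
  finally show ?thesis .
qed

lemma wxx_integrable:
  assumes t: "t \<in> {0..T}"
  shows "integrable lborel (\<lambda>x. (wxx t x)\<^sup>2)" "(LINT x|lborel. (wxx t x)\<^sup>2) \<le> K"
proof -
  have [measurable]: "wxx t \<in> borel_measurable borel" by (intro borel_measurable_continuous_onI wxx_c t)
  show i: "integrable lborel (\<lambda>x. (wxx t x)\<^sup>2)"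
    by (intro integrableI_bounded) (auto intro: le_less_trans[OF wxx_L2[OF t]])
  have "ennreal (LINT x|lborel. (wxx t x)\<^sup>2) \<le> ennreal K"
    using wxx_L2[OF t] by (subst nn_integral_eq_integral[symmetric]) (use i in auto)
  then show "(LINT x|lborel. (wxx t x)\<^sup>2) \<le> K" using K by (subst (asm) ennreal_le_iff) auto
qed

text \<open>By \<open>energy_identity\<close> the integrand of the derivative is a flux plus the
  remainder. The flux integrates to 0, and \<open>remainder_le\<close> is integrated with the mass
  \<open>pi / d\<close> of the weight: the bad constant \<open>N\<close> survives with one factor
  \<open>d\<close>.\<close>

lemma energy_derivative:
  assumes N: "\<And>t x. t \<in> {0..T} \<Longrightarrow> cmod (b t x) \<le> N \<and> cmod (bt t x) \<le> N" and d: "d > 0" "d \<le> 1" and t: "t \<in> {0..T}"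
  obtains E' where "(energy d has_real_derivative E') (at t within {0..T})"
    "E' \<le> (3 * K + 2 + K\<^sup>2 / lam) * energy d t + eps\<^sup>2 / 2 * (K\<^sup>2 + pi * d * ((K / 2 + 1) * N)\<^sup>2)"
proof -
  define G where "G x = - eps\<^sup>2 * Re (cnj (bt t x) * (of_real (weight' d x) * bx t x + of_real (weight d x) * bxx t x))
      + lam * (weight d x * ht t x)" for x
  define X where "X x = - lam * (w t x * h t x) + eps\<^sup>2 / 2 * (w t x * (cmod (bx t x))\<^sup>2 + wx t x * Re (cnj (bx t x) * b t x))" for x
  define hx where "hx x = 2 * Re (cnj (b t x) * bx t x) * L t x + rx t x * (1 - (cmod (b t x))\<^sup>2 / r t x)" for x
  define Y where "Y x = - lam * (wx t x * h t x + w t x * hx x) + eps\<^sup>2 / 2 * (wx t x * (cmod (bx t x))\<^sup>2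
      + w t x * (2 * Re (cnj (bx t x) * bxx t x)) + wxx t x * Re (cnj (bx t x) * b t x)
      + wx t x * (Re (cnj (bxx t x) * b t x) + Re (cnj (bx t x) * bx t x)))" for x
  define Rm where "Rm x = weight d x * (eps\<^sup>2 * (- wx t x * (cmod (bx t x))\<^sup>2 - wxx t x / 2 * Re (cnj (bx t x) * b t x)))
       + weight' d x * (lam * (w t x * h t x) - eps\<^sup>2 / 2 * (w t x * (cmod (bx t x))\<^sup>2 + wx t x * Re (cnj (bx t x) * b t x))
           - eps\<^sup>2 * Re (cnj (bt t x) * bx t x))" for x
  define F' where "F' x = weight' d x * X x + weight d x * Y x" for x
  have hxb: "bdd hx" using bdd_all(10)[OF t] by (simp add: hx_def[abs_def])
  have hxc: "continuous_on UNIV hx"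
    unfolding hx_def[abs_def] using r_pos[OF t]
    by (intro continuous_intros cont rx_c t) (auto simp: less_imp_neq[symmetric])
  have Xb: "bdd X" "bdd Y" unfolding X_def[abs_def] Y_def[abs_def] by (intro bdd_intros bdd_all t hxb)+
  obtain C1 where C1: "\<And>x. \<bar>F' x\<bar> \<le> C1 * weight d x" using bdd_weight_bound[OF d(1) Xb] by (auto simp: F'_def)
  obtain C2 where C2: "\<And>x. \<bar>weight d x * X x\<bar> \<le> C2 * weight d x"
    using bdd_weight_bound[OF d(1) bdd_const[of 0] Xb(1)] by auto
  have C: "\<bar>F' x\<bar> \<le> max C1 C2 * weight d x" "\<bar>weight d x * X x\<bar> \<le> max C1 C2 * weight d x" for x
  proof -
    have "C1 * weight d x \<le> max C1 C2 * weight d x" "C2 * weight d x \<le> max C1 C2 * weight d x"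
      using weight_pos[of d x] by (intro mult_right_mono; simp)+
    then show "\<bar>F' x\<bar> \<le> max C1 C2 * weight d x" "\<bar>weight d x * X x\<bar> \<le> max C1 C2 * weight d x"
      using C1[of x] C2[of x] by linarith+
  qed
  have X_x: "(X has_real_derivative Y x) (at x)" for x
  proof -
    have 1: "((\<lambda>x. w t x * h t x) has_real_derivative wx t x * h t x + w t x * hx x) (at x)"
      using DERIV_mult[OF w_x[OF t] h_x[OF t]] by (simp add: hx_def mult.commute)
    have 2: "((\<lambda>x. w t x * (cmod (bx t x))\<^sup>2) has_real_derivative wx t x * (cmod (bx t x))\<^sup>2 + w t x * (2 * Re (cnj (bx t x) * bxx t x))) (at x)"
      using DERIV_mult[OF w_x[OF t] cmod_square_has_derivative[OF bx_x[OF t]]] by (simp add: mult.commute)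
    have 3: "((\<lambda>x. wx t x * Re (cnj (bx t x) * b t x)) has_real_derivative wxx t x * Re (cnj (bx t x) * b t x)
      + wx t x * (Re (cnj (bxx t x) * b t x) + Re (cnj (bx t x) * bx t x))) (at x)"
      using DERIV_mult[OF wx_x[OF t] Re_cnj_mult_has_derivative[OF bx_x[OF t] b_x[OF t]]] by (simp add: mult.commute)
    show ?thesis
      unfolding X_def[abs_def] Y_def
      using DERIV_add[OF DERIV_cmult[OF 1, of "- lam"] DERIV_cmult[OF DERIV_add[OF 2 3], of "eps\<^sup>2 / 2"]]
      by (simp add: add.assoc)
  qed
  have F: "((\<lambda>x. weight d x * X x) has_real_derivative F' x) (at x)" for x
    unfolding F'_def using DERIV_mult[OF weight_has_derivative X_x[of x]] by (simp add: mult.commute)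
  have F'c: "continuous_on UNIV F'"
    unfolding F'_def[abs_def] X_def Y_def by (intro continuous_intros cont bxx_c wxx_c hxc t)
  note F'0 = integral_derivative_eq_0[OF d(1) F F'c C]
  have id: "G x = F' x + Rm x" for x
  proof -
    have hh: "h t x = (cmod (b t x))\<^sup>2 * L t x - (cmod (b t x))\<^sup>2 + r t x" for x
      by (simp add: h_def rel_entropy_def L_def)
    have bt: "bt t x = - (of_real (w t x) * bx t x + of_real (wx t x / 2) * b t x) + \<i> * of_real (eps / 2) * bxx t x
        - \<i> * of_real (lam / eps * L t x) * b t x" by (simp add: bt_def L_def)
    have "G x = - eps\<^sup>2 * Re (cnj (bt t x) * (of_real (weight' d x) * bx t x + of_real (weight d x) * bxx t x))
      + lam * (weight d x * (2 * Re (cnj (b t x) * bt t x) * L t x + - (rx t x * w t x + r t x * wx t x) * (1 - (cmod (b t x))\<^sup>2 / r t x)))"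
      by (simp add: G_def ht_def)
    from trans[OF this energy_identity[OF eps(1) r_pos[OF t] bt, where k' = "weight' d x" and k = "weight d x" and rx = "rx t x" and wxx = "wxx t x"]]
    have G: "G x = (- lam * (weight' d x * (w t x * h t x) + weight d x * (wx t x * h t x + w t x * hx x))
       + eps\<^sup>2 / 2 * (weight' d x * (w t x * (cmod (bx t x))\<^sup>2 + wx t x * Re (cnj (bx t x) * b t x))
          + weight d x * (wx t x * (cmod (bx t x))\<^sup>2 + w t x * (2 * Re (cnj (bx t x) * bxx t x)) + wxx t x * Re (cnj (bx t x) * b t x)
             + wx t x * (Re (cnj (bxx t x) * b t x) + Re (cnj (bx t x) * bx t x))))) + Rm x"
      by (simp only: hx_def Rm_def hh)
    \<comment> \<open>In \<open>energy_identity\<close> the flux is sorted by \<open>lam\<close> and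
      \<open>eps^2\<close>, in \<open>F'\<close> by \<open>weight'\<close> and
      \<open>weight\<close>.\<close>
    have "- c * (k' * A + k * B) + e * (k' * A' + k * B') = k' * (- c * A + e * A') + k * (- c * B + e * B')" for c e k k' A B A' B' :: real
      by (simp add: algebra_simps)
    then show ?thesis unfolding G F'_def X_def Y_def by (simp only:)
  qed
  have Gc: "continuous_on UNIV G" unfolding G_def[abs_def] by (intro continuous_intros cont bxx_c t)
  have Gi: "integrable lborel G"
  proof (rule integrable_weight_bound[OF d(1) Gc])
    have "G x = weight' d x * (- eps\<^sup>2 * Re (cnj (bt t x) * bx t x)) + weight d x * (- eps\<^sup>2 * Re (cnj (bt t x) * bxx t x) + lam * ht t x)" for x
      unfolding G_def by (simp add: algebra_simps)
    moreover have "bdd (\<lambda>x. - eps\<^sup>2 * Re (cnj (bt t x) * bx t x))" "bdd (\<lambda>x. - eps\<^sup>2 * Re (cnj (bt t x) * bxx t x) + lam * ht t x)"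
      by (intro bdd_intros bdd_all t)+
    ultimately show "\<exists>C. \<forall>x. \<bar>G x\<bar> \<le> C * weight d x"
      using bdd_weight_bound[OF d(1)] by presburger
  qed
  have Ri: "integrable lborel Rm"
    using Bochner_Integration.integrable_diff[OF Gi F'0(1)] by (simp add: id)
  have wi: "integrable lborel (\<lambda>x. weight d x * (wxx t x)\<^sup>2)"
    by (intro integrable_weight_mult[OF d(1)] continuous_intros wxx_c t bdd_square bdd_all)
  have di: "integrable lborel (\<lambda>x. weight d x * dens t x)"
    by (intro integrable_weight_mult[OF d(1)] cont bdd_all t)
  define c1 where "c1 = 3 * K + 2 + K\<^sup>2 / lam"
  define c2 where "c2 = eps\<^sup>2 / 2 * (d * ((K / 2 + 1) * N))\<^sup>2"
  show thesis
  proof (rule that[of "LINT x|lborel. G x"])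
    have i1: "integrable lborel (\<lambda>x. - 2 * Re (cnj (bt t x) * (of_real (weight' d x) * bx t x + of_real (weight d x) * bxx t x)))"
    proof (rule integrable_weight_bound[OF d(1)])
      show "continuous_on UNIV (\<lambda>x. - 2 * Re (cnj (bt t x) * (of_real (weight' d x) * bx t x + of_real (weight d x) * bxx t x)))"
        by (intro continuous_intros cont bxx_c t)
      have "- 2 * Re (cnj (bt t x) * (of_real (weight' d x) * bx t x + of_real (weight d x) * bxx t x))
         = weight' d x * (- 2 * Re (cnj (bt t x) * bx t x)) + weight d x * (- 2 * Re (cnj (bt t x) * bxx t x))" for x
        by (simp add: algebra_simps)
      moreover have "bdd (\<lambda>x. - 2 * Re (cnj (bt t x) * bx t x))" "bdd (\<lambda>x. - 2 * Re (cnj (bt t x) * bxx t x))"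
        by (intro bdd_intros bdd_all t)+
      ultimately show "\<exists>C. \<forall>x. \<bar>- 2 * Re (cnj (bt t x) * (of_real (weight' d x) * bx t x + of_real (weight d x) * bxx t x))\<bar> \<le> C * weight d x"
        using bdd_weight_bound[OF d(1)] by presburger
    qed
    have i2: "integrable lborel (\<lambda>x. weight d x * ht t x)" by (intro integrable_weight_mult[OF d(1)] cont bdd_all t)
    have "((\<lambda>t. eps\<^sup>2 / 2 * (LINT x|lborel. weight d x * (cmod (bx t x))\<^sup>2) + lam * (LINT x|lborel. weight d x * h t x)) has_real_derivative
       eps\<^sup>2 / 2 * (LINT x|lborel. - 2 * Re (cnj (bt t x) * (of_real (weight' d x) * bx t x + of_real (weight d x) * bxx t x)))
       + lam * (LINT x|lborel. weight d x * ht t x)) (at t within {0..T})"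
      by (intro DERIV_add DERIV_cmult parabolic_energy_has_derivative entropy_has_derivative d t)
    also have "eps\<^sup>2 / 2 * (LINT x|lborel. - 2 * Re (cnj (bt t x) * (of_real (weight' d x) * bx t x + of_real (weight d x) * bxx t x)))
       + lam * (LINT x|lborel. weight d x * ht t x) = (LINT x|lborel. eps\<^sup>2 / 2 * (- 2 * Re (cnj (bt t x) * (of_real (weight' d x) * bx t x + of_real (weight d x) * bxx t x)))
       + lam * (weight d x * ht t x))"
      unfolding integral_mult_right_zero[symmetric]
      by (intro Bochner_Integration.integral_add[symmetric] integrable_mult_right i1 i2)
    also have "\<dots> = (LINT x|lborel. G x)"
    proof (rule Bochner_Integration.integral_cong)
      have "eps\<^sup>2 / 2 * (- 2 * Z) + Z' = - eps\<^sup>2 * Z + Z'" for Z Z' :: real by simp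
      then show "eps\<^sup>2 / 2 * (- 2 * Re (cnj (bt t x) * (of_real (weight' d x) * bx t x + of_real (weight d x) * bxx t x)))
       + lam * (weight d x * ht t x) = G x" for x
        by (simp only: G_def)
    qed simp
    finally show "(energy d has_real_derivative (LINT x|lborel. G x)) (at t within {0..T})"
      by (rule has_field_derivative_transform_within[OF _ zero_less_one t]) (use energy_split[OF d(1)] in auto)
    have "(LINT x|lborel. G x) = (LINT x|lborel. Rm x)"
      using F'0 Ri by (simp add: id)
    also have "\<dots> \<le> (LINT x|lborel. c1 * (weight d x * dens t x) + eps\<^sup>2 / 2 * K * (weight d x * (wxx t x)\<^sup>2) + c2 * weight d x)"
    proof (rule integral_mono[OF Ri])
      show "integrable lborel (\<lambda>x. c1 * (weight d x * dens t x) + eps\<^sup>2 / 2 * K * (weight d x * (wxx t x)\<^sup>2) + c2 * weight d x)"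
        by (intro Bochner_Integration.integrable_add integrable_mult_right di wi integrable_weight d)
      fix x
      show "Rm x \<le> c1 * (weight d x * dens t x) + eps\<^sup>2 / 2 * K * (weight d x * (wxx t x)\<^sup>2) + c2 * weight d x"
        unfolding Rm_def c1_def c2_def dens_def
      proof (rule remainder_le[OF eps lam K d weight_pos weight'_le[OF d(1)]])
        show "(cmod (b t x))\<^sup>2 \<le> 2 * r t x + 2 * h t x"
          unfolding h_def by (rule le_rel_entropy[OF rho_pos[OF t] r_pos[OF t]])
      qed (use w_bound[OF t] r_bound[OF t] h_nonneg[OF t] N[OF t] in auto)
    qed
    also have "\<dots> = c1 * energy d t + eps\<^sup>2 / 2 * K * (LINT x|lborel. weight d x * (wxx t x)\<^sup>2) + c2 * (pi / d)"
      using di wi integrable_weight[OF d(1)] has_bochner_integral_integral_eq[OF has_bochner_integral_weight[OF d(1)]]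
      by (simp add: energy_def)
    also have "\<dots> \<le> c1 * energy d t + eps\<^sup>2 / 2 * K * K + c2 * (pi / d)"
    proof -
      have "(LINT x|lborel. weight d x * (wxx t x)\<^sup>2) \<le> (LINT x|lborel. (wxx t x)\<^sup>2)"
        using wi wxx_integrable(1)[OF t] weight_le_1[of d] by (intro integral_mono) (auto simp: mult_left_le_one_le weight_pos less_imp_le)
      also have "\<dots> \<le> K" by (rule wxx_integrable(2)[OF t])
      finally show ?thesis using K by (intro add_right_mono add_left_mono mult_left_mono) auto
    qed
    also have "c2 * (pi / d) = eps\<^sup>2 / 2 * (pi * d * ((K / 2 + 1) * N)\<^sup>2)"
      using d by (simp add: c2_def power_mult_distrib power2_eq_square)
    finally show "(LINT x|lborel. G x) \<le> (3 * K + 2 + K\<^sup>2 / lam) * energy d t + eps\<^sup>2 / 2 * (K\<^sup>2 + pi * d * ((K / 2 + 1) * N)\<^sup>2)"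
    proof -
      assume le: "(LINT x|lborel. G x) \<le> c1 * energy d t + eps\<^sup>2 / 2 * K * K + eps\<^sup>2 / 2 * (pi * d * ((K / 2 + 1) * N)\<^sup>2)"
      have "eps\<^sup>2 / 2 * K * K + eps\<^sup>2 / 2 * Z = eps\<^sup>2 / 2 * (K\<^sup>2 + Z)" for Z
        by (simp add: algebra_simps power2_eq_square)
      with le show ?thesis by (simp only: c1_def add.assoc)
    qed
  qed
qed

text \<open>Since \<open>|b|^2 = r\<close> initially, the entropy vanishes there, and the gradient
  carries the factor \<open>eps^2 / 2\<close>. This is the origin of the order
  \<open>eps^2\<close>.\<close>

lemma energy_initial:
  assumes d: "d > 0"
  shows "energy d 0 \<le> eps\<^sup>2 / 2 * K"
proof -
  have t: "0 \<in> {0..T}" using T by simp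
  have h0: "h 0 x = 0" for x using r_pos[OF t, of x] by (simp add: h_def init rel_entropy_def)
  have [measurable]: "bx 0 \<in> borel_measurable borel" by (intro borel_measurable_continuous_onI cont t)
  have i: "integrable lborel (\<lambda>x. (cmod (bx 0 x))\<^sup>2)"
    by (intro integrableI_bounded) (auto intro: le_less_trans[OF init_L2])
  have "ennreal (LINT x|lborel. (cmod (bx 0 x))\<^sup>2) \<le> ennreal K"
    using init_L2 by (subst nn_integral_eq_integral[symmetric]) (use i in auto)
  then have l: "(LINT x|lborel. (cmod (bx 0 x))\<^sup>2) \<le> K" using K by (subst (asm) ennreal_le_iff) auto
  have i1: "integrable lborel (\<lambda>x. weight d x * (cmod (bx 0 x))\<^sup>2)"
    by (intro integrable_weight_mult[OF d] continuous_intros cont bdd_intros bdd_all t)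
  have "(LINT x|lborel. weight d x * (cmod (bx 0 x))\<^sup>2) \<le> (LINT x|lborel. (cmod (bx 0 x))\<^sup>2)"
    using i i1 weight_le_1[of d] by (intro integral_mono) (auto simp: mult_left_le_one_le weight_pos less_imp_le)
  with l have "(LINT x|lborel. weight d x * (cmod (bx 0 x))\<^sup>2) \<le> K" by linarith
  then have "eps\<^sup>2 / 2 * (LINT x|lborel. weight d x * (cmod (bx 0 x))\<^sup>2) \<le> eps\<^sup>2 / 2 * K"
    by (intro mult_left_mono) auto
  then show ?thesis using energy_split[OF d t] by (simp add: h0)
qed

text \<open>Gronwall for the weighted energy at fixed \<open>eps\<close>, with a bound that does not
  see \<open>d\<close> once \<open>d\<close> is small, followed by monotone convergence as the
  weights increase to 1. The constant \<open>N\<close> disappears in the process and only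
  \<open>K\<close>, \<open>lam\<close> and \<open>T\<close> remain.\<close>

theorem energy_estimate:
  assumes t: "t \<in> {0..T}"
  shows "(\<integral>\<^sup>+x. ennreal (dens t x) \<partial>lborel) \<le> ennreal (exp ((3 * K + 2 + K\<^sup>2 / lam) * T) * (K\<^sup>2 + K + 1) * eps\<^sup>2)"
proof -
  define A where "A = 3 * K + 2 + K\<^sup>2 / lam"
  have A1: "A \<ge> 1" using K lam by (simp add: A_def add_nonneg_nonneg add_increasing2)
  obtain N where N: "N \<ge> 1" "\<And>t x. t \<in> {0..T} \<Longrightarrow> cmod (b t x) \<le> N \<and> cmod (bt t x) \<le> N"
    using bounds by metis
  define P where "P = ((K / 2 + 1) * N)\<^sup>2"
  have P0: "P \<ge> 0" by (simp add: P_def)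
  \<comment> \<open>Chosen so that \<open>pi * d * P <= 1\<close> for \<open>d <= d0\<close>. It
    depends on \<open>eps\<close> through \<open>N\<close>, which is harmless as \<open>d\<close>
    tends to 0 in the end.\<close>
  define d0 where "d0 = 1 / (1 + pi * P)"
  have d0: "d0 > 0" "d0 \<le> 1" "pi * d0 * P \<le> 1" using P0 by (auto simp: d0_def add_pos_nonneg divide_le_eq)
  \<comment> \<open>The source in the energy inequality is now at most \<open>B * eps^2\<close>. As
    \<open>A >= 1\<close>, adding \<open>B * eps^2\<close> to the energy turns the inequality into a
    homogeneous one, and \<open>\<phi>\<close> below is nonincreasing.\<close>
  define B where "B = (K\<^sup>2 + 1) / 2"
  have e: "energy d t \<le> exp (A * T) * (K\<^sup>2 + K + 1) * eps\<^sup>2" if d: "0 < d" "d \<le> d0" for d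
  proof -
    have d1: "d \<le> 1" using d d0 by simp
    have dP: "pi * d * P \<le> 1"
    proof -
      have "pi * d * P \<le> pi * d0 * P" using d P0 by (intro mult_right_mono) auto
      then show ?thesis using d0(3) by (rule order_trans)
    qed
    define \<phi> where "\<phi> \<tau> = exp (- (A * \<tau>)) * (energy d \<tau> + B * eps\<^sup>2)" for \<tau>
    have "\<phi> t \<le> \<phi> 0"
    proof (cases "t = 0")
      case False
      then have t0: "0 < t" using t by simp
      have "\<exists>D. (\<phi> has_real_derivative D) (at \<tau> within {0..t}) \<and> D \<le> 0" if \<tau>: "\<tau> \<in> {0..t}" for \<tau>
      proof -
        have \<tau>': "\<tau> \<in> {0..T}" using \<tau> t by auto
        obtain E' where E': "(energy d has_real_derivative E') (at \<tau> within {0..T})"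
          "E' \<le> A * energy d \<tau> + eps\<^sup>2 / 2 * (K\<^sup>2 + pi * d * P)"
          using energy_derivative[OF N(2) d(1) d1 \<tau>'] unfolding A_def P_def by metis
        have Ed: "(energy d has_real_derivative E') (at \<tau> within {0..t})"
          using E'(1) by (rule DERIV_subset) (use t in auto)
        have D: "(\<phi> has_real_derivative exp (- (A * \<tau>)) * (E' - A * (energy d \<tau> + B * eps\<^sup>2))) (at \<tau> within {0..t})"
          unfolding \<phi>_def[abs_def] by (auto intro!: derivative_eq_intros Ed simp: algebra_simps)
        have "eps\<^sup>2 / 2 * (K\<^sup>2 + pi * d * P) \<le> eps\<^sup>2 / 2 * (K\<^sup>2 + 1)" using dP by (intro mult_left_mono) auto
        also have "\<dots> = 1 * (B * eps\<^sup>2)" by (simp add: B_def)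
        also have "\<dots> \<le> A * (B * eps\<^sup>2)" using A1 by (intro mult_right_mono) (auto simp: B_def)
        finally have "E' - A * (energy d \<tau> + B * eps\<^sup>2) \<le> 0" using E'(2) by (simp add: algebra_simps)
        then have "exp (- (A * \<tau>)) * (E' - A * (energy d \<tau> + B * eps\<^sup>2)) \<le> 0"
          by (simp add: mult_nonneg_nonpos)
        with D show ?thesis by blast
      qed
      then obtain D where D: "\<And>\<tau>. \<tau> \<in> {0..t} \<Longrightarrow> (\<phi> has_real_derivative D \<tau>) (at \<tau> within {0..t}) \<and> D \<tau> \<le> 0"
        by metis
      obtain z where z: "z \<in> {0<..<t}" "\<phi> t - \<phi> 0 = D z * (t - 0)"
        using mvt_simple[OF t0, of \<phi> "\<lambda>\<tau> h. D \<tau> * h"] D by (auto simp: has_field_derivative_def)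
      have "D z * (t - 0) \<le> 0" using D[of z] z t0 by (intro mult_nonpos_nonneg) auto
      then show ?thesis using z by simp
    qed simp
    also have "\<phi> 0 \<le> eps\<^sup>2 / 2 * K + B * eps\<^sup>2" using energy_initial[OF d(1)] by (simp add: \<phi>_def)
    also have "\<dots> \<le> (K\<^sup>2 + K + 1) * eps\<^sup>2"
    proof -
      have "eps\<^sup>2 / 2 * K + B * eps\<^sup>2 = (K / 2 + B) * eps\<^sup>2" by (simp add: algebra_simps)
      also have "\<dots> \<le> (K\<^sup>2 + K + 1) * eps\<^sup>2"
      proof (rule mult_right_mono)
        have "K / 2 + (Z + 1) / 2 \<le> Z + K + 1" if "Z \<ge> 0" for Z using K that by argo
        then show "K / 2 + B \<le> K\<^sup>2 + K + 1" unfolding B_def by simp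
      qed simp
      finally show ?thesis .
    qed
    finally have "exp (- (A * t)) * (energy d t + B * eps\<^sup>2) \<le> (K\<^sup>2 + K + 1) * eps\<^sup>2" by (simp add: \<phi>_def)
    then have "exp (A * t) * (exp (- (A * t)) * (energy d t + B * eps\<^sup>2)) \<le> exp (A * t) * ((K\<^sup>2 + K + 1) * eps\<^sup>2)"
      by (intro mult_left_mono) auto
    then have "energy d t + B * eps\<^sup>2 \<le> exp (A * t) * ((K\<^sup>2 + K + 1) * eps\<^sup>2)"
      by (simp add: mult.assoc[symmetric] exp_minus_inverse)
    also have "\<dots> \<le> exp (A * T) * ((K\<^sup>2 + K + 1) * eps\<^sup>2)"
      using t A1 K by (intro mult_right_mono) auto
    finally have "energy d t + B * eps\<^sup>2 \<le> exp (A * T) * ((K\<^sup>2 + K + 1) * eps\<^sup>2)" .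
    moreover have "0 \<le> B * eps\<^sup>2" by (simp add: B_def)
    ultimately show ?thesis by (simp add: mult.assoc)
  qed
  define Q where "Q = exp (A * T) * (K\<^sup>2 + K + 1) * eps\<^sup>2"
  define dn where "dn n = d0 * (1 / real (Suc n))" for n
  have dn: "0 < dn n" "dn n \<le> d0" for n
    using d0(1) mult_left_mono[of "1 / real (Suc n)" 1 d0] by (auto simp: dn_def)
  have "(\<lambda>n. \<integral>\<^sup>+x. ennreal (weight (dn n) x * dens t x) \<partial>lborel) \<longlonglongrightarrow> (\<integral>\<^sup>+x. ennreal (dens t x) \<partial>lborel)"
  proof (rule nn_integral_LIMSEQ)
    show "incseq (\<lambda>n x. ennreal (weight (dn n) x * dens t x))"
    proof (intro incseq_SucI le_funI ennreal_leI mult_right_mono dens_nonneg t)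
      fix n x
      have "dn (Suc n) \<le> dn n" unfolding dn_def using d0(1) by (intro mult_left_mono divide_left_mono) auto
      then have "\<bar>dn (Suc n) * x\<bar> \<le> \<bar>dn n * x\<bar>" using dn(1)[of n] dn(1)[of "Suc n"] by (simp add: abs_mult mult_right_mono)
      then have "(dn (Suc n) * x)\<^sup>2 \<le> (dn n * x)\<^sup>2" by (simp add: abs_le_square_iff)
      then show "weight (dn n) x \<le> weight (dn (Suc n)) x"
        unfolding weight_def by (intro divide_left_mono) (auto simp: add_pos_nonneg mult_pos_pos)
    qed
    show "(\<lambda>n. ennreal (weight (dn n) x * dens t x)) \<longlonglongrightarrow> ennreal (dens t x)" for x
    proof (rule tendsto_ennrealI)
      have "dn \<longlonglongrightarrow> d0 * 0"
        unfolding dn_def[abs_def] by (intro tendsto_intros LIMSEQ_Suc[OF lim_1_over_n])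
      then have "(\<lambda>n. 1 / (1 + (dn n * x)\<^sup>2) * dens t x) \<longlonglongrightarrow> 1 / (1 + (0 * x)\<^sup>2) * dens t x"
        by (intro tendsto_intros) auto
      then show "(\<lambda>n. weight (dn n) x * dens t x) \<longlonglongrightarrow> dens t x" by (simp add: weight_def)
    qed
    show "(\<lambda>x. ennreal (weight (dn n) x * dens t x)) \<in> borel_measurable lborel" for n
      by (intro measurable_compose[OF _ measurable_ennreal] lborel_measurable_continuous continuous_intros cont t)
  qed
  moreover have "(\<integral>\<^sup>+x. ennreal (weight (dn n) x * dens t x) \<partial>lborel) \<le> ennreal Q" for n
  proof -
    have "integrable lborel (\<lambda>x. weight (dn n) x * dens t x)"
      by (intro integrable_weight_mult[OF dn(1)] cont bdd_all t)
    then have "(\<integral>\<^sup>+x. ennreal (weight (dn n) x * dens t x) \<partial>lborel) = ennreal (energy (dn n) t)"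
      unfolding energy_def using dens_nonneg[OF t] weight_pos by (intro nn_integral_eq_integral AE_I2 mult_nonneg_nonneg) (auto intro: less_imp_le)
    also have "\<dots> \<le> ennreal Q" using e[OF dn] by (intro ennreal_leI) (simp add: Q_def)
    finally show ?thesis .
  qed
  ultimately have "(\<integral>\<^sup>+x. ennreal (dens t x) \<partial>lborel) \<le> ennreal Q"
    by (intro LIMSEQ_le_const2) auto
  then show ?thesis by (simp add: Q_def A_def)
qed

section \<open>Consequences of the energy estimate, uniform in \<open>eps\<close>\<close>

definition econst :: real where
  "econst = exp ((3 * K + 2 + K\<^sup>2 / lam) * T) * (K\<^sup>2 + K + 1)"

lemma econst_pos: "econst > 0"
  unfolding econst_def using K by (intro mult_pos_pos) (auto simp: add_pos_pos add_nonneg_pos)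

lemma bx_L2:
  assumes t: "t \<in> {0..T}"
  shows "(\<integral>\<^sup>+x. ennreal ((cmod (bx t x))\<^sup>2) \<partial>lborel) \<le> ennreal (2 * econst)"
proof -
  have [measurable]: "bx t \<in> borel_measurable borel" by (intro borel_measurable_continuous_onI cont t)
  have "ennreal (eps\<^sup>2 / 2) * (\<integral>\<^sup>+x. ennreal ((cmod (bx t x))\<^sup>2) \<partial>lborel)
     = (\<integral>\<^sup>+x. ennreal (eps\<^sup>2 / 2 * (cmod (bx t x))\<^sup>2) \<partial>lborel)"
  proof -
    have "ennreal (eps\<^sup>2 / 2 * z\<^sup>2) = ennreal (eps\<^sup>2 / 2) * ennreal (z\<^sup>2)" for z by (rule ennreal_mult) auto
    then show ?thesis by (simp only:) (subst nn_integral_cmult, auto)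
  qed
  also have "\<dots> \<le> (\<integral>\<^sup>+x. ennreal (dens t x) \<partial>lborel)"
  proof (intro nn_integral_mono ennreal_leI)
    show "eps\<^sup>2 / 2 * (cmod (bx t x))\<^sup>2 \<le> dens t x" for x
      unfolding dens_def using h_nonneg[OF t, of x] lam by simp
  qed
  also have "\<dots> \<le> ennreal (econst * eps\<^sup>2)"
    using energy_estimate[OF t] by (simp add: econst_def)
  also have "\<dots> = ennreal (eps\<^sup>2 / 2) * ennreal (2 * econst)"
    using econst_pos by (subst ennreal_mult[symmetric]) (auto simp: mult.commute)
  finally show ?thesis
    using eps by (subst (asm) ennreal_mult_le_mult_iff) auto
qed

lemma modulus_L2:
  assumes t: "t \<in> {0..T}"
  shows "(\<integral>\<^sup>+x. ennreal ((cmod (b t x) - sqrt (r t x))\<^sup>2) \<partial>lborel) \<le> ennreal (econst / lam * eps\<^sup>2)"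
proof -
  have [measurable]: "b t \<in> borel_measurable borel" "r t \<in> borel_measurable borel"
    by (intro borel_measurable_continuous_onI cont t)+
  have le: "(cmod (b t x) - sqrt (r t x))\<^sup>2 \<le> h t x" for x
    using rel_entropy_ge[OF rho_pos[OF t] r_pos[OF t], of x x] by (simp add: h_def)
  have "ennreal lam * (\<integral>\<^sup>+x. ennreal ((cmod (b t x) - sqrt (r t x))\<^sup>2) \<partial>lborel)
     = (\<integral>\<^sup>+x. ennreal (lam * (cmod (b t x) - sqrt (r t x))\<^sup>2) \<partial>lborel)"
  proof -
    have "ennreal (lam * z\<^sup>2) = ennreal lam * ennreal (z\<^sup>2)" for z using lam by (intro ennreal_mult) auto
    then show ?thesis by (simp only:) (subst nn_integral_cmult, auto)
  qed
  also have "\<dots> \<le> (\<integral>\<^sup>+x. ennreal (dens t x) \<partial>lborel)"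
  proof (intro nn_integral_mono ennreal_leI)
    fix x
    have "lam * (cmod (b t x) - sqrt (r t x))\<^sup>2 \<le> lam * h t x" using le lam by (intro mult_left_mono) auto
    also have "\<dots> \<le> dens t x" unfolding dens_def by simp
    finally show "lam * (cmod (b t x) - sqrt (r t x))\<^sup>2 \<le> dens t x" .
  qed
  also have "\<dots> \<le> ennreal (econst * eps\<^sup>2)"
    using energy_estimate[OF t] by (simp add: econst_def)
  also have "\<dots> = ennreal lam * ennreal (econst / lam * eps\<^sup>2)"
    using econst_pos lam by (subst ennreal_mult[symmetric]) auto
  finally show ?thesis
    using lam by (subst (asm) ennreal_mult_le_mult_iff) auto
qed

text \<open>An L2 bound on the derivative gives the Hoelder exponent 1/2. Cauchy-Schwarz is replaced
  by \<open>|bx| <= s / 2 * |bx|^2 + 1 / (2 * s)\<close>, integrated between the two points.\<close>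

lemma b_hoelder:
  assumes t: "t \<in> {0..T}"
  shows "norm (b t x - b t y) \<le> (econst + 1) * sqrt \<bar>x - y\<bar>"
proof -
  have *: "norm (b t z - b t y) \<le> (econst + 1) * sqrt (z - y)" if yz: "y < z" for y z
  proof -
    \<comment> \<open>With this \<open>s\<close> both terms have the order
      \<open>sqrt (z - y)\<close>.\<close>
    define s where "s = sqrt (z - y)"
    have s: "s > 0" "s\<^sup>2 = z - y" using yz by (auto simp: s_def)
    have c: "continuous_on {y..z} (bx t)" by (rule continuous_on_subset[OF cont(2)[OF t]]) simp
    have [measurable]: "bx t \<in> borel_measurable borel" by (intro borel_measurable_continuous_onI cont t)
    have i2: "integrable lborel (\<lambda>x. (cmod (bx t x))\<^sup>2)"
      by (intro integrableI_bounded) (auto intro: le_less_trans[OF bx_L2[OF t]])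
    have "ennreal (LINT x|lborel. (cmod (bx t x))\<^sup>2) \<le> ennreal (2 * econst)"
      using bx_L2[OF t] by (subst nn_integral_eq_integral[symmetric]) (use i2 in auto)
    then have l2: "(LINT x|lborel. (cmod (bx t x))\<^sup>2) \<le> 2 * econst"
      using econst_pos by (subst (asm) ennreal_le_iff) auto
    have hb: "has_bochner_integral lborel (\<lambda>x. indicator {y..z} x *\<^sub>R bx t x) (b t z - b t y)"
      using yz c b_x[OF t] by (intro has_bochner_integral_FTC_Icc) (auto intro: has_vector_derivative_at_within)
    have ib: "integrable lborel (\<lambda>x. s / 2 * (cmod (bx t x))\<^sup>2 + 1 / (2 * s) * indicator {y..z} x)"
      using i2 by (intro Bochner_Integration.integrable_add integrable_mult_right) (auto simp: emeasure_lborel_Icc_eq)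
    have "norm (b t z - b t y) = norm (LINT x|lborel. indicator {y..z} x *\<^sub>R bx t x)"
      using has_bochner_integral_integral_eq[OF hb] by simp
    also have "\<dots> \<le> (LINT x|lborel. norm (indicator {y..z} x *\<^sub>R bx t x))" by (rule integral_norm_bound)
    also have "\<dots> \<le> (LINT x|lborel. s / 2 * (cmod (bx t x))\<^sup>2 + 1 / (2 * s) * indicator {y..z} x)"
    proof (rule integral_mono[OF integrable_norm[OF integrable.intros[OF hb]] ib])
      fix x
      have "2 * (s * cmod (bx t x)) * 1 \<le> (s * cmod (bx t x))\<^sup>2 + 1\<^sup>2" by (rule sum_squares_bound)
      then have "2 * (s * cmod (bx t x)) * 1 / (2 * s) \<le> ((s * cmod (bx t x))\<^sup>2 + 1\<^sup>2) / (2 * s)"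
        using s by (intro divide_right_mono) auto
      also have "2 * (s * cmod (bx t x)) * 1 / (2 * s) = cmod (bx t x)" using s by simp
      also have "((s * cmod (bx t x))\<^sup>2 + 1\<^sup>2) / (2 * s) = s / 2 * (cmod (bx t x))\<^sup>2 + 1 / (2 * s)"
        using s(1) by (simp add: power2_eq_square add_divide_distrib)
      finally have "cmod (bx t x) \<le> s / 2 * (cmod (bx t x))\<^sup>2 + 1 / (2 * s)" .
      then show "norm (indicator {y..z} x *\<^sub>R bx t x) \<le> s / 2 * (cmod (bx t x))\<^sup>2 + 1 / (2 * s) * indicator {y..z} x"
        using s by (auto simp: indicator_def)
    qed
    also have "\<dots> = s / 2 * (LINT x|lborel. (cmod (bx t x))\<^sup>2) + 1 / (2 * s) * (z - y)"
      using i2 yz by (subst Bochner_Integration.integral_add) (auto simp: emeasure_lborel_Icc_eq)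
    also have "1 / (2 * s) * (z - y) = s / 2" unfolding s(2)[symmetric] using s(1) by (simp add: power2_eq_square)
    also have "s / 2 * (LINT x|lborel. (cmod (bx t x))\<^sup>2) \<le> s / 2 * (2 * econst)"
      using l2 s by (intro mult_left_mono) auto
    also have "s / 2 * (2 * econst) + s / 2 \<le> (econst + 1) * s" using s by (simp add: algebra_simps)
    finally show ?thesis by (simp add: s_def)
  qed
  consider "x < y" | "x = y" | "y < x" by linarith
  then show ?thesis
  proof cases
    case 1
    then show ?thesis using *[OF 1] by (simp add: norm_minus_commute abs_if)
  next
    case 3
    then show ?thesis using *[OF 3] by simp
  qed simp
qed

text \<open>A square integral of order \<open>eps^2\<close> over an interval of length
  \<open>eps\<close> forces a value of order \<open>eps\<close> somewhere in it. The length
  \<open>eps\<close> is affordable: by \<open>b_hoelder\<close>, moving by \<open>eps\<close>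
  changes \<open>b\<close> by \<open>O(sqrt eps)\<close>. The summand 1 makes the contradiction
  strict.\<close>

lemma b_close:
  assumes t: "t \<in> {0..T}"
  shows "\<exists>y\<in>{x..x + eps}. (cmod (b t y) - sqrt (r t y))\<^sup>2 \<le> (econst / lam + 1) * eps"
proof (rule ccontr)
  assume "\<not> ?thesis"
  then have gt: "(econst / lam + 1) * eps < (cmod (b t y) - sqrt (r t y))\<^sup>2" if "y \<in> {x..x + eps}" for y
    using that by (simp add: not_le)
  have "ennreal ((econst / lam + 1) * eps) * ennreal eps = (\<integral>\<^sup>+y. ennreal ((econst / lam + 1) * eps) * indicator {x..x + eps} y \<partial>lborel)"
    using eps by (subst nn_integral_cmult_indicator) auto
  also have "\<dots> \<le> (\<integral>\<^sup>+y. ennreal ((cmod (b t y) - sqrt (r t y))\<^sup>2) \<partial>lborel)"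
    using gt by (intro nn_integral_mono) (auto simp: indicator_def intro!: ennreal_leI less_imp_le)
  also have "\<dots> \<le> ennreal (econst / lam * eps\<^sup>2)" by (rule modulus_L2[OF t])
  finally have "ennreal ((econst / lam + 1) * eps * eps) \<le> ennreal (econst / lam * eps\<^sup>2)"
    using eps lam econst_pos by (subst ennreal_mult) auto
  then have "(econst / lam + 1) * eps * eps \<le> econst / lam * eps\<^sup>2"
    using econst_pos lam by (subst (asm) ennreal_le_iff) auto
  then have "eps * eps \<le> 0" by (simp add: algebra_simps power2_eq_square)
  then show False using eps by (simp add: mult_le_0_iff)
qed

end

subsection \<open>Lower bound for the limiting density\<close>

text \<open>Maximum principle: a compensated \<open>r\<close>, with a slowly growing function of \<open>x\<close> added so that minima
  exist, cannot have its minimum at a positive time.\<close>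

lemma transport_lower_bound:
  fixes r rx w wx :: "real \<Rightarrow> real \<Rightarrow> real"
  assumes rc: "continuous_on ({0..T} \<times> UNIV) (\<lambda>(t, x). r t x)"
    and r_x: "\<And>t x. t \<in> {0..T} \<Longrightarrow> (r t has_real_derivative rx t x) (at x)"
    and r_t: "\<And>t x. t \<in> {0..T} \<Longrightarrow> ((\<lambda>\<tau>. r \<tau> x) has_real_derivative - (rx t x * w t x + r t x * wx t x)) (at t within {0..T})"
    and pos: "\<And>t x. t \<in> {0..T} \<Longrightarrow> r t x \<ge> 0"
    and wb: "\<And>t x. t \<in> {0..T} \<Longrightarrow> \<bar>w t x\<bar> \<le> K \<and> \<bar>wx t x\<bar> \<le> K"
    and init: "\<And>x. r 0 x \<ge> m" and t: "t \<in> {0..T}"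
  shows "exp (- (K * t)) * m \<le> r t x"
proof -
  have K0: "K \<ge> 0" using wb[OF t, of x] by linarith
  \<comment> \<open>A smooth substitute for \<open>|x|\<close>: it is unbounded and has slope at
    most 1 in absolute value.\<close>
  define p where "p x = sqrt (1 + x\<^sup>2)" for x :: real
  have p1: "p x \<ge> 1" "p x \<ge> \<bar>x\<bar>" for x by (auto simp: p_def intro: real_le_rsqrt)
  have p_x: "(p has_real_derivative x / p x) (at x)" for x
  proof -
    have "1 + x\<^sup>2 > 0" by (simp add: add_pos_nonneg)
    then show ?thesis unfolding p_def[abs_def] by (auto intro!: derivative_eq_intros simp: field_simps)
  qed
  have main: "m \<le> exp (K * t) * r t x + \<delta> * (p x + (K + 1) * t)" if \<delta>: "\<delta> > 0" for \<delta>
  proof (rule ccontr)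
    \<comment> \<open>The factor \<open>exp (K * t)\<close> makes the zero order coefficient
      \<open>K - wx\<close> nonnegative. The transport of \<open>p\<close> by \<open>w\<close> costs
      at most \<open>K\<close>, so the slope \<open>K + 1\<close> in time makes the time derivative
      strictly positive at a critical point in \<open>x\<close>.\<close>
    define P where "P t x = exp (K * t) * r t x + \<delta> * (p x + (K + 1) * t)" for t x
    assume "\<not> ?thesis"
    then have Pm: "P t x < m" by (simp add: P_def)
    \<comment> \<open>For \<open>|y| >= R\<close> the term \<open>\<delta> * p y\<close> alone
      exceeds \<open>m\<close>, so a minimum below \<open>m\<close> over the rectangle lies in the
      interior with respect to \<open>x\<close>.\<close>
    define R where "R = \<bar>x\<bar> + m / \<delta> + 1"
    have m0: "m > 0"
    proof -
      have "0 \<le> P t x" unfolding P_def using pos[OF t, of x] \<delta> p1(1)[of x] K0 t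
        by (intro add_nonneg_nonneg mult_nonneg_nonneg) auto
      then show ?thesis using Pm by simp
    qed
    have R: "\<bar>x\<bar> < R" using m0 \<delta> by (simp add: R_def add_pos_pos)
    have Pc: "continuous_on ({0..T} \<times> {-R..R}) (\<lambda>(t, x). P t x)"
    proof -
      have c1: "continuous_on ({0..T} \<times> {-R..R}) (\<lambda>q. r (fst q) (snd q))"
        using rc unfolding split_beta' by (rule continuous_on_subset) auto
      show ?thesis unfolding P_def p_def split_beta' by (intro continuous_intros c1)
    qed
    have "compact ({0..T} \<times> {-R..R})" by (intro compact_Times) auto
    moreover have "{0..T} \<times> {-R..R} \<noteq> {}" using t R by auto
    ultimately obtain q where q: "q \<in> {0..T} \<times> {-R..R}" "\<And>z. z \<in> {0..T} \<times> {-R..R} \<Longrightarrow> (case q of (t, x) \<Rightarrow> P t x) \<le> (case z of (t, x) \<Rightarrow> P t x)"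
      using continuous_attains_inf[OF _ _ Pc] by blast
    obtain t1 x1 where q': "q = (t1, x1)" by (cases q)
    have t1: "t1 \<in> {0..T}" and x1: "x1 \<in> {-R..R}" using q(1) q' by auto
    have min: "P t1 x1 \<le> P s y" if "s \<in> {0..T}" "y \<in> {-R..R}" for s y
      using q(2)[of "(s, y)"] that q' by auto
    have "x \<in> {-R..R}" using R by (simp add: abs_less_iff)
    from min[OF t this] have P1: "P t1 x1 < m" using Pm by linarith
    have x1R: "\<bar>x1\<bar> < R"
    proof (rule ccontr)
      assume "\<not> \<bar>x1\<bar> < R"
      then have "m / \<delta> \<le> p x1 + (K + 1) * t1"
      proof -
        have "(K + 1) * t1 \<ge> 0" using K0 t1 by simp
        moreover have "\<bar>x\<bar> + m / \<delta> + 1 \<le> p x1" using p1(2)[of x1] \<open>\<not> \<bar>x1\<bar> < R\<close> by (simp add: R_def)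
        ultimately show ?thesis using abs_ge_zero[of x] by linarith
      qed
      then have "m \<le> \<delta> * (p x1 + (K + 1) * t1)" using \<delta> by (simp add: pos_divide_le_eq mult.commute)
      also have "\<dots> \<le> P t1 x1" unfolding P_def using pos[OF t1] by simp
      finally show False using P1 by simp
    qed
    have t1p: "t1 > 0"
    proof (rule ccontr)
      assume "\<not> t1 > 0"
      then have "t1 = 0" using t1 by simp
      moreover have "0 \<le> \<delta> * p x1" using \<delta> p1(1)[of x1] by (intro mult_nonneg_nonneg) auto
      ultimately have "m \<le> P t1 x1" unfolding P_def using init[of x1] by simp
      then show False using P1 by simp
    qed
    have Px: "(P t1 has_real_derivative exp (K * t1) * rx t1 x1 + \<delta> * (x1 / p x1)) (at x1)"
      unfolding P_def[abs_def] by (auto intro!: derivative_eq_intros r_x[OF t1] p_x)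
    have "exp (K * t1) * rx t1 x1 + \<delta> * (x1 / p x1) = 0"
    proof (rule DERIV_local_min[OF Px])
      show "0 < R - \<bar>x1\<bar>" using x1R by simp
      show "\<forall>y. \<bar>x1 - y\<bar> < R - \<bar>x1\<bar> \<longrightarrow> P t1 x1 \<le> P t1 y"
      proof (intro allI impI min[OF t1])
        fix y assume "\<bar>x1 - y\<bar> < R - \<bar>x1\<bar>"
        then show "y \<in> {-R..R}" unfolding atLeastAtMost_iff by arith
      qed
    qed
    then have e0: "exp (K * t1) * rx t1 x1 = - (\<delta> * (x1 / p x1))" by simp
    define D where "D = (K * exp (K * t1)) * r t1 x1 + exp (K * t1) * - (rx t1 x1 * w t1 x1 + r t1 x1 * wx t1 x1) + \<delta> * (K + 1)"
    have Pt: "((\<lambda>\<tau>. P \<tau> x1) has_real_derivative D) (at t1 within {0..T})"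
      unfolding P_def D_def by (auto intro!: derivative_eq_intros r_t[OF t1] simp: algebra_simps)
    have "D > 0"
    proof -
      have "D = exp (K * t1) * (r t1 x1 * (K - wx t1 x1)) - (exp (K * t1) * rx t1 x1) * w t1 x1 + \<delta> * (K + 1)"
        by (simp add: D_def algebra_simps)
      also have "\<dots> = exp (K * t1) * (r t1 x1 * (K - wx t1 x1)) + \<delta> * (K + 1 + x1 / p x1 * w t1 x1)"
        unfolding e0 by (simp add: algebra_simps)
      also have "\<dots> > 0"
      proof (rule add_nonneg_pos)
        show "0 \<le> exp (K * t1) * (r t1 x1 * (K - wx t1 x1))"
          using pos[OF t1, of x1] wb[OF t1, of x1] by (intro mult_nonneg_nonneg) auto
        have "\<bar>x1 / p x1\<bar> \<le> 1" using p1[of x1] by (simp add: abs_divide divide_le_eq)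
        then have "\<bar>x1 / p x1 * w t1 x1\<bar> \<le> 1 * K"
          unfolding abs_mult using wb[OF t1, of x1] by (intro mult_mono) auto
        then have "K + 1 + x1 / p x1 * w t1 x1 > 0" by (simp only: abs_le_iff mult_1) linarith
        then show "0 < \<delta> * (K + 1 + x1 / p x1 * w t1 x1)" using \<delta> by simp
      qed
      finally show ?thesis .
    qed
    from has_real_derivative_pos_inc_left[OF Pt this]
    obtain e where e: "e > 0" "\<And>k. k > 0 \<Longrightarrow> t1 - k \<in> {0..T} \<Longrightarrow> k < e \<Longrightarrow> P (t1 - k) x1 < P t1 x1" by auto
    define k where "k = min t1 (e / 2)"
    have k: "k > 0" "k < e" "t1 - k \<in> {0..T}" using t1 t1p e(1) by (auto simp: k_def min_def)
    show False using e(2)[OF k(1,3,2)] min[OF k(3) x1] by simp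
  qed
  have "m \<le> exp (K * t) * r t x"
  proof (rule field_le_epsilon)
    fix e :: real assume e: "e > 0"
    have q: "p x + (K + 1) * t > 0" using p1(1)[of x] K0 t by (intro add_pos_nonneg) auto
    show "m \<le> exp (K * t) * r t x + e"
      using main[of "e / (p x + (K + 1) * t)"] e q by simp
  qed
  then have "exp (- (K * t)) * m \<le> exp (- (K * t)) * (exp (K * t) * r t x)" by (intro mult_left_mono) auto
  also have "\<dots> = r t x" by (simp add: mult.assoc[symmetric] exp_minus_inverse mult.commute[of "exp (- _)"])
  finally show ?thesis .
qed

subsection \<open>Solutions of the amplitude-velocity system\<close>

lemma ln_cmod_square_has_derivative:
  assumes "(a has_vector_derivative a') (at x within S)" "a x \<noteq> 0"
  shows "((\<lambda>x. ln ((cmod (a x))\<^sup>2)) has_real_derivative 2 * Re (cnj (a x) * a') / (cmod (a x))\<^sup>2) (at x within S)"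
proof -
  have "((\<lambda>x. ln ((cmod (a x))\<^sup>2)) has_real_derivative 1 / (cmod (a x))\<^sup>2 * (2 * Re (cnj (a x) * a'))) (at x within S)"
    using assms by (intro DERIV_chain2[OF DERIV_ln_divide cmod_square_has_derivative]) auto
  then show ?thesis by simp
qed

text \<open>The content of \<open>system_solution\<close> for \<open>s > 5/2\<close>, with
  derivatives named as functions instead of \<open>vector_derivative\<close>, the logarithmic
  derivative computed, and a single bound \<open>K\<close>, which for positive \<open>eps\<close>
  may depend on \<open>eps\<close>.\<close>

locale regular_solution =
  fixes lam eps T K :: real and a ax axx :: "real \<Rightarrow> real \<Rightarrow> complex" and v vx vxx :: "real \<Rightarrow> real \<Rightarrow> real"
  assumes K_ge: "K \<ge> 1"
    and a_nz: "\<And>t x. t \<in> {0..T} \<Longrightarrow> a t x \<noteq> 0"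
    and a_x: "\<And>t x. t \<in> {0..T} \<Longrightarrow> (a t has_vector_derivative ax t x) (at x)"
    and ax_x: "\<And>t x. t \<in> {0..T} \<Longrightarrow> (ax t has_vector_derivative axx t x) (at x)"
    and v_x: "\<And>t x. t \<in> {0..T} \<Longrightarrow> (v t has_real_derivative vx t x) (at x)"
    and vx_x: "\<And>t x. t \<in> {0..T} \<Longrightarrow> (vx t has_real_derivative vxx t x) (at x)"
    and a_bound: "\<And>t x. t \<in> {0..T} \<Longrightarrow> norm (a t x) \<le> K \<and> norm (ax t x) \<le> K \<and> norm (axx t x) \<le> K"
    and v_bound: "\<And>t x. t \<in> {0..T} \<Longrightarrow> \<bar>v t x\<bar> \<le> K \<and> \<bar>vx t x\<bar> \<le> K \<and> \<bar>vxx t x\<bar> \<le> K"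
    and ax_L2: "\<And>t. t \<in> {0..T} \<Longrightarrow> (\<integral>\<^sup>+x. ennreal ((norm (ax t x))\<^sup>2) \<partial>lborel) \<le> ennreal K"
    and vxx_L2: "\<And>t. t \<in> {0..T} \<Longrightarrow> (\<integral>\<^sup>+x. ennreal ((vxx t x)\<^sup>2) \<partial>lborel) \<le> ennreal K"
    and a_cont: "continuous_on ({0..T} \<times> UNIV) (\<lambda>(t, x). a t x)"
    and ax_cont: "continuous_on ({0..T} \<times> UNIV) (\<lambda>(t, x). ax t x)"
    and axx_cont: "continuous_on ({0..T} \<times> UNIV) (\<lambda>(t, x). axx t x)"
    and v_cont: "continuous_on ({0..T} \<times> UNIV) (\<lambda>(t, x). v t x)"
    and vx_cont: "continuous_on ({0..T} \<times> UNIV) (\<lambda>(t, x). vx t x)"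
    and vxx_cont: "continuous_on ({0..T} \<times> UNIV) (\<lambda>(t, x). vxx t x)"
    and v_t: "\<And>t x. t \<in> {0..T} \<Longrightarrow> ((\<lambda>\<tau>. v \<tau> x) has_real_derivative
        - (v t x * vx t x + lam * (2 * Re (cnj (a t x) * ax t x) / (cmod (a t x))\<^sup>2))) (at t within {0..T})"
    and a_t: "\<And>t x. t \<in> {0..T} \<Longrightarrow> ((\<lambda>\<tau>. a \<tau> x) has_vector_derivative
        \<i> * of_real (eps / 2) * axx t x - of_real (v t x) * ax t x - of_real (vx t x / 2) * a t x) (at t within {0..T})"

lemma solution_regular:
  assumes s: "s > 5/2" and T: "T > 0" and sol: "system_solution s lam eps T a0 v0 a v"
  shows "\<exists>K ax axx vx vxx. regular_solution lam eps T K a ax axx v vx vxx"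
proof -
  have T0: "T \<ge> 0" using T by simp
  have zh: "continuous_zhidkov s T a" "continuous_zhidkov s T (\<lambda>t x. of_real (v t x))"
    using sol by (auto simp: system_solution_def)
  obtain ax axx K1 where a:
    "\<And>t x. t \<in> {0..T} \<Longrightarrow> (a t has_vector_derivative ax t x) (at x)"
    "\<And>t x. t \<in> {0..T} \<Longrightarrow> (ax t has_vector_derivative axx t x) (at x)"
    "\<And>t x. t \<in> {0..T} \<Longrightarrow> norm (a t x) \<le> K1 \<and> norm (ax t x) \<le> K1 \<and> norm (axx t x) \<le> K1"
    "\<And>t. t \<in> {0..T} \<Longrightarrow> (\<integral>\<^sup>+x. ennreal ((norm (ax t x))\<^sup>2) \<partial>lborel) \<le> ennreal K1"
    "\<And>t. t \<in> {0..T} \<Longrightarrow> (\<integral>\<^sup>+x. ennreal ((norm (axx t x))\<^sup>2) \<partial>lborel) \<le> ennreal K1"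
    "continuous_on ({0..T} \<times> UNIV) (\<lambda>(t, x). a t x)"
    "continuous_on ({0..T} \<times> UNIV) (\<lambda>(t, x). ax t x)"
    "continuous_on ({0..T} \<times> UNIV) (\<lambda>(t, x). axx t x)"
    using continuous_zhidkov_regular[OF s T0 zh(1)] by blast
  obtain fx fxx K2 where f:
    "\<And>t x. t \<in> {0..T} \<Longrightarrow> ((\<lambda>x. complex_of_real (v t x)) has_vector_derivative fx t x) (at x)"
    "\<And>t x. t \<in> {0..T} \<Longrightarrow> (fx t has_vector_derivative fxx t x) (at x)"
    "\<And>t x. t \<in> {0..T} \<Longrightarrow> norm (complex_of_real (v t x)) \<le> K2 \<and> norm (fx t x) \<le> K2 \<and> norm (fxx t x) \<le> K2"
    "\<And>t. t \<in> {0..T} \<Longrightarrow> (\<integral>\<^sup>+x. ennreal ((norm (fx t x))\<^sup>2) \<partial>lborel) \<le> ennreal K2"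
    "\<And>t. t \<in> {0..T} \<Longrightarrow> (\<integral>\<^sup>+x. ennreal ((norm (fxx t x))\<^sup>2) \<partial>lborel) \<le> ennreal K2"
    "continuous_on ({0..T} \<times> UNIV) (\<lambda>(t, x). complex_of_real (v t x))"
    "continuous_on ({0..T} \<times> UNIV) (\<lambda>(t, x). fx t x)"
    "continuous_on ({0..T} \<times> UNIV) (\<lambda>(t, x). fxx t x)"
    using continuous_zhidkov_regular[OF s T0 zh(2)] by blast
  \<comment> \<open>\<open>v\<close> is treated as a complex valued member of the Zhidkov space;
    since its values are real, real parts recover its derivatives.\<close>
  define vx where "vx t x = Re (fx t x)" for t x
  define vxx where "vxx t x = Re (fxx t x)" for t x
  define K where "K = 1 + \<bar>K1\<bar> + \<bar>K2\<bar>"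
  have KK: "1 \<le> K" "K1 \<le> K" "K2 \<le> K" by (auto simp: K_def)
  have v_x: "(v t has_real_derivative vx t x) (at x)" if "t \<in> {0..T}" for t x
    using f(1)[OF that, of x] by (simp add: vx_def has_real_derivative_iff_has_vector_derivative has_vector_derivative_complex_iff)
  have vx_x: "(vx t has_real_derivative vxx t x) (at x)" if "t \<in> {0..T}" for t x
    using f(2)[OF that, of x] by (simp add: vx_def[abs_def] vxx_def has_real_derivative_iff_has_vector_derivative has_vector_derivative_complex_iff)
  have sys: "a t x \<noteq> 0" "(\<exists>vt. ((\<lambda>\<tau>. v \<tau> x) has_vector_derivative vt) (at t within {0..T}) \<and>
           vt + v t x * ddx (v t) x + lam * ddx (\<lambda>y. ln ((cmod (a t y))\<^sup>2)) x = 0)"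
     "(\<exists>at'. ((\<lambda>\<tau>. a \<tau> x) has_vector_derivative at') (at t within {0..T}) \<and>
           at' + of_real (v t x) * ddx (a t) x + a t x / 2 * of_real (ddx (v t) x)
             = \<i> * of_real (eps / 2) * ddx (ddx (a t)) x)" if "t \<in> {0..T}" for t x
    using sol that unfolding system_solution_def by blast+
  have d1: "ddx (v t) x = vx t x" if "t \<in> {0..T}" for t x
    using v_x[OF that] by (intro vector_derivative_at) (simp add: has_real_derivative_iff_has_vector_derivative)
  have d2: "ddx (a t) x = ax t x" if "t \<in> {0..T}" for t x
    by (rule vector_derivative_at[OF a(1)[OF that]])
  have d3: "ddx (ax t) x = axx t x" if "t \<in> {0..T}" for t x
    by (rule vector_derivative_at[OF a(2)[OF that]])
  have d4: "ddx (\<lambda>y. ln ((cmod (a t y))\<^sup>2)) x = 2 * Re (cnj (a t x) * ax t x) / (cmod (a t x))\<^sup>2" if "t \<in> {0..T}" for t x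
    using ln_cmod_square_has_derivative[OF a(1)[OF that] sys(1)[OF that]]
    by (intro vector_derivative_at) (simp add: has_real_derivative_iff_has_vector_derivative)
  have "regular_solution lam eps T K a ax axx v vx vxx"
  proof (rule regular_solution.intro[OF KK(1) sys(1) a(1,2) v_x vx_x _ _ _ _ a(6-8)])
    fix t x assume t: "t \<in> {0..T}"
    show "norm (a t x) \<le> K \<and> norm (ax t x) \<le> K \<and> norm (axx t x) \<le> K" using a(3)[OF t, of x] KK(2) by linarith
    show "\<bar>v t x\<bar> \<le> K \<and> \<bar>vx t x\<bar> \<le> K \<and> \<bar>vxx t x\<bar> \<le> K"
      using f(3)[OF t, of x] KK(3) abs_Re_le_cmod[of "fx t x"] abs_Re_le_cmod[of "fxx t x"]
      unfolding vx_def vxx_def norm_of_real by linarith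
    show "(\<integral>\<^sup>+x. ennreal ((norm (ax t x))\<^sup>2) \<partial>lborel) \<le> ennreal K"
      using a(4)[OF t] ennreal_leI[OF KK(2)] by (rule order_trans)
    show "(\<integral>\<^sup>+x. ennreal ((vxx t x)\<^sup>2) \<partial>lborel) \<le> ennreal K"
    proof -
      have "(\<integral>\<^sup>+x. ennreal ((vxx t x)\<^sup>2) \<partial>lborel) \<le> (\<integral>\<^sup>+x. ennreal ((norm (fxx t x))\<^sup>2) \<partial>lborel)"
        unfolding vxx_def using abs_Re_le_cmod by (intro nn_integral_mono ennreal_leI) (simp add: abs_le_square_iff[symmetric])
      also have "\<dots> \<le> ennreal K2" by (rule f(5)[OF t])
      also have "\<dots> \<le> ennreal K" by (rule ennreal_leI[OF KK(3)])
      finally show ?thesis .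
    qed
    from sys(2)[OF t, of x, unfolded d1[OF t] d4[OF t]]
    obtain vt where "((\<lambda>\<tau>. v \<tau> x) has_vector_derivative vt) (at t within {0..T})"
      "vt + v t x * vx t x + lam * (2 * Re (cnj (a t x) * ax t x) / (cmod (a t x))\<^sup>2) = 0"
      by (elim exE conjE) (rule that)
    moreover from this(2) have "vt = - (v t x * vx t x + lam * (2 * Re (cnj (a t x) * ax t x) / (cmod (a t x))\<^sup>2))" by linarith
    ultimately show "((\<lambda>\<tau>. v \<tau> x) has_real_derivative
        - (v t x * vx t x + lam * (2 * Re (cnj (a t x) * ax t x) / (cmod (a t x))\<^sup>2))) (at t within {0..T})"
      by (simp only: has_real_derivative_iff_has_vector_derivative)
    from sys(3)[OF t, of x, unfolded d1[OF t] d2[OF t] d3[OF t]]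
    obtain at' where "((\<lambda>\<tau>. a \<tau> x) has_vector_derivative at') (at t within {0..T})"
      "at' + of_real (v t x) * ax t x + a t x / 2 * of_real (vx t x) = \<i> * of_real (eps / 2) * axx t x"
      by (elim exE conjE) (rule that)
    moreover from this(2) have "at' = \<i> * of_real (eps / 2) * axx t x - of_real (v t x) * ax t x - of_real (vx t x / 2) * a t x"
      by (simp add: algebra_simps)
    ultimately show "((\<lambda>\<tau>. a \<tau> x) has_vector_derivative
        \<i> * of_real (eps / 2) * axx t x - of_real (v t x) * ax t x - of_real (vx t x / 2) * a t x) (at t within {0..T})"
      by simp
  next
    have "continuous_on ({0..T} \<times> UNIV) (\<lambda>p. Re (case p of (t, x) \<Rightarrow> complex_of_real (v t x)))"
      "continuous_on ({0..T} \<times> UNIV) (\<lambda>p. Re (case p of (t, x) \<Rightarrow> fx t x))"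
      "continuous_on ({0..T} \<times> UNIV) (\<lambda>p. Re (case p of (t, x) \<Rightarrow> fxx t x))"
      using f(6-8) by (intro continuous_on_Re; simp)+
    then show "continuous_on ({0..T} \<times> UNIV) (\<lambda>(t, x). v t x)"
    "continuous_on ({0..T} \<times> UNIV) (\<lambda>(t, x). vx t x)"
    "continuous_on ({0..T} \<times> UNIV) (\<lambda>(t, x). vxx t x)"
      by (simp_all add: split_beta' vx_def vxx_def)
  qed
  then show ?thesis by blast
qed

lemma joint_continuous_slice:
  assumes "continuous_on (S \<times> UNIV) (\<lambda>(t, x). f t x)"
  shows "continuous_on S (\<lambda>t. f t x)" "t \<in> S \<Longrightarrow> continuous_on UNIV (f t)"
proof -
  have "continuous_on S (\<lambda>t. case (t, x) of (t, x) \<Rightarrow> f t x)"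
    by (rule continuous_on_compose2[OF assms]) (auto intro!: continuous_intros)
  then show "continuous_on S (\<lambda>t. f t x)" by simp
  assume "t \<in> S"
  then have "continuous_on UNIV (\<lambda>x. case (t, x) of (t, x) \<Rightarrow> f t x)"
    by (intro continuous_on_compose2[OF assms]) (auto intro!: continuous_intros)
  then show "continuous_on UNIV (f t)" by simp
qed

text \<open>By the velocity equation, the \<open>x\<close> derivative of the integrand of the phase
  is minus the time derivative of \<open>v\<close>. Differentiating under the integral and
  integrating in time, the gradient of the phase becomes \<open>v 0 + (v t - v 0)\<close>.\<close>

lemma phase_derivatives:
  assumes s: "s > 5/2" and T: "T > 0" and sol: "system_solution s lam eps T a0 (ddx Phi0) a v"
    and Phi0: "Phi0 differentiable_on UNIV" and t: "t \<in> {0..T}"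
  shows "(phase lam Phi0 a v t has_real_derivative v t x) (at x)"
    "((\<lambda>\<tau>. phase lam Phi0 a v \<tau> x) has_real_derivative - ((v t x)\<^sup>2 / 2 + lam * ln ((cmod (a t x))\<^sup>2))) (at t within {0..T})"
proof -
  obtain K ax axx vx vxx where "regular_solution lam eps T K a ax axx v vx vxx"
    using solution_regular[OF s T sol] by blast
  then interpret S: regular_solution lam eps T K a ax axx v vx vxx .
  note nz = S.a_nz and a = S.a_x and v = S.v_x and c = S.a_cont S.ax_cont S.v_cont S.vx_cont and v_t = S.v_t
  define g where "g x \<tau> = (v \<tau> x)\<^sup>2 / 2 + lam * ln ((cmod (a \<tau> x))\<^sup>2)" for x \<tau>
  define gx where "gx x \<tau> = v \<tau> x * vx \<tau> x + lam * (2 * Re (cnj (a \<tau> x) * ax \<tau> x) / (cmod (a \<tau> x))\<^sup>2)" for x \<tau>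
  have ph: "phase lam Phi0 a v \<tau> y = Phi0 y - integral {0..\<tau>} (g y)" for \<tau> y
    by (simp add: phase_def g_def[abs_def])
  have gc: "continuous_on {0..T} (g x)" for x
    unfolding g_def using nz
    by (intro continuous_intros joint_continuous_slice[OF c(1)] joint_continuous_slice[OF c(3)]) auto
  have P0: "(Phi0 has_real_derivative v 0 x) (at x)" for x
  proof -
    have "Phi0 differentiable (at x)" using Phi0 by (simp add: differentiable_on_def)
    then have "(Phi0 has_vector_derivative ddx Phi0 x) (at x)" by (simp add: vector_derivative_works)
    then show ?thesis using sol by (simp add: system_solution_def has_real_derivative_iff_has_vector_derivative)
  qed
  show "((\<lambda>\<tau>. phase lam Phi0 a v \<tau> x) has_real_derivative - ((v t x)\<^sup>2 / 2 + lam * ln ((cmod (a t x))\<^sup>2))) (at t within {0..T})"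
  proof -
    have "((\<lambda>u. integral {0..u} (g x)) has_vector_derivative g x t) (at t within {0..T})"
      by (rule integral_has_vector_derivative[OF gc t])
    then have "((\<lambda>u. Phi0 x - integral {0..u} (g x)) has_real_derivative 0 - g x t) (at t within {0..T})"
      by (intro DERIV_diff DERIV_const) (simp add: has_real_derivative_iff_has_vector_derivative)
    then show ?thesis by (simp add: ph g_def)
  qed
  have tsub: "{0..t} \<subseteq> {0..T}" using t by auto
  have "((\<lambda>x. integral (cbox 0 t) (g x)) has_field_derivative integral (cbox 0 t) (gx x)) (at x within UNIV)"
  proof (rule leibniz_rule_field_derivative)
    fix y \<tau> assume "\<tau> \<in> cbox 0 t"
    then have \<tau>: "\<tau> \<in> {0..T}" using tsub by auto
    show "((\<lambda>x. g x \<tau>) has_field_derivative gx y \<tau>) (at y within UNIV)"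
    proof -
      have "((\<lambda>x. (v \<tau> x)\<^sup>2 / 2) has_real_derivative v \<tau> y * vx \<tau> y) (at y)"
        by (auto intro!: derivative_eq_intros v[OF \<tau>])
      then show ?thesis unfolding g_def gx_def
        by (intro DERIV_add DERIV_cmult ln_cmod_square_has_derivative a \<tau> nz) auto
    qed
  next
    fix y
    show "g y integrable_on cbox 0 t"
      using continuous_on_subset[OF gc tsub] by (simp add: integrable_continuous_interval)
  next
    have sw: "continuous_on (UNIV \<times> cbox 0 t) (\<lambda>p. f (snd p) (fst p))"
      if "continuous_on ({0..T} \<times> UNIV) (\<lambda>(t, x). f t x)" for f :: "real \<Rightarrow> real \<Rightarrow> 'b::topological_space"
    proof -
      have "continuous_on (UNIV \<times> cbox 0 t) (\<lambda>p. case (snd p, fst p) of (t, x) \<Rightarrow> f t x)"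
        using tsub by (intro continuous_on_compose2[OF that]) (auto intro!: continuous_intros)
      then show ?thesis by simp
    qed
    show "continuous_on (UNIV \<times> cbox 0 t) (\<lambda>(x, \<tau>). gx x \<tau>)"
      unfolding gx_def split_beta' using tsub nz
      by (intro continuous_intros sw[OF c(1)] sw[OF c(2)] sw[OF c(3)] sw[OF c(4)]) auto
  qed auto
  then have 1: "((\<lambda>x. integral {0..t} (g x)) has_real_derivative integral {0..t} (gx x)) (at x)" by simp
  have "((\<lambda>\<tau>. - gx x \<tau>) has_integral (v t x - v 0 x)) {0..t}"
  proof (rule fundamental_theorem_of_calculus)
    show "((\<lambda>\<tau>. v \<tau> x) has_vector_derivative - gx x \<tau>) (at \<tau> within {0..t})" if "\<tau> \<in> {0..t}" for \<tau>
      using has_vector_derivative_within_subset[OF _ tsub] v_t[of \<tau> x] that tsub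
      by (auto simp: gx_def has_real_derivative_iff_has_vector_derivative)
  qed (use t in auto)
  then have "integral {0..t} (\<lambda>\<tau>. - gx x \<tau>) = v t x - v 0 x" by (rule integral_unique)
  then have "integral {0..t} (gx x) = v 0 x - v t x" by simp
  with DERIV_diff[OF P0[of x] 1]
  show "(phase lam Phi0 a v t has_real_derivative v t x) (at x)"
    by (simp add: ph[abs_def])
qed

lemma mult_cis_has_derivative:
  assumes "(A has_vector_derivative A') (at x within S)" "(\<theta> has_real_derivative \<theta>') (at x within S)"
  shows "((\<lambda>x. A x * cis (\<theta> x)) has_vector_derivative (A' + \<i> * of_real \<theta>' * A x) * cis (\<theta> x)) (at x within S)"
proof -
  have "((\<lambda>x. cis (\<theta> x)) has_vector_derivative \<theta>' *\<^sub>R (\<i> * cis (\<theta> x))) (at x within S)"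
  proof -
    have "(\<theta> has_derivative (\<lambda>h. h * \<theta>')) (at x within S)"
      using assms(2) unfolding has_real_derivative_iff_has_vector_derivative has_vector_derivative_def real_scaleR_def .
    from has_derivative_cis[OF this] show ?thesis unfolding has_vector_derivative_def by simp
  qed
  from has_vector_derivative_mult[OF assms(1) this]
  show ?thesis by (simp add: scaleR_conv_of_real algebra_simps)
qed

text \<open>For \<open>eps\<close> different from 0 the term with \<open>axx\<close> would
  contribute \<open>- eps * Im (cnj a * axx)\<close>.\<close>

lemma (in regular_solution) density_transport:
  assumes eps: "eps = 0" and t: "t \<in> {0..T}"
  shows "((\<lambda>\<tau>. (cmod (a \<tau> x))\<^sup>2) has_real_derivative
    - (2 * Re (cnj (a t x) * ax t x) * v t x + (cmod (a t x))\<^sup>2 * vx t x)) (at t within {0..T})"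
proof -
  have "2 * Re (cnj (a t x) * (\<i> * of_real (eps / 2) * axx t x - of_real (v t x) * ax t x - of_real (vx t x / 2) * a t x))
     = - (2 * Re (cnj (a t x) * ax t x) * v t x + (cmod (a t x))\<^sup>2 * vx t x)"
    unfolding cmod_power2 by (simp add: eps algebra_simps power2_eq_square)
  then show ?thesis using cmod_square_has_derivative[OF a_t[OF t, of x]] by simp
qed

subsection \<open>Convergence of the wave functions\<close>

text \<open>\<open>\<phi>\<close> is the difference of the two phases and
  \<open>b = a * cis (\<phi> / eps)\<close>. With \<open>v = w + eps * \<theta>\<close>, the terms
  of the amplitude and phase equations that contain \<open>\<theta>\<close> recombine into the
  derivatives of \<open>b\<close>, and only the difference of the logarithms is left over. The bound
  \<open>2 * K0^2\<close> is taken from the limiting solution alone, so it does not depend on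
  \<open>eps\<close>.\<close>

lemma wkb_comparison_instance:
  assumes S0: "regular_solution lam 0 T K0 a0 a0x a0xx w wx wxx"
    and S1: "regular_solution lam eps T K1 a ax axx v vx vxx"
    and eps: "0 < eps" "eps \<le> 1" and lam: "lam > 0" and T: "T > 0"
    and init: "\<And>x. a 0 x = a0 0 x" and m: "m > 0" "\<And>x. m \<le> (cmod (a0 0 x))\<^sup>2"
    and \<phi>_x: "\<And>t x. t \<in> {0..T} \<Longrightarrow> (\<phi> t has_real_derivative v t x - w t x) (at x)"
    and \<phi>_t: "\<And>t x. t \<in> {0..T} \<Longrightarrow> ((\<lambda>\<tau>. \<phi> \<tau> x) has_real_derivative
      - ((v t x)\<^sup>2 / 2 + lam * ln ((cmod (a t x))\<^sup>2)) + ((w t x)\<^sup>2 / 2 + lam * ln ((cmod (a0 t x))\<^sup>2))) (at t within {0..T})"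
    and \<phi>_0: "\<And>x. \<phi> 0 x = 0"
  shows "\<exists>bx bxx M rmin. wkb_comparison (\<lambda>t x. a t x * cis (\<phi> t x / eps)) bx bxx w wx wxx (\<lambda>t x. (cmod (a0 t x))\<^sup>2)
    (\<lambda>t x. 2 * Re (cnj (a0 t x) * a0x t x)) eps lam T (2 * K0\<^sup>2) M rmin"
proof -
  interpret S0: regular_solution lam 0 T K0 a0 a0x a0xx w wx wxx by (rule S0)
  interpret S1: regular_solution lam eps T K1 a ax axx v vx vxx by (rule S1)
  have T0: "0 \<in> {0..T}" using T by simp
  define \<theta> where "\<theta> t x = (v t x - w t x) / eps" for t x
  define \<theta>x where "\<theta>x t x = (vx t x - wx t x) / eps" for t x
  define b where "b t x = a t x * cis (\<phi> t x / eps)" for t x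
  define bx where "bx t x = (ax t x + \<i> * of_real (\<theta> t x) * a t x) * cis (\<phi> t x / eps)" for t x
  define bxx where "bxx t x = ((axx t x + (\<i> * of_real (\<theta> t x) * ax t x + \<i> * of_real (\<theta>x t x) * a t x))
     + \<i> * of_real (\<theta> t x) * (ax t x + \<i> * of_real (\<theta> t x) * a t x)) * cis (\<phi> t x / eps)" for t x
  define rx where "rx t x = 2 * Re (cnj (a0 t x) * a0x t x)" for t x
  have K0: "K0 \<ge> 1" by (rule S0.K_ge)
  have K1: "K1 \<ge> 1" by (rule S1.K_ge)
  have K0sq: "K0 \<le> K0\<^sup>2" "1 \<le> K0\<^sup>2" using K0 by (auto simp: power2_eq_square intro: order_trans[OF _ mult_right_mono[of 1 K0 K0]])
  have KK: "K0 \<le> 2 * K0\<^sup>2" "1 \<le> 2 * K0\<^sup>2" using K0sq by linarith+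
  \<comment> \<open>Derivatives of \<open>cis (\<phi> / eps)\<close> cost powers of
    \<open>1 / eps\<close>; these enter only the bound \<open>M\<close>, which may depend on
    \<open>eps\<close>.\<close>
  define Q where "Q = (K0 + K1) / eps"
  have Q0: "Q \<ge> 0" using K0 K1 eps by (simp add: Q_def)
  have \<theta>b: "\<bar>\<theta> t x\<bar> \<le> Q" "\<bar>\<theta>x t x\<bar> \<le> Q" if "t \<in> {0..T}" for t x
  proof -
    have "\<bar>v t x - w t x\<bar> \<le> K0 + K1" "\<bar>vx t x - wx t x\<bar> \<le> K0 + K1"
      using S0.v_bound[OF that, of x] S1.v_bound[OF that, of x] by linarith+
    then show "\<bar>\<theta> t x\<bar> \<le> Q" "\<bar>\<theta>x t x\<bar> \<le> Q"
      using eps by (auto simp: \<theta>_def \<theta>x_def Q_def abs_divide divide_right_mono)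
  qed
  have \<phi>e_x: "((\<lambda>x. \<phi> t x / eps) has_real_derivative \<theta> t x) (at x)" if "t \<in> {0..T}" for t x
    unfolding \<theta>_def by (rule DERIV_cdivide[OF \<phi>_x[OF that]])
  have \<theta>_x: "(\<theta> t has_real_derivative \<theta>x t x) (at x)" if "t \<in> {0..T}" for t x
    unfolding \<theta>_def[abs_def] \<theta>x_def by (rule DERIV_cdivide[OF DERIV_diff[OF S1.v_x[OF that] S0.v_x[OF that]]])
  have b_x: "(b t has_vector_derivative bx t x) (at x)" if "t \<in> {0..T}" for t x
    unfolding b_def[abs_def] bx_def by (rule mult_cis_has_derivative[OF S1.a_x[OF that] \<phi>e_x[OF that]])
  have bx_x: "(bx t has_vector_derivative bxx t x) (at x)" if t: "t \<in> {0..T}" for t x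
  proof -
    have 1: "((\<lambda>x. of_real (\<theta> t x)) has_vector_derivative complex_of_real (\<theta>x t x)) (at x)"
      using \<theta>_x[OF t, of x] by (simp add: has_real_derivative_iff_has_vector_derivative has_vector_derivative_of_real)
    have "((\<lambda>x. ax t x + \<i> * of_real (\<theta> t x) * a t x) has_vector_derivative
       axx t x + (\<i> * of_real (\<theta> t x) * ax t x + \<i> * of_real (\<theta>x t x) * a t x)) (at x)"
      by (intro has_vector_derivative_add S1.ax_x[OF t] has_vector_derivative_mult S1.a_x[OF t] has_vector_derivative_mult_right 1)
    from mult_cis_has_derivative[OF this \<phi>e_x[OF t, of x]] show ?thesis
      unfolding bx_def[abs_def] bxx_def .
  qed
  note c1 = S1.a_cont S1.ax_cont S1.axx_cont S1.v_cont S1.vx_cont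
  note c0 = S0.a_cont S0.ax_cont S0.v_cont S0.vx_cont S0.vxx_cont
  note sl1 = c1[THEN joint_continuous_slice(1)] c0[THEN joint_continuous_slice(1)]
  note sl2 = c1[THEN joint_continuous_slice(2)] c0[THEN joint_continuous_slice(2)]
  have \<phi>cx: "continuous_on UNIV (\<phi> t)" if "t \<in> {0..T}" for t
    using \<phi>_x[OF that] by (meson DERIV_isCont continuous_at_imp_continuous_on)
  have \<phi>ct: "continuous_on {0..T} (\<lambda>t. \<phi> t x)" for x
    using DERIV_continuous[OF \<phi>_t] by (auto simp: continuous_on_eq_continuous_within)
  have bound: "norm (b t x) \<le> K1 \<and> norm (bx t x) \<le> K1 + Q * K1 \<and> norm (bxx t x) \<le> (K1 + (Q * K1 + Q * K1)) + Q * (K1 + Q * K1)" if t: "t \<in> {0..T}" for t x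
  proof (intro conjI)
    have aB: "norm (a t x) \<le> K1" "norm (ax t x) \<le> K1" "norm (axx t x) \<le> K1" using S1.a_bound[OF t] by auto
    have m: "norm (\<i> * of_real z * y) \<le> Q * Z" if "\<bar>z\<bar> \<le> Q" "norm y \<le> Z" for z y Z
      using mult_mono[OF that Q0 norm_ge_zero] by (simp add: norm_mult)
    show "norm (b t x) \<le> K1" using aB by (simp add: b_def norm_mult)
    have n1: "norm (ax t x + \<i> * of_real (\<theta> t x) * a t x) \<le> K1 + Q * K1"
      by (intro norm_triangle_le add_mono aB m \<theta>b t)
    then show "norm (bx t x) \<le> K1 + Q * K1" by (simp add: bx_def norm_mult)
    have "norm ((axx t x + (\<i> * of_real (\<theta> t x) * ax t x + \<i> * of_real (\<theta>x t x) * a t x))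
     + \<i> * of_real (\<theta> t x) * (ax t x + \<i> * of_real (\<theta> t x) * a t x)) \<le> (K1 + (Q * K1 + Q * K1)) + Q * (K1 + Q * K1)"
      by (intro norm_triangle_le add_mono aB m \<theta>b t n1)
    then show "norm (bxx t x) \<le> (K1 + (Q * K1 + Q * K1)) + Q * (K1 + Q * K1)" by (simp add: bxx_def norm_mult)
  qed
  define M where "M = (K1 + (Q * K1 + Q * K1)) + Q * (K1 + Q * K1)"
  have QK: "0 \<le> Q * K1" "0 \<le> Q * (K1 + Q * K1)" using Q0 K1 by auto
  have M: "K1 \<le> M" "K1 + Q * K1 \<le> M" using QK unfolding M_def by linarith+
  have r_x: "((\<lambda>x. (cmod (a0 t x))\<^sup>2) has_real_derivative rx t x) (at x)" if "t \<in> {0..T}" for t x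
    unfolding rx_def by (rule cmod_square_has_derivative[OF S0.a_x[OF that]])
  have r_t: "((\<lambda>\<tau>. (cmod (a0 \<tau> x))\<^sup>2) has_real_derivative - (rx t x * w t x + (cmod (a0 t x))\<^sup>2 * wx t x)) (at t within {0..T})" if "t \<in> {0..T}" for t x
    unfolding rx_def by (rule S0.density_transport[OF refl that])
  \<comment> \<open>The lower bound of \<open>transport_lower_bound\<close> at its smallest, the
    final time.\<close>
  define rmin where "rmin = exp (- (K0 * T)) * m"
  have rlow: "rmin \<le> (cmod (a0 t x))\<^sup>2" if t: "t \<in> {0..T}" for t x
  proof -
    have "rmin \<le> exp (- (K0 * t)) * m" unfolding rmin_def using t K0 m by (intro mult_right_mono) (auto intro: mult_left_mono)
    also have "\<dots> \<le> (cmod (a0 t x))\<^sup>2"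
    proof (rule transport_lower_bound[where r = "\<lambda>t x. (cmod (a0 t x))\<^sup>2" and rx = rx and w = w and wx = wx, OF _ r_x r_t _ _ m(2) t])
      show "continuous_on ({0..T} \<times> UNIV) (\<lambda>(t, x). (cmod (a0 t x))\<^sup>2)"
        using S0.a_cont unfolding split_beta' by (intro continuous_intros)
    qed (use S0.v_bound in auto)
    finally show ?thesis .
  qed
  have "wkb_comparison b bx bxx w wx wxx (\<lambda>t x. (cmod (a0 t x))\<^sup>2) rx eps lam T (2 * K0\<^sup>2) M rmin"
  proof (rule wkb_comparison.intro[OF eps lam T KK(2) _ b_x bx_x _ _ _ _ _ _ _ r_x _ r_t S0.v_x S0.vx_x])
    show "rmin > 0" using m by (simp add: rmin_def)
    fix t assume t: "t \<in> {0..T}"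
    show "continuous_on UNIV (bxx t)"
      unfolding bxx_def[abs_def] \<theta>_def \<theta>x_def using eps
      by (intro continuous_intros sl2 \<phi>cx t) auto
    show "continuous_on UNIV (rx t)" unfolding rx_def[abs_def] by (intro continuous_intros sl2 t)
    show "continuous_on UNIV (wxx t)" by (rule sl2(10)[OF t])
    show "(\<integral>\<^sup>+x. ennreal ((wxx t x)\<^sup>2) \<partial>lborel) \<le> ennreal (2 * K0\<^sup>2)"
      by (rule order_trans[OF S0.vxx_L2[OF t] ennreal_leI[OF KK(1)]])
    fix x
    show "norm (b t x) \<le> M \<and> norm (bx t x) \<le> M \<and> norm (bxx t x) \<le> M"
      using bound[OF t, of x] M unfolding M_def[symmetric] by linarith
    show "b t x \<noteq> 0" using S1.a_nz[OF t] by (simp add: b_def)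
    show "rmin \<le> (cmod (a0 t x))\<^sup>2 \<and> (cmod (a0 t x))\<^sup>2 \<le> 2 * K0\<^sup>2 \<and> \<bar>rx t x\<bar> \<le> 2 * K0\<^sup>2"
    proof (intro conjI rlow[OF t])
      have B: "cmod (a0 t x) \<le> K0" "cmod (a0x t x) \<le> K0" using S0.a_bound[OF t] by auto
      have "(cmod (a0 t x))\<^sup>2 \<le> K0\<^sup>2" using B by (intro power_mono) auto
      then show "(cmod (a0 t x))\<^sup>2 \<le> 2 * K0\<^sup>2" using K0sq by linarith
      have "\<bar>Re (cnj (a0 t x) * a0x t x)\<bar> \<le> cmod (a0 t x) * cmod (a0x t x)"
        using abs_Re_le_cmod[of "cnj (a0 t x) * a0x t x"] by (simp only: norm_mult complex_mod_cnj)
      also have "\<dots> \<le> K0 * K0" using B K0 by (intro mult_mono) auto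
      finally show "\<bar>rx t x\<bar> \<le> 2 * K0\<^sup>2" by (simp only: rx_def abs_mult abs_numeral power2_eq_square)
    qed
    show "\<bar>w t x\<bar> \<le> 2 * K0\<^sup>2 \<and> \<bar>wx t x\<bar> \<le> 2 * K0\<^sup>2 \<and> \<bar>wxx t x\<bar> \<le> 2 * K0\<^sup>2"
      using S0.v_bound[OF t, of x] KK(1) by linarith
    define N where "N = - ((v t x)\<^sup>2 / 2 + lam * ln ((cmod (a t x))\<^sup>2)) + ((w t x)\<^sup>2 / 2 + lam * ln ((cmod (a0 t x))\<^sup>2))"
    have rho: "(cmod (b t x))\<^sup>2 = (cmod (a t x))\<^sup>2" by (simp add: b_def norm_mult)
    have pos: "(cmod (a t x))\<^sup>2 > 0" "(cmod (a0 t x))\<^sup>2 > 0" using S0.a_nz[OF t] S1.a_nz[OF t] by auto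
    have "((\<lambda>\<tau>. \<phi> \<tau> x / eps) has_real_derivative N / eps) (at t within {0..T})"
      unfolding N_def by (rule DERIV_cdivide[OF \<phi>_t[OF t]])
    from mult_cis_has_derivative[OF S1.a_t[OF t] this]
    have "((\<lambda>\<tau>. b \<tau> x) has_vector_derivative ((\<i> * of_real (eps / 2) * axx t x - of_real (v t x) * ax t x - of_real (vx t x / 2) * a t x)
      + \<i> * of_real (N / eps) * a t x) * cis (\<phi> t x / eps)) (at t within {0..T})" by (simp only: b_def)
    also have "((\<i> * of_real (eps / 2) * axx t x - of_real (v t x) * ax t x - of_real (vx t x / 2) * a t x)
      + \<i> * of_real (N / eps) * a t x) * cis (\<phi> t x / eps)
      = - (of_real (w t x) * bx t x + of_real (wx t x / 2) * b t x) + \<i> * of_real (eps / 2) * bxx t x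
        - \<i> * of_real (lam / eps * ln ((cmod (b t x))\<^sup>2 / (cmod (a0 t x))\<^sup>2)) * b t x"
    proof -
      \<comment> \<open>Substituting this, \<open>(v^2 - w^2) / 2 = eps * w * \<theta> + eps^2 *
        \<theta>^2 / 2\<close>. The first term completes \<open>w * bx\<close> and the second
        completes \<open>i * eps / 2 * bxx\<close>.\<close>
      have vw: "v t x = w t x + eps * \<theta> t x" "vx t x = wx t x + eps * \<theta>x t x" using eps by (simp_all add: \<theta>_def \<theta>x_def)
      define l where "l = lam / eps * ln ((cmod (b t x))\<^sup>2 / (cmod (a0 t x))\<^sup>2)"
      have "N / eps = - (w t x * \<theta> t x + eps / 2 * (\<theta> t x)\<^sup>2) - l"
        unfolding N_def l_def rho ln_divide_pos[OF pos] using eps by (simp add: vw(1) field_simps power2_eq_square)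
      then have Nl: "complex_of_real (N / eps) = - (of_real (w t x) * of_real (\<theta> t x) + of_real (eps / 2) * (of_real (\<theta> t x) * of_real (\<theta> t x))) - of_real l"
        by (simp add: power2_eq_square)
      have "((\<i> * of_real (eps / 2) * axx t x - of_real (v t x) * ax t x - of_real (vx t x / 2) * a t x)
      + \<i> * of_real (N / eps) * a t x) * cis (\<phi> t x / eps)
      = - (of_real (w t x) * bx t x + of_real (wx t x / 2) * b t x) + \<i> * of_real (eps / 2) * bxx t x
        - \<i> * of_real l * b t x"
        unfolding Nl bx_def bxx_def b_def vw by (simp add: algebra_simps add_divide_distrib power2_eq_square)
      then show ?thesis unfolding l_def .
    qed
    finally show "((\<lambda>\<tau>. b \<tau> x) has_vector_derivative
      (- (of_real (w t x) * bx t x + of_real (wx t x / 2) * b t x) + \<i> * of_real (eps / 2) * bxx t x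
        - \<i> * of_real (lam / eps * ln ((cmod (b t x))\<^sup>2 / (cmod (a0 t x))\<^sup>2)) * b t x)) (at t within {0..T})" .
  next
    fix x
    show "continuous_on {0..T} (\<lambda>t. bx t x)"
      unfolding bx_def \<theta>_def using eps by (intro continuous_intros sl1 \<phi>ct) auto
    show "continuous_on {0..T} (\<lambda>t. bxx t x)"
      unfolding bxx_def \<theta>_def \<theta>x_def using eps by (intro continuous_intros sl1 \<phi>ct) auto
    show "(cmod (b 0 x))\<^sup>2 = (cmod (a0 0 x))\<^sup>2" by (simp add: b_def \<phi>_0 init)
  next
    \<comment> \<open>The two phases agree at time 0, so \<open>b\<close> starts from the amplitude
      of the limit and its gradient has the L2 bound of the latter. Any initial phase difference
      would spoil this by a factor \<open>1 / eps\<close>.\<close>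
    have "bx 0 x = a0x 0 x" for x
    proof (rule vector_derivative_unique_at[OF b_x[OF T0]])
      have "b 0 = a0 0" by (rule ext) (simp add: b_def \<phi>_0 init)
      then show "(b 0 has_vector_derivative a0x 0 x) (at x)" using S0.a_x[OF T0] by simp
    qed
    then show "(\<integral>\<^sup>+x. ennreal ((cmod (bx 0 x))\<^sup>2) \<partial>lborel) \<le> ennreal (2 * K0\<^sup>2)"
      using order_trans[OF S0.ax_L2[OF T0] ennreal_leI[OF KK(1)]] by simp
  qed
  then show ?thesis unfolding b_def[abs_def] rx_def[abs_def] by blast
qed

text \<open>\<open>B\<close> is \<open>b\<close> at one time and \<open>A\<close> is
  \<open>sqrt r\<close>. The phase of \<open>B eps x\<close> need not converge, but Hoelder
  continuity makes it common to the two points \<open>x - eps / 2 * y\<close> and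
  \<open>x + eps / 2 * y\<close> in the limit, so the product tends to \<open>(A x)^2\<close>. The
  remaining phase is a symmetric difference quotient of \<open>\<theta>\<close>.\<close>

lemma wkb_family_limit:
  fixes B :: "real \<Rightarrow> real \<Rightarrow> complex" and A \<theta> :: "real \<Rightarrow> real"
  assumes hoelder: "\<And>eps x y. eps \<in> {0<..1} \<Longrightarrow> norm (B eps x - B eps y) \<le> C * sqrt \<bar>x - y\<bar>"
    and close: "\<And>eps x. eps \<in> {0<..1} \<Longrightarrow> \<exists>z\<in>{x..x + eps}. (cmod (B eps z) - A z)\<^sup>2 \<le> D * eps"
    and Ab: "\<And>x. \<bar>A x\<bar> \<le> K" and CD: "C \<ge> 0" "D \<ge> 0"
  shows "\<And>eps x. eps \<in> {0<..1} \<Longrightarrow> norm (B eps x) \<le> C + sqrt D + K"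
    "isCont A x \<Longrightarrow> (\<theta> has_real_derivative w) (at x) \<Longrightarrow>
     ((\<lambda>eps. B eps (x - eps / 2 * y) * cnj (B eps (x + eps / 2 * y)) * cis ((\<theta> (x - eps / 2 * y) - \<theta> (x + eps / 2 * y)) / eps))
       \<longlongrightarrow> of_real ((A x)\<^sup>2) * cis (- (y * w))) (at 0 within {0<..1})"
proof -
  let ?F = "at 0 within {0<..1::real}"
  have cl: "\<exists>z\<in>{x..x + eps}. \<bar>cmod (B eps z) - A z\<bar> \<le> sqrt (D * eps) \<and> norm (B eps x - B eps z) \<le> C * sqrt eps" if e: "eps \<in> {0<..1}" for eps x
  proof -
    obtain z where z: "z \<in> {x..x + eps}" "(cmod (B eps z) - A z)\<^sup>2 \<le> D * eps" using close[OF e] by blast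
    have "\<bar>cmod (B eps z) - A z\<bar> \<le> sqrt (D * eps)" using real_sqrt_le_mono[OF z(2)] by simp
    moreover have "norm (B eps x - B eps z) \<le> C * sqrt eps"
      by (rule order_trans[OF hoelder[OF e]]) (use z CD in \<open>auto intro!: mult_left_mono\<close>)
    ultimately show ?thesis using z by blast
  qed
  show bd: "norm (B eps x) \<le> C + sqrt D + K" if e: "eps \<in> {0<..1}" for eps x
  proof -
    obtain z where z: "\<bar>cmod (B eps z) - A z\<bar> \<le> sqrt (D * eps)" "norm (B eps x - B eps z) \<le> C * sqrt eps" using cl[OF e] by blast
    have "D * eps \<le> D" "C * sqrt eps \<le> C" using e CD by (auto intro!: mult_left_le)
    then have "sqrt (D * eps) \<le> sqrt D" "C * sqrt eps \<le> C" by simp_all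
    moreover have "norm (B eps x) \<le> norm (B eps x - B eps z) + norm (B eps z)" using norm_triangle_ineq[of "B eps x - B eps z" "B eps z"] by simp
    ultimately show ?thesis using z Ab[of z] by linarith
  qed
  define N where "N = C + sqrt D + K"
  assume A: "isCont A x" and \<theta>: "(\<theta> has_real_derivative w) (at x)"
  have ev: "\<forall>\<^sub>F eps in ?F. eps \<in> {0<..1}" by (auto simp: eventually_at_filter)
  have le0: "((\<lambda>eps. eps) \<longlongrightarrow> 0) ?F" by (rule tendsto_ident_at)
  have s0: "((\<lambda>eps. c * sqrt (d * eps)) \<longlongrightarrow> 0) ?F" for c d
  proof -
    have "((\<lambda>eps. c * sqrt (d * eps)) \<longlongrightarrow> c * sqrt (d * 0)) ?F" by (intro tendsto_intros)
    then show ?thesis by simp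
  qed
  \<comment> \<open>Three errors: moving \<open>B\<close> from \<open>x\<close> to the nearby point
    \<open>z\<close>, comparing \<open>|B|\<close> with \<open>A\<close> at \<open>z\<close>, and
    moving \<open>A\<close> back to \<open>x\<close>.\<close>
  have lB: "((\<lambda>eps. cmod (B eps x)) \<longlongrightarrow> A x) ?F"
  proof (rule tendstoI)
    fix e :: real assume e: "e > 0"
    obtain d where d: "d > 0" "\<And>z. dist z x < d \<Longrightarrow> dist (A z) (A x) < e / 3"
      using A e unfolding continuous_at_eps_delta by (metis divide_pos_pos zero_less_numeral dist_real_def)
    have "\<forall>\<^sub>F eps in ?F. eps < d" using order_tendstoD(2)[OF le0 d(1)] .
    moreover have "\<forall>\<^sub>F eps in ?F. 1 * sqrt (D * eps) < e / 3" using e by (intro order_tendstoD(2)[OF s0]) auto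
    moreover have "\<forall>\<^sub>F eps in ?F. C * sqrt (1 * eps) < e / 3" using e by (intro order_tendstoD(2)[OF s0]) auto
    ultimately show "\<forall>\<^sub>F eps in ?F. dist (cmod (B eps x)) (A x) < e" using ev
    proof eventually_elim
      case (elim eps)
      obtain z where z: "z \<in> {x..x + eps}" "\<bar>cmod (B eps z) - A z\<bar> \<le> sqrt (D * eps)" "norm (B eps x - B eps z) \<le> C * sqrt eps" using cl[OF elim(4)] by blast
      have "dist (A z) (A x) < e / 3" using z elim by (intro d(2)) (auto simp: dist_real_def)
      moreover have "\<bar>cmod (B eps x) - cmod (B eps z)\<bar> \<le> norm (B eps x - B eps z)" by (rule norm_triangle_ineq3)
      moreover have "sqrt (D * eps) < e / 3" "C * sqrt eps < e / 3" using elim by simp_all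
      ultimately show ?case using z unfolding dist_real_def by argo
    qed
  qed
  have near: "((\<lambda>eps. B eps (x + eps * c) - B eps x) \<longlongrightarrow> 0) ?F" for c
  proof (rule Lim_null_comparison[OF _ s0[of C "\<bar>c\<bar>"]])
    show "\<forall>\<^sub>F eps in ?F. norm (B eps (x + eps * c) - B eps x) \<le> C * sqrt (\<bar>c\<bar> * eps)"
      using ev
    proof eventually_elim
      case (elim eps)
      then show ?case using hoelder[OF elim, of "x + eps * c" x] by (simp add: abs_mult mult.commute)
    qed
  qed
  have prod: "((\<lambda>eps. B eps (x - eps / 2 * y) * cnj (B eps (x + eps / 2 * y))) \<longlongrightarrow> of_real ((A x)\<^sup>2)) ?F"
  proof -
    have n1: "((\<lambda>eps. B eps (x - eps / 2 * y) - B eps x) \<longlongrightarrow> 0) ?F" using near[of "- (y / 2)"] by simp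
    have n2: "((\<lambda>eps. B eps (x + eps / 2 * y) - B eps x) \<longlongrightarrow> 0) ?F" using near[of "y / 2"] by simp
    have z1: "((\<lambda>eps. (B eps (x - eps / 2 * y) - B eps x) * cnj (B eps (x + eps / 2 * y))) \<longlongrightarrow> 0) ?F"
    proof (rule Lim_null_comparison)
      show "((\<lambda>eps. norm (B eps (x - eps / 2 * y) - B eps x) * N) \<longlongrightarrow> 0) ?F"
        using tendsto_mult_right[OF tendsto_norm[OF n1], of N] by simp
      show "\<forall>\<^sub>F eps in ?F. norm ((B eps (x - eps / 2 * y) - B eps x) * cnj (B eps (x + eps / 2 * y))) \<le> norm (B eps (x - eps / 2 * y) - B eps x) * N"
        using ev by eventually_elim (simp add: norm_mult mult_left_mono N_def bd)
    qed
    have z2: "((\<lambda>eps. B eps x * cnj (B eps (x + eps / 2 * y) - B eps x)) \<longlongrightarrow> 0) ?F"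
    proof (rule Lim_null_comparison)
      show "((\<lambda>eps. N * norm (B eps (x + eps / 2 * y) - B eps x)) \<longlongrightarrow> 0) ?F"
        using tendsto_mult_left[OF tendsto_norm[OF n2], of N] by simp
      show "\<forall>\<^sub>F eps in ?F. norm (B eps x * cnj (B eps (x + eps / 2 * y) - B eps x)) \<le> N * norm (B eps (x + eps / 2 * y) - B eps x)"
        using ev by eventually_elim (simp only: norm_mult complex_mod_cnj mult_right_mono[OF bd norm_ge_zero] N_def)
    qed
    have z3: "((\<lambda>eps. complex_of_real ((cmod (B eps x))\<^sup>2)) \<longlongrightarrow> of_real ((A x)\<^sup>2)) ?F"
      by (intro tendsto_of_real tendsto_power lB)
    have "B eps (x - eps / 2 * y) * cnj (B eps (x + eps / 2 * y)) = (B eps (x - eps / 2 * y) - B eps x) * cnj (B eps (x + eps / 2 * y))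
       + B eps x * cnj (B eps (x + eps / 2 * y) - B eps x) + complex_of_real ((cmod (B eps x))\<^sup>2)" for eps
      unfolding complex_norm_square by (simp add: algebra_simps)
    then show ?thesis using tendsto_add[OF tendsto_add[OF z1 z2] z3] by simp
  qed
  have ph: "((\<lambda>eps. (\<theta> (x - eps / 2 * y) - \<theta> (x + eps / 2 * y)) / eps) \<longlongrightarrow> - (y * w)) ?F"
  proof -
    have d: "((\<lambda>e. \<theta> (x + e * c)) has_real_derivative w * c) (at 0)" for c
    proof -
      have "((\<lambda>e. x + e * c) has_real_derivative c) (at 0)" by (auto intro!: derivative_eq_intros)
      moreover have "(\<theta> has_real_derivative w) (at (x + 0 * c))" using \<theta> by simp
      ultimately show ?thesis by (intro DERIV_chain2[where f = \<theta> and g = "\<lambda>e. x + e * c"])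
    qed
    have "((\<lambda>e. \<theta> (x + e * (- (y / 2))) - \<theta> (x + e * (y / 2))) has_real_derivative - (y * w)) (at 0)"
      using DERIV_diff[OF d[of "- (y / 2)"] d[of "y / 2"]] by (simp add: field_simps)
    then have "((\<lambda>e. (\<theta> (x + e * (- (y / 2))) - \<theta> (x + e * (y / 2))) / e) \<longlongrightarrow> - (y * w)) (at 0)"
      by (auto simp: has_field_derivative_iff)
    then have "((\<lambda>e. (\<theta> (x + e * (- (y / 2))) - \<theta> (x + e * (y / 2))) / e) \<longlongrightarrow> - (y * w)) ?F"
      by (rule tendsto_within_subset) simp
    then show ?thesis by simp
  qed
  have "((\<lambda>eps. cis ((\<theta> (x - eps / 2 * y) - \<theta> (x + eps / 2 * y)) / eps)) \<longlongrightarrow> cis (- (y * w))) ?F"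
    by (intro tendsto_intros ph)
  from tendsto_mult[OF prod this]
  show "((\<lambda>eps. B eps (x - eps / 2 * y) * cnj (B eps (x + eps / 2 * y)) * cis ((\<theta> (x - eps / 2 * y) - \<theta> (x + eps / 2 * y)) / eps))
       \<longlongrightarrow> of_real ((A x)\<^sup>2) * cis (- (y * w))) ?F" .
qed

subsection \<open>The limit of the Wigner distributions\<close>

lemma lborel_integral_triple:
  fixes f :: "real \<times> real \<times> real \<Rightarrow> 'a::{banach, second_countable_topology}"
  assumes f: "integrable lborel f"
  shows "(LINT t|lborel. LINT x|lborel. LINT y|lborel. f (t, x, y)) = (LINT p|lborel. f p)"
    and "AE t in lborel. AE x in lborel. integrable lborel (\<lambda>y. f (t, x, y))"
proof -
  have [measurable]: "f \<in> borel_measurable borel" using f by auto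
  have f1: "integrable (lborel \<Otimes>\<^sub>M lborel) f" using f by (simp add: lborel_prod)
  have ae: "AE t in lborel. integrable (lborel \<Otimes>\<^sub>M lborel) (\<lambda>q :: real \<times> real. f (t, q))"
    using lborel_pair.AE_integrable_fst'[OF f1] by (simp add: lborel_prod)
  show "AE t in lborel. AE x in lborel. integrable lborel (\<lambda>y. f (t, x, y))"
    using ae by eventually_elim (drule lborel_pair.AE_integrable_fst', simp)
  have "(LINT t|lborel. LINT x|lborel. LINT y|lborel. f (t, x, y)) = (LINT t|lborel. LINT q|lborel. f (t, q))"
  proof (rule integral_cong_AE)
    show "AE t in lborel. (LINT x|lborel. LINT y|lborel. f (t, x, y)) = (LINT q|lborel. f (t, q))"
      using ae
    proof eventually_elim
      case (elim t)
      show ?case using lborel_pair.integral_fst'[OF elim] by (simp add: lborel_prod)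
    qed
  qed measurable
  also have "\<dots> = (LINT p|lborel. f p)"
    using lborel_pair.integral_fst'[OF f1] by (simp add: lborel_prod)
  finally show "(LINT t|lborel. LINT x|lborel. LINT y|lborel. f (t, x, y)) = (LINT p|lborel. f p)" .
qed

lemma lborel_nn_integral_pair:
  fixes f :: "real \<times> 'b::euclidean_space \<Rightarrow> ennreal"
  assumes [measurable]: "f \<in> borel_measurable borel"
  shows "(\<integral>\<^sup>+p. f p \<partial>lborel) = (\<integral>\<^sup>+t. \<integral>\<^sup>+q. f (t, q) \<partial>lborel \<partial>lborel)"
  using lborel.nn_integral_fst[of f lborel] by (simp add: lborel_prod)

text \<open>All data are controlled for times in \<open>{0..T}\<close> only; the extension by zero
  is a Borel function on the whole plane, as Lebesgue integration over \<open>(t, x)\<close>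
  requires.\<close>

definition time_strip :: "real \<Rightarrow> (real \<Rightarrow> real \<Rightarrow> 'a::real_vector) \<Rightarrow> real \<times> real \<Rightarrow> 'a" where
  "time_strip T f p = (if fst p \<in> {0..T} then f (fst p) (snd p) else 0)"

lemma time_strip_measurable:
  fixes f :: "real \<Rightarrow> real \<Rightarrow> 'a::{real_normed_vector, second_countable_topology}"
  assumes "continuous_on ({0..T} \<times> UNIV) (\<lambda>(t, x). f t x)"
  shows "time_strip T f \<in> borel_measurable borel"
proof -
  have "{0..T} \<times> (UNIV :: real set) \<in> sets borel" by (intro borel_closed closed_Times) auto
  from borel_measurable_continuous_on_indicator[OF this assms]
  show ?thesis by (rule measurable_cong[THEN iffD1, rotated]) (auto simp: time_strip_def indicator_def)
qed

lemma time_strip_graph_measurable: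
  assumes "continuous_on ({0..T} \<times> UNIV) (\<lambda>(t, x). w t x :: real)"
  shows "(\<lambda>p. (fst p, snd p, time_strip T w p)) \<in> borel \<rightarrow>\<^sub>M borel"
  by (intro borel_measurable_Pair time_strip_measurable[OF assms] borel_measurable_continuous_onI continuous_intros)

text \<open>The measure is the image of a density on the \<open>(t, x)\<close> plane under the graph
  map of \<open>w\<close>; integrals against it thereby become Lebesgue integrals over the plane.
  Tonelli compares the two on each Borel set.\<close>

lemma time_measure_monokinetic:
  assumes f: "\<And>t. t \<in> {0..T} \<Longrightarrow> f t = monokinetic (r t) (w t)"
    and rc: "continuous_on ({0..T} \<times> UNIV) (\<lambda>(t, x). r t x)"
    and wc: "continuous_on ({0..T} \<times> UNIV) (\<lambda>(t, x). w t x)"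
  shows "time_measure T f = distr (density lborel (\<lambda>p. ennreal (time_strip T r p))) borel
    (\<lambda>p. (fst p, snd p, time_strip T w p))"
proof -
  note [measurable] = time_strip_measurable[OF rc] time_strip_measurable[OF wc]
  note g [measurable] = time_strip_graph_measurable[OF wc]
  have slice: "indicator {0..T} t * emeasure (f t) {p. (t, p) \<in> A}
     = (\<integral>\<^sup>+x. ennreal (time_strip T r (t, x)) * indicator A (t, x, time_strip T w (t, x)) \<partial>lborel)"
    if A [measurable]: "A \<in> sets borel" for A t
  proof (cases "t \<in> {0..T}")
    case True
    have [measurable]: "r t \<in> borel_measurable borel" "w t \<in> borel_measurable borel"
      by (intro borel_measurable_continuous_onI joint_continuous_slice(2)[OF rc True] joint_continuous_slice(2)[OF wc True])+
    have "Pair t \<in> borel \<rightarrow>\<^sub>M (borel :: (real \<times> real \<times> real) measure)"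
      by (intro borel_measurable_continuous_onI continuous_intros)
    from measurable_sets[OF this A] have S: "{p. (t, p) \<in> A} \<in> sets borel" by (simp add: vimage_def)
    have gm: "(\<lambda>x. (x, w t x)) \<in> density lborel (\<lambda>x. ennreal (r t x)) \<rightarrow>\<^sub>M borel"
      by (simp add: borel_prod[symmetric])
    have "(\<lambda>x. (x, w t x)) \<in> borel \<rightarrow>\<^sub>M borel" by (simp add: borel_prod[symmetric])
    from measurable_sets[OF this S] have S': "{x. (t, x, w t x) \<in> A} \<in> sets borel" by (simp add: vimage_def)
    have "emeasure (f t) {p. (t, p) \<in> A} = (\<integral>\<^sup>+x. ennreal (r t x) * indicator {x. (t, x, w t x) \<in> A} x \<partial>lborel)"
      unfolding f[OF True] monokinetic_def using S S' gm
      by (subst emeasure_distr) (auto simp: vimage_def emeasure_density)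
    then show ?thesis using True by (simp add: time_strip_def indicator_def)
  qed (simp add: time_strip_def del: atLeastAtMost_iff)
  show ?thesis
  proof (rule measure_eqI)
    show "sets (time_measure T f) = sets (distr (density lborel (\<lambda>p. ennreal (time_strip T r p))) borel
      (\<lambda>p. (fst p, snd p, time_strip T w p)))" by (simp add: sets_time_measure)
    fix A assume "A \<in> sets (time_measure T f)"
    then have A [measurable]: "A \<in> sets borel" by (simp add: sets_time_measure)
    have m: "(\<lambda>p. ennreal (time_strip T r p) * indicator A (fst p, snd p, time_strip T w p)) \<in> borel_measurable borel"
      by measurable
    have m': "(\<lambda>t. \<integral>\<^sup>+x. ennreal (time_strip T r (t, x)) * indicator B (t, x, time_strip T w (t, x)) \<partial>lborel) \<in> borel_measurable borel"
      if [measurable]: "B \<in> sets borel" for B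
    proof -
      have "(\<lambda>p. ennreal (time_strip T r p) * indicator B (fst p, snd p, time_strip T w p)) \<in> borel_measurable (borel \<Otimes>\<^sub>M lborel)"
        unfolding measurable_cong_sets[OF sets_pair_measure_cong[OF refl sets_lborel] refl] borel_prod by measurable
      from lborel.borel_measurable_nn_integral_fst[OF this] show ?thesis by simp
    qed
    have "emeasure (time_measure T f) A = (\<integral>\<^sup>+t. indicator {0..T} t * emeasure (f t) {p. (t, p) \<in> A} \<partial>lborel)"
    proof (rule emeasure_time_measure[OF _ _ A])
      show "sets (f t) = sets borel" if "t \<in> {0..T}" for t by (simp add: f[OF that] monokinetic_def)
      show "(\<lambda>t. indicator {0..T} t * emeasure (f t) {p. (t, p) \<in> B}) \<in> borel_measurable borel" if "B \<in> sets borel" for B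
        unfolding slice[OF that] by (rule m'[OF that])
    qed
    also have "\<dots> = (\<integral>\<^sup>+p. ennreal (time_strip T r p) * indicator A (fst p, snd p, time_strip T w p) \<partial>lborel)"
      unfolding slice[OF A] using lborel_nn_integral_pair[OF m] by simp
    also have "\<dots> = emeasure (distr (density lborel (\<lambda>p. ennreal (time_strip T r p))) borel (\<lambda>p. (fst p, snd p, time_strip T w p))) A"
      using measurable_sets[OF g A]
      by (subst emeasure_distr) (auto simp: emeasure_density vimage_def indicator_def intro!: nn_integral_cong)
    finally show "emeasure (time_measure T f) A = emeasure (distr (density lborel (\<lambda>p. ennreal (time_strip T r p))) borel
      (\<lambda>p. (fst p, snd p, time_strip T w p))) A" .
  qed
qed

lemma time_measure_monokinetic_integral:
  fixes g :: "real \<times> real \<times> real \<Rightarrow> 'a::{banach, second_countable_topology}"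
  assumes f: "\<And>t. t \<in> {0..T} \<Longrightarrow> f t = monokinetic (r t) (w t)"
    and rc: "continuous_on ({0..T} \<times> UNIV) (\<lambda>(t, x). r t x)"
    and wc: "continuous_on ({0..T} \<times> UNIV) (\<lambda>(t, x). w t x)"
    and r: "\<And>t x. t \<in> {0..T} \<Longrightarrow> r t x \<ge> 0"
    and g [measurable]: "g \<in> borel_measurable borel"
  shows "integrable (time_measure T f) g \<longleftrightarrow> integrable lborel (\<lambda>p. time_strip T r p *\<^sub>R g (fst p, snd p, time_strip T w p))"
    and "(LINT p|time_measure T f. g p) = (LINT p|lborel. time_strip T r p *\<^sub>R g (fst p, snd p, time_strip T w p))"
proof -
  note [measurable] = time_strip_measurable[OF rc] time_strip_measurable[OF wc]
  note h = time_strip_graph_measurable[OF wc]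
  have h': "(\<lambda>p. (fst p, snd p, time_strip T w p)) \<in> density lborel (\<lambda>p. ennreal (time_strip T r p)) \<rightarrow>\<^sub>M borel"
    using h by simp
  have gh: "(\<lambda>p. g (fst p, snd p, time_strip T w p)) \<in> borel_measurable borel"
    using measurable_compose[OF h g] by simp
  have r0: "time_strip T r p \<ge> 0" for p using r by (simp add: time_strip_def)
  have eq: "time_measure T f = distr (density lborel (\<lambda>p. ennreal (time_strip T r p))) borel
    (\<lambda>p. (fst p, snd p, time_strip T w p))"
    by (rule time_measure_monokinetic[OF _ rc wc]) (rule f)
  show "integrable (time_measure T f) g \<longleftrightarrow> integrable lborel (\<lambda>p. time_strip T r p *\<^sub>R g (fst p, snd p, time_strip T w p))"
    unfolding eq integrable_distr_eq[OF h' g] using gh r0 by (subst integrable_density) auto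
  show "(LINT p|time_measure T f. g p) = (LINT p|lborel. time_strip T r p *\<^sub>R g (fst p, snd p, time_strip T w p))"
    unfolding eq integral_distr[OF h' g] using gh r0 by (subst integral_density) auto
qed

text \<open>Finiteness is over bounded sets of \<open>x\<close>: in the application the density
  stays above a positive constant, so the full strip has infinite mass.\<close>

lemma time_measure_monokinetic_finite:
  assumes f: "\<And>t. t \<in> {0..T} \<Longrightarrow> f t = monokinetic (r t) (w t)"
    and rc: "continuous_on ({0..T} \<times> UNIV) (\<lambda>(t, x). r t x)"
    and wc: "continuous_on ({0..T} \<times> UNIV) (\<lambda>(t, x). w t x)"
    and r: "\<And>t x. t \<in> {0..T} \<Longrightarrow> r t x \<le> N" and N: "N \<ge> 0"
  shows "emeasure (time_measure T f) ({0..T} \<times> {-R..R} \<times> UNIV) < \<infinity>"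
proof -
  note [measurable] = time_strip_measurable[OF rc] time_strip_measurable[OF wc]
  define A :: "(real \<times> real \<times> real) set" where "A = {0..T} \<times> {-R..R} \<times> UNIV"
  have A: "A \<in> sets borel" unfolding A_def by (intro borel_closed closed_Times) auto
  note h = time_strip_graph_measurable[OF wc]
  have eq: "time_measure T f = distr (density lborel (\<lambda>p. ennreal (time_strip T r p))) borel
    (\<lambda>p. (fst p, snd p, time_strip T w p))"
    by (rule time_measure_monokinetic[OF _ rc wc]) (rule f)
  have B: "{0..T} \<times> {-R..R} = cbox (0, -R) (T, R)" by (auto simp: cbox_Pair_eq)
  have "emeasure (time_measure T f) A = (\<integral>\<^sup>+p. ennreal (time_strip T r p) * indicator A (fst p, snd p, time_strip T w p) \<partial>lborel)"
    unfolding eq using measurable_sets[OF h A] A h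
    by (subst emeasure_distr) (auto simp: emeasure_density vimage_def indicator_def intro!: nn_integral_cong)
  also have "\<dots> \<le> (\<integral>\<^sup>+p. ennreal N * indicator ({0..T} \<times> {-R..R}) p \<partial>lborel)"
    using r N by (intro nn_integral_mono) (auto simp: A_def indicator_def time_strip_def intro!: ennreal_leI)
  also have "\<dots> = ennreal N * emeasure lborel ({0..T} \<times> {-R..R})"
    by (intro nn_integral_cmult_indicator) (simp add: B)
  also have "\<dots> < \<infinity>"
    unfolding B using emeasure_lborel_cbox_finite[of "(0, -R)" "(T, R)"] by (simp add: ennreal_mult_less_top)
  finally show ?thesis by (simp only: A_def)
qed

text \<open>The distribution is an absolutely convergent integral over \<open>(t, x, y)\<close>,
  dominated by \<open>M^2\<close> times the partial Fourier transform of \<open>\<phi>\<close>, so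
  the pointwise limit passes inside. The limit integrand depends on \<open>y\<close> through
  \<open>cis (- (y * w))\<close>, and Fourier inversion evaluates \<open>\<phi> (t, x, _)\<close> at
  \<open>w\<close>, with a factor \<open>2 * pi\<close> that the normalisation removes.\<close>

lemma wigner_distribution_limit:
  fixes U :: "real \<Rightarrow> real \<Rightarrow> real \<Rightarrow> complex" and r w :: "real \<Rightarrow> real \<Rightarrow> real"
  assumes \<phi>: "wigner_test T \<phi>"
    and rc: "continuous_on ({0..T} \<times> UNIV) (\<lambda>(t, x). r t x)"
    and wc: "continuous_on ({0..T} \<times> UNIV) (\<lambda>(t, x). w t x)"
    and r: "\<And>t x. t \<in> {0..T} \<Longrightarrow> 0 \<le> r t x \<and> r t x \<le> N"
    and Uc: "\<And>eps. eps \<in> {0<..1} \<Longrightarrow> continuous_on ({0..T} \<times> UNIV) (\<lambda>(t, x). U eps t x)"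
    and Ub: "\<And>eps t x. eps \<in> {0<..1} \<Longrightarrow> t \<in> {0..T} \<Longrightarrow> norm (U eps t x) \<le> M"
    and lim: "\<And>t x y. t \<in> {0..T} \<Longrightarrow> ((\<lambda>eps. U eps t (x - eps / 2 * y) * cnj (U eps t (x + eps / 2 * y)))
      \<longlongrightarrow> of_real (r t x) * cis (- (y * w t x))) (at 0 within {0<..1})"
  shows "integrable lborel (\<lambda>p. time_strip T r p *\<^sub>R \<phi> (fst p, snd p, time_strip T w p))"
    and "((\<lambda>eps. 1 / (2 * pi) * wigner_distribution T eps (U eps) \<phi>)
      \<longlongrightarrow> (LINT p|lborel. time_strip T r p *\<^sub>R \<phi> (fst p, snd p, time_strip T w p))) (at_right 0)"
proof -
  note [measurable] = time_strip_measurable[OF rc] time_strip_measurable[OF wc]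
  define G where "G p = indicator ({0..T} \<times> UNIV) p *\<^sub>R (case p of (t, x, y) \<Rightarrow> fourier_xi \<phi> t x y)" for p
  define V where "V eps p = indicator ({0..T} \<times> UNIV) p *\<^sub>R
    (case p of (t, x, y) \<Rightarrow> U eps t (x - eps / 2 * y) * cnj (U eps t (x + eps / 2 * y)))" for eps p
  define L where "L p = (case p of (t, x, y) \<Rightarrow> of_real (time_strip T r (t, x)) * cis (- (y * time_strip T w (t, x))))" for p :: "real \<times> real \<times> real"
  define P where "P p = time_strip T r p *\<^sub>R \<phi> (fst p, snd p, time_strip T w p)" for p
  note h = time_strip_graph_measurable[OF wc]
  have \<phi>c: "continuous_on UNIV \<phi>" and \<phi>i: "\<And>t x. t \<in> {0..T} \<Longrightarrow> integrable lborel (\<lambda>\<xi>. \<phi> (t, x, \<xi>))"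
    and G: "integrable lborel G"
    using \<phi> unfolding wigner_test_def set_integrable_def G_def[abs_def] by auto
  have \<phi>m: "\<phi> \<in> borel_measurable borel" by (rule borel_measurable_continuous_onI[OF \<phi>c])
  have [measurable]: "P \<in> borel_measurable borel" unfolding P_def[abs_def]
    by (intro borel_measurable_scaleR measurable_compose[OF h \<phi>m]) measurable
  have Gm [measurable]: "G \<in> borel_measurable borel" using G by auto
  have Lm [measurable]: "L \<in> borel_measurable borel"
  proof -
    have pr: "(\<lambda>p :: real \<times> real \<times> real. (fst p, fst (snd p))) \<in> borel \<rightarrow>\<^sub>M borel"
      by (intro borel_measurable_continuous_onI continuous_intros)
    have [measurable]: "(\<lambda>p :: real \<times> real \<times> real. snd (snd p)) \<in> borel_measurable borel"
      by (intro borel_measurable_continuous_onI continuous_intros)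
    note [measurable] = measurable_compose[OF pr time_strip_measurable[OF rc]] measurable_compose[OF pr time_strip_measurable[OF wc]]
    show ?thesis unfolding L_def[abs_def] split_beta' by measurable
  qed
  have Vm: "V eps \<in> borel_measurable borel" if e: "eps \<in> {0<..1}" for eps
    unfolding V_def[abs_def]
  proof (rule borel_measurable_continuous_on_indicator)
    show "({0..T} \<times> UNIV :: (real \<times> real \<times> real) set) \<in> sets borel" by (intro borel_closed closed_Times) auto
    have 1: "continuous_on ({0..T} \<times> UNIV) (\<lambda>p :: real \<times> real \<times> real. case (fst p, fst (snd p) + c * snd (snd p)) of (t, x) \<Rightarrow> U eps t x)" for c
      by (rule continuous_on_compose2[OF Uc[OF e]]) (auto intro!: continuous_intros)
    show "continuous_on ({0..T} \<times> UNIV) (\<lambda>(t, x, y). U eps t (x - eps / 2 * y) * cnj (U eps t (x + eps / 2 * y)))"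
      using continuous_on_mult[OF 1[of "- (eps / 2)"] continuous_on_cnj[OF 1[of "eps / 2"]]] by (simp add: split_beta')
  qed
  have M: "M \<ge> 0" if "t \<in> {0..T}" for t using order_trans[OF norm_ge_zero Ub[of 1 t 0]] that by simp
  have Vb: "norm (V eps p) \<le> M * M" if e: "eps \<in> {0<..1}" for eps p
    using mult_mono[OF Ub[OF e] Ub[OF e] M norm_ge_zero]
    by (cases p) (auto simp: V_def indicator_def norm_mult)
  have GV: "integrable lborel (\<lambda>p. G p * V eps p)" if e: "eps \<in> {0<..1}" for eps
  proof (rule Bochner_Integration.integrable_bound)
    show "integrable lborel (\<lambda>p. M * M * norm (G p))" using G by simp
    show "AE p in lborel. norm (G p * V eps p) \<le> norm (M * M * norm (G p))"
      using Vb[OF e] by (intro AE_I2) (auto simp: norm_mult abs_mult mult.commute[of "M * M"] intro!: mult_left_mono)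
  qed (use Vm[OF e] in measurable)
  have GL: "integrable lborel (\<lambda>p. G p * L p)"
  proof (rule Bochner_Integration.integrable_bound)
    show "integrable lborel (\<lambda>p. N * norm (G p))" using G by simp
    show "AE p in lborel. norm (G p * L p) \<le> norm (N * norm (G p))"
    proof (rule AE_I2)
      fix p :: "real \<times> real \<times> real"
      have "norm (G p * L p) \<le> N * norm (G p)"
      proof (cases "fst p \<in> {0..T}")
        case True
        then have "norm (L p) \<le> N" using r by (auto simp: L_def split_beta' time_strip_def norm_mult)
        then show ?thesis by (simp add: norm_mult mult.commute[of N] mult_left_mono)
      qed (auto simp: G_def indicator_def)
      then show "norm (G p * L p) \<le> norm (N * norm (G p))" by simp
    qed
  qed measurable
  have W: "wigner_distribution T eps (U eps) \<phi> = (LINT p|lborel. G p * V eps p)" if e: "eps \<in> {0<..1}" for eps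
  proof -
    have "wigner_distribution T eps (U eps) \<phi> = (LINT t|lborel. LINT x|lborel. LINT y|lborel. G (t, x, y) * V eps (t, x, y))"
      unfolding wigner_distribution_def set_lebesgue_integral_def
      by (intro Bochner_Integration.integral_cong refl) (auto simp: G_def V_def indicator_def)
    then show ?thesis using lborel_integral_triple(1)[OF GV[OF e]] by simp
  qed
  have "((\<lambda>eps. LINT p|lborel. G p * V eps p) \<longlongrightarrow> (LINT p|lborel. G p * L p)) (at 0 within {0<..1})"
  proof (rule integral_dominated_convergence_within[where w = "\<lambda>p. M * M * norm (G p)"])
    show "(\<lambda>p. G p * L p) \<in> borel_measurable lborel" by measurable
    show "(\<lambda>p. G p * V eps p) \<in> borel_measurable lborel" if "eps \<in> {0<..1} - {0}" for eps
      by (intro borel_measurable_times) (use Gm Vm[of eps] that in simp_all)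
    show "integrable lborel (\<lambda>p. M * M * norm (G p))" using G by simp
    show "AE p in lborel. norm (G p * V eps p) \<le> M * M * norm (G p)" if "eps \<in> {0<..1} - {0}" for eps
      using Vb[of eps] that by (intro AE_I2) (auto simp: norm_mult mult.commute[of "M * M"] intro!: mult_left_mono)
    show "AE p in lborel. ((\<lambda>eps. G p * V eps p) \<longlongrightarrow> G p * L p) (at 0 within {0<..1})"
    proof (rule AE_I2)
      fix p :: "real \<times> real \<times> real"
      obtain t x y where p: "p = (t, x, y)" by (cases p)
      show "((\<lambda>eps. G p * V eps p) \<longlongrightarrow> G p * L p) (at 0 within {0<..1})"
      proof (cases "t \<in> {0..T}")
        case True
        then show ?thesis using lim[OF True, of x y] unfolding p
          by (intro tendsto_mult tendsto_const) (simp add: V_def L_def time_strip_def)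
      qed (simp add: p G_def)
    qed
  qed
  moreover have "\<forall>\<^sub>F eps in at 0 within {0<..1}. (LINT p|lborel. G p * V eps p) = wigner_distribution T eps (U eps) \<phi>"
    using W by (auto simp: eventually_at_filter)
  ultimately have "((\<lambda>eps. wigner_distribution T eps (U eps) \<phi>) \<longlongrightarrow> (LINT p|lborel. G p * L p)) (at 0 within {0<..1})"
    by (rule Lim_transform_eventually)
  \<comment> \<open>The bounds concern \<open>eps <= 1\<close>, which is no restriction for a limit
    at 0.\<close>
  moreover have "at 0 within {0<..1} = at_right (0::real)"
    by (rule at_within_nhd[of _ "{..<1}"]) auto
  ultimately have conv: "((\<lambda>eps. wigner_distribution T eps (U eps) \<phi>) \<longlongrightarrow> (LINT p|lborel. G p * L p)) (at_right 0)" by simp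
  have inv: "(LINT y|lborel. G (t, x, y) * L (t, x, y)) = 2 * pi * P (t, x)"
    if i: "integrable lborel (\<lambda>y. G (t, x, y))" for t x
  proof (cases "t \<in> {0..T}")
    case True
    have "continuous_on UNIV (\<lambda>\<xi>. \<phi> (t, x, \<xi>))" by (intro continuous_on_compose2[OF \<phi>c] continuous_intros) auto
    moreover have "integrable lborel (\<lambda>y. LINT \<xi>|lborel. cis (y * \<xi>) * \<phi> (t, x, \<xi>))"
      using i True by (simp add: G_def fourier_xi_def)
    ultimately have "(LINT y|lborel. (LINT \<xi>|lborel. cis (y * \<xi>) * \<phi> (t, x, \<xi>)) * cis (- (y * w t x))) = 2 * pi * \<phi> (t, x, w t x)"
      by (intro fourier_inversion \<phi>i True)
    moreover have "(LINT y|lborel. G (t, x, y) * L (t, x, y))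
       = (LINT y|lborel. of_real (r t x) * ((LINT \<xi>|lborel. cis (y * \<xi>) * \<phi> (t, x, \<xi>)) * cis (- (y * w t x))))"
      using True by (intro Bochner_Integration.integral_cong refl) (simp add: G_def L_def time_strip_def fourier_xi_def)
    ultimately show ?thesis using True by (simp add: P_def time_strip_def scaleR_conv_of_real)
  qed (simp add: G_def P_def time_strip_def del: atLeastAtMost_iff)
  have inv_AE: "AE t in lborel. AE x in lborel. (LINT y|lborel. G (t, x, y) * L (t, x, y)) = 2 * pi * P (t, x)"
    using lborel_integral_triple(2)[OF G] by (rule eventually_mono) (erule eventually_mono, rule inv)
  \<comment> \<open>Integrability of the limit density \<open>P\<close> is not among the hypotheses.
    It comes from inversion, valid for almost all \<open>(t, x)\<close>: \<open>2 * pi * |P|\<close>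
    is at most the inner integral of \<open>|G * L|\<close>.\<close>
  have P_le: "AE t in lborel. AE x in lborel. ennreal (norm (P (t, x))) \<le> (\<integral>\<^sup>+y. ennreal (norm (G (t, x, y) * L (t, x, y))) \<partial>lborel)"
    using lborel_integral_triple(2)[OF G] lborel_integral_triple(2)[OF GL]
  proof eventually_elim
    case (elim t)
    then show ?case
    proof eventually_elim
      case (elim x)
      have "norm (P (t, x)) \<le> 2 * pi * norm (P (t, x))" using pi_gt3 mult_right_mono[of 1 "2 * pi" "norm (P (t, x))"] by simp
      also have "\<dots> = norm (LINT y|lborel. G (t, x, y) * L (t, x, y))" unfolding inv[OF elim(1)] by (simp add: norm_mult)
      finally have "ennreal (norm (P (t, x))) \<le> ennreal (norm (LINT y|lborel. G (t, x, y) * L (t, x, y)))" by (rule ennreal_leI)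
      also have "\<dots> \<le> (\<integral>\<^sup>+y. ennreal (norm (G (t, x, y) * L (t, x, y))) \<partial>lborel)" by (rule integral_norm_bound_ennreal[OF elim(2)])
      finally show ?case .
    qed
  qed
  have P: "integrable lborel P"
  proof (rule integrableI_bounded)
    have "(\<integral>\<^sup>+p. ennreal (norm (P p)) \<partial>lborel) = (\<integral>\<^sup>+t. \<integral>\<^sup>+x. ennreal (norm (P (t, x))) \<partial>lborel \<partial>lborel)"
      by (rule lborel_nn_integral_pair) measurable
    also have "\<dots> \<le> (\<integral>\<^sup>+t. \<integral>\<^sup>+x. \<integral>\<^sup>+y. ennreal (norm (G (t, x, y) * L (t, x, y))) \<partial>lborel \<partial>lborel \<partial>lborel)"
      by (rule nn_integral_mono_AE, rule eventually_mono[OF P_le], rule nn_integral_mono_AE)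
    also have "\<dots> = (\<integral>\<^sup>+t. \<integral>\<^sup>+q. ennreal (norm (G (t, q) * L (t, q))) \<partial>lborel \<partial>lborel)"
      by (intro nn_integral_cong lborel_nn_integral_pair[symmetric]) measurable
    also have "\<dots> = (\<integral>\<^sup>+p. ennreal (norm (G p * L p)) \<partial>lborel)"
      by (intro lborel_nn_integral_pair[symmetric]) measurable
    also have "\<dots> < \<infinity>" using GL by (simp add: integrable_iff_bounded)
    finally show "(\<integral>\<^sup>+p. ennreal (norm (P p)) \<partial>lborel) < \<infinity>" .
  qed measurable
  show "integrable lborel (\<lambda>p. time_strip T r p *\<^sub>R \<phi> (fst p, snd p, time_strip T w p))"
    using P unfolding P_def[abs_def] .
  have "(LINT p|lborel. G p * L p) = (LINT t|lborel. LINT x|lborel. LINT y|lborel. G (t, x, y) * L (t, x, y))"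
    by (rule lborel_integral_triple(1)[OF GL, symmetric])
  also have "\<dots> = (LINT t|lborel. LINT x|lborel. 2 * pi * P (t, x))"
  proof (rule integral_cong_AE)
    show "AE t in lborel. (LINT x|lborel. LINT y|lborel. G (t, x, y) * L (t, x, y)) = (LINT x|lborel. 2 * pi * P (t, x))"
      using inv_AE
    proof eventually_elim
      case (elim t)
      then show ?case by (intro integral_cong_AE) measurable
    qed
  qed measurable
  also have "\<dots> = 2 * pi * (LINT t|lborel. LINT x|lborel. P (t, x))" by simp
  also have "(LINT t|lborel. LINT x|lborel. P (t, x)) = (LINT p|lborel. P p)"
    using P lborel_pair.integral_fst'[of P] by (simp add: lborel_prod)
  finally have GLP: "(LINT p|lborel. G p * L p) = 2 * pi * (LINT p|lborel. P p)" .
  show "((\<lambda>eps. 1 / (2 * pi) * wigner_distribution T eps (U eps) \<phi>)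
      \<longlongrightarrow> (LINT p|lborel. time_strip T r p *\<^sub>R \<phi> (fst p, snd p, time_strip T w p))) (at_right 0)"
    using tendsto_mult_left[OF conv, of "1 / (2 * pi)"] unfolding GLP P_def[abs_def] by simp
qed

subsection \<open>The Vlasov equation\<close>

lemma has_real_derivative_along_curve:
  fixes \<alpha> \<beta> \<gamma> :: "real \<Rightarrow> real"
  assumes \<phi>: "(\<phi> has_derivative (\<lambda>(h, k, l). A * h + B * k + C * l)) (at (\<alpha> s, \<beta> s, \<gamma> s))"
    and c: "(\<alpha> has_real_derivative a) (at s within S)" "(\<beta> has_real_derivative b) (at s within S)"
      "(\<gamma> has_real_derivative c) (at s within S)"
  shows "((\<lambda>s. \<phi> (\<alpha> s, \<beta> s, \<gamma> s)) has_real_derivative A * a + B * b + C * c) (at s within S)"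
proof -
  have "((\<lambda>s. (\<alpha> s, \<beta> s, \<gamma> s)) has_derivative (\<lambda>h. (a * h, b * h, c * h))) (at s within S)"
    using c unfolding has_field_derivative_def by (intro has_derivative_Pair)
  from has_derivative_compose[OF this \<phi>]
  show ?thesis unfolding has_field_derivative_def by (rule has_derivative_eq_rhs) (auto simp: algebra_simps)
qed

lemma set_lebesgue_integral_cbox:
  fixes f :: "'a::euclidean_space \<Rightarrow> real"
  assumes "continuous_on (cbox a b) f"
  shows "set_integrable lborel (cbox a b) f" "(LINT x:cbox a b|lborel. f x) = integral (cbox a b) f"
proof -
  show "set_integrable lborel (cbox a b) f"
    unfolding set_integrable_def by (intro borel_integrable_compact assms compact_cbox)
  then show "(LINT x:cbox a b|lborel. f x) = integral (cbox a b) f"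
    by (rule set_borel_integral_eq_integral)
qed

text \<open>The conservation law is integrated over a rectangle that contains the support in
  \<open>x\<close>. The flux drops out, the value at time \<open>T\<close> vanishes because the test
  function is supported before \<open>T\<close>, and the value at time 0 is the integral against the
  initial measure.\<close>

lemma monokinetic_vlasov_solution:
  assumes T: "T > 0"
    and f: "\<And>t. t \<in> {0..T} \<Longrightarrow> f t = monokinetic (r t) (w t)" and f0: "f 0 = f0"
    and rc: "continuous_on ({0..T} \<times> UNIV) (\<lambda>(t, x). r t x)" and wc: "continuous_on ({0..T} \<times> UNIV) (\<lambda>(t, x). w t x)"
    and rxc: "continuous_on ({0..T} \<times> UNIV) (\<lambda>(t, x). rx t x)" and wxc: "continuous_on ({0..T} \<times> UNIV) (\<lambda>(t, x). wx t x)"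
    and pos: "\<And>t x. t \<in> {0..T} \<Longrightarrow> r t x > 0"
    and r_x: "\<And>t x. t \<in> {0..T} \<Longrightarrow> (r t has_real_derivative rx t x) (at x)"
    and w_x: "\<And>t x. t \<in> {0..T} \<Longrightarrow> (w t has_real_derivative wx t x) (at x)"
    and r_t: "\<And>t x. t \<in> {0..T} \<Longrightarrow> ((\<lambda>\<tau>. r \<tau> x) has_real_derivative - (rx t x * w t x + r t x * wx t x)) (at t within {0..T})"
    and w_t: "\<And>t x. t \<in> {0..T} \<Longrightarrow> ((\<lambda>\<tau>. w \<tau> x) has_real_derivative - (w t x * wx t x + lam * (rx t x / r t x))) (at t within {0..T})"
  shows "vlasov_solution lam T f f0"
proof -
  have T0: "0 \<in> {0..T}" using T by auto
  have r0: "r t x \<ge> 0" if "t \<in> {0..T}" for t x using pos[OF that, of x] by simp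
  have f0': "f0 = monokinetic (r 0) (w 0)" using f[OF T0] f0 by simp
  have meas: "r t \<in> borel_measurable borel" "w t \<in> borel_measurable borel" if "t \<in> {0..T}" for t
    by (intro borel_measurable_continuous_onI joint_continuous_slice(2)[OF rc that] joint_continuous_slice(2)[OF wc that])+
  have graph: "(\<lambda>x. (x, w t x)) \<in> borel \<rightarrow>\<^sub>M borel" if "t \<in> {0..T}" for t
    by (intro borel_measurable_Pair meas that) simp
  have marg: "distr (f t) borel fst = density lborel (\<lambda>x. ennreal (r t x))" if t: "t \<in> {0..T}" for t
  proof -
    have "distr (f t) borel fst = distr (density lborel (\<lambda>x. ennreal (r t x))) borel (fst \<circ> (\<lambda>x. (x, w t x)))"
      unfolding f[OF t] monokinetic_def using graph[OF t]
      by (intro distr_distr) (auto intro!: borel_measurable_continuous_onI continuous_intros)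
    also have "fst \<circ> (\<lambda>x. (x, w t x)) = (\<lambda>x. x)" by auto
    finally show ?thesis by (simp add: distr_id2)
  qed
  have lnr: "ddx (\<lambda>y. ln (r t y)) x = rx t x / r t x" if t: "t \<in> {0..T}" for t x
  proof (rule vector_derivative_at)
    have "((\<lambda>y. ln (r t y)) has_real_derivative 1 / r t x * rx t x) (at x)"
      by (rule DERIV_chain2[where f = ln and g = "r t", OF DERIV_ln_divide[OF pos[OF t]] r_x[OF t]])
    then show "((\<lambda>y. ln (r t y)) has_vector_derivative rx t x / r t x) (at x)"
      by (simp add: has_real_derivative_iff_has_vector_derivative)
  qed
  have weak: "set_integrable (time_measure T f) ({0..T} \<times> UNIV) F \<and> integrable f0 (\<lambda>p. \<phi> (0, p)) \<and>
     (LINT p:({0..T} \<times> UNIV)|time_measure T f. F p) + (LINT p|f0. \<phi> (0, p)) = 0"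
    if test: "vlasov_test T \<phi> \<phi>t \<phi>x \<phi>\<xi>" and F: "F = (\<lambda>(t, x, \<xi>). \<phi>t (t, x, \<xi>) + \<xi> * \<phi>x (t, x, \<xi>)
                          - lam * ddx (\<lambda>y. ln (r t y)) x * \<phi>\<xi> (t, x, \<xi>))" for \<phi> \<phi>t \<phi>x \<phi>\<xi> F
  proof -
    note test' = test[unfolded vlasov_test_def]
    have c: "continuous_on UNIV \<phi>t" "continuous_on UNIV \<phi>x" "continuous_on UNIV \<phi>\<xi>"
      using test' by simp_all
    have d: "(\<phi> has_derivative (\<lambda>(h, k, l). \<phi>t p * h + \<phi>x p * k + \<phi>\<xi> p * l)) (at p)" for p
    proof -
      have "\<forall>p. (\<phi> has_derivative (\<lambda>(h, k, l). \<phi>t p * h + \<phi>x p * k + \<phi>\<xi> p * l)) (at p)"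
        using test' by (elim conjE) assumption
      then show ?thesis by (rule spec)
    qed
    obtain T' R0 where T': "T' < T" and supp: "\<And>t x \<xi>. \<phi> (t, x, \<xi>) \<noteq> 0 \<Longrightarrow> t \<le> T' \<and> \<bar>x\<bar> \<le> R0 \<and> \<bar>\<xi>\<bar> \<le> R0"
      using test unfolding vlasov_test_def by blast
    have c0: "continuous_on UNIV \<phi>"
      by (intro continuous_at_imp_continuous_on ballI has_derivative_continuous[OF d])
    \<comment> \<open>The partial derivatives vanish as well, since \<open>\<phi>\<close> is zero on
      an open set around such points.\<close>
    have zero: "\<phi>t (t, x, \<xi>) = 0 \<and> \<phi>x (t, x, \<xi>) = 0 \<and> \<phi>\<xi> (t, x, \<xi>) = 0" if x: "\<bar>x\<bar> > R0" for t x \<xi>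
    proof -
      let ?S = "{p :: real \<times> real \<times> real. \<bar>fst (snd p)\<bar> > R0}"
      have op: "open ?S" by (intro open_Collect_less continuous_intros)
      have "(\<phi> has_derivative (\<lambda>h. 0)) (at (t, x, \<xi>))"
      proof (rule has_derivative_transform_within_open[OF has_derivative_const[of 0] op])
        show "(t, x, \<xi>) \<in> ?S" using x by simp
        show "0 = \<phi> p" if "p \<in> ?S" for p
          using supp[of "fst p" "fst (snd p)" "snd (snd p)"] that by (cases "\<phi> p = 0") auto
      qed
      from has_derivative_unique[OF d this]
      have e: "(\<lambda>(h, k, l). \<phi>t (t, x, \<xi>) * h + \<phi>x (t, x, \<xi>) * k + \<phi>\<xi> (t, x, \<xi>) * l) = (\<lambda>h. 0)" .
      show ?thesis using fun_cong[OF e, of "(1, 0, 0)"] fun_cong[OF e, of "(0, 1, 0)"] fun_cong[OF e, of "(0, 0, 1)"] by simp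
    qed
    \<comment> \<open>Strictly beyond \<open>R0\<close>, so that boundary values at \<open>R\<close>
      and \<open>- R\<close> vanish, and positive even if \<open>R0\<close> is not.\<close>
    define R where "R = \<bar>R0\<bar> + 1"
    have R: "R > R0" "R > 0" by (auto simp: R_def)
    define \<psi> where "\<psi> t x = \<phi> (t, x, w t x)" for t x
    define G where "G t x = r t x * (\<phi>t (t, x, w t x) + w t x * \<phi>x (t, x, w t x) - lam * (rx t x / r t x) * \<phi>\<xi> (t, x, w t x))" for t x
    \<comment> \<open>The \<open>x\<close> derivative of \<open>r * w * \<psi>\<close>;
      \<open>H2\<close> below is the \<open>t\<close> derivative of \<open>r * \<psi>\<close>, with
      the equations for \<open>r\<close> and \<open>w\<close> inserted. In the sum the derivatives
      of \<open>r\<close> and \<open>w\<close> combine to \<open>G\<close>, the weak integrand along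
      the graph.\<close>
    define H1 where "H1 t x = (rx t x * w t x + r t x * wx t x) * \<psi> t x + r t x * w t x * (\<phi>x (t, x, w t x) + \<phi>\<xi> (t, x, w t x) * wx t x)" for t x
    define H2 where "H2 t x = - (rx t x * w t x + r t x * wx t x) * \<psi> t x
      + r t x * (\<phi>t (t, x, w t x) + \<phi>\<xi> (t, x, w t x) * (- (w t x * wx t x + lam * (rx t x / r t x))))" for t x
    have GH: "G t x = H1 t x + H2 t x" for t x by (simp add: G_def H1_def H2_def algebra_simps)
    have \<psi>0: "\<psi> t x = 0" if "\<bar>x\<bar> > R0" for t x using supp[of t x "w t x"] that by (auto simp: \<psi>_def)
    have G0: "G t x = 0" if "\<bar>x\<bar> > R0" for t x using zero[OF that] by (simp add: G_def)
    have \<psi>_x: "(\<psi> t has_real_derivative \<phi>x (t, x, w t x) + \<phi>\<xi> (t, x, w t x) * wx t x) (at x)" if t: "t \<in> {0..T}" for t x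
      using has_real_derivative_along_curve[where \<alpha> = "\<lambda>_. t" and \<beta> = "\<lambda>x. x" and \<gamma> = "w t" and s = x, OF d DERIV_const DERIV_ident w_x[OF t]]
      by (simp add: \<psi>_def[abs_def])
    have \<psi>_t: "((\<lambda>\<tau>. \<psi> \<tau> x) has_real_derivative \<phi>t (t, x, w t x) + \<phi>\<xi> (t, x, w t x) * (- (w t x * wx t x + lam * (rx t x / r t x)))) (at t within {0..T})"
      if t: "t \<in> {0..T}" for t x
      using has_real_derivative_along_curve[where \<alpha> = "\<lambda>\<tau>. \<tau>" and \<beta> = "\<lambda>_. x" and \<gamma> = "\<lambda>\<tau>. w \<tau> x" and s = t, OF d DERIV_ident DERIV_const w_t[OF t]]
      by (simp add: \<psi>_def[abs_def])
    have d1: "((\<lambda>x. r t x * w t x * \<psi> t x) has_real_derivative H1 t x) (at x)" if t: "t \<in> {0..T}" for t x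
      using DERIV_mult[OF DERIV_mult[OF r_x[OF t] w_x[OF t]] \<psi>_x[OF t]] by (rule back_subst[of "\<lambda>D. (_ has_real_derivative D) (at x)"]) (simp add: H1_def algebra_simps)
    have d2: "((\<lambda>\<tau>. r \<tau> x * \<psi> \<tau> x) has_real_derivative H2 t x) (at t within {0..T})" if t: "t \<in> {0..T}" for t x
      using DERIV_mult[OF r_t[OF t] \<psi>_t[OF t]] by (rule back_subst[of "\<lambda>D. (_ has_real_derivative D) (at t within {0..T})"]) (simp add: H2_def algebra_simps)
    have I1: "integral {-R..R} (H1 t) = 0" if t: "t \<in> {0..T}" for t
    proof -
      have "(H1 t has_integral (r t R * w t R * \<psi> t R - r t (-R) * w t (-R) * \<psi> t (-R))) {-R..R}"
        by (rule fundamental_theorem_of_calculus)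
          (use R d1[OF t] in \<open>auto simp: has_real_derivative_iff_has_vector_derivative intro: has_vector_derivative_at_within\<close>)
      then show ?thesis using \<psi>0[of R t] \<psi>0[of "-R" t] R by (auto intro: integral_unique)
    qed
    have I2: "integral {0..T} (\<lambda>t. H2 t x) = - (r 0 x * \<psi> 0 x)" for x
    proof -
      have "((\<lambda>t. H2 t x) has_integral (r T x * \<psi> T x - r 0 x * \<psi> 0 x)) {0..T}"
        by (rule fundamental_theorem_of_calculus)
          (use T d2 in \<open>auto simp: has_real_derivative_iff_has_vector_derivative\<close>)
      moreover have "\<psi> T x = 0" using supp[of T x "w T x"] T' by (auto simp: \<psi>_def)
      ultimately show ?thesis by (auto intro: integral_unique)
    qed
    let ?Q = "cbox (0, -R) (T, R)"
    have Q: "?Q \<subseteq> {0..T} \<times> UNIV" "?Q = {0..T} \<times> {-R..R}" by (auto simp: cbox_Pair_eq)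
    have gc: "continuous_on ({0..T} \<times> UNIV) (\<lambda>p. h (fst p, snd p, w (fst p) (snd p)))" if "continuous_on UNIV h" for h :: "real \<times> real \<times> real \<Rightarrow> real"
      using wc by (intro continuous_on_compose2[OF that]) (auto intro!: continuous_intros simp: split_beta')
    note cc = rc[unfolded split_beta'] wc[unfolded split_beta'] rxc[unfolded split_beta'] wxc[unfolded split_beta'] gc[OF c0] gc[OF c(1)] gc[OF c(2)] gc[OF c(3)]
    note cQ = cc[THEN continuous_on_subset, OF Q(1)]
    have nz: "\<forall>p\<in>?Q. r (fst p) (snd p) \<noteq> 0"
    proof
      fix p assume "p \<in> ?Q"
      from subsetD[OF Q(1) this] have "fst p \<in> {0..T}" by (cases p) simp
      from pos[OF this, of "snd p"] show "r (fst p) (snd p) \<noteq> 0" by simp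
    qed
    have H1c: "continuous_on ?Q (\<lambda>(t, x). H1 t x)" and H2c: "continuous_on ?Q (\<lambda>(t, x). H2 t x)" and Gc: "continuous_on ?Q (\<lambda>(t, x). G t x)"
      unfolding H1_def H2_def G_def \<psi>_def split_beta' by (intro continuous_intros cQ nz)+
    have "integral ?Q (\<lambda>(t, x). G t x) = integral ?Q (\<lambda>(t, x). H1 t x) + integral ?Q (\<lambda>(t, x). H2 t x)"
      using integral_add[OF integrable_continuous[OF H1c] integrable_continuous[OF H2c]] by (simp add: GH split_beta')
    also have "integral ?Q (\<lambda>(t, x). H1 t x) = integral {0..T} (\<lambda>t. integral {-R..R} (H1 t))"
      using integral_prod_continuous[OF H1c] by (simp add: cbox_interval)
    also have "\<dots> = integral {0..T} (\<lambda>t. 0)" by (intro integral_cong I1)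
    also have "integral ?Q (\<lambda>(t, x). H2 t x) = integral {0..T} (\<lambda>t. integral {-R..R} (\<lambda>x. H2 t x))"
      using integral_prod_continuous[OF H2c] by (simp add: cbox_interval)
    also have "\<dots> = integral {-R..R} (\<lambda>x. integral {0..T} (\<lambda>t. H2 t x))"
      using integral_swap_continuous[OF H2c] by (simp add: cbox_interval)
    finally have IG: "integral ?Q (\<lambda>(t, x). G t x) = - integral {-R..R} (\<lambda>x. r 0 x * \<psi> 0 x)" by (simp add: I2)
    \<comment> \<open>Outside \<open>{0..T}\<close> nothing is known about the logarithmic
      derivative in \<open>F\<close>, so measurability is established for its restriction to the
      strip.\<close>
    define g where "g p = indicator ({0..T} \<times> UNIV) p *\<^sub>R F p" for p
    have gm: "g \<in> borel_measurable borel"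
    proof -
      let ?g = "\<lambda>p. \<phi>t p + snd (snd p) * \<phi>x p - lam * (rx (fst p) (fst (snd p)) / r (fst p) (fst (snd p))) * \<phi>\<xi> p"
      have S: "({0..T} \<times> UNIV :: (real \<times> real \<times> real) set) \<in> sets borel" by (intro borel_closed closed_Times) auto
      have pr: "continuous_on ({0..T} \<times> UNIV :: (real \<times> real \<times> real) set) (\<lambda>p. h (fst p) (fst (snd p)))"
        if "continuous_on ({0..T} \<times> UNIV) (\<lambda>p. h (fst p) (snd p))" for h :: "real \<Rightarrow> real \<Rightarrow> real"
      proof -
        have 1: "continuous_on ({0..T} \<times> UNIV) (\<lambda>p :: real \<times> real \<times> real. (fst p, fst (snd p)))" by (intro continuous_intros)
        have 2: "(\<lambda>p :: real \<times> real \<times> real. (fst p, fst (snd p))) ` ({0..T} \<times> UNIV) \<subseteq> {0..T} \<times> UNIV" by auto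
        show ?thesis using continuous_on_compose2[OF that 1 2] by simp
      qed
      have "continuous_on ({0..T} \<times> UNIV) ?g"
        using pos by (intro continuous_intros pr cc c[THEN continuous_on_subset]) (auto simp: less_imp_neq[symmetric])
      from borel_measurable_continuous_on_indicator[OF S this]
      have "(\<lambda>p. indicator ({0..T} \<times> UNIV) p *\<^sub>R ?g p) \<in> borel_measurable borel" .
      also have "(\<lambda>p. indicator ({0..T} \<times> UNIV) p *\<^sub>R ?g p) = g"
        by (rule ext) (auto simp: g_def F indicator_def lnr)
      finally show ?thesis .
    qed
    have gG: "time_strip T r q *\<^sub>R g (fst q, snd q, time_strip T w q) = indicator ?Q q *\<^sub>R (case q of (t, x) \<Rightarrow> G t x)" for q
    proof (cases "fst q \<in> {0..T}")
      case True
      then have gq: "g (fst q, snd q, w (fst q) (snd q)) = \<phi>t (fst q, snd q, w (fst q) (snd q)) + w (fst q) (snd q) * \<phi>x (fst q, snd q, w (fst q) (snd q))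
          - lam * (rx (fst q) (snd q) / r (fst q) (snd q)) * \<phi>\<xi> (fst q, snd q, w (fst q) (snd q))"
        unfolding g_def F prod.case lnr[OF True] by simp
      have eq: "time_strip T r q *\<^sub>R g (fst q, snd q, time_strip T w q) = G (fst q) (snd q)"
        using True unfolding time_strip_def by (simp only: if_True gq G_def real_scaleR_def)
      show ?thesis
      proof (cases "q \<in> ?Q")
        case False
        then have "\<bar>snd q\<bar> > R0" using True unfolding Q(2) R_def by (cases q) auto
        then show ?thesis unfolding eq using False by (simp add: G0)
      next
        case True
        then show ?thesis unfolding eq by (simp add: split_beta')
      qed
    next
      case False
      then have "q \<notin> ?Q" unfolding Q(2) by (auto simp: mem_Times_iff)
      then show ?thesis using False by (simp add: time_strip_def del: atLeastAtMost_iff)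
    qed
    have "integrable (time_measure T f) g \<longleftrightarrow> integrable lborel (\<lambda>q. time_strip T r q *\<^sub>R g (fst q, snd q, time_strip T w q))"
      by (rule time_measure_monokinetic_integral(1)[OF _ rc wc _ gm]) (erule f r0)+
    then have i: "integrable (time_measure T f) g"
      using set_lebesgue_integral_cbox(1)[OF Gc] unfolding gG set_integrable_def by simp
    have "(LINT p|time_measure T f. g p) = (LINT q|lborel. time_strip T r q *\<^sub>R g (fst q, snd q, time_strip T w q))"
      by (rule time_measure_monokinetic_integral(2)[OF _ rc wc _ gm]) (erule f r0)+
    then have v: "(LINT p|time_measure T f. g p) = integral ?Q (\<lambda>(t, x). G t x)"
      using set_lebesgue_integral_cbox(2)[OF Gc] unfolding gG set_lebesgue_integral_def by simp
    have \<phi>0m: "(\<lambda>p. \<phi> (0, p)) \<in> borel_measurable borel"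
      by (intro borel_measurable_continuous_onI continuous_on_compose2[OF c0] continuous_intros) auto
    have gr: "(\<lambda>x. (x, w 0 x)) \<in> density lborel (\<lambda>x. ennreal (r 0 x)) \<rightarrow>\<^sub>M borel" using graph[OF T0] by simp
    have \<psi>c: "continuous_on {-R..R} (\<lambda>x. r 0 x * \<psi> 0 x)"
    proof -
      have "continuous_on UNIV (\<lambda>x. (0 :: real, x, w 0 x))" by (intro continuous_intros joint_continuous_slice(2)[OF wc T0])
      then have "continuous_on UNIV (\<psi> 0)" unfolding \<psi>_def[abs_def] by (intro continuous_on_compose2[OF c0]) auto
      then have "continuous_on UNIV (\<lambda>x. r 0 x * \<psi> 0 x)" by (intro continuous_on_mult joint_continuous_slice(2)[OF rc T0])
      then show ?thesis by (rule continuous_on_subset) simp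
    qed
    have \<psi>m: "(\<lambda>x. \<phi> (0, x, w 0 x)) \<in> borel_measurable borel"
      using measurable_compose[OF graph[OF T0] \<phi>0m] by simp
    have ind: "r 0 x *\<^sub>R \<phi> (0, x, w 0 x) = indicator {-R..R} x *\<^sub>R (r 0 x * \<psi> 0 x)" for x
    proof (cases "\<bar>x\<bar> > R0")
      case True
      then show ?thesis using \<psi>0[OF True, of 0] by (simp add: \<psi>_def)
    qed (auto simp: R_def \<psi>_def indicator_def)
    have i0: "integrable f0 (\<lambda>p. \<phi> (0, p))"
    proof -
      have "integrable (density lborel (\<lambda>x. ennreal (r 0 x))) (\<lambda>x. \<phi> (0, x, w 0 x)) \<longleftrightarrow> integrable lborel (\<lambda>x. r 0 x *\<^sub>R \<phi> (0, x, w 0 x))"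
        by (rule integrable_density) (use \<psi>m meas(1)[OF T0] r0[OF T0] in simp_all)
      then show ?thesis
        unfolding f0' monokinetic_def integrable_distr_eq[OF gr \<phi>0m] ind
        using set_lebesgue_integral_cbox(1)[of "-R" R, unfolded cbox_interval, OF \<psi>c] unfolding set_integrable_def by simp
    qed
    have v0: "(LINT p|f0. \<phi> (0, p)) = integral {-R..R} (\<lambda>x. r 0 x * \<psi> 0 x)"
    proof -
      have "(LINT x|density lborel (\<lambda>x. ennreal (r 0 x)). \<phi> (0, x, w 0 x)) = (LINT x|lborel. r 0 x *\<^sub>R \<phi> (0, x, w 0 x))"
        by (rule integral_density) (use \<psi>m meas(1)[OF T0] r0[OF T0] in simp_all)
      then show ?thesis
        unfolding f0' monokinetic_def integral_distr[OF gr \<phi>0m] ind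
        using set_lebesgue_integral_cbox(2)[of "-R" R, unfolded cbox_interval, OF \<psi>c] unfolding set_lebesgue_integral_def by simp
    qed
    show ?thesis
      using i v i0 v0 IG unfolding set_integrable_def set_lebesgue_integral_def g_def[abs_def] by simp
  qed
  have "r t differentiable at x" if "t \<in> {0..T}" for t x
    using r_x[OF that, of x] unfolding has_real_derivative_iff_has_vector_derivative by (rule differentiableI_vector)
  then show ?thesis
    unfolding vlasov_solution_def Let_def using f0 marg pos weak by blast
qed

text \<open>The gradient of the phase is known to equal the velocity for times in
  \<open>{0..T}\<close> only; the limits and derivatives in \<open>system_solution\<close> are taken
  within this interval, so other times do not matter.\<close>

lemma system_solution_cong:
  assumes sol: "system_solution s lam eps T a0 v0 a v" and T: "T \<ge> 0"
    and eq: "\<And>t. t \<in> {0..T} \<Longrightarrow> v' t = v t"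
  shows "system_solution s lam eps T a0 v0 a v'"
proof -
  have z: "continuous_zhidkov s T (\<lambda>t x. complex_of_real (v' t x))"
    unfolding continuous_zhidkov_def
  proof (intro ballI conjI)
    fix t assume t: "t \<in> {0..T}"
    have "continuous_zhidkov s T (\<lambda>t x. complex_of_real (v t x))" using sol by (simp add: system_solution_def)
    then have sol': "(\<lambda>x. complex_of_real (v t x)) \<in> zhidkov s"
      "((\<lambda>\<tau>. zhidkov_norm s (\<lambda>x. complex_of_real (v \<tau> x) - complex_of_real (v t x))) \<longlongrightarrow> 0) (at t within {0..T})"
      using t by (simp_all add: continuous_zhidkov_def)
    then show "(\<lambda>x. complex_of_real (v' t x)) \<in> zhidkov s" by (simp add: eq[OF t])
    have "\<forall>\<^sub>F \<tau> in at t within {0..T}. zhidkov_norm s (\<lambda>x. complex_of_real (v \<tau> x) - complex_of_real (v t x))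
       = zhidkov_norm s (\<lambda>x. complex_of_real (v' \<tau> x) - complex_of_real (v' t x))"
      by (simp add: eventually_at_filter eq[OF t] eq)
    with sol'(2) show "((\<lambda>\<tau>. zhidkov_norm s (\<lambda>x. complex_of_real (v' \<tau> x) - complex_of_real (v' t x))) \<longlongrightarrow> 0) (at t within {0..T})"
      by (rule Lim_transform_eventually)
  qed
  have d: "((\<lambda>\<tau>. v' \<tau> x) has_vector_derivative D) (at t within {0..T})"
    if "((\<lambda>\<tau>. v \<tau> x) has_vector_derivative D) (at t within {0..T})" "t \<in> {0..T}" for t x D
    using that by (intro has_vector_derivative_transform[OF that(2) _ that(1)]) (simp add: eq)
  show ?thesis
    unfolding system_solution_def
  proof (intro conjI allI ballI)
    show "continuous_zhidkov s T a" "a 0 x = a0 x" "v' 0 x = v0 x" for x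
      using sol T eq[of 0] by (simp_all add: system_solution_def)
    fix t x assume t: "t \<in> {0..T}"
    have P: "a t x \<noteq> 0 \<and>
        v t differentiable at x \<and> a t differentiable at x \<and> ddx (a t) differentiable at x \<and>
        (\<exists>vt. ((\<lambda>\<tau>. v \<tau> x) has_vector_derivative vt) (at t within {0..T}) \<and>
           vt + v t x * ddx (v t) x + lam * ddx (\<lambda>y. ln ((cmod (a t y))\<^sup>2)) x = 0) \<and>
        (\<exists>at'. ((\<lambda>\<tau>. a \<tau> x) has_vector_derivative at') (at t within {0..T}) \<and>
           at' + of_real (v t x) * ddx (a t) x + a t x / 2 * of_real (ddx (v t) x)
             = \<i> * of_real (eps / 2) * ddx (ddx (a t)) x)"
      using sol t unfolding system_solution_def by blast
    show "a t x \<noteq> 0" "v' t differentiable at x" "a t differentiable at x" "ddx (a t) differentiable at x"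
      using P unfolding eq[OF t] by blast+
    show "\<exists>vt. ((\<lambda>\<tau>. v' \<tau> x) has_vector_derivative vt) (at t within {0..T}) \<and>
           vt + v' t x * ddx (v' t) x + lam * ddx (\<lambda>y. ln ((cmod (a t y))\<^sup>2)) x = 0"
      using P d[OF _ t] unfolding eq[OF t] by blast
    show "\<exists>at'. ((\<lambda>\<tau>. a \<tau> x) has_vector_derivative at') (at t within {0..T}) \<and>
           at' + of_real (v' t x) * ddx (a t) x + a t x / 2 * of_real (ddx (v' t) x)
             = \<i> * of_real (eps / 2) * ddx (ddx (a t)) x"
      using P unfolding eq[OF t] by blast
  qed (rule z)
qed

text \<open>For the phase, which need not be bounded in \<open>x\<close> but has the bounded
  gradient \<open>v\<close>.\<close>

lemma continuous_on_joint_lipschitz: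
  fixes f :: "real \<Rightarrow> real \<Rightarrow> 'a::real_normed_vector"
  assumes c: "\<And>x. continuous_on S (\<lambda>t. f t x)"
    and lip: "\<And>t x y. t \<in> S \<Longrightarrow> norm (f t x - f t y) \<le> K * \<bar>x - y\<bar>"
  shows "continuous_on (S \<times> UNIV) (\<lambda>(t, x). f t x)"
  unfolding continuous_on_def
proof
  fix z assume z: "z \<in> S \<times> (UNIV :: real set)"
  let ?F = "at z within S \<times> UNIV"
  have "continuous_on (S \<times> UNIV) (\<lambda>p. f (fst p) (snd z))"
    by (rule continuous_on_compose2[OF c[of "snd z"]]) (auto intro!: continuous_intros)
  then have 1: "((\<lambda>p. f (fst p) (snd z)) \<longlongrightarrow> f (fst z) (snd z)) ?F"
    using z unfolding continuous_on_def by blast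
  have "((\<lambda>p. f (fst p) (snd p) - f (fst p) (snd z)) \<longlongrightarrow> 0) ?F"
  proof (rule Lim_null_comparison)
    have "((\<lambda>p. K * \<bar>snd p - snd z\<bar>) \<longlongrightarrow> K * \<bar>snd z - snd z\<bar>) ?F" by (intro tendsto_intros)
    then show "((\<lambda>p. K * \<bar>snd p - snd z\<bar>) \<longlongrightarrow> 0) ?F" by simp
    show "\<forall>\<^sub>F p in ?F. norm (f (fst p) (snd p) - f (fst p) (snd z)) \<le> K * \<bar>snd p - snd z\<bar>"
      unfolding eventually_at_filter by (intro always_eventually allI impI lip) auto
  qed
  from tendsto_add[OF this 1] show "((\<lambda>(t, x). f t x) \<longlongrightarrow> (case z of (t, x) \<Rightarrow> f t x)) ?F"
    by (simp add: split_beta')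
qed

lemma phase_0: "phase lam Phi0 a v 0 x = Phi0 x"
  unfolding phase_def using integral_refl[of "0 :: real" "\<lambda>\<tau>. (v \<tau> x)\<^sup>2 / 2 + lam * ln ((cmod (a \<tau> x))\<^sup>2)"] by simp

lemma phase_continuous:
  assumes s: "s > 5/2" and T: "T > 0" and sol: "system_solution s lam eps T a0 (ddx Phi0) a v"
    and Phi0: "Phi0 differentiable_on UNIV"
  shows "continuous_on ({0..T} \<times> UNIV) (\<lambda>(t, x). phase lam Phi0 a v t x)"
proof -
  note d = phase_derivatives[OF s T sol Phi0]
  obtain K ax axx vx vxx where "regular_solution lam eps T K a ax axx v vx vxx"
    using solution_regular[OF s T sol] by blast
  then interpret S: regular_solution lam eps T K a ax axx v vx vxx .
  show ?thesis
  proof (rule continuous_on_joint_lipschitz[where K = K])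
    show "continuous_on {0..T} (\<lambda>t. phase lam Phi0 a v t x)" for x
      using DERIV_continuous[OF d(2)] by (auto simp: continuous_on_eq_continuous_within)
    show "norm (phase lam Phi0 a v t x - phase lam Phi0 a v t y) \<le> K * \<bar>x - y\<bar>" if t: "t \<in> {0..T}" for t x y
      using field_differentiable_bound[of UNIV "phase lam Phi0 a v t" "v t" K x y] d(1)[OF t] S.v_bound[OF t] by auto
  qed
qed

text \<open>The passage from \<open>u\<close> to \<open>b\<close>: the phase of the two-point
  product is split into that of the differences \<open>P - P0\<close>, kept with the amplitudes, and
  a difference of the limiting phase \<open>P0\<close>.\<close>

lemma wkb_product:
  "wkb eps a P t x * cnj (wkb eps a P t y) =
    (a t x * cis ((P t x - P0 t x) / eps)) * cnj (a t y * cis ((P t y - P0 t y) / eps)) * cis ((P0 t x - P0 t y) / eps)"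
proof -
  have e: "(P t x - P0 t x) / eps + (- ((P t y - P0 t y) / eps) + (P0 t x - P0 t y) / eps) = P t x / eps + - (P t y / eps)"
    by (simp add: diff_divide_distrib)
  have "cis (P t x / eps) * cis (- (P t y / eps))
     = cis ((P t x - P0 t x) / eps) * (cis (- ((P t y - P0 t y) / eps)) * cis ((P0 t x - P0 t y) / eps))"
    unfolding cis_mult e ..
  then show ?thesis unfolding wkb_def by (simp add: cis_cnj mult_ac)
qed

lemma wkb_limit:
  fixes a :: "real \<Rightarrow> real \<Rightarrow> real \<Rightarrow> complex" and v :: "real \<Rightarrow> real \<Rightarrow> real \<Rightarrow> real"
  assumes s: "s > 5/2" and lam: "lam > 0" and T: "T > 0" and Phi0: "Phi0 differentiable_on UNIV"
    and sol: "\<And>eps. eps \<in> {0..1} \<Longrightarrow> system_solution s lam eps T a0 (ddx Phi0) (a eps) (v eps)"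
    and m: "m > 0" "\<And>x. m \<le> (cmod (a0 x))\<^sup>2"
    and Phi: "\<And>eps. Phi eps = phase lam Phi0 (a eps) (v eps)"
    and U: "\<And>eps. U eps = wkb eps (a eps) (Phi eps)"
  shows "\<exists>M. \<forall>eps\<in>{0<..1}. \<forall>t\<in>{0..T}. \<forall>x. norm (U eps t x) \<le> M"
    and "\<And>t x y. t \<in> {0..T} \<Longrightarrow> ((\<lambda>eps. U eps t (x - eps / 2 * y) * cnj (U eps t (x + eps / 2 * y)))
      \<longlongrightarrow> of_real ((cmod (a 0 t x))\<^sup>2) * cis (- (y * v 0 t x))) (at 0 within {0<..1})"
proof -
  have sol0: "system_solution s lam 0 T a0 (ddx Phi0) (a 0) (v 0)" by (rule sol) simp
  obtain K a0x a0xx w_x w_xx where S0: "regular_solution lam 0 T K (a 0) a0x a0xx (v 0) w_x w_xx"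
    using solution_regular[OF s T sol0] by blast
  interpret S0: regular_solution lam 0 T K "a 0" a0x a0xx "v 0" w_x w_xx by (rule S0)
  note d0 = phase_derivatives[OF s T sol0 Phi0, folded Phi]
  have init: "a eps 0 x = a0 x" if "eps \<in> {0..1}" for eps x using sol[OF that] by (simp add: system_solution_def)
  define B where "B t eps x = a eps t x * cis ((Phi eps t x - Phi 0 t x) / eps)" for t eps x
  \<comment> \<open>The exported constant \<open>econst\<close> takes only \<open>lam\<close>,
    \<open>T\<close> and the bound for the limiting solution as arguments, so \<open>C\<close> and
    \<open>D\<close> are visibly the same for all \<open>eps\<close> and all times.\<close>
  define C where "C = wkb_comparison.econst lam T (2 * K\<^sup>2) + 1"
  define D where "D = wkb_comparison.econst lam T (2 * K\<^sup>2) / lam + 1"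
  have comp: "\<exists>bx bxx M rmin. wkb_comparison (\<lambda>t. B t eps) bx bxx (v 0) w_x w_xx (\<lambda>t x. (cmod (a 0 t x))\<^sup>2)
    (\<lambda>t x. 2 * Re (cnj (a 0 t x) * a0x t x)) eps lam T (2 * K\<^sup>2) M rmin" if eps: "eps \<in> {0<..1}" for eps
  proof -
    have e: "eps \<in> {0..1}" "0 < eps" "eps \<le> 1" using eps by auto
    obtain K1 ax axx vx vxx where S1: "regular_solution lam eps T K1 (a eps) ax axx (v eps) vx vxx"
      using solution_regular[OF s T sol[OF e(1)]] by blast
    note d1 = phase_derivatives[OF s T sol[OF e(1)] Phi0, folded Phi]
    show ?thesis unfolding B_def[abs_def]
    proof (rule wkb_comparison_instance[where \<phi> = "\<lambda>t x. Phi eps t x - Phi 0 t x", OF S0 S1 e(2,3) lam T _ m(1)])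
      show "a eps 0 x = a 0 0 x" for x using init[OF e(1)] init[of 0] by simp
      show "m \<le> (cmod (a 0 0 x))\<^sup>2" for x using m(2) init[of 0] by simp
      show "Phi eps 0 x - Phi 0 0 x = 0" for x by (simp add: Phi phase_0)
      fix t x assume t: "t \<in> {0..T}"
      show "((\<lambda>x. Phi eps t x - Phi 0 t x) has_real_derivative v eps t x - v 0 t x) (at x)"
        by (rule DERIV_diff[OF d1(1)[OF t] d0(1)[OF t]])
      show "((\<lambda>\<tau>. Phi eps \<tau> x - Phi 0 \<tau> x) has_real_derivative
        - ((v eps t x)\<^sup>2 / 2 + lam * ln ((cmod (a eps t x))\<^sup>2)) + ((v 0 t x)\<^sup>2 / 2 + lam * ln ((cmod (a 0 t x))\<^sup>2))) (at t within {0..T})"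
        using DERIV_diff[OF d1(2)[OF t, of x] d0(2)[OF t, of x]] by (simp only: diff_minus_eq_add)
    qed
  qed
  have econst: "wkb_comparison.econst lam T (2 * K\<^sup>2) > 0"
  proof -
    obtain bx bxx M rmin where "wkb_comparison (\<lambda>t. B t 1) bx bxx (v 0) w_x w_xx (\<lambda>t x. (cmod (a 0 t x))\<^sup>2)
      (\<lambda>t x. 2 * Re (cnj (a 0 t x) * a0x t x)) 1 lam T (2 * K\<^sup>2) M rmin" using comp[of 1] by auto
    then show ?thesis by (rule wkb_comparison.econst_pos)
  qed
  have CD: "C \<ge> 0" "D \<ge> 0" using econst lam by (simp_all add: C_def D_def)
  have hoelder: "norm (B t eps x - B t eps y) \<le> C * sqrt \<bar>x - y\<bar>" if e: "eps \<in> {0<..1}" and t: "t \<in> {0..T}" for eps t x y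
  proof -
    obtain bx bxx M rmin where "wkb_comparison (\<lambda>t. B t eps) bx bxx (v 0) w_x w_xx (\<lambda>t x. (cmod (a 0 t x))\<^sup>2)
      (\<lambda>t x. 2 * Re (cnj (a 0 t x) * a0x t x)) eps lam T (2 * K\<^sup>2) M rmin" using comp[OF e] by auto
    from wkb_comparison.b_hoelder[OF this t] show ?thesis by (simp only: C_def)
  qed
  have close: "\<exists>z\<in>{x..x + eps}. (cmod (B t eps z) - cmod (a 0 t z))\<^sup>2 \<le> D * eps" if e: "eps \<in> {0<..1}" and t: "t \<in> {0..T}" for eps t x
  proof -
    obtain bx bxx M rmin where "wkb_comparison (\<lambda>t. B t eps) bx bxx (v 0) w_x w_xx (\<lambda>t x. (cmod (a 0 t x))\<^sup>2)
      (\<lambda>t x. 2 * Re (cnj (a 0 t x) * a0x t x)) eps lam T (2 * K\<^sup>2) M rmin" using comp[OF e] by auto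
    from wkb_comparison.b_close[OF this t, of x] show ?thesis by (simp add: D_def)
  qed
  have Ab: "\<bar>cmod (a 0 t x)\<bar> \<le> K" if t: "t \<in> {0..T}" for t x using S0.a_bound[OF t, of x] by simp
  have bd: "norm (B t eps x) \<le> C + sqrt D + K" if e: "eps \<in> {0<..1}" and t: "t \<in> {0..T}" for t eps x
    by (rule wkb_family_limit(1)[where B = "B t", OF hoelder[OF _ t] close[OF _ t] Ab[OF t] CD e])
  have "norm (U eps t x) = norm (B t eps x)" for eps t x
    by (simp add: U B_def wkb_def norm_mult)
  then show "\<exists>M. \<forall>eps\<in>{0<..1}. \<forall>t\<in>{0..T}. \<forall>x. norm (U eps t x) \<le> M"
    using bd by (intro exI[of _ "C + sqrt D + K"]) auto
  show "((\<lambda>eps. U eps t (x - eps / 2 * y) * cnj (U eps t (x + eps / 2 * y)))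
      \<longlongrightarrow> of_real ((cmod (a 0 t x))\<^sup>2) * cis (- (y * v 0 t x))) (at 0 within {0<..1})" if t: "t \<in> {0..T}" for t x y
  proof -
    have "isCont (\<lambda>x. cmod (a 0 t x)) x"
      by (intro continuous_intros has_vector_derivative_continuous[OF S0.a_x[OF t]])
    from wkb_family_limit(2)[where B = "B t", OF hoelder[OF _ t] close[OF _ t] Ab[OF t] CD this d0(1)[OF t], of y]
    show ?thesis unfolding U wkb_product[where ?P0.0 = "Phi 0"] B_def .
  qed
qed

theorem theorem5p4:
  fixes s lam rho_min T :: real
    and rho0 Phi0 :: "real \<Rightarrow> real"
    and a :: "real \<Rightarrow> real \<Rightarrow> real \<Rightarrow> complex"
    and v Phi :: "real \<Rightarrow> real \<Rightarrow> real \<Rightarrow> real"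
    and u :: "real \<Rightarrow> real \<Rightarrow> real \<Rightarrow> complex"
    and mu :: "real \<Rightarrow> (real \<times> real) measure"
  assumes "s > 5/2" and "lam > 0"
    and "(\<lambda>x. complex_of_real (rho0 x)) \<in> zhidkov s"
    and "Phi0 differentiable_on UNIV"
    and "(\<lambda>x. complex_of_real (ddx Phi0 x)) \<in> zhidkov s"
    and "rho_min > 0" and "\<And>x. rho0 x \<ge> rho_min"
    and "T > 0"
    and "\<And>eps. eps \<in> {0..1} \<Longrightarrow>
           system_solution s lam eps T (\<lambda>x. complex_of_real (sqrt (rho0 x))) (ddx Phi0) (a eps) (v eps)"
    and "\<And>eps. Phi eps = phase lam Phi0 (a eps) (v eps)"
    and "\<And>eps. u eps = wkb eps (a eps) (Phi eps)"
    and "\<And>t. mu t = monokinetic (\<lambda>x. (cmod (a 0 t x))\<^sup>2) (ddx (Phi 0 t))"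
  shows "(\<forall>R. emeasure (time_measure T mu) ({0..T} \<times> {-R..R} \<times> UNIV) < \<infinity>) \<and>
    (\<forall>\<phi>. wigner_test T \<phi> \<longrightarrow>
       integrable (time_measure T mu) \<phi> \<and>
       ((\<lambda>eps. 1 / (2 * pi) * wigner_distribution T eps (u eps) \<phi>)
          \<longlongrightarrow> (LINT p|time_measure T mu. \<phi> p)) (at_right 0)) \<and>
    (\<forall>t\<in>{0..T}. \<forall>x. Phi 0 t differentiable at x) \<and>
    system_solution s lam 0 T (\<lambda>x. complex_of_real (sqrt (rho0 x))) (ddx Phi0)
      (a 0) (\<lambda>t. ddx (Phi 0 t)) \<and>
    vlasov_solution lam T mu (monokinetic rho0 (ddx Phi0))"
proof -
  note s = assms(1) and lam = assms(2) and Phi0 = assms(4) and T = assms(8) and sol = assms(9) and Phi = assms(10) and u = assms(11) and mu = assms(12)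
  have sol0: "system_solution s lam 0 T (\<lambda>x. complex_of_real (sqrt (rho0 x))) (ddx Phi0) (a 0) (v 0)" by (rule sol) simp
  have a0sq: "(cmod (complex_of_real (sqrt (rho0 x))))\<^sup>2 = rho0 x" for x
    using assms(6) assms(7)[of x] by simp
  have a00: "(cmod (a 0 0 x))\<^sup>2 = rho0 x" for x
    using sol0 a0sq[of x] by (simp add: system_solution_def)
  obtain K ax axx vx vxx where S0: "regular_solution lam 0 T K (a 0) ax axx (v 0) vx vxx"
    using solution_regular[OF s T sol0] by blast
  interpret S0: regular_solution lam 0 T K "a 0" ax axx "v 0" vx vxx by (rule S0)
  note d0 = phase_derivatives[OF s T sol0 Phi0, folded Phi]
  have Phi_x: "(Phi 0 t has_vector_derivative v 0 t x) (at x)" if "t \<in> {0..T}" for t x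
    using d0(1)[OF that] by (simp add: has_real_derivative_iff_has_vector_derivative)
  have ddx_Phi: "ddx (Phi 0 t) = v 0 t" if "t \<in> {0..T}" for t
    by (rule ext) (rule vector_derivative_at[OF Phi_x[OF that]])
  define r where "r t x = (cmod (a 0 t x))\<^sup>2" for t x
  have mu_eq: "mu t = monokinetic (r t) (v 0 t)" if "t \<in> {0..T}" for t
    unfolding mu ddx_Phi[OF that] r_def[abs_def] ..
  have rc: "continuous_on ({0..T} \<times> UNIV) (\<lambda>(t, x). r t x)"
    using S0.a_cont unfolding r_def split_beta' by (intro continuous_intros)
  have r_bound: "0 \<le> r t x \<and> r t x \<le> K\<^sup>2" if "t \<in> {0..T}" for t x
    using S0.a_bound[OF that, of x] unfolding r_def by (auto intro!: power_mono)
  have "emeasure (time_measure T mu) ({0..T} \<times> {-R..R} \<times> UNIV) < \<infinity>" for R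
    by (rule time_measure_monokinetic_finite[OF mu_eq rc S0.v_cont]) (use r_bound in auto)
  moreover have "integrable (time_measure T mu) \<phi> \<and>
       ((\<lambda>eps. 1 / (2 * pi) * wigner_distribution T eps (u eps) \<phi>)
          \<longlongrightarrow> (LINT p|time_measure T mu. \<phi> p)) (at_right 0)" if \<phi>: "wigner_test T \<phi>" for \<phi>
  proof -
    have "\<And>x. rho_min \<le> (cmod (complex_of_real (sqrt (rho0 x))))\<^sup>2" unfolding a0sq by (rule assms(7))
    note lim = wkb_limit[OF s lam T Phi0 sol assms(6) this Phi u]
    obtain M where M: "\<forall>eps\<in>{0<..1}. \<forall>t\<in>{0..T}. \<forall>x. norm (u eps t x) \<le> M"
      using lim(1) by blast
    \<comment> \<open>Joint continuity for each fixed \<open>eps\<close> suffices, since it only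
      gives measurability of the two-point product; the uniform bound is \<open>M\<close>.\<close>
    have uc: "continuous_on ({0..T} \<times> UNIV) (\<lambda>(t, x). u eps t x)" if e: "eps \<in> {0<..1}" for eps
    proof -
      have e': "eps \<in> {0..1}" "eps \<noteq> 0" using e by auto
      obtain K1 ax axx vx vxx where "regular_solution lam eps T K1 (a eps) ax axx (v eps) vx vxx"
        using solution_regular[OF s T sol[OF e'(1)]] by blast
      from regular_solution.a_cont[OF this] phase_continuous[OF s T sol[OF e'(1)] Phi0, folded Phi]
      show ?thesis unfolding u wkb_def split_beta' using e'(2) by (intro continuous_intros) auto
    qed
    have r0: "r t x \<ge> 0" for t x by (simp add: r_def)
    have \<phi>m: "\<phi> \<in> borel_measurable borel"
      using \<phi> by (intro borel_measurable_continuous_onI) (simp add: wigner_test_def)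
    note int = time_measure_monokinetic_integral[OF mu_eq rc S0.v_cont r0 \<phi>m]
    have 1: "integrable (time_measure T mu) \<phi> \<longleftrightarrow> integrable lborel (\<lambda>p. time_strip T r p *\<^sub>R \<phi> (fst p, snd p, time_strip T (v 0) p))"
      and 2: "(LINT p|time_measure T mu. \<phi> p) = (LINT p|lborel. time_strip T r p *\<^sub>R \<phi> (fst p, snd p, time_strip T (v 0) p))"
      by (rule int, assumption)+
    have ub: "norm (u eps t x) \<le> M" if "eps \<in> {0<..1}" "t \<in> {0..T}" for eps t x using M that by blast
    have l: "((\<lambda>eps. u eps t (x - eps / 2 * y) * cnj (u eps t (x + eps / 2 * y)))
      \<longlongrightarrow> of_real (r t x) * cis (- (y * v 0 t x))) (at 0 within {0<..1})" if "t \<in> {0..T}" for t x y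
      unfolding r_def by (rule lim(2)[OF _ that])
    show ?thesis
      unfolding 1 2
      using wigner_distribution_limit[where U = u and r = r and w = "v 0", OF \<phi> rc S0.v_cont r_bound uc ub l] by blast
  qed
  moreover have "Phi 0 t differentiable at x" if "t \<in> {0..T}" for t x
    using Phi_x[OF that] by (rule differentiableI_vector)
  moreover have "system_solution s lam 0 T (\<lambda>x. complex_of_real (sqrt (rho0 x))) (ddx Phi0) (a 0) (\<lambda>t. ddx (Phi 0 t))"
    by (rule system_solution_cong[OF sol0 less_imp_le[OF T] ddx_Phi])
  moreover have "vlasov_solution lam T mu (monokinetic rho0 (ddx Phi0))"
  proof (rule monokinetic_vlasov_solution[where r = r and w = "v 0" and rx = "\<lambda>t x. 2 * Re (cnj (a 0 t x) * ax t x)" and wx = vx, OF T mu_eq _ rc S0.v_cont _ S0.vx_cont])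
    have "Phi 0 0 = Phi0" by (rule ext) (simp add: Phi phase_0)
    then show "mu 0 = monokinetic rho0 (ddx Phi0)" unfolding mu a00 by simp
    show "continuous_on ({0..T} \<times> UNIV) (\<lambda>(t, x). 2 * Re (cnj (a 0 t x) * ax t x))"
      using S0.a_cont S0.ax_cont unfolding split_beta' by (intro continuous_intros)
    fix t x assume t: "t \<in> {0..T}"
    show "r t x > 0" using S0.a_nz[OF t] by (simp add: r_def)
    show "(r t has_real_derivative 2 * Re (cnj (a 0 t x) * ax t x)) (at x)"
      unfolding r_def[abs_def] by (rule cmod_square_has_derivative[OF S0.a_x[OF t]])
    show "(v 0 t has_real_derivative vx t x) (at x)" by (rule S0.v_x[OF t])
    show "((\<lambda>\<tau>. r \<tau> x) has_real_derivative - (2 * Re (cnj (a 0 t x) * ax t x) * v 0 t x + r t x * vx t x)) (at t within {0..T})"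
      unfolding r_def by (rule S0.density_transport[OF refl t])
    show "((\<lambda>\<tau>. v 0 \<tau> x) has_real_derivative - (v 0 t x * vx t x + lam * (2 * Re (cnj (a 0 t x) * ax t x) / r t x))) (at t within {0..T})"
      unfolding r_def by (rule S0.v_t[OF t])
  qed
  ultimately show ?thesis by blast
qed

end
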